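(* Consider the greedy cleaning process on the star with $N$ halflines and $N^{\alpha}$ workers described in the context. (I) For any $\alpha\in(0,1)$ and any $x>0$, $$\mathbf{P}(\sigma_x=\infty)\to 1\quad\text{as } N\to\infty .$$ Further, for any $\alpha\in(0,1)$ and any $\varepsilon>0$, $$\mathbf{P}\left(\theta_N\le N^{1-\alpha+\varepsilon}\right)\to 1\quad\text{as } N\to\infty .$$ (II) If $2/3<\alpha<1$, then $\mathbf{P}(A_2)\to 0$ as $N\to\infty$. (III) If $0<\alpha<2/3$, then $\mathbf{P}(A_2)\to 1$ as $N\to\infty$.
   Context: Model. For $N\ge1$ the state space is $\mathcal{X}=\bigcup_{i=1}^N\mathcal{R}_i^+$, a union of $N$ halflines $\mathcal{R}_i^+\cong[0,\infty)$ glued at a single common point, the origin. The distance between two points at distances $x$ and $y$ from the origin is $|x-y|$ if they lie on the same halfline and $x+y$ if they lie on different halflines. At time $0$ each halfline carries a homogeneous rate-1 Poisson process of "dust particles", independently over halflines. Fix $\alpha\in(0,1)$. There are $N^\alpha$ workers (meaning the integer part $[N^\alpha]$), labelled $w=1,\dots,N^\alpha$, all at the origin at time $0$. Each worker has its own rate-1 Poisson clock; the clocks are independent of each other and of the dust. When the clock of a worker rings, the worker instantaneously jumps to the closest existing dust particle (in the distance on $\mathcal{X}$ that equals $|x-y|$ for points on the same halfline and $x+y$ for points on different halflines, where $x,y$ are their distances from the origin), removes it, and stays at that location until its clock rings again. Terminology. A jump of a worker is an advance if it is a jump from the origin or a jump from one dust particle location to another dust particle on the same halfline. Otherwise it is a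 skip: a jump from a location on one halfline to a dust particle on another halfline. Notation. $l_w(t)\in\{1,\dots,N\}$ is the index of the halfline on which worker $w$ is located at time $t$ ($l_w(t)=0$ if $w$ is still at the origin). $\sigma_x$ is the first time at which some worker skips to a dust particle at distance at least $x$ from the origin ($\sigma_x=\infty$ if this never happens). $\theta_N$ is the time of the very last skip made by any worker. $A_2^{(t)}=\{l_{w_1}(s)\ne l_{w_2}(s)\text{ for all } w_1\neq w_2\text{ and all } s\ge t\}$ and $A_2=\bigcup_{t\ge0}A_2^{(t)}$ is the event that eventually all workers stay on different halflines. *)

theory Defs
  imports "HOL-Probability.Probability"
begin

text \<open>
  A point of the star is a pair of a halfline index in \<open>{1..N}\<close> and a distance from the origin.
  The origin, which all halflines share, is given the index \<open>0\<close>; a dust particle is never at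
  the origin, so this index also serves as the value of \<open>l\<^sub>w(t)\<close> for a worker who has not moved.
\<close>

type_synonym point = "nat \<times> real"

definition origin :: point where
  "origin = (0, 0)"

definition star_dist :: "point \<Rightarrow> point \<Rightarrow> real" where
  "star_dist p q = (if fst p = fst q then \<bar>snd p - snd q\<bar> else snd p + snd q)"

text \<open>
  One realisation of the model is given by \<open>d\<close> and \<open>c\<close>: \<open>d i k\<close> is the distance from the origin of
  the \<open>k\<close>-th particle on halfline \<open>i\<close>, and \<open>c w k\<close> is the time of the \<open>k\<close>-th ring of the clock of
  worker \<open>w\<close> (both counted from \<open>k = 0\<close>). The definitions below are meant for realisations in which
  no two clocks ring simultaneously, the closest particle is always unique and rings do not
  accumulate; this is almost surely the case. Elsewhere they take unspecified values, so probabilities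
  are to be read in the completion of the underlying measure.
\<close>

definition dust :: "nat \<Rightarrow> (nat \<Rightarrow> nat \<Rightarrow> real) \<Rightarrow> point set" where
  "dust N d = {(i, d i k) | i k. i \<in> {1..N}}"

definition rings :: "nat \<Rightarrow> (nat \<Rightarrow> nat \<Rightarrow> real) \<Rightarrow> real set" where
  "rings W c = {c w k | w k. w \<in> {1..W}}"

text \<open>Jumps of all workers together are numbered \<open>0, 1, 2, \<dots>\<close> in order of time.\<close>

primrec jump_time :: "nat \<Rightarrow> (nat \<Rightarrow> nat \<Rightarrow> real) \<Rightarrow> nat \<Rightarrow> real" where
  "jump_time W c 0 = Inf (rings W c)"
| "jump_time W c (Suc n) = Inf {s \<in> rings W c. jump_time W c n < s}"

definition jumper :: "nat \<Rightarrow> (nat \<Rightarrow> nat \<Rightarrow> real) \<Rightarrow> nat \<Rightarrow> nat" where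
  "jumper W c n = (THE w. w \<in> {1..W} \<and> (\<exists>k. c w k = jump_time W c n))"

definition jump :: "nat \<Rightarrow> (nat \<Rightarrow> point) \<times> point set \<Rightarrow> (nat \<Rightarrow> point) \<times> point set" where
  "jump w = (\<lambda>(pos, S). let q = arg_min (star_dist (pos w)) (\<lambda>q. q \<in> S)
                        in (pos(w := q), S - {q}))"

text \<open>The positions of the workers and the set of remaining particles after \<open>n\<close> jumps.\<close>

primrec config :: "nat \<Rightarrow> nat \<Rightarrow> (nat \<Rightarrow> nat \<Rightarrow> real) \<Rightarrow> (nat \<Rightarrow> nat \<Rightarrow> real) \<Rightarrow> nat
    \<Rightarrow> (nat \<Rightarrow> point) \<times> point set" where
  "config N W d c 0 = (\<lambda>_. origin, dust N d)"
| "config N W d c (Suc n) = jump (jumper W c n) (config N W d c n)"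

definition jump_source :: "nat \<Rightarrow> nat \<Rightarrow> (nat \<Rightarrow> nat \<Rightarrow> real) \<Rightarrow> (nat \<Rightarrow> nat \<Rightarrow> real) \<Rightarrow> nat \<Rightarrow> point" where
  "jump_source N W d c n = fst (config N W d c n) (jumper W c n)"

definition jump_target :: "nat \<Rightarrow> nat \<Rightarrow> (nat \<Rightarrow> nat \<Rightarrow> real) \<Rightarrow> (nat \<Rightarrow> nat \<Rightarrow> real) \<Rightarrow> nat \<Rightarrow> point" where
  "jump_target N W d c n = fst (config N W d c (Suc n)) (jumper W c n)"

definition is_advance :: "nat \<Rightarrow> nat \<Rightarrow> (nat \<Rightarrow> nat \<Rightarrow> real) \<Rightarrow> (nat \<Rightarrow> nat \<Rightarrow> real) \<Rightarrow> nat \<Rightarrow> bool" where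
  "is_advance N W d c n \<longleftrightarrow>
     jump_source N W d c n = origin \<or>
     fst (jump_source N W d c n) = fst (jump_target N W d c n)"

definition is_skip :: "nat \<Rightarrow> nat \<Rightarrow> (nat \<Rightarrow> nat \<Rightarrow> real) \<Rightarrow> (nat \<Rightarrow> nat \<Rightarrow> real) \<Rightarrow> nat \<Rightarrow> bool" where
  "is_skip N W d c n \<longleftrightarrow> \<not> is_advance N W d c n"

text \<open>In \<open>ennreal\<close>, \<open>Inf {} = \<infinity>\<close> (no such skip ever occurs) and \<open>Sup {} = 0\<close> (no skips at all).\<close>

definition sigma_time :: "nat \<Rightarrow> nat \<Rightarrow> (nat \<Rightarrow> nat \<Rightarrow> real) \<Rightarrow> (nat \<Rightarrow> nat \<Rightarrow> real) \<Rightarrow> real \<Rightarrow> ennreal" where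
  "sigma_time N W d c x =
     Inf {ennreal (jump_time W c n) | n.
            is_skip N W d c n \<and> x \<le> star_dist origin (jump_target N W d c n)}"

definition theta_time :: "nat \<Rightarrow> nat \<Rightarrow> (nat \<Rightarrow> nat \<Rightarrow> real) \<Rightarrow> (nat \<Rightarrow> nat \<Rightarrow> real) \<Rightarrow> ennreal" where
  "theta_time N W d c = Sup {ennreal (jump_time W c n) | n. is_skip N W d c n}"

definition halfline_at :: "nat \<Rightarrow> nat \<Rightarrow> (nat \<Rightarrow> nat \<Rightarrow> real) \<Rightarrow> (nat \<Rightarrow> nat \<Rightarrow> real) \<Rightarrow> nat \<Rightarrow> real \<Rightarrow> nat" where
  "halfline_at N W d c w t = fst (fst (config N W d c (card {s \<in> rings W c. s \<le> t})) w)"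

definition separated_from :: "nat \<Rightarrow> nat \<Rightarrow> (nat \<Rightarrow> nat \<Rightarrow> real) \<Rightarrow> (nat \<Rightarrow> nat \<Rightarrow> real) \<Rightarrow> real \<Rightarrow> bool" where
  "separated_from N W d c t \<longleftrightarrow>
     (\<forall>w1\<in>{1..W}. \<forall>w2\<in>{1..W}. w1 \<noteq> w2 \<longrightarrow>
        (\<forall>s\<ge>t. halfline_at N W d c w1 s \<noteq> halfline_at N W d c w2 s))"

definition eventually_separated :: "nat \<Rightarrow> nat \<Rightarrow> (nat \<Rightarrow> nat \<Rightarrow> real) \<Rightarrow> (nat \<Rightarrow> nat \<Rightarrow> real) \<Rightarrow> bool" where
  "eventually_separated N W d c \<longleftrightarrow> (\<exists>t\<ge>0. separated_from N W d c t)"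

text \<open>
  A homogeneous rate-1 Poisson process on the positive halfline, given by the increasing sequence of
  its points: the first point and the successive gaps are independent and exponentially distributed.
\<close>

definition gap :: "(nat \<Rightarrow> real) \<Rightarrow> nat \<Rightarrow> real" where
  "gap T k = (case k of 0 \<Rightarrow> T 0 | Suc j \<Rightarrow> T (Suc j) - T j)"

definition (in prob_space) poisson_process :: "('a \<Rightarrow> nat \<Rightarrow> real) \<Rightarrow> bool" where
  "poisson_process T \<longleftrightarrow>
     indep_vars (\<lambda>_. borel) (\<lambda>k \<omega>. gap (T \<omega>) k) UNIV \<and>
     (\<forall>k. distributed M lborel (\<lambda>\<omega>. gap (T \<omega>) k) (exponential_density 1))"

locale star_cleaning = prob_space M for M :: "'a measure" +
  fixes N W :: nat
    and D C :: "'a \<Rightarrow> nat \<Rightarrow> nat \<Rightarrow> real"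
  assumes dust_poisson: "\<And>i. i \<in> {1..N} \<Longrightarrow> poisson_process (\<lambda>\<omega>. D \<omega> i)"
    and clock_poisson: "\<And>w. w \<in> {1..W} \<Longrightarrow> poisson_process (\<lambda>\<omega>. C \<omega> w)"
    and indep: "indep_vars (\<lambda>_. PiM UNIV (\<lambda>_. borel))
                  (\<lambda>j \<omega>. case j of Inl i \<Rightarrow> D \<omega> i | Inr w \<Rightarrow> C \<omega> w) ({1..N} <+> {1..W})"

definition num_workers :: "real \<Rightarrow> nat \<Rightarrow> nat" where
  "num_workers \<alpha> N = nat \<lfloor>real N powr \<alpha>\<rfloor>"

end

theory Submission
 imports Defs "HOL-Real_Asymp.Real_Asymp"
begin

abbreviation meas :: "'a measure => ('a => 'b) set" where
 "meas M == measurable M (count_space UNIV)"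

abbreviation biimp :: "bool => bool => bool" (infixr "<->" 25) where
 "A <-> B == A = B"

abbreviation eventual :: "(nat => bool) => bool" (binder "EV " 10) where
 "eventual P == eventually P sequentially"

abbreviation npowr :: "nat => real => real" (infixr "pw" 80) where
 "N pw x == real N powr x"

text \<open>
The level is the least distance from the origin of the closest remaining particle, over all halflines;
a worker who enters a halfline always removes the particle at the level. On a halfline where every
particle is at most twice as far as the one before, the worker at the last removed particle never
leaves, so at most as many of these halflines are visited as there are workers. They are frequent
enough, \<open>N powr (- s)\<close> for every \<open>s > 0\<close>, to keep the level small forever, and a skip lands at the level.
A worker who still skips late must have landed many times, which costs more particles near the level
than there are, unless the number of such workers drops by a power of \<open>N\<close> in each of finitely many
periods of length \<open>N powr (1 - \<alpha> + \<epsilon> / 2)\<close>. If two workers stay together, then two disjoint chains of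
exceptionally short gaps and one gap of order \<open>N powr (\<alpha> - 1)\<close> occur on their halfline; the expected
number of such halflines is \<open>N powr (3 * \<alpha> - 2 + o(1))\<close>. Conversely there are about that many halflines
whose first two particles are removed by two workers in immediate succession, each followed by gaps
that make the two workers alternate until both are too far out to leave. These gaps are fresh at
that moment, and a second moment computation shows that the event happens on some halfline.
\<close>

section \<open>Enumeration of a locally finite set\<close>

text \<open>A good halfline and a chain have the same price. If the level is
  \<open>m = 2 powr (- a)\<close>, about \<open>a\<close> gaps of the orders \<open>m\<close>,
  \<open>2 * m\<close>, \<open>4 * m\<close>, ... have to be small, and the product of these orders
  is about \<open>2 powr (- a ^ 2 / 2)\<close>. Hence the price \<open>N powr (- s)\<close> belongs
  to the level \<open>2 powr (- sqrt (2 * s * log 2 N))\<close>, and the level settles where the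
  halflines of this price are about as many as the workers, at \<open>s = 1 - \<alpha>\<close>. It
  is bounded above with an \<open>s\<close> slightly below this value and below with an
  \<open>s\<close> slightly above; the margins are multiples of a small \<open>dl\<close>, and error
  factors are powers of \<open>N powr dl\<close>. The obstacle to coexistence is that every decision
  of a worker depends on all the others. Only two kinds of information are therefore combined: what
  the history up to a meeting has revealed, and gaps that it has not looked at. The event concerns
  all future times while a fresh pattern fixes finitely many gaps; so the patterns only have to
  carry the two workers to the region where regularity alone excludes skips.\<close>

locale enum_set =
 fixes R :: "real set" and e :: "nat => real"
 assumes fin: "!!t. finite {s \<in> R. s <= t}"
  and unbdd: "!!t. \<exists>s\<in>R. t < s"
  and e_0: "e 0 = Inf R"
  and e_Suc: "!!n. e (Suc n) = Inf {s \<in> R. e n < s}"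
begin

text \<open>Only finitely many elements lie below any given one, so the infimum is a
  minimum.\<close>

lemma Inf_attained:
 assumes "A <= R" "A ~= {}"
 shows "Inf A \<in> A & (\<forall>s\<in>A. Inf A <= s)"
proof -
 obtain a where a: "a \<in> A" using assms by auto
 let ?B = "{s \<in> A. s <= a}"
 have B: "finite ?B" by (rule finite_subset[OF _ fin[of a]]) (use assms in auto)
 have ne: "?B ~= {}" using a by auto
 have m: "Min ?B \<in> ?B" using Min_in[OF B ne] .
 have le: "Min ?B <= s" if "s \<in> A" for s
 proof (cases "s <= a")
  case True thus ?thesis using Min_le[OF B] that by auto
 next
  case False thus ?thesis using m by auto
 qed
 have "Inf A = Min ?B"
  by (rule cInf_eq_minimum) (use m le in auto)
 thus ?thesis using m le by auto
qed

lemma e_0_in: "e 0 \<in> R" and e_0_le: "s \<in> R ==> e 0 <= s"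
 using Inf_attained[of R] unbdd[of 0] by (auto simp: e_0)

lemma e_Suc_in: "e (Suc n) \<in> R" and e_less_Suc: "e n < e (Suc n)"
 and e_Suc_le: "s \<in> R ==> e n < s ==> e (Suc n) <= s"
 using Inf_attained[of "{s \<in> R. e n < s}"] unbdd[of "e n"] by (auto simp: e_Suc)

lemma e_in: "e n \<in> R"
 by (cases n) (auto simp: e_0_in e_Suc_in)

lemma e_strict_mono: "strict_mono e"
 by (rule strict_monoI_Suc) (rule e_less_Suc)

lemma e_less_iff: "e m < e n <-> m < n"
 using e_strict_mono strict_mono_less by blast

lemma e_le_iff: "e m <= e n <-> m <= n"
 using e_strict_mono strict_mono_less_eq by blast

lemma e_unbdd: "\<exists>n. t < e n"
proof (rule ccontr)
 assume "~ ?thesis"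
 hence "range e <= {s \<in> R. s <= t}" using e_in by (auto simp: not_less)
 hence "finite (range e)" using fin finite_subset by blast
 thus False using e_strict_mono strict_mono_imp_inj_on
  by (metis finite_imageD infinite_UNIV_nat)
qed

lemma e_surj: assumes "s \<in> R" shows "\<exists>n. s = e n"
proof (rule ccontr)
 assume neg: "~ ?thesis"
 have "e n < s" for n
 proof (induction n)
  case 0 show ?case using e_0_le[OF assms] neg by (metis less_eq_real_def)
 next
  case (Suc n) thus ?case using e_Suc_le[OF assms] neg by (metis less_eq_real_def)
 qed
 thus False using e_unbdd[of s] by (meson less_asym)
qed

lemma R_eq: "R = range e"
 using e_in e_surj by (auto simp: image_iff)

text \<open>\<open>halfline_at\<close> counts rings up to a real time; this turns the count into a
  jump number.\<close>

lemma card_le_less_iff: "n < card {s \<in> R. s <= t} <-> e n <= t"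
proof -
 obtain m where m: "t < e m" using e_unbdd by auto
 define p where "p = (LEAST m. t < e m)"
 have p: "t < e p" unfolding p_def by (rule LeastI[of _ m], rule m)
 have p': "e n <= t" if "n < p" for n using that not_less_Least p_def by (metis not_le_imp_less)
 have "{s \<in> R. s <= t} = e ` {..<p}"
 proof -
  have "n < p" if "e n <= t" for n
   using that p e_less_iff by (meson le_less_trans)
  thus ?thesis unfolding R_eq using p' by auto
 qed
 hence "card {s \<in> R. s <= t} = p"
  using card_image[of e "{..<p}"] e_strict_mono strict_mono_imp_inj_on
  by (metis card_lessThan inj_on_subset subset_UNIV)
 thus ?thesis using p p' e_less_iff by (metis le_less_trans not_le_imp_less)
qed

end

section \<open>The process in terms of indices\<close>

text \<open>A state consists of the current halfline \<open>l w\<close> of each worker (\<open>0\<close> for the origin), the index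
  \<open>x w\<close> of the particle he sits at, and the number \<open>k i\<close> of particles removed from halfline \<open>i\<close>; the
  latter suffice since the removed particles of a halfline always form an initial segment.\<close>

type_synonym state = "(nat => nat) \<times> (nat => nat) \<times> (nat => nat)"

definition place :: "nat => (nat => nat => real) => nat => nat => real" where
 "place N d l x = (if l \<in> {1..N} then d l x else 0)"

definition front_dist :: "nat => (nat => nat => real) => state => nat => nat => real" where
 "front_dist N d s w i = (case s of (l, x, k) =>
   if l w = i then d i (k i) - place N d (l w) (x w) else place N d (l w) (x w) + d i (k i))"

text \<open>Taking the least minimizer makes the choice total and measurable in the realisation,
  which is not clear for \<open>arg_min\<close>; both agree when the minimizer is unique.\<close>

definition target :: "nat => (nat => nat => real) => state => nat => nat" where
 "target N d s w =
   (LEAST i. i \<in> {1..N} & (\<forall>j\<in>{1..N}. front_dist N d s w i <= front_dist N d s w j))"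

primrec st :: "nat => (nat => nat => real) => (nat => nat) => nat => state" where
 "st N d J 0 = (%_. 0, %_. 0, %_. 0)"
| "st N d J (Suc n) = (case st N d J n of (l, x, k) =>
   (let i = target N d (l, x, k) (J n) in (l(J n := i), x(J n := k i), k(i := Suc (k i)))))"

locale star_proc =
 fixes N W :: nat and d :: "nat => nat => real" and J :: "nat => nat"
 assumes N_pos: "1 <= N"
  and d_pos: "!!i k. i \<in> {1..N} ==> 0 < d i k"
  and d_Suc: "!!i k. i \<in> {1..N} ==> d i k < d i (Suc k)"
  and J_in: "!!n. J n \<in> {1..W}"
begin

definition "L n w = fst (st N d J n) w"
definition "X n w = fst (snd (st N d J n)) w"
definition "K n i = snd (snd (st N d J n)) i"
definition "Y n w = place N d (L n w) (X n w)"
definition "T n = target N d (st N d J n) (J n)"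
definition "Z n = d (T n) (K n (T n))"
definition "Lev n = Min ((%i. d i (K n i)) ` {1..N})"
definition "FD n i = (if L n (J n) = i then d i (K n i) - Y n (J n) else Y n (J n) + d i (K n i))"

lemma d_less_iff: "i \<in> {1..N} ==> d i k < d i k' <-> k < k'"
 using strict_mono_less[OF strict_monoI_Suc[of "d i"]] d_Suc by auto

lemma d_le_iff: "i \<in> {1..N} ==> d i k <= d i k' <-> k <= k'"
 using strict_mono_less_eq[OF strict_monoI_Suc[of "d i"]] d_Suc by auto

lemma st_eq: "st N d J n = (L n, X n, K n)"
 by (auto simp: L_def X_def K_def prod_eq_iff)

lemma FD_eq: "front_dist N d (st N d J n) (J n) i = FD n i"
 by (auto simp: front_dist_def st_eq FD_def Y_def)

lemma L_0 [simp]: "L 0 w = 0" and X_0 [simp]: "X 0 w = 0" and K_0 [simp]: "K 0 i = 0"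
 by (simp_all add: L_def X_def K_def)

lemma step_eq: "st N d J (Suc n) =
  ((L n)(J n := T n), (X n)(J n := K n (T n)), (K n)(T n := Suc (K n (T n))))"
 by (simp add: st_eq T_def Let_def del: split_paired_All)

lemma L_Suc: "L (Suc n) w = (if w = J n then T n else L n w)"
 and X_Suc: "X (Suc n) w = (if w = J n then K n (T n) else X n w)"
 and K_Suc: "K (Suc n) i = (if i = T n then Suc (K n i) else K n i)"
 unfolding L_def[of "Suc n"] X_def[of "Suc n"] K_def[of "Suc n"] step_eq by auto

lemma T_props: "T n \<in> {1..N}" "!!j. j \<in> {1..N} ==> FD n (T n) <= FD n j"
proof -
 have fin: "finite {1..N}" "{1..N} ~= {}" using N_pos by auto
 let ?P = "%i. i \<in> {1..N} & (\<forall>j\<in>{1..N}. FD n i <= FD n j)"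
 have "Min (FD n ` {1..N}) \<in> FD n ` {1..N}" using fin by (intro Min_in) auto
 then obtain i where i: "i \<in> {1..N}" "FD n i = Min (FD n ` {1..N})" by auto
 hence "?P i" using fin by auto
 hence "?P (LEAST i. ?P i)" by (rule LeastI)
 moreover have "T n = (LEAST i. ?P i)" by (simp add: T_def target_def FD_eq)
 ultimately show "T n \<in> {1..N}" "!!j. j \<in> {1..N} ==> FD n (T n) <= FD n j" by metis+
qed

lemmas T_in = T_props(1)
lemmas T_le = T_props(2)

lemma L_le: "L n w <= N"
 by (induction n) (use T_in in "auto simp: L_Suc")

lemma L_in: "L n w ~= 0 ==> L n w \<in> {1..N}"
 using L_le[of n w] by auto

lemma X_less_K: "L n w ~= 0 ==> X n w < K n (L n w)"
 by (induction n) (auto simp: L_Suc X_Suc K_Suc)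

lemma Y_nonneg: "0 <= Y n w"
 using d_pos by (auto simp: Y_def place_def less_imp_le)

lemma Y_eq: "L n w ~= 0 ==> Y n w = d (L n w) (X n w)"
 using L_in by (auto simp: Y_def place_def)

lemma Y_origin: "L n w = 0 ==> Y n w = 0"
 by (simp add: Y_def place_def)

lemma Y_Suc: "Y (Suc n) w = (if w = J n then Z n else Y n w)"
 using T_in[of n] by (auto simp: Y_def L_Suc X_Suc Z_def place_def)

lemma Lev_le: "i \<in> {1..N} ==> Lev n <= d i (K n i)"
 unfolding Lev_def by (rule Min_le) auto

lemma Lev_attained: "\<exists>i\<in>{1..N}. Lev n = d i (K n i)"
proof -
 have "Lev n \<in> (%i. d i (K n i)) ` {1..N}" unfolding Lev_def
  by (rule Min_in) (use N_pos in auto)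
 thus ?thesis by auto
qed

lemma le_Lev: "(!!i. i \<in> {1..N} ==> a <= d i (K n i)) ==> a <= Lev n"
 using Lev_attained by metis

lemma Lev_le_Z: "Lev n <= Z n"
 using Lev_le[OF T_in] by (simp add: Z_def)

lemma Lev_pos: "0 < Lev n"
 using Lev_attained d_pos by metis

lemma K_mono: "m <= n ==> K m i <= K n i"
 by (rule lift_Suc_mono_le) (auto simp: K_Suc)

lemma Lev_mono: "m <= n ==> Lev m <= Lev n"
proof (rule le_Lev)
 fix i assume i: "i \<in> {1..N}" and "m <= n"
 hence "d i (K m i) <= d i (K n i)" using d_le_iff K_mono by blast
 thus "Lev m <= d i (K n i)" using Lev_le[OF i, of m] by linarith
qed

text \<open>The jumper's distance from the origin is a common summand for all halflines but his own,
  and his own was not chosen although it is favoured by twice that distance. So the target is the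
  least remaining distance of all.\<close>

lemma landing_Z: assumes "L n (J n) ~= T n" shows "Z n = Lev n"
proof (rule antisym)
 show "Lev n <= Z n" by (rule Lev_le_Z)
 show "Z n <= Lev n"
 proof (rule le_Lev)
  fix i assume i: "i \<in> {1..N}"
  have "FD n (T n) <= FD n i" by (rule T_le[OF i])
  thus "Z n <= d i (K n i)" using assms Y_nonneg[of n "J n"]
   by (auto simp: FD_def Z_def split: if_splits)
 qed
qed

text \<open>Otherwise the particle at the level, reached through the origin, would have been
  closer.\<close>

lemma Z_le: "Z n <= 2 * Y n (J n) + Lev n"
proof (cases "L n (J n) = T n")
 case True
 have "Z n - 2 * Y n (J n) <= Lev n"
 proof (rule le_Lev)
  fix i assume i: "i \<in> {1..N}"
  have "FD n (T n) <= FD n i" by (rule T_le[OF i])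
  thus "Z n - 2 * Y n (J n) <= d i (K n i)" using True Y_nonneg[of n "J n"]
   by (auto simp: FD_def Z_def split: if_splits)
 qed
 thus ?thesis by linarith
next
 case False thus ?thesis using landing_Z Y_nonneg[of n "J n"] by simp
qed

lemma consumed_inj: "m < n ==> T m = T n ==> K m (T m) < K n (T n)"
 using K_mono[of "Suc m" n "T m"] by (auto simp: K_Suc)

lemma consumed_at:
 assumes "k < K n i"
 shows "\<exists>m<n. T m = i & K m i = k"
 using assms
proof (induction n)
 case (Suc n)
 show ?case
 proof (cases "k < K n i")
  case True thus ?thesis using Suc.IH less_SucI by blast
 next
  case False
  hence "T n = i" "K n i = k" using Suc.prems by (auto simp: K_Suc split: if_splits)
  thus ?thesis by auto
 qed
qed simp

lemma arrival:
 assumes "L n w ~= 0"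
 shows "\<exists>m<n. J m = w & T m = L n w & K m (T m) = X n w & (\<forall>m'. m < m' & m' < n --> J m' ~= w)"
 using assms
proof (induction n)
 case (Suc n)
 show ?case
 proof (cases "w = J n")
  case True thus ?thesis by (intro exI[of _ n]) (auto simp: L_Suc X_Suc)
 next
  case False
  then obtain m where "m < n" "J m = w" "T m = L n w" "K m (T m) = X n w"
   "\<forall>m'. m < m' & m' < n --> J m' ~= w" using Suc by (auto simp: L_Suc)
  thus ?thesis using False by (intro exI[of _ m]) (auto simp: L_Suc X_Suc less_Suc_eq)
 qed
qed simp

lemma stays:
 assumes "m <= n" "!!m'. m <= m' ==> m' < n ==> J m' ~= w"
 shows "L n w = L m w & X n w = X m w"
 using assms
proof (induction n rule: dec_induct)
 case (step n) thus ?case by (auto simp: L_Suc X_Suc)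
qed simp

end

section \<open>Comparison with the model\<close>

text \<open>\<open>tie2\<close> excludes that a particle ahead on the own halfline,
  \<open>d i k - d i x\<close> away, is as far as a particle elsewhere,
  \<open>d i x + d j k'\<close> away; \<open>tie1\<close> does the same for two particles on other
  halflines.\<close>

locale star_real =
 fixes N W :: nat and d c :: "nat => nat => real"
 assumes N1: "1 <= N" and W1: "1 <= W"
  and dpos: "!!i k. i \<in> {1..N} ==> 0 < d i k"
  and dSuc: "!!i k. i \<in> {1..N} ==> d i k < d i (Suc k)"
  and tie1: "!!i j k k'. i \<in> {1..N} ==> j \<in> {1..N} ==> i ~= j ==> d i k ~= d j k'"
  and tie2: "!!i j k x k'. i \<in> {1..N} ==> j \<in> {1..N} ==> i ~= j ==> d i k - 2 * d i x ~= d j k'"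
  and cpos: "!!w r. w \<in> {1..W} ==> 0 < c w r"
  and cSuc: "!!w r. w \<in> {1..W} ==> c w r < c w (Suc r)"
  and ctie: "!!w w' r r'. w \<in> {1..W} ==> w' \<in> {1..W} ==> w ~= w' ==> c w r ~= c w' r'"
  and cunb: "!!w t. w \<in> {1..W} ==> \<exists>r. t < c w r"
begin

lemma c_less_iff: "w \<in> {1..W} ==> c w k < c w k' <-> k < k'"
 using strict_mono_less[OF strict_monoI_Suc[of "c w"]] cSuc by auto

lemma c_le_iff: "w \<in> {1..W} ==> c w k <= c w k' <-> k <= k'"
 using strict_mono_less_eq[OF strict_monoI_Suc[of "c w"]] cSuc by auto

lemma c_eq_iff: "w \<in> {1..W} ==> w' \<in> {1..W} ==> c w k = c w' k' <-> w = w' & k = k'"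
 using ctie c_less_iff by (metis linorder_neq_iff)

lemma finite_rings_le: "finite {s \<in> rings W c. s <= t}"
proof -
 have "finite {r. c w r <= t}" if w: "w \<in> {1..W}" for w
 proof -
  obtain r where "t < c w r" using cunb[OF w] by auto
  hence "{r. c w r <= t} <= {..<r}" using c_less_iff[OF w] by (auto intro: le_less_trans)
  thus ?thesis using finite_subset by blast
 qed
 hence "finite (\<Union>w\<in>{1..W}. c w ` {r. c w r <= t})" by auto
 moreover have "{s \<in> rings W c. s <= t} <= (\<Union>w\<in>{1..W}. c w ` {r. c w r <= t})"
  by (auto simp: rings_def)
 ultimately show ?thesis using finite_subset by blast
qed

sublocale enum: enum_set "rings W c" "jump_time W c"
proof
 show "\<exists>s\<in>rings W c. t < s" for t
 proof -
  have "1 \<in> {1..W}" using W1 by auto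
  then obtain r where "t < c 1 r" using cunb by blast
  thus ?thesis using \<open>1 \<in> {1..W}\<close> by (auto simp: rings_def)
 qed
qed (use finite_rings_le in auto)

lemma jumper_props: "jumper W c n \<in> {1..W} & (\<exists>r. c (jumper W c n) r = jump_time W c n)"
proof -
 obtain w r where w: "w \<in> {1..W}" "jump_time W c n = c w r"
  using enum.e_in[of n] by (auto simp: rings_def)
 have "w \<in> {1..W} & (\<exists>k. c w k = jump_time W c n)" using w by auto
 moreover have "w' = w" if "w' \<in> {1..W} & (\<exists>k. c w' k = jump_time W c n)" for w'
  using that w c_eq_iff by metis
 ultimately show ?thesis unfolding jumper_def by (rule theI)
qed

lemma jumper_eqI: "w \<in> {1..W} ==> c w r = jump_time W c n ==> jumper W c n = w"
 using jumper_props[of n] c_eq_iff by metis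

lemma ring_step: "w \<in> {1..W} ==> \<exists>n. jump_time W c n = c w r & jumper W c n = w"
proof -
 assume w: "w \<in> {1..W}"
 hence "c w r \<in> rings W c" by (auto simp: rings_def)
 then obtain n where "c w r = jump_time W c n" using enum.e_surj by auto
 thus ?thesis using jumper_eqI[OF w] by metis
qed

sublocale star_proc N W d "jumper W c"
 by standard (use N1 dpos dSuc jumper_props in auto)

lemma front_star_dist:
 assumes "j \<in> {1..N}" "K n j <= k"
 shows "star_dist (L n w, Y n w) (j, d j k) = (if L n w = j then d j k - Y n w else Y n w + d j k)"
proof (cases "L n w = j")
 case True
 hence "X n w < k" using X_less_K[of n w] assms by auto
 hence "d j (X n w) < d j k" using d_less_iff assms by blast
 thus ?thesis using True assms Y_eq[of n w] by (auto simp: star_dist_def)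
qed (auto simp: star_dist_def)

lemma arg_min_front:
 "arg_min (star_dist (L n (jumper W c n), Y n (jumper W c n)))
   (%q. q \<in> {(i, d i k) | i k. i \<in> {1..N} & K n i <= k}) = (T n, Z n)"
proof -
 let ?w = "jumper W c n"
 let ?S = "{(i, d i k) | i k. i \<in> {1..N} & K n i <= k}"
 let ?f = "star_dist (L n ?w, Y n ?w)"
 have q: "(T n, Z n) \<in> ?S" using T_in by (auto simp: Z_def)
 have fq: "?f (T n, Z n) = FD n (T n)"
  using front_star_dist[OF T_in, of n n] by (auto simp: Z_def FD_def)
 have less: "?f (T n, Z n) < ?f p" if p: "p \<in> ?S" "p ~= (T n, Z n)" for p
 proof -
  obtain j k where jk: "p = (j, d j k)" "j \<in> {1..N}" "K n j <= k" using p by auto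
  have fp: "?f p = (if L n ?w = j then d j k - Y n ?w else Y n ?w + d j k)"
   using front_star_dist[OF jk(2,3)] jk(1) by simp
  have "FD n j <= ?f p" unfolding fp FD_def using d_le_iff[OF jk(2)] jk(3) by auto
  hence le: "?f (T n, Z n) <= ?f p" using fq T_le[OF jk(2)] by (metis order_trans)
  \<comment> \<open>A tie between different halflines is excluded by \<open>tie2\<close> if one of
    them is the jumper's own, and by \<open>tie1\<close> otherwise.\<close>
  have "?f (T n, Z n) ~= ?f p"
  proof (cases "j = T n")
   case True
   hence "d j k ~= Z n" using p jk by auto
   thus ?thesis using fp fq True by (auto simp: FD_def Z_def split: if_splits)
  next
   case False
   show ?thesis
   proof (cases "L n ?w = T n")
    case True
    have "L n ?w ~= 0" using T_in[of n] True by auto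
    hence "Y n ?w = d (T n) (X n ?w)" using Y_eq True by metis
    thus ?thesis using fp fq True False tie2[OF T_in jk(2), of n "K n (T n)" "X n ?w" k]
     by (auto simp: FD_def algebra_simps)
   next
    case 2: False
    show ?thesis
    proof (cases "L n ?w = j")
     case True
     hence "L n ?w ~= 0" using jk by auto
     hence "Y n ?w = d j (X n ?w)" using Y_eq True by metis
     thus ?thesis using fp fq True False tie2[OF jk(2) T_in, of n k "X n ?w" "K n (T n)"]
      by (auto simp: FD_def algebra_simps)
    next
     case 3: False
     show ?thesis using fp fq 2 3 False tie1[OF jk(2) T_in, of n k "K n (T n)"]
      by (auto simp: FD_def)
    qed
   qed
  qed
  with le show ?thesis by simp
 qed
 have gen: "arg_min f P = a" if "P a" "!!p. P p ==> p ~= a ==> f a < f p"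
  for f :: "point => real" and P a
  unfolding arg_min_def is_arg_min_def
 proof (rule some_equality)
  show "P a & ~ (\<exists>y. P y & f y < f a)"
   using that by (metis less_asym)
  show "p = a" if "P p & ~ (\<exists>y. P y & f y < f p)" for p
   using that \<open>P a\<close> \<open>!!p. P p ==> p ~= a ==> f a < f p\<close> by blast
 qed
 show ?thesis by (rule gen) (use q less in "blast+")
qed

lemma config_eq:
 "config N W d c n = (%w. (L n w, Y n w), {(i, d i k) | i k. i \<in> {1..N} & K n i <= k})"
proof (induction n)
 case 0
 show ?case by (auto simp: origin_def dust_def Y_def place_def fun_eq_iff)
next
 case (Suc n)
 let ?w = "jumper W c n"
 let ?S = "{(i, d i k) | i k. i \<in> {1..N} & K n i <= k}"
 have "config N W d c (Suc n) = ((%w. (L n w, Y n w))(?w := (T n, Z n)), ?S - {(T n, Z n)})"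
  unfolding config.simps Suc jump_def Let_def split using arg_min_front[of n] by simp
 moreover have "(%w. (L n w, Y n w))(?w := (T n, Z n)) = (%w. (L (Suc n) w, Y (Suc n) w))"
  by (auto simp: L_Suc Y_Suc fun_eq_iff)
 moreover have "?S - {(T n, Z n)} = {(i, d i k) | i k. i \<in> {1..N} & K (Suc n) i <= k}"
 proof -
  have "(K n i <= k & (i, d i k) ~= (T n, Z n)) <-> K (Suc n) i <= k" if "i \<in> {1..N}" for i k
  proof (cases "i = T n")
   case True
   hence "d i k = Z n <-> k = K n (T n)"
    using d_le_iff[OF that] by (metis Z_def order_antisym order_refl)
   thus ?thesis using True by (auto simp: K_Suc)
  qed (auto simp: K_Suc)
  note eq = this
  have "?S - {(T n, Z n)} = {(i, d i k) | i k. i \<in> {1..N} & (K n i <= k & (i, d i k) ~= (T n, Z n))}"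
   by (rule set_eqI) (unfold mem_Collect_eq Diff_iff singleton_iff, metis)
  also have "... = {(i, d i k) | i k. i \<in> {1..N} & K (Suc n) i <= k}"
   by (intro Collect_cong ex_cong1 conj_cong refl eq)
  finally show ?thesis .
 qed
 ultimately show ?case by simp
qed

lemma is_skip_iff: "is_skip N W d c n <-> L n (jumper W c n) ~= 0 & L n (jumper W c n) ~= T n"
proof -
 have "(L n (jumper W c n), Y n (jumper W c n)) = origin <-> L n (jumper W c n) = 0"
  using Y_origin by (auto simp: origin_def)
 thus ?thesis
  unfolding is_skip_def is_advance_def jump_source_def jump_target_def config_eq
  by (auto simp: L_Suc)
qed

lemma target_dist: "star_dist origin (jump_target N W d c n) = Z n"
 using T_in[of n]
 by (auto simp: jump_target_def config_eq L_Suc Y_Suc star_dist_def origin_def simp del: config.simps)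

lemma halfline_at_eq: "halfline_at N W d c w t = L (card {s \<in> rings W c. s <= t}) w"
 by (simp add: halfline_at_def config_eq)

definition "skip n <-> L n (jumper W c n) ~= 0 & L n (jumper W c n) ~= T n"

lemma sigma_inf_iff: "sigma_time N W d c x = \<infinity> <-> (\<forall>n. skip n --> Z n < x)"
proof -
 have "Inf {ennreal (jump_time W c n) | n.
   is_skip N W d c n & x <= star_dist origin (jump_target N W d c n)} = \<infinity> <-> (\<forall>n. ~ (is_skip N W d c n & x <= star_dist origin (jump_target N W d c n)))"
  (is "Inf ?A = \<infinity> <-> _")
 proof -
  have "Inf ?A = top <-> (\<forall>a\<in>?A. a = top)" by (metis (mono_tags, lifting) Inf_top_conv(1))
  thus ?thesis unfolding infinity_ennreal_def by auto
 qed
 note eq = this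
 have "sigma_time N W d c x = \<infinity> <->
   (\<forall>n. ~ (is_skip N W d c n & x <= star_dist origin (jump_target N W d c n)))"
  unfolding sigma_time_def by (rule eq)
 thus ?thesis unfolding is_skip_iff target_dist skip_def by (metis not_le)
qed

lemma theta_le_iff: "0 <= b ==> theta_time N W d c <= ennreal b <-> (\<forall>n. skip n --> jump_time W c n <= b)"
 unfolding theta_time_def Sup_le_iff by (auto simp: is_skip_iff skip_def ennreal_le_iff)

lemma eventually_separated_iff:
 "eventually_separated N W d c <->
   (\<exists>m. \<forall>n\<ge>m. \<forall>w1\<in>{1..W}. \<forall>w2\<in>{1..W}. w1 ~= w2 --> L n w1 ~= L n w2)"
proof
 assume "eventually_separated N W d c"
 then obtain t where t: "t \<ge> 0" "!!w1 w2 s. w1\<in>{1..W} ==> w2\<in>{1..W} ==> w1 ~= w2 ==> s \<ge> t ==>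
   L (card {s' \<in> rings W c. s' <= s}) w1 ~= L (card {s' \<in> rings W c. s' <= s}) w2"
  by (auto simp: eventually_separated_def separated_from_def halfline_at_eq)
 obtain m where m: "t < jump_time W c m" using enum.e_unbdd by auto
 have "card {s' \<in> rings W c. s' <= jump_time W c n} = Suc n" for n
 proof -
  have "p < card {s' \<in> rings W c. s' <= jump_time W c n} <-> p < Suc n" for p
   using enum.card_le_less_iff[of p "jump_time W c n"] enum.e_le_iff[of p n] by auto
  thus ?thesis by (metis linorder_neq_iff)
 qed
 hence card_eq: "card {s' \<in> rings W c. s' <= jump_time W c n} = Suc n" for n .
 have "\<forall>w1\<in>{1..W}. \<forall>w2\<in>{1..W}. w1 ~= w2 --> L n w1 ~= L n w2" if n: "n \<ge> Suc m" for n
 proof -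
  obtain p where p: "n = Suc p" "m <= p" using n by (cases n) auto
  have "t <= jump_time W c p" using m p enum.e_le_iff[of m p] by linarith
  thus ?thesis using t(2)[of _ _ "jump_time W c p"] unfolding card_eq p by blast
 qed
 thus "\<exists>m. \<forall>n\<ge>m. \<forall>w1\<in>{1..W}. \<forall>w2\<in>{1..W}. w1 ~= w2 --> L n w1 ~= L n w2" by blast
next
 assume "\<exists>m. \<forall>n\<ge>m. \<forall>w1\<in>{1..W}. \<forall>w2\<in>{1..W}. w1 ~= w2 --> L n w1 ~= L n w2"
 then obtain m where m: "!!n w1 w2. n \<ge> m ==> w1\<in>{1..W} ==> w2\<in>{1..W} ==> w1 ~= w2 ==> L n w1 ~= L n w2"
  by blast
 have pos: "0 <= jump_time W c m" using enum.e_in[of m] cpos by (auto simp: rings_def intro: less_imp_le)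
 have "m <= card {s' \<in> rings W c. s' <= s}" if "jump_time W c m <= s" for s
  using enum.card_le_less_iff[of m s] that by simp
 thus "eventually_separated N W d c"
  unfolding eventually_separated_def separated_from_def halfline_at_eq
  using m pos by blast
qed

end

section \<open>Leaders and the level\<close>

text \<open>Every complete cell between \<open>a\<close> and \<open>b\<close> contributes an element
  of its own; the 2 accounts for the incomplete cells at the ends.\<close>

lemma card_cells:
 fixes f :: "'b => real"
 assumes "finite S" "0 < h" "0 <= a" "mu <= a" "a < b" "b <= nu"
  and cell: "!!l::nat. mu <= real l * h ==> (real l + 1) * h <= nu ==>
   \<exists>i\<in>S. real l * h <= f i & f i < (real l + 1) * h"
 shows "(b - a) / h - 2 <= card {i \<in> S. a < f i & f i < b}"
proof -
 \<comment> \<open>The added 1 makes the first cell start strictly beyond \<open>a\<close>, also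
   when \<open>a\<close> is a multiple of \<open>h\<close>.\<close>
 define p where "p = nat \<lfloor>a / h\<rfloor> + 1"
 define r where "r = nat \<lfloor>b / h\<rfloor>"
 have p: "real p <= a / h + 1" "a / h < p" using assms(2,3) by (auto simp: p_def floor_less_cancel)
 have r: "real r <= b / h" "b / h - 1 < r" using assms by (auto simp: r_def floor_less_cancel)
 have ex: "\<exists>i\<in>S. real l * h <= f i & f i < (real l + 1) * h" if "l \<in> {p..<r}" for l
 proof (rule cell)
  have "a / h <= l" using that p by auto
  hence "a <= l * h" using assms(2) by (simp add: field_simps)
  thus "mu <= real l * h" using assms by simp
  have "real l + 1 <= b / h" using that r by auto
  hence "(real l + 1) * h <= b" using assms(2) by (simp add: field_simps)
  thus "(real l + 1) * h <= nu" using assms by simp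
 qed
 then obtain g where g: "!!l. l \<in> {p..<r} ==> g l \<in> S & real l * h <= f (g l) & f (g l) < (real l + 1) * h"
  by metis
 have inj: "inj_on g {p..<r}"
 proof (rule inj_onI)
  fix x y assume xy: "x \<in> {p..<r}" "y \<in> {p..<r}" "g x = g y"
  have "real x * h < (real y + 1) * h" "real y * h < (real x + 1) * h"
   using g[OF xy(1)] g[OF xy(2)] xy(3) by auto
  hence "real x < real y + 1" "real y < real x + 1" using assms(2) by auto
  thus "x = y" by linarith
 qed
 have sub: "g ` {p..<r} <= {i \<in> S. a < f i & f i < b}"
 proof safe
  fix l assume l: "l \<in> {p..<r}"
  show "g l \<in> S" using g[OF l] by simp
  have "a / h < l" using l p by auto
  hence "a < l * h" using assms(2) by (simp add: field_simps)
  thus "a < f (g l)" using g[OF l] by simp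
  have "real l + 1 <= b / h" using l r by auto
  hence "(real l + 1) * h <= b" using assms(2) by (simp add: field_simps)
  thus "f (g l) < b" using g[OF l] by simp
 qed
 have "card {p..<r} <= card {i \<in> S. a < f i & f i < b}"
  using card_mono[OF _ sub] card_image[OF inj] assms(1) by simp
 hence "real r - p <= card {i \<in> S. a < f i & f i < b}" by auto
 thus ?thesis using p r by (simp add: diff_divide_distrib)
qed

definition good :: "(nat => real) => bool" where
 "good t <-> (\<forall>k. t (Suc k) <= 2 * t k)"

context star_proc
begin

text \<open>On a good halfline the worker at the last removed particle does not leave, so once visited
  such a halfline is never abandoned.\<close>

lemma leader:
 assumes "i \<in> {1..N}" "good (d i)" "0 < K n i"
 shows "\<exists>w\<in>{1..W}. L n w = i & Suc (X n w) = K n i"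
 using assms(3)
proof (induction n)
 case (Suc n)
 show ?case
 proof (cases "T n = i")
  case True
  thus ?thesis using J_in by (intro bexI[of _ "J n"]) (auto simp: L_Suc X_Suc K_Suc)
 next
  case False
  hence "0 < K n i" using Suc by (simp add: K_Suc)
  then obtain w where w: "w \<in> {1..W}" "L n w = i" "Suc (X n w) = K n i" using Suc by auto
  have "J n ~= w"
  proof
   assume J: "J n = w"
   have "L n w ~= 0" using w assms by auto
   hence Y: "Y n w = d i (X n w)" using Y_eq w by metis
   have "d i (K n i) <= 2 * d i (X n w)" using assms(2) w(3) unfolding good_def by metis
   moreover have "FD n (T n) <= FD n i" using T_le assms by blast
   ultimately have "d (T n) (K n (T n)) <= 0" using False J w Y by (auto simp: FD_def)
   thus False using d_pos[OF T_in] by (metis not_le)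
  qed
  thus ?thesis using w False by (intro bexI[of _ w]) (auto simp: L_Suc X_Suc K_Suc)
 qed
qed simp

text \<open>A worker is on one halfline only, so different good halflines have different
  leaders.\<close>

lemma card_visited_good: "card {i \<in> {1..N}. good (d i) & 0 < K n i} <= W"
proof -
 have "\<exists>f. \<forall>i\<in>{i \<in> {1..N}. good (d i) & 0 < K n i}. f i \<in> {1..W} & L n (f i) = i"
  using leader by (intro bchoice) blast
 then obtain f where f: "!!i. i \<in> {i \<in> {1..N}. good (d i) & 0 < K n i} ==> f i \<in> {1..W} & L n (f i) = i"
  by blast
 have "card {i \<in> {1..N}. good (d i) & 0 < K n i} <= card {1..W}"
 proof (rule card_inj_on_le[of f])
  show "inj_on f {i \<in> {1..N}. good (d i) & 0 < K n i}" by (rule inj_onI) (metis f)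
  show "f ` {i \<in> {1..N}. good (d i) & 0 < K n i} <= {1..W}" using f by blast
 qed simp
 thus ?thesis by simp
qed

text \<open>Were the level above \<open>m\<close>, all these good halflines would have been visited,
  and each needs a worker.\<close>

lemma Lev_bound:
 assumes "W < card {i \<in> {1..N}. good (d i) & d i 0 <= m}"
 shows "Lev n <= m"
proof (rule ccontr)
 assume neg: "~ ?thesis"
 have "{i \<in> {1..N}. good (d i) & d i 0 <= m} <= {i \<in> {1..N}. good (d i) & 0 < K n i}"
 proof safe
  fix i assume i: "i \<in> {1..N}" "d i 0 <= m"
  show "0 < K n i" using Lev_le[OF i(1), of n] i neg by (cases "K n i = 0") auto
 qed
 moreover have "finite {i \<in> {1..N}. good (d i) & 0 < K n i}" by simp
 ultimately have "card {i \<in> {1..N}. good (d i) & d i 0 <= m} <= W"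
  using card_visited_good[of n] card_mono le_trans by blast
 thus False using assms by simp
qed

lemma first_landing:
 assumes "K n (T n) = 0" shows "L n (J n) ~= T n"
 using X_less_K[of n "J n"] assms T_in[of n] by (auto simp: )

text \<open>The first particle of a halfline is removed by someone coming from elsewhere, who lands
  at the level of that moment; the level never decreases.\<close>

lemma first_le_Lev:
 assumes "0 < K n i" shows "d i 0 <= Lev n"
proof -
 obtain m where m: "m < n" "T m = i" "K m i = 0" using consumed_at[OF assms] by auto
 hence "Z m = Lev m" using landing_Z[OF first_landing] by auto
 thus ?thesis using m Lev_mono[of m n] by (auto simp: Z_def)
qed

lemma newly_visited:
 assumes "i \<in> {1..N}" "Lev s < d i 0" "d i 0 < Lev n"
 shows "K s i = 0" "0 < K n i"
proof -
 show "K s i = 0" using first_le_Lev[of s i] assms(2) by force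
 show "0 < K n i" using Lev_le[OF assms(1), of n] assms(3) by (cases "K n i = 0") auto
qed

section \<open>Rings, landings and visitors of a halfline\<close>

definition "cnt s n w = card {p \<in> {s..<n}. J p = w}"
text \<open>As \<open>T p\<close> is never 0, the jump from the origin counts as a landing
  too.\<close>

definition "land s n w = card {p \<in> {s..<n}. J p = w & L p w ~= T p}"

lemma cnt_Suc: "s <= n ==> cnt s (Suc n) w = (if J n = w then Suc (cnt s n w) else cnt s n w)"
proof -
 assume "s <= n"
 hence "{p \<in> {s..<Suc n}. J p = w} = (if J n = w then insert n {p \<in> {s..<n}. J p = w} else {p \<in> {s..<n}. J p = w})"
  by (auto simp: less_Suc_eq)
 thus ?thesis by (simp add: cnt_def)
qed

lemma land_Suc: "s <= n ==>
 land s (Suc n) w = (if J n = w & L n w ~= T n then Suc (land s n w) else land s n w)"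
proof -
 assume "s <= n"
 hence "{p \<in> {s..<Suc n}. J p = w & L p w ~= T p} = (if J n = w & L n w ~= T n
   then insert n {p \<in> {s..<n}. J p = w & L p w ~= T p} else {p \<in> {s..<n}. J p = w & L p w ~= T p})"
  by (auto simp: less_Suc_eq)
 thus ?thesis by (simp add: land_def)
qed

lemma cnt_same [simp]: "cnt s s w = 0" and land_same [simp]: "land s s w = 0"
 by (auto simp: cnt_def land_def)

lemma cnt_split: "s <= m ==> m <= n ==> cnt s n w = cnt s m w + cnt m n w"
 by (rotate_tac, induction n rule: dec_induct) (auto simp: cnt_Suc)

text \<open>The particle index of the worker serves as a potential: a jump along the halfline raises
  it by at least 1, and a landing destroys less than \<open>b\<close> of it, because halflines are
  only left at indices below \<open>b\<close>.\<close>

lemma cnt_le_land: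
 assumes "s <= n" "1 <= b"
  and "!!p. s <= p ==> p < n ==> J p = w ==> L p w ~= 0 ==> L p w ~= T p ==> X p w < b"
  and "!!p. L p w = 0 ==> X p w = 0"
 shows "cnt s n w + X s w <= land s n w * b + X n w"
 using assms(1,3)
proof (induction n rule: dec_induct)
 case (step n)
 hence IH: "cnt s n w + X s w <= land s n w * b + X n w" by auto
 show ?case
 proof (cases "J n = w")
  case False thus ?thesis using IH step by (auto simp: cnt_Suc land_Suc X_Suc)
 next
  case J: True
  show ?thesis
  proof (cases "L n w = T n")
   case True
   hence "X n w < K n (T n)" using X_less_K[of n w] T_in[of n] by auto
   thus ?thesis using IH J True step by (auto simp: cnt_Suc land_Suc X_Suc)
  next
   case False
   have "X n w < b" using step.prems[of n] assms(2,4) False J step.hyps by (cases "L n w = 0") auto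
   thus ?thesis using IH J False step by (auto simp: cnt_Suc land_Suc X_Suc)
  qed
 qed
qed simp

lemma X_origin: "L n w = 0 ==> X n w = 0"
proof (induction n)
 case (Suc n)
 show ?case
 proof (cases "w = J n")
  case True thus ?thesis using Suc.prems T_in[of n] by (auto simp: L_Suc)
 next
  case False thus ?thesis using Suc by (auto simp: L_Suc X_Suc)
 qed
qed simp

text \<open>A landing removes the particle at the level, so the landings of a period use up
  different particles between the two levels.\<close>

lemma card_landings_le:
 assumes "finite P" "!!i k. i \<in> {1..N} ==> Lev s <= d i k ==> d i k <= Lev n ==> (i, k) \<in> P"
 shows "card {p \<in> {s..<n}. L p (J p) ~= T p} <= card P"
proof (rule card_inj_on_le[of "%p. (T p, K p (T p))"])
 show "inj_on (%p. (T p, K p (T p))) {p \<in> {s..<n}. L p (J p) ~= T p}"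
 proof (rule inj_onI)
  fix p p' assume "(T p, K p (T p)) = (T p', K p' (T p'))"
  thus "p = p'" using consumed_inj[of p p'] consumed_inj[of p' p] by (cases p p' rule: linorder_cases) auto
 qed
 show "(%p. (T p, K p (T p))) ` {p \<in> {s..<n}. L p (J p) ~= T p} <= P"
 proof safe
  fix p assume p: "p \<in> {s..<n}" "L p (J p) ~= T p"
  have "d (T p) (K p (T p)) = Lev p" using landing_Z[OF p(2)] by (simp add: Z_def)
  moreover have "T p \<in> {1..N}" by (rule T_in)
  ultimately show "(T p, K p (T p)) \<in> P" using Lev_mono[of s p] Lev_mono[of p n] p T_in
   by (intro assms(2)) auto
 qed
qed (use assms in auto)

lemma sum_land: "(\<Sum>w\<in>A. land s n w) <= card {p \<in> {s..<n}. L p (J p) ~= T p}" if "finite A"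
proof -
 have "(\<Sum>w\<in>A. land s n w) = card (\<Union>w\<in>A. {p \<in> {s..<n}. J p = w & L p w ~= T p})"
  unfolding land_def by (rule card_UN_disjoint[symmetric]) (use that in auto)
 also have "... <= card {p \<in> {s..<n}. L p (J p) ~= T p}" by (rule card_mono) auto
 finally show ?thesis .
qed

text \<open>For dating the present stay of a worker: \<open>e\<close> is the landing that began
  it.\<close>

lemma entry_line:
 assumes "L n w = i" "i ~= 0"
 shows "\<exists>e<n. J e = w & T e = i & L e w ~= T e & (\<forall>p. e < p & p <= n --> L p w = i)"
 using assms
proof (induction n)
 case (Suc n)
 show ?case
 proof (cases "J n = w & L n w ~= T n")
  case True
  hence "T n = i" using Suc.prems by (simp add: L_Suc)
  hence "J n = w & T n = i & L n w ~= T n & (\<forall>p. n < p & p <= Suc n --> L p w = i)"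
   using True Suc.prems by (metis le_SucE not_less)
  thus ?thesis by blast
 next
  case False
  hence "L n w = i" using Suc.prems by (auto simp: L_Suc split: if_splits)
  then obtain e where e: "e < n" "J e = w" "T e = i" "L e w ~= T e"
   "\<forall>p. e < p & p <= n --> L p w = i" using Suc.IH Suc.prems by metis
  have "\<forall>p. e < p & p <= Suc n --> L p w = i" using e(5) Suc.prems(1) by (metis le_SucE)
  thus ?thesis using e by (metis less_SucI)
 qed
qed simp

lemma entry:
 "L n w ~= 0 ==>
  \<exists>e<n. J e = w & T e = L n w & L e w ~= T e & (\<forall>p. e < p & p <= n --> L p w = L n w)"
 by (rule entry_line) auto

text \<open>Every visitor has landed there once and then removed one of the at most \<open>q\<close>
  particles that the level can reach.\<close>

lemma card_workers_on_line:
 assumes "!!n. Lev n <= m" "i \<in> {1..N}" "!!k. d i k <= m ==> k < q"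
 shows "finite {w. \<exists>n. L n w = i} & card {w. \<exists>n. L n w = i} <= q"
proof -
 have "\<exists>e. J e = w & T e = i & L e w ~= T e" if ex: "\<exists>n. L n w = i" for w
 proof -
  obtain n where "L n w = i" using ex by auto
  thus ?thesis using entry[of n w] assms(2) by auto
 qed
 then obtain e where e: "!!w. \<exists>n. L n w = i ==> J (e w) = w & T (e w) = i & L (e w) w ~= T (e w)"
  by metis
 have inj: "inj_on (%w. K (e w) i) {w. \<exists>n. L n w = i}"
 proof (rule inj_onI)
  fix w w' assume w: "w \<in> {w. \<exists>n. L n w = i}" "w' \<in> {w. \<exists>n. L n w = i}" "K (e w) i = K (e w') i"
  have w': "\<exists>n. L n w = i" "\<exists>n. L n w' = i" using w by auto
  note e1 = e[OF w'(1)] and e2 = e[OF w'(2)]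
  have TT: "T (e w) = T (e w')" and KK: "K (e w) (T (e w)) = K (e w') (T (e w'))"
   using e1 e2 w(3) by metis+
  have "~ e w < e w'" "~ e w' < e w"
   using consumed_inj[OF _ TT] consumed_inj[OF _ TT[symmetric]] KK by (metis less_irrefl)+
  hence "e w = e w'" by linarith
  thus "w = w'" using e1 e2 by metis
 qed
 have sub: "(%w. K (e w) i) ` {w. \<exists>n. L n w = i} <= {..<q}"
 proof (rule image_subsetI)
  fix w assume "w \<in> {w. \<exists>n. L n w = i}"
  hence ew: "J (e w) = w & T (e w) = i & L (e w) w ~= T (e w)" using e by blast
  hence "Z (e w) = Lev (e w)" using landing_Z by metis
  hence "d i (K (e w) i) <= m" using assms(1)[of "e w"] ew by (auto simp: Z_def)
  thus "K (e w) i \<in> {..<q}" using assms(3) by auto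
 qed
 show ?thesis
  using inj_on_finite[OF inj sub] card_inj_on_le[OF inj sub] by auto
qed

end

section \<open>Regular realisations\<close>

text \<open>All the regularity of the clocks and of the dust that is needed: a law of large numbers with
  constant-factor precision for all long enough blocks of gaps. The length required of a block may
  grow linearly with its starting index, but with a tiny slope \<open>1/B\<close>.\<close>

definition reg :: "nat => real => (nat => real) => bool" where
 "reg q B t <-> t 0 <= q &
   (\<forall>k R. q + k / B <= real R --> R / 4 <= t (k + R) - t k & t (k + R) - t k <= 4 * real R)"

lemma reg_lower: "reg q B t ==> q + k / B <= real R ==> R / 4 <= t (k + R) - t k"
 and reg_upper: "reg q B t ==> q + k / B <= real R ==> t (k + R) - t k <= 4 * real R"
 and reg_0: "reg q B t ==> t 0 <= q"
 by (auto simp: reg_def)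

text \<open>A block too short for \<open>reg\<close> is prolonged to an admissible length, which by
  monotonicity only increases the difference.\<close>

lemma reg_upper':
 assumes "reg q B t" "mono t" "0 < B"
 shows "t (k + u) - t k <= 4 * (real u + real q + 1 + k / B)"
proof -
 define R where "R = u + nat \<lceil>q + k / B\<rceil>"
 have pos: "0 <= q + k / B" using assms by simp
 have R: "q + k / B <= R" "real R <= real u + real q + 1 + k / B" unfolding R_def using pos by linarith+
 have "t (k + u) <= t (k + R)" using assms(2) by (rule monoD) (simp add: R_def)
 moreover have "t (k + R) - t k <= 4 * real R" by (rule reg_upper[OF assms(1) R(1)])
 moreover have "4 * real R <= 4 * (real u + real q + 1 + k / B)" using R(2) by (intro mult_left_mono) auto
 ultimately show ?thesis by simp
qed

context star_real
begin

text \<open>The link between the two time scales of the proof, real time and the worker's own number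
  of rings.\<close>

lemma ring_count:
 assumes w: "w \<in> {1..W}"
 shows "c w r < jump_time W c n <-> r < cnt 0 n w"
proof (induction n arbitrary: r)
 case 0
 have "c w r \<in> rings W c" using w by (auto simp: rings_def)
 thus ?case using enum.e_0_le[of "c w r"] by auto
next
 case (Suc n)
 have in_rings: "c w r \<in> rings W c" using w by (auto simp: rings_def)
 have le: "c w r < jump_time W c (Suc n) <-> c w r <= jump_time W c n"
  using enum.e_Suc_le[OF in_rings, of n] enum.e_less_Suc[of n] by linarith
 show ?case
 proof (cases "jumper W c n = w")
  case True
  then obtain r0 where r0: "c w r0 = jump_time W c n" using jumper_props[of n] by auto
  have "c w r' < c w r0 <-> r' < cnt 0 n w" for r' using Suc[of r'] r0 by simp
  hence "r' < r0 <-> r' < cnt 0 n w" for r' using c_less_iff[OF w] by blast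
  hence "r0 = cnt 0 n w" by (metis linorder_neq_iff)
  thus ?thesis unfolding le r0[symmetric] c_le_iff[OF w] using True by (simp add: cnt_Suc less_Suc_eq_le)
 next
  case False
  hence "c w r ~= jump_time W c n" using jumper_eqI[OF w] by metis
  thus ?thesis using le Suc[of r] False by (auto simp: cnt_Suc)
 qed
qed

lemma jump_time_ring: "jumper W c n = w ==> jump_time W c n = c w (cnt 0 n w)"
proof -
 assume w: "jumper W c n = w"
 hence win: "w \<in> {1..W}" and "\<exists>r. c w r = jump_time W c n" using jumper_props[of n] by auto
 then obtain r0 where r0: "c w r0 = jump_time W c n" by auto
 have "c w r' < c w r0 <-> r' < cnt 0 n w" for r' using ring_count[OF win, of r' n] r0 by simp
 hence "r' < r0 <-> r' < cnt 0 n w" for r' using c_less_iff[OF win] by blast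
 hence "r0 = cnt 0 n w" by (metis linorder_neq_iff)
 thus ?thesis using r0 by simp
qed

definition "steps t = card {s \<in> rings W c. s <= t}"

lemma less_steps: "p < steps t <-> jump_time W c p <= t"
 unfolding steps_def by (rule enum.card_le_less_iff)

lemma steps_mono: "t <= t' ==> steps t <= steps t'"
 using less_steps by (metis linorder_not_less order_trans order_less_irrefl)

lemma c_mono: "w \<in> {1..W} ==> mono (c w)"
 by (rule monoI) (simp add: c_le_iff)

lemma d_mono: "i \<in> {1..N} ==> mono (d i)"
 by (rule monoI) (simp add: d_le_iff)

lemma K_diff: "s <= n ==> K n i = K s i + card {p \<in> {s..<n}. T p = i}"
proof -
 define c where "c n = card {p \<in> {s..<n}. T p = i}" for n
 have c_Suc: "c (Suc n) = (if T n = i then Suc (c n) else c n)" if "s <= n" for n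
 proof -
  have "{p \<in> {s..<Suc n}. T p = i} = (if T n = i then insert n {p \<in> {s..<n}. T p = i} else {p \<in> {s..<n}. T p = i})"
   using that by (auto simp: less_Suc_eq)
  thus ?thesis by (simp add: c_def)
 qed
 have "s <= n ==> K n i = K s i + c n"
 proof (induction n rule: dec_induct)
  case base show ?case by (simp add: c_def)
 next
  case (step n) thus ?case by (auto simp: K_Suc c_Suc)
 qed
 thus "s <= n ==> K n i = K s i + card {p \<in> {s..<n}. T p = i}" by (simp add: c_def)
qed

lemma skip_iff: "skip p <-> L p (jumper W c p) ~= 0 & L p (jumper W c p) ~= T p"
 by (simp add: skip_def)

lemma skip_front: assumes "skip p" shows "2 * Y p (jumper W c p) <= d (L p (jumper W c p)) (K p (L p (jumper W c p)))"
proof -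
 let ?w = "jumper W c p"
 have L: "L p ?w \<in> {1..N}" using assms L_in by (auto simp: skip_iff)
 have "FD p (T p) <= FD p (L p ?w)" by (rule T_le[OF L])
 moreover have "0 < d (T p) (K p (T p))" using d_pos[OF T_in] by blast
 ultimately show ?thesis using assms by (auto simp: FD_def skip_iff)
qed

end

text \<open>\<open>q\<close> is the scale of all errors, later a tiny power of \<open>N\<close>;
  \<open>q ^ 20 <= N\<close> allows fixed powers of \<open>q\<close> to be absorbed. The slope
  \<open>1 / N ^ 4\<close> of \<open>reg\<close> costs at most 1 for indices up to
  \<open>N ^ 4\<close>, which covers the rings up to time \<open>N ^ 2\<close>
  (\<open>cnt_time\<close>).\<close>

locale star_reg = star_real +
 fixes q :: nat
 assumes q8: "8 <= q" and qN: "q ^ 20 <= N" and WN: "W <= N"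
  and regd: "!!i. i \<in> {1..N} ==> reg q (real N ^ 4) (d i)"
  and regc: "!!w. w \<in> {1..W} ==> reg q (real N ^ 4) (c w)"
  and lev1: "!!n. Lev n <= 1"
begin

abbreviation (input) "jt \<equiv> jump_time W c"
abbreviation (input) "jp \<equiv> jumper W c"
abbreviation "K0 \<equiv> 4000 * q ^ 2"

lemma q_pow: "a <= b ==> real q ^ a <= real q ^ b"
 using q8 by (intro power_increasing) auto

lemma N_large: "real q ^ 20 <= N" "10 ^ 18 <= real N"
proof -
 show *: "real q ^ 20 <= N" using qN by (metis of_nat_le_iff of_nat_power)
 have "(8::real) ^ 20 <= real q ^ 20" using q8 by (intro power_mono) auto
 moreover have "(10::real) ^ 18 <= 8 ^ 20" by simp
 ultimately show "10 ^ 18 <= real N" using * by linarith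
qed

lemma q_q3: "4000 * real q ^ 3 + 1 <= N"
proof -
 have "(8::real) ^ 17 <= real q ^ 17" using q8 by (intro power_mono) auto
 hence "4001 <= real q ^ 17" by simp
 hence "4001 * real q ^ 3 <= real q ^ 17 * real q ^ 3" by (intro mult_right_mono) auto
 also have "... = real q ^ 20" by (simp add: power_add[symmetric])
 finally have "4001 * real q ^ 3 <= N" using N_large by linarith
 moreover have "1 <= real q ^ 3" using q8 by (intro one_le_power) auto
 ultimately show ?thesis by simp
qed

lemma B_pos: "0 < real N ^ 4" using N1 by simp

lemma below_1: assumes "i \<in> {1..N}" "d i k <= 1" shows "k < q"
proof (rule ccontr)
 assume "~ ?thesis"
 hence "d i q <= 1" using d_le_iff[OF assms(1), of q k] assms(2) by auto
 moreover have "q / 4 <= d i (0 + q) - d i 0" by (rule reg_lower[OF regd[OF assms(1)]]) auto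
 ultimately show False using q8 d_pos[OF assms(1), of 0] by auto
qed

lemma d_ge: assumes "i \<in> {1..N}" "q <= k" shows "k / 4 <= d i k"
proof -
 have "k / 4 <= d i (0 + k) - d i 0" by (rule reg_lower[OF regd[OF assms(1)]]) (use assms in auto)
 thus ?thesis using d_pos[OF assms(1), of 0] by auto
qed

lemma c_ge: assumes "w \<in> {1..W}" "q <= r" shows "r / 4 <= c w r"
proof -
 have "r / 4 <= c w (0 + r) - c w 0" by (rule reg_lower[OF regc[OF assms(1)]]) (use assms in auto)
 thus ?thesis using cpos[OF assms(1), of 0] by auto
qed

text \<open>Landings happen at the level, hence within distance 1, where a halfline has at most
  \<open>q\<close> particles.\<close>

lemma landings_le: "card {p \<in> {s..<n}. L p (jp p) ~= T p} <= N * q"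
proof -
 have "card {p \<in> {s..<n}. L p (jp p) ~= T p} <= card ({1..N} \<times> {..<q})"
  by (rule card_landings_le) (use below_1 lev1[of n] in "auto intro: order_trans")
 thus ?thesis by simp
qed

lemma land_le: "land s n w <= N * q"
 using sum_land[of "{w}" s n] landings_le[of s n] by simp

lemma line_workers: assumes "i \<in> {1..N}"
 shows "finite {w. \<exists>n. L n w = i}" "card {w. \<exists>n. L n w = i} <= q"
 using card_workers_on_line[OF lev1 assms, of q] below_1[OF assms] by auto

lemma sitting_length:
 assumes "s < n" "jp s = w" "jp n = w" "!!p. s < p ==> p < n ==> jp p ~= w"
 shows "jt n - jt s <= 4 * (q + 2 + cnt 0 s w / real N ^ 4)"
proof -
 have w: "w \<in> {1..W}" using jumper_props[of s] assms by auto
 have "cnt (Suc s) n w = 0" unfolding cnt_def using assms(4) by (auto simp: Suc_le_eq)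
 hence "cnt 0 n w = Suc (cnt 0 s w)"
  using cnt_split[of 0 "Suc s" n w] assms by (simp add: cnt_Suc)
 hence "jt n = c w (cnt 0 s w + 1)" "jt s = c w (cnt 0 s w)"
  using jump_time_ring assms by auto
 thus ?thesis using reg_upper'[OF regc[OF w] c_mono[OF w] B_pos, of "cnt 0 s w" 1] by auto
qed

lemma window_rings:
 fixes G :: real
 assumes "w \<in> {1..W}" "s < n" "jt n - jt s <= G"
 shows "real (cnt (Suc s) n w) <= 4 * G + real q + 2 + cnt 0 (Suc s) w / real N ^ 4"
proof -
 define r where "r = cnt 0 (Suc s) w"
 define m where "m = cnt (Suc s) n w"
 have G: "0 <= G" using assms enum.e_less_iff[of s n] by linarith
 have rB: "0 <= r / real N ^ 4" by simp
 show ?thesis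
 proof (cases "m - 1 < q + r / real N ^ 4")
  case True
  hence "real m <= q + r / real N ^ 4 + 1" by linarith
  thus ?thesis using G unfolding r_def m_def by linarith
 next
  case False
  have m: "1 <= m" using False q8 rB by (cases m) auto
  have "cnt 0 n w = r + m" unfolding r_def m_def by (rule cnt_split) (use assms in auto)
  hence "c w (r + (m - 1)) < jt n" using ring_count[OF assms(1)] m by simp
  moreover have "jt (Suc s) <= c w r" using ring_count[OF assms(1), of r "Suc s"] by (simp add: r_def)
  moreover have "jt s < jt (Suc s)" by (rule enum.e_less_Suc)
  moreover have "real (m - 1) / 4 <= c w (r + (m - 1)) - c w r"
   by (rule reg_lower[OF regc[OF assms(1)]]) (use False m in auto)
  ultimately have "real (m - 1) / 4 <= G" using assms by linarith
  hence "real m <= 4 * G + 1" using m by (simp add: of_nat_diff)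
  thus ?thesis using rB unfolding r_def m_def by linarith
 qed
qed

text \<open>A worker far out on a halfline never skips: while he rests, the few workers of his halfline
  can only remove a number of particles that is small compared to his distance from the origin.\<close>

lemma no_far_skip: "skip p ==> X p (jp p) < K0"
proof (induction p rule: less_induct)
 case (less p)
 define w where "w = jp p"
 define i where "i = L p w"
 define k where "k = X p w"
 define k' where "k' = K p i"
 have w: "w \<in> {1..W}" using jumper_props[of p] by (simp add: w_def)
 have i0: "i ~= 0" and i: "i \<in> {1..N}" using less.prems L_in by (auto simp: skip_iff w_def i_def)
 have kk': "k < k'" using X_less_K[of p w] i0 by (simp add: k_def k'_def i_def)
 show ?case
 proof (rule ccontr)
  assume "~ ?thesis"
  hence kbig: "K0 <= k" by (simp add: k_def w_def)
  have "q <= K0" by (simp add: power2_eq_square)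
  hence kq: "q <= k" using kbig by linarith
  obtain s where s: "s < p" "jp s = w" "T s = i" "K s i = k" "!!p'. s < p' ==> p' < p ==> jp p' ~= w"
   using arrival[of p w] i0 unfolding i_def k_def by metis
  have Ks: "K (Suc s) i = Suc k" using s by (simp add: K_Suc)
  \<comment> \<open>By the induction hypothesis earlier skips started at indices below
    \<open>K0\<close>, so the number of rings is controlled by landings and the present index. This
    is needed because the precision of \<open>reg\<close> deteriorates with the ring number.\<close>
  have cnt_bound: "cnt 0 n v <= N * q * K0 + X n v" if "n <= p" for n v
  proof -
   have "cnt 0 n v + X 0 v <= land 0 n v * K0 + X n v"
   proof (rule cnt_le_land)
    show "1 <= K0" using q8 by simp
    show "X p' v < K0" if "0 <= p'" "p' < n" "jp p' = v" "L p' v ~= 0" "L p' v ~= T p'" for p'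
     using less.IH[of p'] that \<open>n <= p\<close> by (auto simp: skip_iff)
   qed (use X_origin in auto)
   also have "land 0 n v * K0 <= N * q * K0" by (rule mult_right_mono[OF land_le]) simp
   finally show ?thesis by simp
  qed
  have NN: "real (N * q * K0) + 1 <= real N ^ 2"
  proof -
   have "real N * (4000 * real q ^ 3 + 1) <= real N * N"
    using q_q3 by (intro mult_left_mono) auto
   moreover have "real (N * q * K0) = real N * (4000 * real q ^ 3)"
    by (simp add: power2_eq_square power3_eq_cube)
   ultimately have "real (N * q * K0) + real N <= real N ^ 2"
    by (simp only: power2_eq_square distrib_left)
   thus ?thesis using N1 by linarith
  qed
  define P where "P = {v. L (Suc s) v = i}"
  have "P <= {w. \<exists>n. L n w = i}" by (auto simp: P_def)
  hence "finite P" "card P <= card {w. \<exists>n. L n w = i}"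
   using line_workers(1)[OF i] by (auto intro: finite_subset card_mono)
  hence P: "finite P" "card P <= q" using line_workers(2)[OF i] by linarith+
  \<comment> \<open>Landings on \<open>i\<close> happen at indices below \<open>q\<close>, hence
    before \<open>s\<close>; while \<open>w\<close> rests, only workers already present can remove
    particles here.\<close>
  have on_line: "L (Suc s) (jp n) = i" if n: "Suc s <= n" "n < p" "T n = i" for n
  proof -
   have "L (Suc n) (jp n) = i" using n by (simp add: L_Suc)
   then obtain e where e: "e < Suc n" "jp e = jp n" "T e = i" "L e (jp n) ~= T e"
    "!!p'. e < p' ==> p' <= Suc n ==> L p' (jp n) = i"
    using entry_line[OF _ i0] by metis
   have "d i (K e i) = Lev e" using landing_Z[of e] e by (simp add: Z_def)
   hence "K e i < q" using below_1[OF i] lev1[of e] by simp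
   hence "e < Suc s" using K_mono[of "Suc s" e i] Ks kq by (cases "e < Suc s") auto
   thus ?thesis using e(5)[of "Suc s"] n by auto
  qed
  have P_in: "P <= {1..W}"
  proof
   fix v assume "v \<in> P"
   hence "L (Suc s) v = i" by (simp add: P_def)
   then obtain e where "jp e = v" using entry_line[OF _ i0] by metis
   thus "v \<in> {1..W}" using jumper_props by metis
  qed
  \<comment> \<open>Dominates the slope term of \<open>reg\<close> for all ring numbers that occur.
    It involves \<open>k'\<close>, the quantity to be bounded, but with a factor so small that the
    resulting inequality can be solved for \<open>k'\<close>.\<close>
  define E where "E = (real N ^ 2 + k') / real N ^ 4"
  have E0: "0 <= E" by (simp add: E_def)
  define m where "m = 17 * real q + 34 + 17 * E"
  have G: "jt p - jt s <= 4 * (real q + 2 + E)"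
  proof -
   have "cnt 0 s w <= cnt 0 p w" using cnt_split[of 0 s p w] s by simp
   hence "real (cnt 0 s w) <= real N ^ 2 + k'"
    using cnt_bound[of p w] NN kk' unfolding k_def by linarith
   hence le: "cnt 0 s w / real N ^ 4 <= E"
    unfolding E_def by (rule divide_right_mono) simp
   have "jt p - jt s <= 4 * (real q + 2 + cnt 0 s w / real N ^ 4)"
    using sitting_length[OF s(1,2) w_def[symmetric] s(5)] by simp
   also have "... <= 4 * (real q + 2 + E)" using le by (intro mult_left_mono add_left_mono) auto
   finally show ?thesis .
  qed
  have rings: "real (cnt (Suc s) p v) <= m" if "v \<in> P" for v
  proof -
   have v: "v \<in> {1..W}" using P_in that by auto
   have "X (Suc s) v < K (Suc s) i" using X_less_K[of "Suc s" v] that i0 by (auto simp: P_def)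
   also have "... <= k'" unfolding k'_def by (rule K_mono) (use s in auto)
   finally have "real (cnt 0 (Suc s) v) <= real N ^ 2 + k'"
    using cnt_bound[of "Suc s" v] NN s(1) by linarith
   hence "cnt 0 (Suc s) v / real N ^ 4 <= E"
    unfolding E_def by (rule divide_right_mono) simp
   thus ?thesis using window_rings[OF v s(1) G] by (simp add: m_def)
  qed
  have "k' = Suc k + card {n \<in> {Suc s..<p}. T n = i}"
   using K_diff[of "Suc s" p i] s(1) Ks by (simp add: k'_def)
  moreover have "card {n \<in> {Suc s..<p}. T n = i} <= card (\<Union>v\<in>P. {n \<in> {Suc s..<p}. jp n = v})"
   by (rule card_mono) (use P on_line in "auto simp: P_def")
  moreover have "... <= (\<Sum>v\<in>P. cnt (Suc s) p v)"
   unfolding cnt_def by (rule card_UN_le[OF P(1)])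
  moreover have "real (\<Sum>v\<in>P. cnt (Suc s) p v) <= card P * m"
   unfolding of_nat_sum by (rule order_trans[OF sum_mono[OF rings]]) auto
  moreover have "card P * m <= q * m"
   by (rule mult_right_mono) (use P E0 in "auto simp: m_def")
  ultimately have u: "real k' <= k + 1 + q * m" by linarith
  have frac: "17 * (real q * E) <= 1 + k' / 100"
  proof -
   have "real q ^ 1 <= real q ^ 3" by (rule q_pow) simp
   hence qN2: "17 * real q <= real N" using q_q3 unfolding power_one_right by linarith
   have "real N ^ 2 / real N ^ 4 = 1 / real N ^ 2"
    using N1 by (simp add: divide_simps power4_eq_xxxx power2_eq_square)
   hence E: "E = 1 / real N ^ 2 + k' / real N ^ 4"
    by (simp add: E_def add_divide_distrib)
   have "17 * (real q * E) = 17 * (real q * (1 / real N ^ 2)) + 17 * (real q * (k' / real N ^ 4))"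
    unfolding E by (simp only: distrib_left)
   moreover have "17 * (real q * (1 / real N ^ 2)) <= 1"
   proof -
    have "real N * 1 <= real N * real N" using N1 by (intro mult_left_mono) auto
    hence "17 * real q <= real N ^ 2" using qN2 unfolding power2_eq_square by linarith
    thus ?thesis using N1 by (simp add: divide_simps)
   qed
   moreover have "17 * (real q * (k' / real N ^ 4)) <= k' / 100"
   proof -
    have "17 * real q * 100 <= real N * real N ^ 3"
    proof (rule mult_mono[OF qN2])
     have "100 <= real N" using N_large(2) by simp
     also have "... <= real N ^ 3" using N1 by (intro self_le_power) auto
     finally show "100 <= real N ^ 3" .
    qed auto
    hence "17 * real q * 100 * k' <= real N ^ 4 * k'"
     by (intro mult_right_mono) (auto simp: power_numeral_reduce)
    thus ?thesis using N1 by (simp add: divide_simps mult_ac)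
   qed
   ultimately show ?thesis by linarith
  qed
  have "q * m = 17 * real q ^ 2 + 34 * real q + 17 * (real q * E)"
   by (simp add: m_def algebra_simps power2_eq_square)
  moreover have "8 * real q <= real q ^ 2" using q8 by (simp add: power2_eq_square mult_right_mono)
  moreover have "64 <= real q ^ 2" using q8 power_mono[of 8 "real q" 2] by simp
  ultimately have u2: "real k' - k <= 22 * real q ^ 2 + k / 90" using u frac by simp
  have "d i k' - d i k <= 4 * (real k' - k + q + 1 + k / real N ^ 4)"
   using reg_upper'[OF regd[OF i] d_mono[OF i] B_pos, of k "k' - k"] kk' by (simp add: of_nat_diff)
  moreover have "k / real N ^ 4 <= k / 100"
  proof -
   have "100 <= real N" using N_large(2) by simp
   also have "... <= real N ^ 4" using N1 by (intro self_le_power) auto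
   finally show ?thesis using N1 by (intro divide_left_mono) auto
  qed
  moreover have "real k \<ge> 4000 * real q ^ 2" using kbig by (metis of_nat_le_iff of_nat_mult of_nat_numeral of_nat_power)
  \<comment> \<open>The removals cost about \<open>22 * q ^ 2 + k / 90\<close> indices, each worth a
    distance of at most 4 on average; \<open>K0 = 4000 * q ^ 2\<close> makes this less than
    \<open>k / 4\<close>, the guaranteed distance of index \<open>k\<close>.\<close>
  ultimately have "d i k' - d i k < k / 4"
   using u2 \<open>8 * real q <= real q ^ 2\<close> \<open>64 <= real q ^ 2\<close> by simp
  moreover have "k / 4 <= d i k" by (rule d_ge[OF i kq])
  moreover have "2 * d i k <= d i k'"
   using skip_front[OF less.prems] Y_eq[of p w] i0 by (simp add: w_def[symmetric] i_def[symmetric] k_def[symmetric] k'_def[symmetric])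
  ultimately show False by linarith
 qed
qed

end

section \<open>Particles removed by one worker on his way outwards\<close>

context star_proc
begin

definition "vis w i n = (%p. K p i) ` {p. p < n & J p = w & T p = i}"

lemma finite_vis: "finite (vis w i n)"
 unfolding vis_def by (rule finite_imageI) (rule finite_subset[of _ "{..<n}"], auto)

lemma vis_Suc: "vis w i (Suc n) = (if J n = w & T n = i then insert (K n i) (vis w i n) else vis w i n)"
proof -
 have "{p. p < Suc n & J p = w & T p = i} =
  (if J n = w & T n = i then insert n {p. p < n & J p = w & T p = i} else {p. p < n & J p = w & T p = i})"
  by (auto simp: less_Suc_eq)
 thus ?thesis by (simp add: vis_def)
qed

lemma vis_disjoint: "w ~= w' ==> vis w i n \<inter> vis w' i n = {}"
proof -
 assume ne: "w ~= w'"
 have "K p i ~= K p' i" if "J p = w" "T p = i" "J p' = w'" "T p' = i" for p p'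
 proof -
  have "p ~= p'" using that ne by auto
  thus ?thesis using consumed_inj[of p p'] consumed_inj[of p' p] that
   by (metis less_irrefl linorder_neqE_nat)
 qed
 thus ?thesis by (auto simp: vis_def)
qed

lemma X_in_vis: "L n w = i ==> i ~= 0 ==> X n w \<in> vis w i n"
proof -
 assume "L n w = i" "i ~= 0"
 then obtain m where "m < n" "J m = w" "T m = i" "K m i = X n w" using arrival[of n w] by metis
 thus ?thesis by (force simp: vis_def)
qed

text \<open>A jump reaches at most \<open>2y + m\<close> from \<open>y\<close> when the level is at most \<open>m\<close>; hence the
  thresholds \<open>(2\<^sup>j - 1) m\<close>, each of which costs another particle.\<close>

lemma chain:
 assumes "L n w = i" "i ~= 0" "!!p. p < n ==> Lev p <= m" "(2 ^ j - 1) * m < Y n w"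
 shows "j <= card {k \<in> vis w i n. d i k <= (2 ^ j - 1) * m}"
 using assms
proof (induction n arbitrary: j)
 case 0 thus ?case by simp
next
 case (Suc n)
 have m: "0 < m" using Suc.prems(3)[of n] Lev_pos[of n] by simp
 show ?case
 proof (cases "J n = w")
  case False
  hence "L n w = i" "(2 ^ j - 1) * m < Y n w" using Suc.prems by (auto simp: L_Suc Y_Suc)
  thus ?thesis using Suc.IH Suc.prems(2,3) False by (simp add: vis_Suc)
 next
  case J: True
  hence T: "T n = i" using Suc.prems by (simp add: L_Suc)
  have z: "(2 ^ j - 1) * m < Z n" using Suc.prems(4) J by (simp add: Y_Suc)
  show ?thesis
  proof (cases "L n w = i")
   case False
   \<comment> \<open>A worker who has just landed is at the level, within the threshold of
     \<open>j = 1\<close>; only \<open>j = 0\<close> is left.\<close>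
   hence "Z n <= m" using landing_Z[of n] J T Suc.prems(3)[of n] by simp
   hence "(2 ^ j - 1) * m < 1 * m" using z by simp
   hence "(2::real) ^ j - 1 < 1" using m by (simp only: mult_less_cancel_right_pos)
   moreover have "(2::real) ^ 1 <= 2 ^ j" if "1 <= j" using that by (intro power_increasing) auto
   ultimately have "j = 0" by (cases "1 <= j") auto
   thus ?thesis by simp
  next
   case L: True
   let ?S = "%j n. {k \<in> vis w i n. d i k <= (2 ^ j - 1) * m}"
   have fin: "finite (?S j n')" for j n' using finite_vis by simp
   have sub: "?S j n <= ?S j (Suc n)" for j by (auto simp: vis_Suc)
   show ?thesis
   proof (cases "(2 ^ j - 1) * m < Y n w")
    case True
    have "j <= card (?S j n)" by (rule Suc.IH[OF L Suc.prems(2) _ True]) (use Suc.prems(3) in auto)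
    also have "... <= card (?S j (Suc n))" by (rule card_mono[OF fin sub])
    finally show ?thesis .
   next
    case False
    show ?thesis
    proof (cases j)
     case (Suc j')
     have "Z n <= 2 * Y n w + m" using Z_le[of n] Suc.prems(3)[of n] J by simp
     \<comment> \<open>The map from \<open>y\<close> to \<open>2 * y + m\<close> carries the
       threshold of \<open>j'\<close> to that of \<open>j\<close>. So the worker jumped from beyond
       the previous threshold, and the particle he left is not among those counted there.\<close>
     hence y: "(2 ^ j' - 1) * m < Y n w" using z Suc by (simp add: algebra_simps)
     have Y: "Y n w = d i (X n w)" using Y_eq[of n w] L Suc.prems(2) by simp
     have IH: "j' <= card (?S j' n)" by (rule Suc.IH[OF L Suc.prems(2) _ y]) (use Suc.prems(3) in auto)
     have "X n w \<notin> ?S j' n" using y Y by auto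
     hence "j <= card (insert (X n w) (?S j' n))" using IH fin Suc by simp
     also have "... <= card (?S j (Suc n))"
     proof (rule card_mono[OF fin])
      have "(2 ^ j' - 1) * m <= (2 ^ j - 1) * m" using m Suc by simp
      hence "?S j' n <= ?S j (Suc n)" by (auto simp: vis_Suc)
      moreover have "X n w \<in> ?S j (Suc n)"
       using X_in_vis[OF L Suc.prems(2)] False Y by (auto simp: vis_Suc)
      ultimately show "insert (X n w) (?S j' n) <= ?S j (Suc n)" by simp
     qed
     finally show ?thesis .
    qed simp
   qed
  qed
 qed
qed

text \<open>More than \<open>j\<close> indices include one that is at least \<open>j\<close>, and
  distances increase with the index.\<close>

lemma index_below:
 assumes "i \<in> {1..N}" "finite A" "!!k. k \<in> A ==> d i k <= c" "j < card A"
 shows "d i j <= c"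
proof -
 have "\<exists>k\<in>A. j <= k"
 proof (rule ccontr)
  assume "~ ?thesis"
  hence "A <= {..<j}" by auto
  thus False using assms(4) card_mono[of "{..<j}" A] by simp
 qed
 then obtain k where "k \<in> A" "j <= k" by auto
 thus ?thesis using assms(3)[of k] d_le_iff[OF assms(1), of j k] by simp
qed

lemma L_stays_nonzero: "n <= p ==> L n w ~= 0 ==> L p w ~= 0"
proof (induction p rule: dec_induct)
 case (step p)
 have "T p ~= 0" using T_in[of p] by auto
 thus ?case using step by (auto simp: L_Suc)
qed simp

lemma left_origin: "0 < cnt 0 n w ==> L n w ~= 0"
proof -
 assume "0 < cnt 0 n w"
 hence "{p \<in> {0..<n}. J p = w} ~= {}" unfolding cnt_def by (metis card.empty less_irrefl)
 then obtain p where "p < n" "J p = w" by auto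
 thus ?thesis using L_stays_nonzero[of "Suc p" n w] T_in[of p] by (auto simp: L_Suc)
qed

text \<open>The first removal on each newly passed halfline is a step of its own.\<close>

lemma card_steps_visited:
 assumes "finite S" "!!i. i \<in> S ==> i \<in> {1..N} & Lev s < d i 0 & d i 0 < Lev n"
 shows "card S <= n - s"
proof -
 have "\<exists>p. s <= p & p < n & T p = i" if "i \<in> S" for i
 proof -
  have i: "i \<in> {1..N}" "Lev s < d i 0" "d i 0 < Lev n" using assms(2)[OF that] by auto
  obtain p where p: "p < n" "T p = i" "K p i = 0" using consumed_at[of 0 n i] newly_visited[OF i] by auto
  have "s <= p"
  proof (rule ccontr)
   assume "~ ?thesis"
   hence "K (Suc p) i <= K s i" by (intro K_mono) auto
   thus False using p newly_visited(1)[OF i] by (simp add: K_Suc)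
  qed
  thus ?thesis using p by auto
 qed
 then obtain f where f: "!!i. i \<in> S ==> s <= f i & f i < n & T (f i) = i" by metis
 have "card S <= card {s..<n}"
 proof (rule card_inj_on_le[of f])
  show "inj_on f S" by (rule inj_onI) (metis f)
  show "f ` S <= {s..<n}" using f by auto
 qed simp
 thus ?thesis by simp
qed

end

section \<open>Speed of the level and the workers who still skip\<close>

context star_reg
begin

text \<open>At width \<open>q / N\<close> the mean number of first particles in a cell is of order
  \<open>q\<close>, just enough for no cell to be empty.\<close>

definition "fine_cells <-> (\<forall>l::nat. (real l + 1) * (q / N) <= 1 -->
  (\<exists>i\<in>{1..N}. real l * (q / N) <= d i 0 & d i 0 < (real l + 1) * (q / N)))"

text \<open>Each fine cell that the level passes contains the start of a newly visited halfline, and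
  every such halfline costs a step.\<close>

lemma Lev_rise:
 assumes "fine_cells" "s <= n"
 shows "Lev n - Lev s <= (q / N) * (real n - real s + 2)"
proof (cases "Lev s < Lev n")
 case True
 have h: "0 < real q / N" using q8 N1 by simp
 have "(Lev n - Lev s) / (q / N) - 2 <= card {i \<in> {1..N}. Lev s < d i 0 & d i 0 < Lev n}"
  by (rule card_cells[where mu = 0 and nu = 1]) (use h Lev_pos[of s] True lev1[of n] assms in "auto simp: fine_cells_def")
 also have "... <= real (n - s)"
  unfolding of_nat_le_iff by (rule card_steps_visited) auto
 finally have "(Lev n - Lev s) / (q / N) <= real n - real s + 2" using assms(2) by (simp add: of_nat_diff)
 thus ?thesis using h by (simp only: pos_divide_le_eq mult.commute)
next
 case False
 hence "Lev n - Lev s <= 0" by simp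
 also have "0 <= (q / N) * (real n - real s + 2)" using assms(2) by simp
 finally show ?thesis .
qed

lemma steps_between: "s < n ==> n - s = Suc (\<Sum>w\<in>{1..W}. cnt (Suc s) n w)"
proof -
 assume "s < n"
 have "(\<Sum>w\<in>{1..W}. cnt (Suc s) n w) = card (\<Union>w\<in>{1..W}. {p \<in> {Suc s..<n}. jp p = w})"
  unfolding cnt_def by (rule card_UN_disjoint[symmetric]) auto
 also have "(\<Union>w\<in>{1..W}. {p \<in> {Suc s..<n}. jp p = w}) = {Suc s..<n}" using jumper_props by auto
 finally show ?thesis using \<open>s < n\<close> by simp
qed

text \<open>The rise of the level while one worker rests, that is in time
  \<open>4 * (q + 3)\<close>: every worker rings at most \<open>24 * q\<close> times, which with
  rounding gives \<open>27 * q * W\<close> steps of size \<open>q / N\<close>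
  (\<open>window_rise\<close>).\<close>

definition "eta = 27 * real q ^ 2 * W / N"

text \<open>Keeps the slope term of \<open>reg\<close> at most 1 up to time
  \<open>N ^ 2\<close>.\<close>

lemma cnt_time:
 assumes "w \<in> {1..W}" "jt n <= real N ^ 2"
 shows "real (cnt 0 n w) <= real N ^ 4"
proof (cases "cnt 0 n w <= q")
 case True
 hence "real (cnt 0 n w) <= real q" by simp
 also have "... <= real q ^ 20" using q_pow[of 1 20] by simp
 also have "... <= real N" using N_large by simp
 also have "... <= real N ^ 4" using N1 by (intro self_le_power) auto
 finally show ?thesis .
next
 case False
 let ?r = "cnt 0 n w - 1"
 have "?r < cnt 0 n w" "q <= ?r" using False by auto
 hence "?r / 4 <= real N ^ 2" using ring_count[OF assms(1), of ?r n] c_ge[OF assms(1), of ?r] assms(2) by linarith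
 hence "real (cnt 0 n w) <= 4 * real N ^ 2 + 1" using False by (simp add: of_nat_diff)
 also have "... <= 5 * real N ^ 2" using N1 by (simp add: one_le_power)
 also have "... <= real N ^ 2 * real N ^ 2"
 proof (rule mult_right_mono)
  have "real N <= real N ^ 2" using N1 by (intro self_le_power) auto
  moreover have "(5::real) <= 10 ^ 18" by simp
  ultimately show "5 <= real N ^ 2" using N_large(2) by linarith
 qed simp
 finally show ?thesis by (simp add: power_add[symmetric])
qed

lemma window_rise:
 assumes "fine_cells" "s <= n" "jt n - jt s <= 4 * (real q + 3)" "jt n <= real N ^ 2"
 shows "real n - s <= 25 * real q * W" "Lev n - Lev s <= eta"
proof -
 show le: "real n - s <= 25 * real q * W"
 proof (cases "s = n")
  case False
  hence sn: "s < n" using assms by simp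
  have "real (cnt (Suc s) n w) <= 24 * real q" if w: "w \<in> {1..W}" for w
  proof -
   have "cnt 0 (Suc s) w <= cnt 0 n w" using cnt_split[of 0 "Suc s" n w] sn by simp
   hence "real (cnt 0 (Suc s) w) <= real N ^ 4" using cnt_time[OF w assms(4)] by linarith
   hence frac: "cnt 0 (Suc s) w / real N ^ 4 <= 1" using B_pos by (simp add: divide_le_eq)
   have "real (cnt (Suc s) n w) <= 4 * (4 * (real q + 3)) + real q + 2 + 1"
    by (rule order_trans[OF window_rings[OF w sn assms(3)]]) (use frac in simp)
   also have "4 * (4 * (real q + 3)) + real q + 2 + 1 <= 24 * real q" using q8 by simp
   finally show ?thesis .
  qed
  hence "(\<Sum>w\<in>{1..W}. real (cnt (Suc s) n w)) <= (\<Sum>w\<in>{1..W}. 24 * real q)"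
   by (rule sum_mono)
  hence "real (n - s) <= 1 + 24 * real q * W"
   unfolding steps_between[OF sn] by (simp add: mult_ac)
  moreover have "1 * 1 <= real q * W" using q8 W1 by (intro mult_mono) auto
  ultimately show ?thesis using sn by (simp add: of_nat_diff)
 qed simp
 have "Lev n - Lev s <= (q / N) * (real n - real s + 2)" by (rule Lev_rise[OF assms(1,2)])
 also have "... <= (q / N) * (27 * real q * W)"
 proof (rule mult_left_mono)
  have "1 * 1 <= real q * W" using q8 W1 by (intro mult_mono) auto
  thus "real n - real s + 2 <= 27 * real q * W" using le by simp
 qed simp
 also have "... = eta" by (simp add: eta_def power2_eq_square)
 finally show "Lev n - Lev s <= eta" .
qed

lemma window_cnt:
 assumes w: "w \<in> {1..W}" and "0 <= t" "0 <= T0" "t + T0 <= real N ^ 2"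
 shows "T0 / 4 - 2 * q - 3 <= cnt (steps t) (steps (t + T0)) w"
proof -
 define n where "n = steps t"
 define n' where "n' = steps (t + T0)"
 define r where "r = cnt 0 n w"
 define R where "R = cnt n n' w"
 have nn': "n <= n'" unfolding n_def n'_def by (rule steps_mono) (use assms in simp)
 have "cnt 0 n' w = r + R" unfolding r_def R_def by (rule cnt_split) (use nn' in auto)
 hence "jt n' <= c w (r + R)" using ring_count[OF w, of "r + R" n'] by simp
 moreover have "t + T0 < jt n'" using less_steps[of n' "t + T0"] by (simp add: n'_def)
 ultimately have cr: "t + T0 < c w (r + R)" by simp
 have "T0 <= 4 * (real R + q + 3) + q"
 proof (cases "r = 0")
  case True
  have "c w (0 + R) - c w 0 <= 4 * (real R + real q + 1 + real 0 / real N ^ 4)"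
   by (rule reg_upper'[OF regc[OF w] c_mono[OF w] B_pos])
  thus ?thesis using True cr reg_0[OF regc[OF w]] assms by simp
 next
  case False
  have "c w (r - 1) < jt n" using ring_count[OF w, of "r - 1" n] False by (simp add: r_def)
  obtain p where p: "jt p = c w (r - 1)" using ring_step[OF w] by metis
  hence "p < n" using \<open>c w (r - 1) < jt n\<close> enum.e_less_iff[of p n] by simp
  hence t: "c w (r - 1) <= t" using p less_steps[of p t] by (simp add: n_def)
  have "real (r - 1) / real N ^ 4 <= 1"
  proof -
   have "jt p <= real N ^ 2" using t p assms by simp
   moreover have "jumper W c p = w" using jumper_eqI[OF w, of "r - 1" p] p by simp
   ultimately have "real (cnt 0 p w) <= real N ^ 4" and "c w (cnt 0 p w) = c w (r - 1)"
    using cnt_time[OF w, of p] jump_time_ring[of p w] p by auto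
   hence "real (r - 1) <= real N ^ 4" using c_eq_iff[OF w w] by metis
   thus ?thesis using B_pos by (simp add: divide_le_eq)
  qed
  hence "4 * (real (R + 1) + real q + 1 + real (r - 1) / real N ^ 4) <= 4 * (real (R + 1) + real q + 1 + 1)"
   by (intro mult_left_mono add_left_mono) auto
  moreover have "c w (r - 1 + (R + 1)) - c w (r - 1) <= 4 * (real (R + 1) + real q + 1 + real (r - 1) / real N ^ 4)"
   by (rule reg_upper'[OF regc[OF w] c_mono[OF w] B_pos])
  ultimately have "c w (r - 1 + (R + 1)) - c w (r - 1) <= 4 * (real R + real q + 3)" by simp
  moreover have "r - 1 + (R + 1) = r + R" using False by simp
  ultimately show ?thesis using cr t by simp
 qed
 thus ?thesis unfolding R_def[symmetric] n_def[symmetric] n'_def[symmetric] using q8 by simp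
qed

text \<open>From index \<open>K0\<close> on there are no skips, so every jump leads further out on
  the same halfline.\<close>

lemma far_stays:
 assumes "L n w ~= 0" "K0 <= X n w" "n <= p"
 shows "L p w = L n w & K0 <= X p w"
 using assms(3)
proof (induction p rule: dec_induct)
 case (step p)
 show ?case
 proof (cases "jp p = w")
  case True
  hence "~ skip p" using no_far_skip[of p] step.IH by auto
  hence T: "T p = L p w" using True step.IH assms(1) by (auto simp: skip_iff)
  hence "X p w < K p (T p)" using X_less_K[of p w] step.IH assms(1) by auto
  thus ?thesis using T True step.IH by (auto simp: L_Suc X_Suc)
 qed (use step.IH in "auto simp: L_Suc X_Suc")
qed (use assms in simp)

lemma later_skip_near:
 assumes "skip p" "jp p = w" "n <= p" shows "X n w < K0"
proof (cases "L n w = 0")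
 case True thus ?thesis using X_origin[OF True] q8 by simp
next
 case False
 thus ?thesis using far_stays[OF False _ assms(3)] no_far_skip[OF assms(1)] assms(2) by force
qed

lemma cnt_le_land_near:
 assumes "n <= n'" "X n' w < K0"
 shows "cnt n n' w <= (land n n' w + 1) * K0"
proof -
 have "cnt n n' w + X n w <= land n n' w * K0 + X n' w"
 proof (rule cnt_le_land[OF assms(1)])
  show "1 <= K0" using q8 by simp
  show "X p w < K0" if "n <= p" "p < n'" "jp p = w" "L p w ~= 0" "L p w ~= T p" for p
   using no_far_skip[of p] that by (auto simp: skip_iff)
 qed (use X_origin in auto)
 thus ?thesis using assms(2) by simp
qed

definition "U t = {w \<in> {1..W}. \<exists>p\<ge>steps t. skip p & jp p = w}"

lemma U_mono: "t <= t' ==> U t' <= U t"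
 using steps_mono[of t t'] by (auto simp: U_def intro: order_trans)

lemma finite_U [simp]: "finite (U t)"
 by (simp add: U_def)

text \<open>The rings of a period of length \<open>T0\<close>, divided by \<open>K0\<close>: a
  worker who ends the period near the origin uses at most \<open>K0\<close> rings per landing, up to
  one extra stay (\<open>cnt_le_land_near\<close>).\<close>

definition "min_land T0 = (T0 / 4 - 2 * q - 3) / K0 - 1"

lemma land_lower:
 assumes w: "w \<in> {1..W}" and "0 <= t" "0 <= T0" "t + T0 <= real N ^ 2" "X (steps (t + T0)) w < K0"
 shows "min_land T0 <= land (steps t) (steps (t + T0)) w"
proof -
 have "steps t <= steps (t + T0)" by (rule steps_mono) (use assms in simp)
 from cnt_le_land_near[OF this assms(5)]
 have "real (cnt (steps t) (steps (t + T0)) w) <= (real (land (steps t) (steps (t + T0)) w) + 1) * real K0"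
  by (metis of_nat_1 of_nat_add of_nat_le_iff of_nat_mult)
 hence "T0 / 4 - 2 * q - 3 <= (real (land (steps t) (steps (t + T0)) w) + 1) * real K0"
  using window_cnt[OF assms(1-4)] by linarith
 moreover have "0 < real K0" using q8 by simp
 ultimately have "(T0 / 4 - 2 * q - 3) / K0 <= real (land (steps t) (steps (t + T0)) w) + 1"
  by (simp only: pos_divide_le_eq)
 thus ?thesis by (simp add: min_land_def)
qed

definition "good_cells mu h <-> (\<forall>l::nat. mu <= real l * h --> (real l + 1) * h <= 1 -->
 (\<exists>i\<in>{i \<in> {1..N}. good (d i)}. real l * h <= d i 0 & d i 0 < (real l + 1) * h))"

definition "cell h l = {(i, k). i \<in> {1..N} & real l * h <= d i k & d i k < (real l + 1) * h}"

definition "few_particles h A <-> (\<forall>l::nat. real l * h <= 1 -->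
  finite (cell h l) & card (cell h l) <= A)"

text \<open>Once everybody has left the origin, only members of \<open>U t\<close> change halflines.
  When the level rises, the good halflines it passes are occupied by leaders who arrived in this
  period, hence by different members of \<open>U t\<close>; so it passes about
  \<open>card (U t)\<close> cells at most. The landings of the period share the particles of these
  cells, and every member of \<open>U (t + T0)\<close> needs \<open>min_land T0\<close> of
  them.\<close>

lemma U_step:
 assumes gc: "good_cells mu h" and fp: "few_particles h A" and h: "0 < h"
  and t: "0 <= t" "0 <= T0" "t + T0 <= real N ^ 2"
  and lo: "!!w. w \<in> {1..W} ==> L (steps t) w ~= 0" and mu: "mu <= Lev (steps t)"
 shows "card (U (t + T0)) * min_land T0 <= A * (real (card (U t)) + 4)"
proof -
 define n where "n = steps t"
 define n' where "n' = steps (t + T0)"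
 define a where "a = Lev n"
 define b where "b = Lev n'"
 have nn': "n <= n'" unfolding n_def n'_def by (rule steps_mono) (use t in simp)
 have ab: "a <= b" "0 < a" "b <= 1" unfolding a_def b_def using Lev_mono[OF nn'] Lev_pos lev1 by auto
 have width: "(b - a) / h <= card (U t) + 2"
 proof (cases "a < b")
  case True
  let ?S = "{i \<in> {i \<in> {1..N}. good (d i)}. a < d i 0 & d i 0 < b}"
  have "(b - a) / h - 2 <= card ?S"
   by (rule card_cells[where mu = mu and nu = 1])
    (use h ab True mu gc in "auto simp: good_cells_def a_def n_def")
  also have "card ?S <= card (U t)"
  proof -
   have ex: "\<exists>w. w \<in> U t & L n' w = i" if "i \<in> ?S" for i
   proof -
    have i: "i \<in> {1..N}" "good (d i)" "Lev n < d i 0" "d i 0 < Lev n'"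
     using that by (auto simp: a_def b_def)
    note nv = newly_visited[OF i(1,3,4)]
    obtain w where w: "w \<in> {1..W}" "L n' w = i" using leader[OF i(1,2) nv(2)] by auto
    obtain e where e: "e < n'" "jp e = w" "T e = i" "L e w ~= T e"
     using entry_line[OF w(2)] i(1) by (metis atLeastAtMost_iff not_one_le_zero)
    have "n <= e"
    proof (rule ccontr)
     assume "~ ?thesis"
     hence "K (Suc e) i <= K n i" by (intro K_mono) auto
     thus False using e nv(1) by (simp add: K_Suc)
    qed
    moreover have "L e w ~= 0" using L_stays_nonzero[of n e w] lo[OF w(1)] \<open>n <= e\<close> by (simp add: n_def)
    ultimately have "w \<in> U t" using e w by (auto simp: U_def skip_iff n_def)
    thus ?thesis using w by auto
   qed
   have "\<exists>g. \<forall>i\<in>?S. g i \<in> U t & L n' (g i) = i" by (rule bchoice) (use ex in blast)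
   then obtain g where g: "\<forall>i\<in>?S. g i \<in> U t & L n' (g i) = i" ..
   show ?thesis
   proof (rule card_inj_on_le[of g])
    show "inj_on g ?S"
    proof (rule inj_onI)
     fix x y assume "x \<in> ?S" "y \<in> ?S" and eq: "g x = g y"
     hence "L n' (g x) = x" "L n' (g y) = y" using g by blast+
     thus "x = y" using eq by metis
    qed
    show "g ` ?S <= U t" using g by blast
   qed simp
  qed
  finally show ?thesis by simp
 qed (use ab in auto)
 \<comment> \<open>Of the 4, two come from the incomplete cells in \<open>card_cells\<close> and two
   from the cells that contain the two levels.\<close>
 have landings: "real (card {p \<in> {n..<n'}. L p (jp p) ~= T p}) <= A * (real (card (U t)) + 4)"
 proof -
  define l0 where "l0 = nat \<lfloor>a / h\<rfloor>"
  define l1 where "l1 = nat \<lfloor>b / h\<rfloor>"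
  have l1: "l <= l1 ==> real l * h <= 1" for l
  proof -
   assume "l <= l1"
   moreover have "0 <= b / h" using ab h by simp
   hence "real l1 <= b / h" unfolding l1_def by linarith
   ultimately have "real l <= b / h" by linarith
   thus ?thesis using h ab by (simp add: field_simps)
  qed
  let ?P = "\<Union>l\<in>{l0..l1}. cell h l"
  have fin: "finite ?P" using fp l1 by (auto simp: few_particles_def)
  have "card {p \<in> {n..<n'}. L p (jp p) ~= T p} <= card ?P"
  proof (rule card_landings_le[OF fin])
   fix i k assume i: "i \<in> {1..N}" "Lev n <= d i k" "d i k <= Lev n'"
   define l where "l = nat \<lfloor>d i k / h\<rfloor>"
   have "0 <= d i k / h" using h d_pos[OF i(1), of k] by simp
   hence l: "real l <= d i k / h" "d i k / h < real l + 1" unfolding l_def by linarith+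
   have "a / h <= d i k / h" "d i k / h <= b / h" using i h by (auto simp: a_def b_def divide_right_mono)
   hence "l \<in> {l0..l1}" unfolding l_def l0_def l1_def by (auto intro!: nat_mono floor_mono)
   moreover have "(i, k) \<in> cell h l" using l h i(1) by (auto simp: cell_def field_simps)
   ultimately show "(i, k) \<in> ?P" by blast
  qed
  also have "card ?P <= (\<Sum>l\<in>{l0..l1}. card (cell h l))" by (rule card_UN_le) simp
  also have "... <= (\<Sum>l\<in>{l0..l1}. A)" by (rule sum_mono) (use fp l1 in "auto simp: few_particles_def")
  finally have "real (card {p \<in> {n..<n'}. L p (jp p) ~= T p}) <= real (card {l0..l1}) * A"
   by (metis of_nat_le_iff of_nat_mult sum_constant of_nat_id)
  also have "... <= (card (U t) + 4) * real A"
  proof (rule mult_right_mono)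
   have "0 <= a / h" "a / h <= b / h" using ab h by (auto simp: divide_right_mono)
   hence "real l1 <= b / h" "a / h < real l0 + 1" "l0 <= l1" unfolding l0_def l1_def
    by (linarith, linarith, intro nat_mono floor_mono)
   hence "real (card {l0..l1}) <= (b - a) / h + 2" by (simp add: of_nat_diff diff_divide_distrib)
   thus "real (card {l0..l1}) <= card (U t) + 4" using width by simp
  qed simp
  finally show ?thesis by (simp add: mult.commute)
 qed
 have "card (U (t + T0)) * min_land T0 = (\<Sum>w\<in>U (t + T0). min_land T0)" by simp
 also have "... <= (\<Sum>w\<in>U (t + T0). real (land n n' w))"
 proof (rule sum_mono)
  fix w assume "w \<in> U (t + T0)"
  then obtain p where "w \<in> {1..W}" "steps (t + T0) <= p" "skip p" "jp p = w" by (auto simp: U_def)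
  thus "min_land T0 <= real (land n n' w)"
   unfolding n_def n'_def using later_skip_near t by (intro land_lower) auto
 qed
 also have "... = real (\<Sum>w\<in>U (t + T0). land n n' w)" by simp
 also have "... <= real (card {p \<in> {n..<n'}. L p (jp p) ~= T p})"
  unfolding of_nat_le_iff by (rule sum_land) simp
 finally show ?thesis using landings by simp
qed

end

lemma gap_le: "mono t ==> 0 <= t 0 ==> gap t j <= t j"
proof -
 assume t: "mono t" "0 <= t 0"
 have "0 <= t k" for k using t(2) monoD[OF t(1), of 0 k] by simp
 thus "gap t j <= t j" by (cases j) (auto simp: gap_def)
qed

context star_reg
begin

lemma steps_0: "steps 0 = 0"
proof -
 obtain w r where "w \<in> {1..W}" "jt 0 = c w r" using enum.e_in[of 0] by (auto simp: rings_def)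
 hence "0 < jt 0" using cpos by simp
 thus ?thesis using less_steps[of 0 0] by simp
qed

lemma all_left:
 assumes "8 * real q + 12 < t" "t <= real N ^ 2" "w \<in> {1..W}" "steps t <= n"
 shows "L n w ~= 0"
proof -
 have "t / 4 - 2 * q - 3 <= cnt (steps 0) (steps (0 + t)) w"
  by (rule window_cnt) (use assms in auto)
 hence "0 < cnt 0 (steps t) w" using assms(1) by (simp add: steps_0)
 thus ?thesis using left_origin L_stays_nonzero assms(4) by blast
qed

text \<open>Every period divides the number of skipping workers by at least
  \<open>min_land T0 / (5 * A)\<close>; after \<open>P\<close> periods it is below 1.\<close>

lemma U_empty:
 assumes gc: "good_cells mu h" and fp: "few_particles h A" and h: "0 < h"
  and t: "8 * real q + 12 < t1" "0 <= T0" "t1 + P * T0 <= real N ^ 2" and mu: "mu <= Lev (steps t1)"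
  and ml: "0 < min_land T0" "real W * (5 * real A) ^ P < min_land T0 ^ P"
 shows "U (t1 + P * T0) = {}"
proof -
 have "j <= P ==> card (U (t1 + j * T0)) * min_land T0 ^ j <= real W * (5 * real A) ^ j" for j
 proof (induction j)
  case 0
  have "card (U t1) <= card {1..W}" by (rule card_mono) (auto simp: U_def)
  thus ?case by simp
 next
  case (Suc j)
  define t where "t = t1 + j * T0"
  have "real (Suc j) * T0 <= real P * T0" using Suc.prems t by (intro mult_right_mono) auto
  hence tT: "t + T0 = t1 + Suc j * T0" "t + T0 <= real N ^ 2" "t1 <= t"
   using t by (auto simp: t_def algebra_simps)
  have st: "steps t1 <= steps t" by (rule steps_mono) (use tT in simp)
  have U_step': "card (U (t + T0)) * min_land T0 <= A * (real (card (U t)) + 4)"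
  proof (rule U_step[OF gc fp h])
   show "L (steps t) w ~= 0" if "w \<in> {1..W}" for w
    using all_left[of t1 w "steps t"] that st t(1) tT(2,3) t(2) by simp
   show "mu <= Lev (steps t)" using mu Lev_mono[OF st] by simp
  qed (use t tT in auto)
  \<comment> \<open>As long as one skipping worker is left, the additive 4 of \<open>U_step\<close>
    is absorbed in the factor 5.\<close>
  have "card (U (t + T0)) * min_land T0 <= 5 * A * real (card (U t))"
  proof (cases "U t = {}")
   case True
   hence "U (t + T0) = {}" using U_mono[of t "t + T0"] t by auto
   thus ?thesis by simp
  next
   case False
   hence "1 <= card (U t)" by (simp add: Suc_le_eq card_gt_0_iff)
   hence "real A * (real (card (U t)) + 4) <= A * (5 * real (card (U t)))"
    by (intro mult_left_mono) auto
   thus ?thesis using U_step' by simp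
  qed
  hence "card (U (t + T0)) * min_land T0 * min_land T0 ^ j <= 5 * A * real (card (U t)) * min_land T0 ^ j"
   using ml by (intro mult_right_mono) auto
  also have "... <= 5 * A * (real W * (5 * real A) ^ j)"
   using Suc by (simp add: t_def mult_left_mono mult.assoc)
  finally show ?case unfolding tT(1) by (simp add: mult_ac)
 qed
 from this[OF order_refl] have "card (U (t1 + P * T0)) * min_land T0 ^ P < min_land T0 ^ P"
  using ml(2) by linarith
 hence "card (U (t1 + P * T0)) < 1" using ml
  by (metis mult_1 mult_le_cancel_right not_le of_nat_1 of_nat_le_iff zero_less_power less_le_not_le)
 thus ?thesis by simp
qed

lemma U_empty_skip: "U t = {} ==> skip p ==> jt p <= t"
proof (rule ccontr)
 assume U: "U t = {}" "skip p" "~ jt p <= t"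
 hence "steps t <= p" using less_steps[of p t] by simp
 hence "jp p \<in> U t" using U jumper_props by (auto simp: U_def)
 thus False using U by simp
qed

text \<open>The trace in the dust of a worker beyond distance 1: the thresholds of
  \<open>chain\<close> bound the first \<open>a\<close> particles, and the process is no longer
  mentioned.\<close>

definition "chain_lines a m = {i \<in> {1..N}. \<forall>j<a. gap (d i) j <= 2 ^ (j + 1) * m}"

lemma gap_le_d: "i \<in> {1..N} ==> gap (d i) j <= d i j"
 using gap_le[OF d_mono] d_pos by (simp add: less_imp_le)

lemma threshold: assumes "0 < m" "2 ^ a * m <= 1" "j < a" shows "(2 ^ Suc j - 1) * m < (1::real)"
proof -
 have "(2::real) ^ Suc j <= 2 ^ a" using assms by (intro power_increasing) auto
 hence "(2 ^ Suc j - 1) * m <= (2 ^ a - 1) * m" using assms by (intro mult_right_mono) auto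
 also have "... < 1" using assms by (simp add: algebra_simps)
 finally show ?thesis .
qed

lemma vis_index:
 assumes "i \<in> {1..N}" "j < card {k \<in> vis w i n. d i k <= b}" shows "d i j <= b"
 by (rule index_below[OF assms(1) _ _ assms(2)]) (auto simp: finite_vis)

lemma far_chain_line:
 assumes "L n w = i" "i ~= 0" "1 < Y n w" "!!p. p < n ==> Lev p <= m" "0 < m" "2 ^ a * m <= 1"
 shows "i \<in> chain_lines a m"
proof -
 have i: "i \<in> {1..N}" using L_in[of n w] assms by simp
 have "gap (d i) j <= 2 ^ (j + 1) * m" if j: "j < a" for j
 proof -
  have "(2 ^ Suc j - 1) * m < Y n w" using threshold[OF assms(5,6) j] assms(3) by linarith
  hence "Suc j <= card {k \<in> vis w i n. d i k <= (2 ^ Suc j - 1) * m}"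
   by (intro chain[OF assms(1,2,4)]) auto
  hence "d i j <= (2 ^ Suc j - 1) * m" by (intro vis_index[OF i]) (simp only: Suc_le_eq)
  also have "... <= 2 ^ (j + 1) * m" using assms(5) by simp
  finally show ?thesis using gap_le_d[OF i, of j] by linarith
 qed
 thus ?thesis using i by (simp add: chain_lines_def)
qed

text \<open>Suppose the level is still below \<open>m\<close> at time \<open>t1\<close>. The workers
  within distance 1 have landed at least \<open>min_land t1\<close> times each, out of at most
  \<open>N * q\<close> landings altogether. The others are on halflines in
  \<open>chain_lines\<close>, at most \<open>q\<close> on each. By \<open>less\<close> this does not
  account for all workers.\<close>

lemma phase1:
 assumes t1: "0 <= t1" "t1 <= real N ^ 2" and m: "0 < m" "2 ^ a * m <= 1"
  and ml: "0 < min_land t1"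
  and less: "real N * q + q * card (chain_lines a m) * min_land t1 < W * min_land t1"
 shows "m <= Lev (steps t1)"
proof (rule ccontr)
 assume "~ ?thesis"
 hence Lm: "Lev p <= m" if "p < steps t1" for p using Lev_mono[of p "steps t1"] that by simp
 define n where "n = steps t1"
 define V where "V = {w \<in> {1..W}. Y n w <= 1}"
 define V' where "V' = {w \<in> {1..W}. 1 < Y n w}"
 have fin: "finite V" "finite V'" by (auto simp: V_def V'_def)
 have "card V * min_land t1 = (\<Sum>w\<in>V. min_land t1)" by simp
 also have "... <= (\<Sum>w\<in>V. real (land 0 n w))"
 proof (rule sum_mono)
  fix w assume w: "w \<in> V"
  have "X n w < K0"
  proof (cases "L n w = 0")
   case True thus ?thesis using X_origin[OF True] q8 by simp
  next
   case False
   hence "d (L n w) (X n w) <= 1" using w Y_eq[OF False] by (simp add: V_def)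
   hence "X n w < q" by (rule below_1[OF L_in[OF False]])
   also have "q <= K0" by (simp add: power2_eq_square)
   finally show ?thesis .
  qed
  hence "min_land t1 <= land (steps 0) (steps (0 + t1)) w"
   using w t1 by (intro land_lower) (auto simp: V_def n_def)
  thus "min_land t1 <= real (land 0 n w)" by (simp add: steps_0 n_def)
 qed
 also have "... = real (\<Sum>w\<in>V. land 0 n w)" by simp
 also have "... <= real (N * q)" unfolding of_nat_le_iff
  by (rule order_trans[OF sum_land[OF fin(1)] landings_le])
 finally have V: "card V * min_land t1 <= real N * q" by simp
 have "V' <= (\<Union>i\<in>chain_lines a m. {w. \<exists>n. L n w = i})"
 proof
  fix w assume w: "w \<in> V'"
  hence L: "L n w ~= 0" using Y_origin[of n w] by (auto simp: V'_def)
  have "L n w \<in> chain_lines a m"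
   by (rule far_chain_line[OF refl L _ _ m]) (use w Lm in "auto simp: V'_def n_def")
  thus "w \<in> (\<Union>i\<in>chain_lines a m. {w. \<exists>n. L n w = i})" by blast
 qed
 moreover have fc: "finite (chain_lines a m)" by (simp add: chain_lines_def)
 moreover have "finite (\<Union>i\<in>chain_lines a m. {w. \<exists>n. L n w = i})"
  using line_workers(1) fc by (auto simp: chain_lines_def)
 ultimately have "card V' <= card (\<Union>i\<in>chain_lines a m. {w. \<exists>n. L n w = i})" by (metis card_mono)
 also have "... <= (\<Sum>i\<in>chain_lines a m. card {w. \<exists>n. L n w = i})" by (rule card_UN_le[OF fc])
 also have "... <= (\<Sum>i\<in>chain_lines a m. q)"
  by (rule sum_mono) (use line_workers(2) in "auto simp: chain_lines_def")
 finally have "card V' <= card (chain_lines a m) * q" by simp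
 hence V': "card V' * min_land t1 <= real (card (chain_lines a m) * q) * min_land t1"
  using ml by (intro mult_right_mono) (simp_all only: of_nat_le_iff less_imp_le)
 have "{1..W} = V \<union> V'" "V \<inter> V' = {}" by (auto simp: V_def V'_def)
 hence "W = card V + card V'" using card_Un_disjoint[OF fin] by (metis card_atLeastAtMost diff_Suc_1)
 hence "W * min_land t1 = card V * min_land t1 + card V' * min_land t1"
  by (simp add: distrib_right)
 thus False using V V' less by (simp add: mult_ac)
qed

text \<open>The worker resting at index \<open>x\<close> arrived there when the level was at most his position, so when
  a second worker lands in front of him the two particles are within the rise of the level.\<close>

lemma close_pair:
 assumes "fine_cells" "jt e <= real N ^ 2" "L e w = i" "i ~= 0" "T e = i" "L e (jp e) ~= i"
 shows "d i (K e i) - d i (X e w) <= eta" "X e w < K e i"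
proof -
 obtain s where s: "s < e" "jp s = w" "T s = i" "K s i = X e w" "!!p. s < p ==> p < e ==> jp p ~= w"
  using arrival[of e w] assms(3,4) by metis
 have w: "w \<in> {1..W}" using jumper_props[of s] s by auto
 have "cnt (Suc s) e w = 0" unfolding cnt_def using s(5) by (auto simp: Suc_le_eq)
 hence r: "cnt 0 e w = Suc (cnt 0 s w)"
  using cnt_split[of 0 "Suc s" e w] s by (simp add: cnt_Suc)
 have "jt e <= c w (cnt 0 s w + 1)" using ring_count[OF w, of "cnt 0 s w + 1" e] r by simp
 moreover have "jt s = c w (cnt 0 s w)" using jump_time_ring s by auto
 moreover have "c w (cnt 0 s w + 1) - c w (cnt 0 s w) <= 4 * (real 1 + real q + 1 + cnt 0 s w / real N ^ 4)"
  by (rule reg_upper'[OF regc[OF w] c_mono[OF w] B_pos])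
 moreover have "cnt 0 s w / real N ^ 4 <= 1"
 proof -
  have "jt s < jt e" using s enum.e_less_iff by blast
  hence "real (cnt 0 s w) <= real N ^ 4" using assms(2) by (intro cnt_time[OF w]) simp
  thus ?thesis using B_pos by (simp add: divide_le_eq)
 qed
 hence "4 * (real 1 + real q + 1 + cnt 0 s w / real N ^ 4) <= 4 * (real q + 3)" by simp
 ultimately have "jt e - jt s <= 4 * (real q + 3)" by linarith
 hence "Lev e - Lev s <= eta" using window_rise(2)[OF assms(1) _ _ assms(2), of s] s(1) by simp
 moreover have "Lev e = d i (K e i)" using landing_Z[of e] assms by (simp add: Z_def)
 moreover have "Lev s <= d i (X e w)" using Lev_le_Z[of s] s by (simp add: Z_def)
 ultimately show "d i (K e i) - d i (X e w) <= eta" by linarith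
 show "X e w < K e i" using X_less_K[of e w] assms by simp
qed

text \<open>Two disjoint chains put \<open>2 * j + 2\<close> particles within the threshold of
  \<open>j + 1\<close>, so the gaps \<open>2 * j\<close> and \<open>2 * j + 1\<close> obey the same
  bound.\<close>

definition "pair_lines a m = {i \<in> {1..N}. (\<exists>k\<in>{1..q}. gap (d i) k <= eta) &
  (\<forall>j<a. gap (d i) (2 * j) <= 2 ^ (j + 1) * m & gap (d i) (2 * j + 1) <= 2 ^ (j + 1) * m)}"

text \<open>A worker who never leaves a halfline gains at least one index with every ring.\<close>

lemma eventually_far:
 assumes "w \<in> {1..W}" "!!p. n0 <= p ==> L p w = i" "i ~= 0"
 shows "\<exists>p1\<ge>n0. \<forall>p\<ge>p1. 1 < Y p w"
proof -
 have i: "i \<in> {1..N}" using L_in[of n0 w] assms by simp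
 have X_ge: "n0 <= p ==> cnt n0 p w <= X p w" for p
 proof (induction p rule: dec_induct)
  case (step p)
  show ?case
  proof (cases "jp p = w")
   case True
   have "T p = i" using assms(2)[of "Suc p"] step True by (simp add: L_Suc)
   hence "X p w < K p (T p)" using X_less_K[of p w] assms(2)[of p] step assms(3) by simp
   thus ?thesis using step True by (simp add: cnt_Suc X_Suc)
  qed (use step in "auto simp: cnt_Suc X_Suc")
 qed simp
 obtain p1 where p1: "c w (cnt 0 n0 w + q) < jt p1" using enum.e_unbdd by auto
 have "1 < Y p w" if p: "max n0 p1 <= p" for p
 proof -
  have "c w (cnt 0 n0 w + q) < jt p" using p1 enum.e_le_iff[of p1 p] p by simp
  hence "cnt 0 n0 w + q < cnt 0 p w" using ring_count[OF assms(1)] by simp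
  hence "q <= cnt n0 p w" using cnt_split[of 0 n0 p w] p by simp
  hence "q <= X p w" using X_ge[of p] p by simp
  hence "~ d i (X p w) <= 1" using below_1[OF i] by force
  moreover have "Y p w = d i (X p w)" using Y_eq[of p w] assms(2)[of p] assms(3) p by simp
  ultimately show ?thesis by simp
 qed
 thus ?thesis by (intro exI[of _ "max n0 p1"]) auto
qed

text \<open>After the last skip two workers share a halfline forever and both pass distance 1. What
  they have removed is disjoint, which doubles the count in \<open>chain\<close>. The one who
  entered later landed in front of the resting earlier one; there \<open>close_pair\<close> supplies
  the short gap.\<close>

lemma pair_line:
 assumes fc: "fine_cells" and th: "!!p. skip p ==> jt p <= real N ^ 2"
  and m: "!!n. Lev n <= m" "2 ^ a * m <= 1"
  and ns: "~ eventually_separated N W d c"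
 shows "pair_lines a m ~= {}"
proof -
 have m0: "0 < m" using Lev_pos[of 0] m(1)[of 0] by simp
 define n0 where "n0 = steps (real N ^ 2)"
 have N2: "8 * real q + 12 < real N ^ 2"
 proof -
  have "real q ^ 1 <= real q ^ 3" by (rule q_pow) simp
  moreover have "1 <= real q ^ 3" using q8 by (intro one_le_power) simp
  moreover have "real N <= real N ^ 2" using N1 by (intro self_le_power) auto
  ultimately show ?thesis using q_q3 unfolding power_one_right by linarith
 qed
 have nz: "L n w ~= 0" if "w \<in> {1..W}" "n0 <= n" for n w
  by (rule all_left[OF N2 order_refl that(1)]) (use that in "simp add: n0_def")
 have no_skip: "~ skip p" if "n0 <= p" for p
  using th[of p] less_steps[of p "real N ^ 2"] that by (auto simp: n0_def)
 have const: "L p w = L n0 w" if "w \<in> {1..W}" "n0 <= p" for p w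
  using that(2)
 proof (induction p rule: dec_induct)
  case (step p)
  thus ?case using no_skip[of p] nz[OF that(1), of p] by (auto simp: L_Suc skip_iff)
 qed simp
 obtain n w1 w2 where n: "n0 <= n" "w1 \<in> {1..W}" "w2 \<in> {1..W}" "w1 ~= w2" "L n w1 = L n w2"
  using ns unfolding eventually_separated_iff by blast
 define i where "i = L n0 w1"
 have L1: "L p w1 = i" and L2: "L p w2 = i" if "n0 <= p" for p
  using const[of _ p] const[of _ n] n that by (auto simp: i_def)
 have i0: "i ~= 0" using nz[OF n(2), of n0] by (simp add: i_def)
 have i: "i \<in> {1..N}" using L_in[of n0 w1] i0 by (simp add: i_def)
 obtain p1 p2 where "p1 \<ge> n0" "p2 \<ge> n0" "!!p. p \<ge> p1 ==> 1 < Y p w1" "!!p. p \<ge> p2 ==> 1 < Y p w2"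
  using eventually_far[OF n(2) L1 i0] eventually_far[OF n(3) L2 i0] by metis
 hence p: "n0 <= max p1 p2" "1 < Y (max p1 p2) w1" "1 < Y (max p1 p2) w2" by auto
 define p where "p = max p1 p2"
 have gaps: "d i (2 * j + 1) <= 2 ^ (j + 1) * m" if j: "j < a" for j
 proof -
  let ?S = "%w. {k \<in> vis w i p. d i k <= (2 ^ Suc j - 1) * m}"
  have c: "Suc j <= card (?S w)" if "L p w = i" "1 < Y p w" for w
   by (rule chain[OF that(1) i0]) (use m threshold[OF m0 m(2) j] that(2) in auto)
  have "card (?S w1 \<union> ?S w2) = card (?S w1) + card (?S w2)"
   by (rule card_Un_disjoint) (use vis_disjoint[OF n(4), of i p] in "auto simp: finite_vis")
  hence C: "2 * j + 1 < card (?S w1 \<union> ?S w2)"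
   using c[of w1] c[of w2] p L1[of p] L2[of p] by (simp add: p_def)
  have F: "finite (?S w1 \<union> ?S w2)" using finite_vis by simp
  have B: "d i k <= (2 ^ Suc j - 1) * m" if "k \<in> ?S w1 \<union> ?S w2" for k using that by blast
  have "d i (2 * j + 1) <= (2 ^ Suc j - 1) * m" by (rule index_below[OF i F B C])
  also have "... <= 2 ^ (j + 1) * m" using m0 by simp
  finally show ?thesis .
 qed
 have "gap (d i) (2 * j) <= 2 ^ (j + 1) * m & gap (d i) (2 * j + 1) <= 2 ^ (j + 1) * m" if "j < a" for j
  using gaps[OF that] gap_le_d[OF i, of "2 * j"] gap_le_d[OF i, of "2 * j + 1"] d_le_iff[OF i, of "2 * j" "2 * j + 1"]
  by simp
 moreover have "\<exists>k\<in>{1..q}. gap (d i) k <= eta"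
 proof -
  have main: "\<exists>k\<in>{1..q}. gap (d i) k <= eta"
   if e: "e < p" "jp e = v'" "T e = i" "L e v' ~= T e" "L e v = i" "v' \<in> {1..W}" for e v v'
  proof -
   have "e < n0"
   proof (rule ccontr)
    assume "~ ?thesis"
    thus False using no_skip[of e] nz[OF e(6), of e] e by (auto simp: skip_iff)
   qed
   hence je: "jt e <= real N ^ 2" using less_steps[of e "real N ^ 2"] by (simp add: n0_def)
   note cp = close_pair[OF fc je e(5) i0 e(3)]
   have cp1: "d i (K e i) - d i (X e v) <= eta" "X e v < K e i" using cp e by auto
   have "d i (K e i) = Lev e" using landing_Z[of e] e by (simp add: Z_def)
   hence "K e i < q" using below_1[OF i] lev1[of e] by simp
   moreover obtain k where k: "K e i = Suc k" using cp1(2) by (cases "K e i") auto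
   moreover have "d i (X e v) <= d i k" using d_le_iff[OF i] cp1(2) k by simp
   ultimately show ?thesis using cp1(1) by (intro bexI[of _ "K e i"]) (auto simp: gap_def)
  qed
  obtain e1 where e1: "e1 < p" "jp e1 = w1" "T e1 = i" "L e1 w1 ~= T e1" "!!p'. e1 < p' ==> p' <= p ==> L p' w1 = i"
   using entry_line[OF L1 i0, of p] p by (auto simp: p_def)
  obtain e2 where e2: "e2 < p" "jp e2 = w2" "T e2 = i" "L e2 w2 ~= T e2" "!!p'. e2 < p' ==> p' <= p ==> L p' w2 = i"
   using entry_line[OF L2 i0, of p] p by (auto simp: p_def)
  have "e1 ~= e2" using e1 e2 n(4) by auto
  then consider "e1 < e2" | "e2 < e1" by linarith
  thus ?thesis
  proof cases
   case 1 show ?thesis by (rule main[OF e2(1-4) _ n(3)]) (rule e1(5), use 1 e2 in auto)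
  next
   case 2 show ?thesis by (rule main[OF e1(1-4) _ n(2)]) (rule e2(5), use 2 e1 in auto)
  qed
 qed
 ultimately have "i \<in> pair_lines a m" using i by (simp add: pair_lines_def)
 thus ?thesis by blast
qed

end

section \<open>Families of independent exponential variables\<close>

text \<open>The exponential density is at most 1; condition on \<open>V\<close>.\<close>

lemma (in prob_space) prob_interval_le:
 assumes X: "distributed M lborel X (exponential_density 1)" and ind: "indep_var borel X borel V" and h: "0 <= h"
 shows "\<P>(om in M. a <= X om + V om & X om + V om <= a + h) <= h"
proof -
 have X_rv [measurable]: "X \<in> borel_measurable M" and V_rv [measurable]: "V \<in> borel_measurable M"
  using indep_var_rv1[OF ind] indep_var_rv2[OF ind] by auto
 interpret PX: prob_space "distr M borel X" by (rule prob_space_distr) simp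
 interpret PV: prob_space "distr M borel V" by (rule prob_space_distr) simp
 interpret PP: pair_prob_space "distr M borel X" "distr M borel V" ..
 let ?A = "{z :: real \<times> real. a <= fst z + snd z & fst z + snd z <= a + h}"
 have A: "?A \<in> sets (borel \<Otimes>\<^sub>M borel)"
 proof -
  have "Measurable.pred (borel \<Otimes>\<^sub>M borel) (%z :: real \<times> real. a <= fst z + snd z & fst z + snd z <= a + h)"
   by measurable
  thus ?thesis by (simp add: pred_def space_pair_measure)
 qed
 have "emeasure M {om \<in> space M. a <= X om + V om & X om + V om <= a + h}
   = emeasure (distr M (borel \<Otimes>\<^sub>M borel) (%x. (X x, V x))) ?A"
  by (subst emeasure_distr) (use A in \<open>auto intro!: arg_cong[where f = "emeasure M"]\<close>)
 also have "... = emeasure (distr M borel X \<Otimes>\<^sub>M distr M borel V) ?A"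
  using ind by (simp add: indep_var_distribution_eq)
 also have "... = (\<integral>\<^sup>+y. emeasure (distr M borel X) ((%x. (x, y)) -` ?A) \<partial>distr M borel V)"
  by (rule PP.emeasure_pair_measure_alt2) (use A in simp)
 also have "... <= (\<integral>\<^sup>+y. ennreal h \<partial>distr M borel V)"
 proof (rule nn_integral_mono)
  fix y :: real
  have D: "distr M borel X = density lborel (exponential_density 1)"
   using X by (metis distributed_def distr_cong sets_lborel)
  have "emeasure (distr M borel X) ((%x. (x, y)) -` ?A) = emeasure (distr M borel X) {a - y .. a + h - y}"
   by (rule arg_cong[where f = "emeasure _"]) auto
  also have "... = (\<integral>\<^sup>+x. ennreal (exponential_density 1 x) * indicator {a - y .. a + h - y} x \<partial>lborel)"
   unfolding D by (subst emeasure_density) auto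
  also have "... <= (\<integral>\<^sup>+x. indicator {a - y .. a + h - y} x \<partial>lborel)"
  proof (rule nn_integral_mono)
   fix x :: real
   have "exponential_density 1 x <= 1" by (simp add: exponential_density_def)
   thus "ennreal (exponential_density 1 x) * indicator {a - y..a + h - y} x
     <= indicator {a - y..a + h - y} x" by (auto split: split_indicator simp: ennreal_le_1)
  qed
  also have "... = ennreal h" using h by simp
  finally show "emeasure (distr M borel X) ((%x. (x, y)) -` ?A) <= ennreal h" .
 qed
 also have "... = ennreal h" using PV.emeasure_space_1 by (simp add: space_distr)
 finally show ?thesis using h by (simp add: emeasure_eq_measure)
qed

locale exp_family = prob_space M for M :: "'a measure" +
 fixes G :: "'i => 'a => real" and I :: "'i set"
 assumes indepG: "indep_vars (%_. borel) G I"
  and expG: "!!z. z \<in> I ==> distributed M lborel (G z) (exponential_density 1)"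
begin

lemma G_meas: "z \<in> I ==> G z \<in> borel_measurable M"
 using indepG by (auto simp: indep_vars_def)

lemma G_sets [measurable (raw)]: "z \<in> I ==> G z \<in> borel_measurable M"
 by (rule G_meas)

lemma prob_le: "z \<in> I ==> 0 <= x ==> \<P>(om in M. G z om <= x) = 1 - exp (- x)"
 using exponential_distributedD_le[OF expG, of z x] by simp

lemma prob_gt: "z \<in> I ==> 0 <= x ==> \<P>(om in M. x < G z om) = exp (- x)"
 using exponential_distributedD_gt[OF expG, of z x] by simp

lemma prob_le': "z \<in> I ==> 0 <= x ==> \<P>(om in M. G z om <= x) <= x"
 using prob_le[of z x] exp_ge_add_one_self[of "- x"] by simp

lemma prob_window:
 assumes z: "z \<in> I" and ab: "0 <= a" "a <= b"
 shows "(b - a) * exp (- b) <= \<P>(om in M. G z om \<in> {a..b})"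
proof -
 note [measurable] = G_meas[OF z]
 have "(b - a) * exp (- b) <= exp (- a) - exp (- b)"
 proof -
  have "exp (- a) = exp (- b) * exp (b - a)" by (simp add: exp_add[symmetric])
  moreover have "exp (- b) * (1 + (b - a)) <= exp (- b) * exp (b - a)"
   by (intro mult_left_mono exp_ge_add_one_self) simp
  ultimately show ?thesis by (simp add: algebra_simps)
 qed
 also have "... = \<P>(om in M. G z om <= b) - \<P>(om in M. G z om <= a)"
  using prob_le[OF z] ab by simp
 also have "... = prob ({om \<in> space M. G z om <= b} - {om \<in> space M. G z om <= a})"
  by (rule finite_measure_Diff[symmetric]) (use ab in auto)
 also have "... <= \<P>(om in M. G z om \<in> {a..b})"
  by (rule finite_measure_mono) auto
 finally show ?thesis .
qed

lemma AE_pos: assumes z: "z \<in> I" shows "AE om in M. 0 < G z om"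
proof -
 note [measurable] = G_meas[OF z]
 have "\<P>(om in M. G z om <= 0) = 0" using prob_le[OF z, of 0] by simp
 hence "AE om in M. om \<notin> {om \<in> space M. G z om <= 0}"
  by (subst (asm) prob_eq_0) auto
 thus ?thesis by (rule AE_mp) (rule AE_I2, auto)
qed

lemma prob_all:
 assumes J: "finite J" "J <= I" and B: "!!j. j \<in> J ==> B j \<in> sets borel"
 shows "\<P>(om in M. \<forall>j\<in>J. G j om \<in> B j) = (\<Prod>j\<in>J. \<P>(om in M. G j om \<in> B j))"
proof (cases "J = {}")
 case True thus ?thesis by (simp add: prob_space)
next
 case False
 have "{om \<in> space M. \<forall>j\<in>J. G j om \<in> B j} = (\<Inter>j\<in>J. G j -` B j \<inter> space M)"
  using False by auto
 moreover have "G j -` B j \<inter> space M = {om \<in> space M. G j om \<in> B j}" for j by auto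
 ultimately show ?thesis using indep_varsD[OF indepG False J(1,2), of B] B by simp
qed

lemma indep_var_fun:
 assumes "z \<in> I" "F <= I" "z \<notin> F" "f \<in> borel_measurable (PiM F (%_. borel))"
 shows "indep_var borel (G z) borel (%om. f (restrict (%i. G i om) F))"
proof -
 have "indep_var (PiM {z} (%_. borel)) (%om. restrict (%i. G i om) {z}) (PiM F (%_. borel)) (%om. restrict (%i. G i om) F)"
  by (rule indep_var_restrict[OF indepG]) (use assms in auto)
 from indep_var_compose[OF this, of "%x. x z" borel f borel] assms
 show ?thesis by (auto simp: comp_def)
qed

lemma prob_interval:
 assumes "z \<in> I" "F <= I" "z \<notin> F" "f \<in> borel_measurable (PiM F (%_. borel))" "0 <= h"
 shows "\<P>(om in M. a <= G z om + f (restrict (%i. G i om) F) &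
   G z om + f (restrict (%i. G i om) F) <= a + h) <= h"
 by (rule prob_interval_le[OF expG indep_var_fun]) (use assms in auto)

text \<open>An interval of length 0 in \<open>prob_interval\<close>; all ties are excluded in this
  way.\<close>

lemma AE_ne:
 assumes "z \<in> I" "F <= I" "z \<notin> F" "f \<in> borel_measurable (PiM F (%_. borel))"
 shows "AE om in M. G z om + f (restrict (%i. G i om) F) ~= 0"
proof -
 let ?X = "%om. G z om + f (restrict (%i. G i om) F)"
 have [measurable]: "?X \<in> borel_measurable M"
  using indep_var_rv1[OF indep_var_fun[OF assms]] indep_var_rv2[OF indep_var_fun[OF assms]] by simp
 have "\<P>(om in M. 0 <= ?X om & ?X om <= 0 + 0) <= 0"
  by (rule prob_interval[OF assms]) simp
 hence "\<P>(om in M. 0 <= ?X om & ?X om <= 0 + 0) = 0"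
  by (simp add: measure_le_0_iff)
 hence "AE om in M. om \<notin> {om \<in> space M. 0 <= ?X om & ?X om <= 0 + 0}"
  by (subst (asm) prob_eq_0) auto
 thus ?thesis by (rule AE_mp) (rule AE_I2, auto)
qed

lemma exp_mgf:
 assumes z: "z \<in> I" and t: "t < 1"
 shows "(\<integral>\<^sup>+om. ennreal (exp (t * G z om)) \<partial>M) = ennreal (1 / (1 - t))"
proof -
 have "(\<integral>\<^sup>+om. ennreal (exp (t * G z om)) \<partial>M) = (\<integral>\<^sup>+x. ennreal (exponential_density 1 x) * ennreal (exp (t * x)) \<partial>lborel)"
  by (rule distributed_nn_integral[OF expG[OF z], symmetric]) simp
 also have "... = (\<integral>\<^sup>+x. ennreal (1 / (1 - t)) * ennreal (exponential_density (1 - t) x) \<partial>lborel)"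
 proof (rule nn_integral_cong)
  fix x :: real
  have "exponential_density 1 x * exp (t * x) = 1 / (1 - t) * exponential_density (1 - t) x"
  proof -
   have "1 / (1 - t) * exponential_density (1 - t) x = (if x < 0 then 0 else exp (- x * (1 - t)))"
    using t by (simp add: exponential_density_def)
   thus ?thesis by (auto simp: exponential_density_def exp_add[symmetric] algebra_simps)
  qed
  thus "ennreal (exponential_density 1 x) * ennreal (exp (t * x))
    = ennreal (1 / (1 - t)) * ennreal (exponential_density (1 - t) x)"
   using t by (metis ennreal_mult'' exp_ge_zero exponential_density_nonneg diff_gt_0_iff_gt)
 qed
 also have "... = ennreal (1 / (1 - t)) * (\<integral>\<^sup>+x. ennreal (exponential_density (1 - t) x) \<partial>lborel)"
  by (rule nn_integral_cmult) simp
 also have "(\<integral>\<^sup>+x. ennreal (exponential_density (1 - t) x) \<partial>lborel) = 1"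
 proof -
  interpret P: prob_space "density lborel (exponential_density (1 - t))"
   by (rule prob_space_exponential_density) (use t in simp)
  show ?thesis using P.emeasure_space_1 by (simp add: emeasure_density)
 qed
 finally show ?thesis by simp
qed

text \<open>Negative \<open>t\<close> is included, so that this gives both tails:
  \<open>t = -1\<close> for small sums and \<open>t = 1 / 2\<close> for large ones.\<close>

lemma chernoff:
 assumes J: "finite J" "J <= I" and t: "t < 1"
 shows "\<P>(om in M. b <= t * (\<Sum>j\<in>J. G j om)) <= exp (- b) * (1 / (1 - t)) ^ card J"
proof -
 have [measurable]: "j \<in> J ==> G j \<in> borel_measurable M" for j using G_meas J by auto
 have "ennreal (exp b) * emeasure M {om \<in> space M. b <= t * (\<Sum>j\<in>J. G j om)}
   = (\<integral>\<^sup>+om. ennreal (exp b) * indicator {om \<in> space M. b <= t * (\<Sum>j\<in>J. G j om)} om \<partial>M)"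
  by (rule nn_integral_cmult_indicator[symmetric]) measurable
 also have "... <= (\<integral>\<^sup>+om. (\<Prod>j\<in>J. ennreal (exp (t * G j om))) \<partial>M)"
 proof (rule nn_integral_mono)
  fix om
  have "(\<Prod>j\<in>J. ennreal (exp (t * G j om))) = ennreal (exp (t * (\<Sum>j\<in>J. G j om)))"
   using J(1) by (simp add: prod_ennreal exp_sum sum_distrib_left)
  thus "ennreal (exp b) * indicator {om \<in> space M. b <= t * (\<Sum>j\<in>J. G j om)} om
    <= (\<Prod>j\<in>J. ennreal (exp (t * G j om)))"
   by (auto split: split_indicator intro!: ennreal_leI)
 qed
 also have "... = (\<Prod>j\<in>J. \<integral>\<^sup>+om. ennreal (exp (t * G j om)) \<partial>M)"
 proof (rule indep_vars_nn_integral[OF J(1)])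
  have "indep_vars (%_. borel) (%j om. ennreal (exp (t * G j om))) J"
   using indep_vars_compose2[OF indep_vars_subset[OF indepG J(2)], of "%_ x. ennreal (exp (t * x))" "%_. borel"] by simp
  thus "indep_vars (%_. borel) (%j om. ennreal (exp (t * G j om))) J" .
 qed simp
 also have "... = (\<Prod>j\<in>J. ennreal (1 / (1 - t)))"
  by (rule prod.cong) (use exp_mgf t J in auto)
 also have "... = ennreal ((1 / (1 - t)) ^ card J)" using t by (simp add: ennreal_power)
 finally have "exp b * \<P>(om in M. b <= t * (\<Sum>j\<in>J. G j om)) <= (1 / (1 - t)) ^ card J"
  using t by (simp add: emeasure_eq_measure ennreal_mult''[symmetric])
 hence "exp (- b) * (exp b * \<P>(om in M. b <= t * (\<Sum>j\<in>J. G j om))) <= exp (- b) * (1 / (1 - t)) ^ card J"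
  by (rule mult_left_mono) simp
 thus ?thesis by (simp only: mult.assoc[symmetric] exp_add[symmetric]) simp
qed

lemma chernoff_lower:
 assumes J: "finite J" "J <= I"
 shows "\<P>(om in M. (\<Sum>j\<in>J. G j om) < card J / 4) <= exp (- 2 / 5 * card J)"
proof -
 have [measurable]: "j \<in> J ==> G j \<in> borel_measurable M" for j using G_meas J by auto
 have "\<P>(om in M. (\<Sum>j\<in>J. G j om) < card J / 4)
   <= \<P>(om in M. - (card J / 4) <= - 1 * (\<Sum>j\<in>J. G j om))"
  by (rule finite_measure_mono) auto
 also have le: "... <= exp (card J / 4) * (1 / 2) ^ card J"
  using chernoff[OF J, of "-1" "- (card J / 4)"] by simp
 \<comment> \<open>\<open>13 / 20\<close> is below \<open>ln 2\<close> and exceeds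
   \<open>1 / 4\<close> by the desired rate \<open>2 / 5\<close>.\<close>
 also have "... <= exp (card J / 4) * exp (- 13 / 20) ^ card J"
 proof (intro mult_left_mono power_mono)
  have "exp (13 / 20 :: real) <= 2"
  proof -
   have "exp (13 / 20 :: real) <= 1 + 13 / 20 + (13 / 20)\<^sup>2"
    by (rule exp_bound) auto
   hence "exp (13/20::real) <= 1 + 13 / 20 + (13 / 20)\<^sup>2" .
   have "ln 2 \<ge> (13 / 20 :: real)" using ln2_ge_two_thirds by simp
   thus ?thesis by (metis exp_le_cancel_iff exp_ln zero_less_numeral)
  qed
  thus "1 / 2 <= exp (- 13 / 20 :: real)" by (simp add: exp_minus field_simps)
 qed simp_all
 also have "exp (- 13 / 20 :: real) ^ card J = exp (card J * (- 13 / 20))"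
  by (simp only: exp_of_nat_mult)
 also have "exp (card J / 4) * ... = exp (- 2 / 5 * card J)"
  by (simp add: exp_add[symmetric])
 finally show ?thesis by simp
qed

lemma chernoff_upper:
 assumes J: "finite J" "J <= I"
 shows "\<P>(om in M. 4 * real (card J) < (\<Sum>j\<in>J. G j om)) <= exp (- 2 / 5 * card J)"
proof -
 have [measurable]: "j \<in> J ==> G j \<in> borel_measurable M" for j using G_meas J by auto
 have "\<P>(om in M. 4 * real (card J) < (\<Sum>j\<in>J. G j om))
   <= \<P>(om in M. real (2 * card J) <= 1 / 2 * (\<Sum>j\<in>J. G j om))"
  by (rule finite_measure_mono) auto
 also have "... <= exp (- real (2 * card J)) * 2 ^ card J"
  using chernoff[OF J, of "1 / 2" "real (2 * card J)"] by simp
 also have "... <= exp (- real (2 * card J)) * exp 1 ^ card J"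
  by (intro mult_left_mono power_mono) (use exp_ge_add_one_self[of "1::real"] in auto)
 also have "... = exp (- real (2 * card J)) * exp (card J)"
  by (simp add: exp_of_nat_mult[symmetric])
 also have "... = exp (- real (card J))"
  by (simp add: exp_add[symmetric])
 also have "... <= exp (- 2 / 5 * card J)" by simp
 finally show ?thesis by simp
qed

end

section \<open>Independence of all gaps\<close>

text \<open>The model has independence between the sequences and among the gaps of each. A finite
  set of pairs is split into its fibres over the sequences, and the two product formulas are
  combined.\<close>

lemma (in prob_space) indep_vars_gaps:
 fixes I :: "'b set"
 assumes X: "indep_vars (%_. PiM UNIV (%_. borel)) X I"
  and g: "!!j. j \<in> I ==> indep_vars (%_. borel) (%k om. gap (X j om) k) UNIV"
 shows "indep_vars (%_. borel) (%z om. gap (X (fst z) om) (snd z)) (I \<times> (UNIV :: nat set))"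
proof -
 have gm [measurable]: "(%x. gap x k) \<in> borel_measurable (PiM UNIV (%_. borel))" for k
  by (cases k) (auto simp: gap_def)
 have rv: "j \<in> I ==> (%om. gap (X j om) k) \<in> borel_measurable M" for j k
  using g by (auto simp: indep_vars_def)
 show ?thesis unfolding indep_vars_def2
 proof (intro conjI ballI indep_setsI)
  fix z :: "'b \<times> nat" assume "z \<in> I \<times> UNIV"
  thus "random_variable borel (%om. gap (X (fst z) om) (snd z))" using rv by auto
  thus "{(%om. gap (X (fst z) om) (snd z)) -` A \<inter> space M |A. A \<in> sets borel} <= events"
   by (auto intro: measurable_sets)
 next
  fix A and J :: "('b \<times> nat) set"
  assume J: "J ~= {}" "J <= I \<times> UNIV" "finite J"
   and A: "\<forall>z\<in>J. A z \<in> {(%om. gap (X (fst z) om) (snd z)) -` A \<inter> space M |A. A \<in> sets borel}"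
  then obtain B where B: "!!z. z \<in> J ==> B z \<in> sets borel & A z = (%om. gap (X (fst z) om) (snd z)) -` B z \<inter> space M"
   by (simp, metis)
  define P where "P = fst ` J"
  define Q where "Q j = {k. (j, k) \<in> J}" for j
  have JPQ: "J = Sigma P Q" by (force simp: P_def Q_def)
  have P: "finite P" "P ~= {}" "P <= I" using J by (auto simp: P_def)
  have Q: "finite (Q j)" for j
   using finite_imageI[OF J(3), of snd] by (rule rev_finite_subset) (force simp: Q_def)
  have Qne: "j \<in> P ==> Q j ~= {}" for j by (force simp: P_def Q_def)
  define E where "E j = {x \<in> space (PiM UNIV (%_. borel)). \<forall>k\<in>Q j. gap x k \<in> B (j, k)}" for j
  have E: "j \<in> P ==> E j \<in> sets (PiM UNIV (%_. borel))" for j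
  proof -
   assume j: "j \<in> P"
   have "{x \<in> space (PiM UNIV (%_. borel)). gap x k \<in> B (j, k)} \<in> sets (PiM UNIV (%_. borel))" if "k \<in> Q j" for k
   proof -
    have "B (j, k) \<in> sets borel" using B that j by (auto simp: JPQ)
    from measurable_sets[OF gm[of k] this] show ?thesis by (simp add: vimage_def Int_def conj_commute)
   qed
   thus ?thesis unfolding E_def using Q[of j] by (intro sets.sets_Collect_finite_All) auto
  qed
  have "(\<Inter>z\<in>J. A z) = (\<Inter>j\<in>P. X j -` E j \<inter> space M)"
   using J(1) B P(2) Qne by (auto simp: JPQ E_def space_PiM)
  hence "prob (\<Inter>z\<in>J. A z) = (\<Prod>j\<in>P. prob (X j -` E j \<inter> space M))"
   using indep_varsD[OF X P(2,1,3), of E] E by simp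
  also have "... = (\<Prod>j\<in>P. \<Prod>k\<in>Q j. prob (A (j, k)))"
  proof (rule prod.cong)
   fix j assume j: "j \<in> P"
   have "X j -` E j \<inter> space M = (\<Inter>k\<in>Q j. (%om. gap (X j om) k) -` B (j, k) \<inter> space M)"
    using Qne[OF j] by (auto simp: E_def space_PiM)
   moreover have jI: "j \<in> I" using j P by auto
   have "B (j, k) \<in> sets borel" if "k \<in> Q j" for k using B that j by (auto simp: JPQ)
   note indep_varsD[OF g[OF jI] Qne[OF j] Q[of j] subset_UNIV this]
   ultimately have "prob (X j -` E j \<inter> space M) = (\<Prod>k\<in>Q j. prob ((%om. gap (X j om) k) -` B (j, k) \<inter> space M))"
    by simp
   also have "... = (\<Prod>k\<in>Q j. prob (A (j, k)))"
    by (rule prod.cong) (use B j in "auto simp: JPQ")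
   finally show "prob (X j -` E j \<inter> space M) = (\<Prod>k\<in>Q j. prob (A (j, k)))" .
  qed simp
  also have "... = (\<Prod>z\<in>J. prob (A z))"
   unfolding JPQ using P Q by (subst prod.Sigma) auto
  finally show "prob (\<Inter>z\<in>J. A z) = (\<Prod>z\<in>J. prob (A z))" .
 qed
qed

lemma sum_gap: "(\<Sum>l\<le>k. gap t l) = t k"
 by (induction k) (auto simp: gap_def)

lemma diff_eq_sum_gap: "t (k + R) - t k = (\<Sum>l\<in>{Suc k..k + R}. gap t l)"
 by (induction R) (auto simp: gap_def)

context exp_family
begin

text \<open>A union bound over all blocks. Half of the exponent \<open>2 / 5 * R\<close> is spent
  through \<open>q + k / B <= R\<close> on the factor \<open>exp (- q / 5)\<close> and on a
  geometric series in \<open>k\<close> with sum of order \<open>B\<close>; the other half makes the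
  sum over \<open>R\<close> converge. The growth of the required length with \<open>k\<close> is
  thus what allows infinitely many blocks at once.\<close>

lemma prob_not_reg:
 assumes t: "!!om l. gap (t om) l = G (f l) om" and f: "inj f" "range f <= I" and B: "1 <= B"
 shows "\<exists>A. A \<in> sets M & {om \<in> space M. ~ reg q B (t om)} <= A & prob A <= 73 * B * exp (- (q / 5))"
proof -
 have fI: "f l \<in> I" for l using f(2) by auto
 have Gf: "G (f l) \<in> borel_measurable M" for l by (rule G_meas[OF fI])
 define A0 where "A0 = {om \<in> space M. q < G (f 0) om}"
 define S where "S k R om = (\<Sum>j\<in>f ` {Suc k..k + R}. G j om)" for k R :: nat and om
 define A1 where "A1 k R = (if q + k / B <= real R then
   {om \<in> space M. S k R om < R / 4} \<union> {om \<in> space M. 4 * real R < S k R om} else {})" for k R :: nat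
 have S: "S k R om = t om (k + R) - t om k" for k R om
  unfolding S_def diff_eq_sum_gap using f(1) t
  by (subst sum.reindex) (auto simp: inj_on_def)
 have Sm [measurable]: "S k R \<in> borel_measurable M" for k R
  unfolding S_def by (rule borel_measurable_sum) (use Gf in auto)
 have A0: "A0 \<in> sets M" using Gf[of 0] by (simp add: A0_def)
 have A1: "A1 k R \<in> sets M" for k R by (simp add: A1_def)
 have p0: "prob A0 <= exp (- real q)" unfolding A0_def using prob_gt[OF fI, of q 0] by simp
 define c where "c = 2 * exp (- (q / 5))"
 define u where "u = exp (- 1 / 5 :: real)"
 define v where "v = exp (- 1 / (5 * B))"
 have v1: "0 < v" "v < 1" "0 < u" "u < 1" using B by (auto simp: v_def u_def)
 have p1: "emeasure M (A1 k R) <= ennreal (c * v ^ k * u ^ R)" for k R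
 proof (cases "q + k / B <= real R")
  case True
  have fin: "finite (f ` {Suc k..k + R})" "f ` {Suc k..k + R} <= I" "card (f ` {Suc k..k + R}) = R"
   using f by (auto simp: card_image inj_on_def)
  have e5: "exp (- (R / 5)) <= exp (- ((q + k / B) / 5))"
   unfolding exp_le_cancel_iff neg_le_iff_le by (rule divide_right_mono) (use True in auto)
  have "prob (A1 k R) <= \<P>(om in M. S k R om < R / 4) + \<P>(om in M. 4 * real R < S k R om)"
   using True by (auto simp: A1_def intro!: measure_Un_le)
  also have "... <= exp (- 2 / 5 * R) + exp (- 2 / 5 * R)"
   using chernoff_lower[OF fin(1,2)] chernoff_upper[OF fin(1,2)] unfolding S_def fin(3)
   by (intro add_mono)
  also have "... = 2 * (exp (- (R / 5)) * exp (- (R / 5)))" by (simp add: exp_add[symmetric])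
  also have "... <= 2 * (exp (- ((q + k / B) / 5)) * exp (- (R / 5)))"
   using e5 by (intro mult_left_mono mult_right_mono) auto
  also have "exp (- ((q + k / B) / 5)) = exp (- (q / 5)) * v ^ k"
   by (simp add: v_def exp_of_nat_mult[symmetric] exp_add[symmetric] add_divide_distrib algebra_simps)
  also have "exp (- (R / 5)) = u ^ R" by (simp add: u_def exp_of_nat_mult[symmetric])
  finally show ?thesis by (simp add: emeasure_eq_measure c_def mult_ac ennreal_leI)
 qed (simp add: A1_def)
 have geom: "(\<Sum>n. ennreal (a * w ^ n)) = ennreal (a / (1 - w))" if "0 <= a" "0 < w" "w < 1" for a w :: real
 proof -
  have "(%n. a * w ^ n) sums (a * (1 / (1 - w)))" using that by (intro sums_mult geometric_sums) auto
  thus ?thesis using that by (intro suminf_ennreal_eq) auto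
 qed
 have c0: "0 <= c" by (simp add: c_def)
 have "emeasure M (\<Union>k. \<Union>R. A1 k R) <= (\<Sum>k. emeasure M (\<Union>R. A1 k R))"
  by (rule emeasure_subadditive_countably) (use A1 in auto)
 also have "... <= (\<Sum>k. \<Sum>R. emeasure M (A1 k R))"
  by (intro suminf_le emeasure_subadditive_countably) (use A1 in auto)
 also have "... <= (\<Sum>k. \<Sum>R. ennreal (c * v ^ k * u ^ R))"
  by (intro suminf_le p1) auto
 also have "... = (\<Sum>k. ennreal (c / (1 - u) * v ^ k))"
  using c0 v1 by (subst geom) (auto simp: mult_ac)
 also have "... = ennreal (c / (1 - u) / (1 - v))"
  using c0 v1 by (intro geom) auto
 finally have "prob (\<Union>k. \<Union>R. A1 k R) <= c / (1 - u) / (1 - v)"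
  using c0 v1 by (simp add: emeasure_eq_measure)
 also have "... <= c * 6 * (6 * B)"
 proof -
  have ineq: "1 / (1 - exp (- x)) <= 1 + 1 / x" if "0 < x" for x :: real
  proof -
   have "exp (- x) <= 1 / (1 + x)" using exp_ge_add_one_self[of x] that by (simp add: exp_minus field_simps)
   hence "x / (1 + x) <= 1 - exp (- x)" using that by (simp add: field_simps)
   hence "1 / (1 - exp (- x)) <= 1 / (x / (1 + x))" using that by (intro divide_left_mono) auto
   also have "... = 1 + 1 / x" using that by (simp add: field_simps)
   finally show ?thesis .
  qed
  have u6: "1 / (1 - u) <= 6" using ineq[of "1/5"] by (simp add: u_def)
  have v6: "1 / (1 - v) <= 6 * B" using ineq[of "1/(5*B)"] B by (simp add: v_def)
  have "c / (1 - u) / (1 - v) = c * (1 / (1 - u)) * (1 / (1 - v))" by simp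
  also have "... <= c * 6 * (6 * B)"
   using u6 v6 c0 v1 by (intro mult_mono mult_nonneg_nonneg) auto
  finally show ?thesis .
 qed
 finally have p2: "prob (\<Union>k. \<Union>R. A1 k R) <= 72 * B * exp (- (q / 5))" by (simp add: c_def mult_ac)
 have "prob (A0 \<union> (\<Union>k. \<Union>R. A1 k R)) <= prob A0 + prob (\<Union>k. \<Union>R. A1 k R)"
  using A0 A1 by (intro measure_Un_le) auto
 also have "... <= exp (- (q / 5)) + 72 * B * exp (- (q / 5))"
  using p0 p2 by (intro add_mono) (auto intro: order_trans)
 also have "... <= 73 * B * exp (- (q / 5))" using B by (simp add: distrib_right[symmetric])
 finally have "prob (A0 \<union> (\<Union>k. \<Union>R. A1 k R)) <= 73 * B * exp (- (q / 5))" .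
 moreover have "{om \<in> space M. ~ reg q B (t om)} <= A0 \<union> (\<Union>k. \<Union>R. A1 k R)"
 proof
  fix om assume om: "om \<in> {om \<in> space M. ~ reg q B (t om)}"
  have t0: "t om 0 = G (f 0) om" using t[of om 0] by (simp add: gap_def)
  show "om \<in> A0 \<union> (\<Union>k. \<Union>R. A1 k R)"
  proof (cases "t om 0 <= q")
   case True
   then obtain k R :: nat where kR: "q + k / B <= real R" "~ (R / 4 <= S k R om & S k R om <= 4 * real R)"
    using om unfolding S reg_def by auto
   hence "om \<in> A1 k R" using om by (auto simp: A1_def)
   thus ?thesis by blast
  qed (use om t0 in "auto simp: A0_def")
 qed
 moreover have "A0 \<union> (\<Union>k. \<Union>R. A1 k R) \<in> sets M" using A0 A1 by auto
 ultimately show ?thesis by blast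
qed

end

section \<open>Measurability\<close>

text \<open>The order of the rings, computed without infima.\<close>

definition next_ring :: "nat => (nat => nat => real) => (nat => nat) => nat" where
 "next_ring W c r = (LEAST w. w \<in> {1..W} & (\<forall>v\<in>{1..W}. c w (r w) <= c v (r v)))"

primrec ring_counts :: "nat => (nat => nat => real) => nat => nat => nat" where
 "ring_counts W c 0 = (%_. 0)"
| "ring_counts W c (Suc n) =
   (let r = ring_counts W c n; w = next_ring W c r in r(w := Suc (r w)))"

definition ring_order :: "nat => (nat => nat => real) => nat => nat" where
 "ring_order W c n = next_ring W c (ring_counts W c n)"

lemma (in star_real) ring_counts_eq: "w \<in> {1..W} ==> ring_counts W c n w = cnt 0 n w"
 and ring_order_eq: "ring_order W c n = jumper W c n"
proof -
 have step: "next_ring W c r = jumper W c n" if r: "!!w. w \<in> {1..W} ==> r w = cnt 0 n w" for r n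
 proof -
  let ?j = "jumper W c n"
  have j: "?j \<in> {1..W}" using jumper_props by blast
  have le: "c ?j (r ?j) <= c v (r v)" "c v (r v) <= c ?j (r ?j) ==> v = ?j" if v: "v \<in> {1..W}" for v
  proof -
   have eq: "c ?j (r ?j) = jump_time W c n" using jump_time_ring[of n ?j] r[OF j] by simp
   have "~ c v (r v) < jump_time W c n" using ring_count[OF v, of "r v" n] r[OF v] by simp
   thus "c ?j (r ?j) <= c v (r v)" using eq by simp
   thus "c v (r v) <= c ?j (r ?j) ==> v = ?j" using c_eq_iff[OF v j] by simp
  qed
  show ?thesis unfolding next_ring_def
  proof (rule Least_equality)
   show "?j \<in> {1..W} & (\<forall>v\<in>{1..W}. c ?j (r ?j) <= c v (r v))" using j le by blast
   fix y assume "y \<in> {1..W} & (\<forall>v\<in>{1..W}. c y (r y) <= c v (r v))"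
   hence "y = ?j" using le(2) j by blast
   thus "?j <= y" by simp
  qed
 qed
 have main: "\<forall>w\<in>{1..W}. ring_counts W c n w = cnt 0 n w" for n
 proof (induction n)
  case (Suc n)
  hence "next_ring W c (ring_counts W c n) = jumper W c n" by (intro step) auto
  thus ?case using Suc by (simp add: Let_def cnt_Suc)
 qed simp
 thus "w \<in> {1..W} ==> ring_counts W c n w = cnt 0 n w" by blast
 show "ring_order W c n = jumper W c n" unfolding ring_order_def using main by (intro step) blast
qed

lemma (in star_real) jump_time_eq:
 "jump_time W c n = c (ring_order W c n) (ring_counts W c n (ring_order W c n))"
 using jump_time_ring[of n "jumper W c n"] jumper_props[of n] by (simp add: ring_order_eq ring_counts_eq)

lemma measurable_argmin [measurable (raw)]:
 fixes f :: "nat => 'a => real"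
 assumes f: "!!i. i \<in> {1..N} ==> f i \<in> borel_measurable M"
 shows "(%x. LEAST i. i \<in> {1..N} & (\<forall>j\<in>{1..N}. f i x <= f j x)) \<in> meas M"
proof (rule measurable_Least)
 fix i
 show "(%x. i \<in> {1..N} & (\<forall>j\<in>{1..N}. f i x <= f j x)) \<in> meas M"
 proof (cases "i \<in> {1..N}")
  case True
  note [measurable] = f[OF True]
  have "(%x. \<forall>j\<in>{1..N}. f i x <= f j x) \<in> meas M"
  proof (rule pred_intros_finite)
   fix j assume "j \<in> {1..N}"
   note [measurable] = f[OF this]
   show "Measurable.pred M (%x. f i x <= f j x)" by measurable
  qed simp
  moreover have "(%x. i \<in> {1..N} & (\<forall>j\<in>{1..N}. f i x <= f j x)) = (%x. \<forall>j\<in>{1..N}. f i x <= f j x)"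
   using True by blast
  ultimately show ?thesis by simp
 next
  case False
  hence "(%x. i \<in> {1..N} & (\<forall>j\<in>{1..N}. f i x <= f j x)) = (%_. False)" by blast
  thus ?thesis by simp
 qed
qed

lemma measurable_ring_counts:
 assumes c: "!!w r. w \<in> {1..W} ==> (%om. c om w r) \<in> borel_measurable M"
 shows "(%om. ring_counts W (c om) n w) \<in> meas M"
  and "(%om. ring_order W (c om) n) \<in> meas M"
proof -
 have order: "(%om. next_ring W (c om) (r om)) \<in> meas M"
  if r: "!!w. (%om. r om w) \<in> meas M" for r :: "'a => nat => nat"
  unfolding next_ring_def
 proof (rule measurable_argmin)
  fix w assume "w \<in> {1..W}"
  thus "(%om. c om w (r om w)) \<in> borel_measurable M"
   by (intro measurable_compose_countable[where f = "%k om. c om w k" and g = "%om. r om w"] c r)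
 qed
 have counts: "\<forall>w. (%om. ring_counts W (c om) n w) \<in> meas M" for n
 proof (induction n)
  case (Suc n)
  note [measurable] = Suc[rule_format] order[OF Suc[rule_format]]
  show ?case by (auto simp: Let_def fun_upd_def)
 qed simp
 show "(%om. ring_counts W (c om) n w) \<in> meas M" using counts by blast
 show "(%om. ring_order W (c om) n) \<in> meas M"
  unfolding ring_order_def by (rule order) (use counts in blast)
qed

context
 fixes M :: "'a measure" and N :: nat and d :: "'a => nat => nat => real"
 assumes dm: "!!i k. i \<in> {1..N} ==> (%om. d om i k) \<in> borel_measurable M"
begin

lemma measurable_place:
 assumes l: "l \<in> meas M" and x: "x \<in> meas M"
 shows "(%om. place N (d om) (l om) (x om)) \<in> borel_measurable M"
proof (rule measurable_compose_countable[OF _ l])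
 fix i
 show "(%om. place N (d om) i (x om)) \<in> borel_measurable M"
 proof (rule measurable_compose_countable[OF _ x])
  fix k
  show "(%om. place N (d om) i k) \<in> borel_measurable M"
   using dm[of i k] by (cases "i \<in> {1..N}") (simp_all only: place_def if_True if_False borel_measurable_const)
 qed
qed

lemma measurable_target:
 assumes s: "!!v. (%om. fst (s om) v) \<in> meas M"
  "!!v. (%om. fst (snd (s om)) v) \<in> meas M"
  "!!v. (%om. snd (snd (s om)) v) \<in> meas M"
  and w: "w \<in> meas M"
 shows "(%om. target N (d om) (s om) (w om)) \<in> meas M"
 unfolding target_def
proof (rule measurable_argmin)
 fix i assume i: "i \<in> {1..N}"
 have l: "(%om. fst (s om) (w om)) \<in> meas M"
  and x: "(%om. fst (snd (s om)) (w om)) \<in> meas M"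
  by (rule measurable_compose_countable[OF _ w], rule s)+
 note [measurable] = l measurable_place[OF l x]
 have [measurable]: "(%om. d om i (snd (snd (s om)) i)) \<in> borel_measurable M"
  by (rule measurable_compose_countable[OF dm[OF i] s(3)])
 have "(%om. front_dist N (d om) (s om) (w om) i) = (%om. if fst (s om) (w om) = i
   then d om i (snd (snd (s om)) i) - place N (d om) (fst (s om) (w om)) (fst (snd (s om)) (w om))
   else place N (d om) (fst (s om) (w om)) (fst (snd (s om)) (w om)) + d om i (snd (snd (s om)) i))"
  by (auto simp: front_dist_def fun_eq_iff split: prod.split)
 thus "(%om. front_dist N (d om) (s om) (w om) i) \<in> borel_measurable M" by simp
qed

lemma measurable_st:
 assumes Jm: "!!n. (%om. J om n) \<in> meas M"
 shows "(%om. fst (st N (d om) (J om) n) v) \<in> meas M"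
 "(%om. fst (snd (st N (d om) (J om) n)) v) \<in> meas M"
 "(%om. snd (snd (st N (d om) (J om) n)) v) \<in> meas M"
proof -
 have "\<forall>v. (%om. fst (st N (d om) (J om) n) v) \<in> meas M &
  (%om. fst (snd (st N (d om) (J om) n)) v) \<in> meas M &
  (%om. snd (snd (st N (d om) (J om) n)) v) \<in> meas M" for n
 proof (induction n)
  case (Suc n)
  define s where "s om = st N (d om) (J om) n" for om
  have s: "(%om. fst (s om) v) \<in> meas M"
   "(%om. fst (snd (s om)) v) \<in> meas M"
   "(%om. snd (snd (s om)) v) \<in> meas M" for v
   using Suc unfolding s_def by auto
  define T where "T om = target N (d om) (s om) (J om n)" for om
  have T: "T \<in> meas M"
   using measurable_target[OF s Jm] unfolding T_def by simp
  have kT: "(%om. snd (snd (s om)) (T om)) \<in> meas M"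
   by (rule measurable_compose_countable[OF _ T]) (rule s)
  note [measurable] = s T kT Jm
  have eq: "fst (st N (d om) (J om) (Suc n)) v = (if v = J om n then T om else fst (s om) v)"
   "fst (snd (st N (d om) (J om) (Suc n))) v = (if v = J om n then snd (snd (s om)) (T om) else fst (snd (s om)) v)"
   "snd (snd (st N (d om) (J om) (Suc n))) v = (if v = T om then Suc (snd (snd (s om)) (T om)) else snd (snd (s om)) v)"
   for om v
   by (auto simp: s_def T_def Let_def split: prod.split)
  show ?case unfolding eq by (intro allI conjI) measurable
 qed simp
 thus "(%om. fst (st N (d om) (J om) n) v) \<in> meas M"
  "(%om. fst (snd (st N (d om) (J om) n)) v) \<in> meas M"
  "(%om. snd (snd (st N (d om) (J om) n)) v) \<in> meas M" by blast+
qed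

end

definition tgt :: "nat => (nat => nat => real) => (nat => nat) => nat => nat" where
 "tgt N d J n = target N d (st N d J n) (J n)"

definition tgt_index :: "nat => (nat => nat => real) => (nat => nat) => nat => nat" where
 "tgt_index N d J n = snd (snd (st N d J n)) (tgt N d J n)"

definition skips :: "nat => (nat => nat => real) => (nat => nat) => nat => bool" where
 "skips N d J n <-> fst (st N d J n) (J n) ~= 0 & fst (st N d J n) (J n) ~= tgt N d J n"

section \<open>The random model\<close>

text \<open>Lets the events of the model, defined through \<open>arg_min\<close> and infima, inherit
  measurability and probability from explicit events that agree with them almost surely.\<close>

lemma pred_completion:
 assumes Q: "Measurable.pred M Q" and AE: "AE om in M. P om <-> Q om"
 shows "Measurable.pred (completion M) P"
  and "measure (completion M) {om \<in> space (completion M). P om} = measure M {om \<in> space M. Q om}"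
proof -
 have Qs: "{om \<in> space M. Q om} \<in> sets M" using Q by simp
 obtain Z where Z: "Z \<in> null_sets M" "{om \<in> space M. ~ (P om <-> Q om)} <= Z"
  using AE by (auto elim!: AE_E simp: null_sets_def)
 let ?P = "{om \<in> space M. P om}"
 have A: "?P - {om \<in> space M. Q om} \<in> null_sets (completion M)"
  by (rule null_sets_completion_subset[OF _ null_sets_completionI[OF Z(1)]]) (use Z(2) in auto)
 have B: "{om \<in> space M. Q om} - ?P \<in> null_sets (completion M)"
  by (rule null_sets_completion_subset[OF _ null_sets_completionI[OF Z(1)]]) (use Z(2) in auto)
 have Qc: "{om \<in> space M. Q om} \<in> sets (completion M)" using Qs by (rule sets_completionI_sets)
 have eq: "?P = ({om \<in> space M. Q om} - ({om \<in> space M. Q om} - ?P)) \<union> (?P - {om \<in> space M. Q om})" by auto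
 have Pc: "?P \<in> sets (completion M)"
  by (subst eq) (intro sets.Un sets.Diff null_setsD2[OF A] null_setsD2[OF B] Qc)
 thus "Measurable.pred (completion M) P" by (simp add: pred_def)
 have "emeasure (completion M) ?P = emeasure (completion M) {om \<in> space M. Q om}"
 proof (rule emeasure_eq_AE)
  show "AE om in completion M. om \<in> ?P <-> om \<in> {om \<in> space M. Q om}"
   using AE_completion[OF AE] by (rule AE_mp) (rule AE_I2, simp)
 qed (use Pc Qc in auto)
 also have "... = emeasure M {om \<in> space M. Q om}" using Qs by simp
 finally show "measure (completion M) {om \<in> space (completion M). P om} = measure M {om \<in> space M. Q om}"
  by (simp add: measure_def)
qed

context star_cleaning
begin

definition GG :: "(nat + nat) \<times> nat => 'a => real" where
 "GG z om = gap (case fst z of Inl i => D om i | Inr w => C om w) (snd z)"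

definition II :: "((nat + nat) \<times> nat) set" where
 "II = ({1..N} <+> {1..W}) \<times> UNIV"

abbreviation "GW om == %z. GG z om"

lemma GG_Inl: "GG (Inl i, k) om = gap (D om i) k" and GG_Inr: "GG (Inr w, k) om = gap (C om w) k"
 by (simp_all add: GG_def)

lemma II_Inl [simp]: "(Inl i, k) \<in> II <-> i \<in> {1..N}" and II_Inr [simp]: "(Inr w, k) \<in> II <-> w \<in> {1..W}"
 by (auto simp: II_def)

sublocale exp_family M GG II
proof
 have *: "(case_sum (D om) (C om) j) = (case j of Inl i => D om i | Inr w => C om w)" for om j by simp
 show "indep_vars (%_. borel) GG II" unfolding II_def GG_def[abs_def]
 proof (rule indep_vars_gaps[OF indep])
  fix j assume "j \<in> {1..N} <+> {1..W}"
  thus "indep_vars (%_. borel) (%k om. gap (case j of Inl i => D om i | Inr w => C om w) k) UNIV"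
   using dust_poisson clock_poisson by (auto simp: poisson_process_def split: sum.split)
 qed
 show "distributed M lborel (GG z) (exponential_density 1)" if "z \<in> II" for z
  using that dust_poisson clock_poisson
  by (cases "fst z") (auto simp: II_def GG_def[abs_def] poisson_process_def)
qed

lemma D_sum: "D om i k = (\<Sum>l\<le>k. GG (Inl i, l) om)" and C_sum: "C om w k = (\<Sum>l\<le>k. GG (Inr w, l) om)"
 by (simp_all add: GG_def sum_gap)

lemma D_meas [measurable (raw)]: "i \<in> {1..N} ==> (%om. D om i k) \<in> borel_measurable M"
 using borel_measurable_sum[of "{..k}" "%l om. GG (Inl i, l) om" M] G_meas by (simp add: D_sum[symmetric])

lemma C_meas [measurable (raw)]: "w \<in> {1..W} ==> (%om. C om w k) \<in> borel_measurable M"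
 using borel_measurable_sum[of "{..k}" "%l om. GG (Inr w, l) om" M] G_meas by (simp add: C_sum[symmetric])

definition "Jm om = ring_order W (C om)"

lemma Jm_meas [measurable]: "(%om. Jm om n) \<in> meas M"
 unfolding Jm_def by (rule measurable_ring_counts) (rule C_meas)

lemma ring_time_meas:
 "(%om. if ring_order W (C om) n \<in> {1..W} then C om (ring_order W (C om) n) (ring_counts W (C om) n (ring_order W (C om) n)) else 0)
  \<in> borel_measurable M"
proof (rule measurable_compose_countable[OF _ Jm_meas[of n, unfolded Jm_def]])
 fix w
 show "(%om. if w \<in> {1..W} then C om w (ring_counts W (C om) n w) else 0) \<in> borel_measurable M"
 proof (cases "w \<in> {1..W}")
  case True
  have "(%om. ring_counts W (C om) n w) \<in> meas M"
   by (rule measurable_ring_counts) (rule C_meas)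
  from measurable_compose_countable[OF C_meas[OF True] this] show ?thesis using True by simp
 next
  case False
  thus ?thesis by (simp only: if_False borel_measurable_const)
 qed
qed

lemma st_meas:
 "(%om. fst (st N (D om) (Jm om) n) v) \<in> meas M"
 "(%om. fst (snd (st N (D om) (Jm om) n)) v) \<in> meas M"
 "(%om. snd (snd (st N (D om) (Jm om) n)) v) \<in> meas M"
 by (rule measurable_st[OF D_meas Jm_meas]; simp)+

lemma tgt_meas: "(%om. tgt N (D om) (Jm om) n) \<in> meas M"
 unfolding tgt_def by (rule measurable_target[OF D_meas st_meas Jm_meas]) simp

lemma tgt_index_meas: "(%om. tgt_index N (D om) (Jm om) n) \<in> meas M"
 unfolding tgt_index_def by (rule measurable_compose_countable[OF _ tgt_meas]) (rule st_meas)

lemma skips_meas: "Measurable.pred M (%om. skips N (D om) (Jm om) n)"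
proof -
 have gen: "Measurable.pred M (%om. f om ~= 0 & f om ~= g om)"
  if fg: "f \<in> meas M" "g \<in> meas M"
  for f g :: "'a => nat"
 proof (rule measurable_compose_countable[OF _ fg(1)])
  fix i
  show "(%om. i ~= 0 & i ~= g om) \<in> meas M"
   by (rule measurable_compose[OF fg(2)]) simp
 qed
 show ?thesis unfolding skips_def
  by (rule gen[OF measurable_compose_countable[OF st_meas(1) Jm_meas] tgt_meas])
qed

lemma Z_meas: "(%om. place N (D om) (tgt N (D om) (Jm om) n) (tgt_index N (D om) (Jm om) n)) \<in> borel_measurable M"
 by (rule measurable_place[OF D_meas tgt_meas tgt_index_meas]) simp

text \<open>The first gap of sequence \<open>j\<close> is isolated, since it does not occur in the
  other terms. \<open>b = 0\<close> excludes coinciding particles and rings, \<open>b = 2\<close>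
  the ties of \<open>tie2\<close>.\<close>

lemma AE_tie:
 assumes i: "i \<in> I1" "j \<in> I1" "i ~= j" and I1: "I1 = {1..N} <+> {1..W}" and b: "b \<in> {0, 2 :: real}"
 shows "AE om in M. (\<Sum>l\<le>k. GG (i, l) om) - b * (\<Sum>l\<le>x. GG (i, l) om) ~= (\<Sum>l\<le>k'. GG (j, l) om)"
proof -
 define F where "F = ({i} \<times> {..k + x}) \<union> ({j} \<times> {1..k'})"
 define f where "f g = (\<Sum>l\<in>{1..k'}. g (j, l)) - ((\<Sum>l\<le>k. g (i, l)) - b * (\<Sum>l\<le>x. g (i, l)))"
  for g :: "(nat + nat) \<times> nat => real"
 have "f \<in> borel_measurable (PiM F (%_. borel))"
  unfolding f_def F_def by (intro borel_measurable_diff borel_measurable_sum borel_measurable_times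
    borel_measurable_const measurable_component_singleton) auto
 hence "AE om in M. GG (j, 0) om + f (restrict (%i. GG i om) F) ~= 0"
  by (intro AE_ne) (use i I1 in "auto simp: II_def F_def")
 thus ?thesis
 proof (rule AE_mp, intro AE_I2 impI)
  fix om assume ne: "GG (j, 0) om + f (restrict (%i. GG i om) F) ~= 0"
  have "f (restrict (%i. GG i om) F) = f (%i. GG i om)"
   unfolding f_def by (intro arg_cong2[where f = "(-)"] arg_cong2[where f = "(*)"] sum.cong refl) (auto simp: F_def)
  moreover have "(\<Sum>l\<le>k'. GG (j, l) om) = GG (j, 0) om + (\<Sum>l\<in>{1..k'}. GG (j, l) om)"
   by (simp add: atLeast0AtMost[symmetric] sum.atLeast_Suc_atMost del: atLeast0AtMost)
  ultimately show "(\<Sum>l\<le>k. GG (i, l) om) - b * (\<Sum>l\<le>x. GG (i, l) om) ~= (\<Sum>l\<le>k'. GG (j, l) om)"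
   using ne by (auto simp: f_def)
 qed
qed

text \<open>By the Chernoff bound at \<open>t = -1\<close>, that many rings occur up to a fixed time
  with geometrically small probability.\<close>

lemma AE_unbounded:
 assumes w: "w \<in> {1..W}" shows "AE om in M. \<forall>t. \<exists>r. t < C om w r"
proof -
 have "AE om in M. \<exists>r. real t < C om w r" for t :: nat
 proof -
  have le: "\<P>(om in M. \<forall>r. C om w r <= t) <= exp t * (1 / 2) ^ r" for r
  proof -
   have "\<P>(om in M. \<forall>r. C om w r <= t)
     <= \<P>(om in M. - real t <= - 1 * (\<Sum>j\<in>(%l. (Inr w, l)) ` {..r}. GG j om))"
   proof (rule finite_measure_mono)
    have "(\<Sum>j\<in>(%l. (Inr w, l)) ` {..r}. GG j om) = C om w r" for om
     by (subst sum.reindex) (auto simp: inj_on_def C_sum[symmetric])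
    thus "{om \<in> space M. \<forall>r. C om w r <= t} <= {om \<in> space M. - real t <= - 1 * (\<Sum>j\<in>(%l. (Inr w, l)) ` {..r}. GG j om)}"
     by auto
    have "(%om. \<Sum>j\<in>(%l. (Inr w, l)) ` {..r}. GG j om) \<in> borel_measurable M"
     by (rule borel_measurable_sum) (use w G_meas in auto)
    thus "{om \<in> space M. - real t <= - 1 * (\<Sum>j\<in>(%l. (Inr w, l)) ` {..r}. GG j om)} \<in> sets M"
     by measurable
   qed
   also have "... <= exp (- (- real t)) * (1 / (1 - (- 1))) ^ card ((%l. (Inr w :: nat + nat, l)) ` {..r})"
    by (rule chernoff) (use w in auto)
   also have "... <= exp t * (1 / 2) ^ r"
    by (simp add: card_image inj_on_def)
   finally show ?thesis .
  qed
  have "(%r. exp t * (1 / 2) ^ r) \<longlonglongrightarrow> exp t * (0 :: real)"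
   by (intro tendsto_mult tendsto_const LIMSEQ_power_zero) auto
  hence "\<P>(om in M. \<forall>r. C om w r <= t) <= exp t * 0"
   by (rule LIMSEQ_le_const) (use le in blast)
  hence "\<P>(om in M. \<forall>r. C om w r <= t) = 0" by (simp add: measure_le_0_iff)
  moreover have "{om \<in> space M. \<forall>r. C om w r <= t} \<in> sets M"
   using C_meas[OF w] by measurable
  ultimately have "AE om in M. om \<notin> {om \<in> space M. \<forall>r. C om w r <= t}"
   by (subst (asm) prob_eq_0) auto
  thus ?thesis by (rule AE_mp) (rule AE_I2, auto simp: not_le)
 qed
 hence "AE om in M. \<forall>t :: nat. \<exists>r. real t < C om w r" by (simp add: AE_all_countable)
 thus ?thesis
 proof (rule AE_mp, intro AE_I2 impI allI)
  fix om and t :: real assume all: "\<forall>t :: nat. \<exists>r. real t < C om w r"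
  obtain n :: nat where "t < real n" using reals_Archimedean2 by blast
  moreover obtain r where "real n < C om w r" using all by blast
  ultimately show "\<exists>r. t < C om w r" by (intro exI[of _ r]) simp
 qed
qed

lemma AE_star_real:
 assumes NW: "1 <= N" "1 <= W"
 shows "AE om in M. star_real N W (D om) (C om)"
proof -
 let ?I = "{1..N} <+> {1..W}"
 have cI: "countable ?I" by (rule countable_finite) auto
 have cII: "countable II" unfolding II_def using cI by auto
 have pos: "AE om in M. \<forall>z\<in>II. 0 < GG z om"
  using AE_pos by (subst AE_ball_countable[OF cII]) blast
 have ties: "AE om in M. \<forall>i\<in>?I. \<forall>j\<in>?I. \<forall>k x k'. i ~= j -->
   (\<Sum>l\<le>k. GG (i, l) om) - b * (\<Sum>l\<le>x. GG (i, l) om) ~= (\<Sum>l\<le>k'. GG (j, l) om)" if b: "b \<in> {0, 2 :: real}" for b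
  unfolding AE_ball_countable[OF cI] AE_all_countable
 proof (intro ballI allI)
  fix i j k x k' assume ij: "i \<in> ?I" "j \<in> ?I"
  show "AE om in M. i ~= j -->
   (\<Sum>l\<le>k. GG (i, l) om) - b * (\<Sum>l\<le>x. GG (i, l) om) ~= (\<Sum>l\<le>k'. GG (j, l) om)"
   using AE_tie[OF ij _ refl b] by (cases "i = j") auto
 qed
 have unb: "AE om in M. \<forall>w\<in>{1..W}. \<forall>t. \<exists>r. t < C om w r"
  using AE_unbounded by (subst AE_ball_countable) auto
 show ?thesis
  using pos ties[OF insertI1] ties[OF insertI2[OF singletonI]] unb
 proof eventually_elim
  case (elim om)
  have pD: "0 < GG (Inl i, k) om" if "i \<in> {1..N}" for i k using elim(1) that by auto
  have pC: "0 < GG (Inr w, k) om" if "w \<in> {1..W}" for w k using elim(1) that by auto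
  have t0: "(\<Sum>l\<le>k. GG (i, l) om) ~= (\<Sum>l\<le>k'. GG (j, l) om)" if "i \<in> ?I" "j \<in> ?I" "i ~= j" for i j k k'
   using elim(2) that by auto
  have t2: "(\<Sum>l\<le>k. GG (i, l) om) - 2 * (\<Sum>l\<le>x. GG (i, l) om) ~= (\<Sum>l\<le>k'. GG (j, l) om)"
   if "i \<in> ?I" "j \<in> ?I" "i ~= j" for i j k x k'
   using elim(3) that by auto
  show ?case
  proof
   show "1 <= N" "1 <= W" by (rule NW)+
   show "0 < D om i k" if "i \<in> {1..N}" for i k
    using sum_pos[of "{..k}" "%l. GG (Inl i, l) om"] pD[OF that] by (simp add: D_sum[symmetric])
   show "D om i k < D om i (Suc k)" if "i \<in> {1..N}" for i k
    using pD[OF that, of "Suc k"] by (simp add: GG_Inl gap_def)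
   show "D om i k ~= D om j k'" if "i \<in> {1..N}" "j \<in> {1..N}" "i ~= j" for i j k k'
    using t0[OF InlI InlI, of i j k k'] that by (simp add: D_sum[symmetric])
   show "D om i k - 2 * D om i x ~= D om j k'" if "i \<in> {1..N}" "j \<in> {1..N}" "i ~= j" for i j k x k'
    using t2[OF InlI InlI, of i j k x k'] that by (simp add: D_sum[symmetric])
   show "0 < C om w r" if "w \<in> {1..W}" for w r
    using sum_pos[of "{..r}" "%l. GG (Inr w, l) om"] pC[OF that] by (simp add: C_sum[symmetric])
   show "C om w r < C om w (Suc r)" if "w \<in> {1..W}" for w r
    using pC[OF that, of "Suc r"] by (simp add: GG_Inr gap_def)
   show "C om w r ~= C om w' r'" if "w \<in> {1..W}" "w' \<in> {1..W}" "w ~= w'" for w w' r r'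
    using t0[OF InrI InrI, of w w' r r'] that by (simp add: C_sum[symmetric])
   show "\<exists>r. t < C om w r" if "w \<in> {1..W}" for w t using elim(4) that by blast
  qed
 qed
qed

end

section \<open>Outer probability bounds\<close>

context prob_space
begin

text \<open>Bounding the outer measure makes the measurability of exceptional events irrelevant.\<close>

definition outer_le :: "('a => bool) => real => bool" where
 "outer_le P b <-> (\<exists>A\<in>events. {om \<in> space M. P om} <= A & prob A <= b)"

lemma outer_leI: "A \<in> events ==> prob A <= b ==> (!!om. om \<in> space M ==> P om ==> om \<in> A) ==> outer_le P b"
 unfolding outer_le_def by blast

lemma outer_mono:
 "outer_le P b ==> b <= b' ==> (!!om. om \<in> space M ==> Q om ==> P om) ==> outer_le Q b'"
proof -
 assume "outer_le P b" "b <= b'" and QP: "!!om. om \<in> space M ==> Q om ==> P om"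
 then obtain A where A: "A \<in> events" "{om \<in> space M. P om} <= A" "prob A <= b" by (auto simp: outer_le_def)
 show ?thesis
  by (rule outer_leI[OF A(1)]) (use A QP \<open>b <= b'\<close> in auto)
qed

lemma outer_meas: "{om \<in> space M. P om} \<in> events ==> \<P>(om in M. P om) <= b ==> outer_le P b"
 unfolding outer_le_def by blast

lemma outer_or: "outer_le P a ==> outer_le Q b ==> outer_le (%om. P om \<or> Q om) (a + b)"
proof -
 assume "outer_le P a" "outer_le Q b"
 then obtain A B where "A \<in> events" "{om \<in> space M. P om} <= A" "prob A <= a"
  "B \<in> events" "{om \<in> space M. Q om} <= B" "prob B <= b" by (auto simp: outer_le_def)
 thus ?thesis
  by (intro outer_leI[of "A \<union> B"]) (use measure_Un_le[of A M B] in auto)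
qed

lemma outer_bex:
 assumes "finite S" "!!i. i \<in> S ==> outer_le (P i) (b i)"
 shows "outer_le (%om. \<exists>i\<in>S. P i om) (\<Sum>i\<in>S. b i)"
 using assms
proof (induction S rule: finite_induct)
 case empty show ?case by (rule outer_leI[of "{}"]) auto
next
 case (insert i S)
 have "outer_le (%om. P i om \<or> (\<exists>i\<in>S. P i om)) (b i + (\<Sum>i\<in>S. b i))"
  by (rule outer_or) (use insert in auto)
 thus ?case using insert.hyps by (auto elim: outer_mono)
qed

lemma outer_AE: assumes "AE om in M. P om" shows "outer_le (%om. ~ P om) 0"
proof -
 obtain Z where "Z \<in> null_sets M" "{om \<in> space M. ~ P om} <= Z"
  using assms by (auto elim!: AE_E simp: null_sets_def)
 thus ?thesis by (intro outer_leI[of Z]) (auto simp: null_sets_def emeasure_eq_measure)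
qed

text \<open>Markov's inequality for the number of measurable covers that occur.\<close>

lemma outer_count:
 fixes p x :: real
 assumes "finite S" "!!i. i \<in> S ==> outer_le (P i) p" "0 < x"
 shows "outer_le (%om. x <= real (card {i \<in> S. P i om})) (card S * p / x)"
proof -
 have "\<exists>A. \<forall>i\<in>S. A i \<in> events & {om \<in> space M. P i om} <= A i & prob (A i) <= p"
  by (rule bchoice) (use assms(2) in "auto simp: outer_le_def")
 then obtain A where A: "!!i. i \<in> S ==> A i \<in> events" "!!i. i \<in> S ==> {om \<in> space M. P i om} <= A i"
  "!!i. i \<in> S ==> prob (A i) <= p" by blast
 let ?f = "%om. \<Sum>i\<in>S. indicat_real (A i) om"
 have [measurable]: "?f \<in> borel_measurable M" using A(1) by auto
 have int: "integrable M ?f"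
  by (rule Bochner_Integration.integrable_sum) (use A(1) in "auto simp: emeasure_eq_measure")
 have "\<P>(om in M. x <= ?f om) <= (\<integral>om. ?f om \<partial>M) / x"
  by (rule integral_Markov_inequality_measure[where A = "{}"]) (use int assms(3) in "auto intro!: sum_nonneg")
 also have "(\<integral>om. ?f om \<partial>M) = (\<Sum>i\<in>S. prob (A i))"
  by (subst Bochner_Integration.integral_sum) (use A(1) in "auto simp: emeasure_eq_measure")
 also have "(\<Sum>i\<in>S. prob (A i)) / x <= card S * p / x"
  using assms(3) A(3) sum_bounded_above[of S "%i. prob (A i)" p] by (intro divide_right_mono) auto
 finally have "\<P>(om in M. x <= ?f om) <= card S * p / x" .
 moreover have "real (card {i \<in> S. P i om}) <= ?f om" if "om \<in> space M" for om
 proof -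
  have "real (card {i \<in> S. P i om}) = (\<Sum>i\<in>{i \<in> S. P i om}. indicat_real (A i) om)"
   using A(2) that by (subst sum.cong[OF refl, of _ _ "%_. 1"]) (auto simp: indicator_def)
  also have "... <= ?f om" by (rule sum_mono2) (use assms(1) in auto)
  finally show ?thesis .
 qed
 ultimately show ?thesis
  by (intro outer_leI[of "{om \<in> space M. x <= ?f om}"]) (auto intro: order_trans)
qed

end

lemma (in exp_family) events_all:
 assumes J: "finite J" "J <= I" and B: "!!j. j \<in> J ==> B j \<in> sets borel"
 shows "{om \<in> space M. \<forall>j\<in>J. G j om \<in> B j} \<in> events"
proof (rule sets.sets_Collect_finite_All[OF _ J(1)])
 fix j assume j: "j \<in> J"
 hence "G j \<in> borel_measurable M" using G_meas J by auto
 from measurable_sets[OF this B[OF j]] show "{om \<in> space M. G j om \<in> B j} \<in> events"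
  by (simp add: vimage_def Int_def conj_commute)
qed

section \<open>Static estimates\<close>

text \<open>Gaps that grow by a factor slightly below 2, until the regularity of the dust takes over.\<close>

definition good_pat :: "nat => real => real => nat => nat => (nat => real) => bool" where
 "good_pat q mu h J l t <-> gap t 0 \<in> {real l * h .. real l * h + h / 2} &
   (\<forall>j<J. gap t (Suc j) \<in> {(1 - 1 / J) * (2 - 1 / J) ^ j * mu .. (2 - 1 / J) ^ j * mu}) &
   (\<forall>k\<in>{Suc J..64 * q}. gap t k <= ln (128 * real q))"

text \<open>Up to index \<open>J\<close> a gap is at most \<open>(2 - 1 / J) ^ k * mu\<close>, a
  distance that the lower ends of the windows have already guaranteed. From there to
  \<open>64 * q\<close> it is at most \<open>ln (128 * q)\<close>, which has been reached at index
  \<open>J\<close>. Beyond that, one gap is bounded by \<open>reg\<close> by less than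
  \<open>k / 4\<close>, and the distance is more.\<close>

lemma good_pat_good:
 assumes pat: "good_pat q mu h J l t" and reg: "reg q B t" and B: "256 <= B" and q: "8 <= q"
  and t: "strict_mono t" "0 < t 0" and mu: "mu <= real l * h" "0 < mu" and J: "1 <= J"
  and y: "ln (128 * real q) <= (2 - 1 / J) ^ J * mu"
 shows "good t"
 unfolding good_def
proof
 fix k
 define r where "r = 2 - 1 / real J"
 have mono: "mono t" using t(1) by (rule strict_mono_mono)
 have low: "r ^ j * mu <= t j" if "j <= J" for j
  using that
 proof (induction j)
  case 0 thus ?case using pat mu by (auto simp: good_pat_def gap_def)
 next
  case (Suc j)
  have "(1 - 1 / J) * r ^ j * mu <= gap t (Suc j)" using pat Suc.prems by (auto simp: good_pat_def r_def)
  hence "r ^ j * mu + (1 - 1 / J) * r ^ j * mu <= t (Suc j)" using Suc by (simp add: gap_def)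
  moreover have "r ^ Suc j * mu = r ^ j * mu + (1 - 1 / J) * r ^ j * mu" by (simp add: r_def algebra_simps)
  ultimately show ?case by simp
 qed
 consider "k < J" | "J <= k" "k < 64 * q" | "64 * q <= k" by linarith
 thus "t (Suc k) <= 2 * t k"
 proof cases
  case 1
  hence "gap t (Suc k) <= r ^ k * mu" using pat by (auto simp: good_pat_def r_def)
  thus ?thesis using low[of k] 1 by (simp add: gap_def)
 next
  case 2
  hence "gap t (Suc k) <= ln (128 * real q)" using pat by (auto simp: good_pat_def)
  also have "... <= t J" using low[of J] y by (simp add: r_def)
  also have "... <= t k" using monoD[OF mono 2(1)] .
  finally show ?thesis by (simp add: gap_def)
 next
  case 3
  have "t (k + 1) - t k <= 4 * (real 1 + real q + 1 + k / B)"
   by (rule reg_upper'[OF reg mono]) (use B in simp)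
  moreover have "k / B <= k / 256" using B by (intro divide_left_mono) auto
  hence "4 * (real 1 + real q + 1 + k / B) <= 4 * (real 1 + real q + 1 + k / 256)"
   by (intro mult_left_mono add_left_mono) auto
  ultimately have "t (k + 1) - t k <= 4 * (real 1 + real q + 1 + k / 256)" by linarith
  moreover have "k / 4 <= t (0 + k) - t 0" by (rule reg_lower[OF reg]) (use 3 in auto)
  moreover have "64 * real q <= k" using 3 by (metis of_nat_le_iff of_nat_mult of_nat_numeral)
  moreover have "8 <= real q" using q by simp
  ultimately show ?thesis using t(2) by simp
 qed
qed

text \<open>The probability of \<open>good_pat\<close> per unit of \<open>h\<close>, from below:
  \<open>1 / 6\<close> for the first gap, \<open>1 / 2\<close> for those beyond index
  \<open>J\<close>, and between them windows of relative width \<open>1 / J\<close>.\<close>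

definition good_rate :: "real => nat => real" where
 "good_rate mu J = 1 / 12 * (\<Prod>j<J. (2 - 1 / J) ^ j * mu / J * exp (- ((2 - 1 / J) ^ j * mu)))"

definition chain_prob :: "nat => real => real" where
 "chain_prob a m = (\<Prod>j<a. 2 ^ (j + 1) * m)"

context star_cleaning
begin

lemma prob_lines:
 assumes S: "S <= {1..N}" and A: "!!i. i \<in> S ==> A i \<in> sets (PiM UNIV (%_. borel))"
 shows "\<P>(om in M. \<forall>i\<in>S. D om i \<in> A i) = (\<Prod>i\<in>S. \<P>(om in M. D om i \<in> A i))"
proof (cases "S = {}")
 case True thus ?thesis by (simp add: prob_space)
next
 case False
 have fin: "finite S" using S finite_subset by blast
 let ?X = "%j om. case j of Inl i => D om i | Inr w => C om w"
 have "prob (\<Inter>j\<in>Inl ` S. ?X j -` (case j of Inl i => A i | Inr w => {}) \<inter> space M)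
   = (\<Prod>j\<in>Inl ` S. prob (?X j -` (case j of Inl i => A i | Inr w => {}) \<inter> space M))"
  by (rule indep_varsD[OF indep]) (use False fin S A in auto)
 also have "... = (\<Prod>i\<in>S. prob ((%om. D om i) -` A i \<inter> space M))"
  by (subst prod.reindex) auto
 also have "(\<Inter>j\<in>Inl ` S. ?X j -` (case j of Inl i => A i | Inr w => {}) \<inter> space M) = {om \<in> space M. \<forall>i\<in>S. D om i \<in> A i}"
  using False by auto
 also have "(\<Prod>i\<in>S. prob ((%om. D om i) -` A i \<inter> space M)) = (\<Prod>i\<in>S. \<P>(om in M. D om i \<in> A i))"
  by (intro prod.cong arg_cong[where f = prob]) auto
 finally show ?thesis .
qed

lemma D_rv: "i \<in> {1..N} ==> (%om. D om i) \<in> measurable M (PiM UNIV (%_. borel))"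
proof -
 assume i: "i \<in> {1..N}"
 have "\<forall>j\<in>{1..N} <+> {1..W}. (%om. case j of Inl i => D om i | Inr w => C om w) \<in> measurable M (PiM UNIV (%_. borel))"
  using indep unfolding indep_vars_def by blast
 from bspec[OF this InlI[OF i]] show ?thesis by simp
qed

lemma gap_meas [measurable]: "(%x. gap x k) \<in> borel_measurable (PiM UNIV (%_. borel))"
 by (cases k) (auto simp: gap_def)

lemma outer_no_line:
 fixes p :: real
 assumes A: "A \<in> sets (PiM UNIV (%_. borel))" and p: "!!i. i \<in> {1..N} ==> p <= \<P>(om in M. D om i \<in> A)"
 shows "outer_le (%om. \<forall>i\<in>{1..N}. D om i \<notin> A) (exp (- (N * p)))"
proof (rule outer_meas)
 let ?B = "UNIV - A :: (nat => real) set"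
 have B: "?B \<in> sets (PiM UNIV (%_. borel))" using sets.compl_sets[OF A] by (simp add: space_PiM)
 have eq: "{om \<in> space M. \<forall>i\<in>{1..N}. D om i \<notin> A} = {om \<in> space M. \<forall>i\<in>{1..N}. D om i \<in> ?B}" by auto
 have ev: "{om \<in> space M. D om i \<in> E} \<in> events" if "i \<in> {1..N}" "E \<in> sets (PiM UNIV (%_. borel))" for i E
  using measurable_sets[OF D_rv[OF that(1)] that(2)] by (simp add: vimage_def Int_def conj_commute)
 show "{om \<in> space M. \<forall>i\<in>{1..N}. D om i \<notin> A} \<in> events"
  unfolding eq by (rule sets.sets_Collect_finite_All[OF ev[OF _ B]]) simp_all
 have "\<P>(om in M. \<forall>i\<in>{1..N}. D om i \<notin> A) = (\<Prod>i\<in>{1..N}. \<P>(om in M. D om i \<in> ?B))"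
  unfolding eq by (rule prob_lines) (use B in auto)
 also have "... <= (\<Prod>i\<in>{1..N}. exp (- p))"
 proof (rule prod_mono)
  fix i assume i: "i \<in> {1..N}"
  have "\<P>(om in M. D om i \<in> ?B) = prob (space M - {om \<in> space M. D om i \<in> A})"
   by (rule arg_cong[where f = prob]) auto
  also have "... = 1 - \<P>(om in M. D om i \<in> A)" by (rule prob_compl[OF ev[OF i A]])
  also have "... <= exp (- p)" using p[OF i] exp_ge_add_one_self[of "- p"] by simp
  finally show "0 <= \<P>(om in M. D om i \<in> ?B) & \<P>(om in M. D om i \<in> ?B) <= exp (- p)" by simp
 qed
 also have "... = exp (- (N * p))" by (simp add: exp_of_nat_mult[symmetric])
 finally show "\<P>(om in M. \<forall>i\<in>{1..N}. D om i \<notin> A) <= exp (- (N * p))" .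
qed

lemma outer_chain_lines:
 assumes m: "0 <= m" and i: "i \<in> {1..N}"
 shows "outer_le (%om. \<forall>j<a. gap (D om i) j <= 2 ^ (j + 1) * m) (chain_prob a m)"
proof (rule outer_meas)
 let ?J = "(%j. (Inl i :: nat + nat, j)) ` {..<a}"
 let ?B = "%z. {..2 ^ (snd z + 1) * m}"
 have eq: "{om \<in> space M. \<forall>j<a. gap (D om i) j <= 2 ^ (j + 1) * m} = {om \<in> space M. \<forall>z\<in>?J. GG z om \<in> ?B z}"
  by (auto simp: GG_Inl)
 show "{om \<in> space M. \<forall>j<a. gap (D om i) j <= 2 ^ (j + 1) * m} \<in> events"
  unfolding eq by (rule events_all) (use i in auto)
 have "\<P>(om in M. \<forall>j<a. gap (D om i) j <= 2 ^ (j + 1) * m) = (\<Prod>z\<in>?J. \<P>(om in M. GG z om \<in> ?B z))"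
  unfolding eq by (rule prob_all) (use i in auto)
 also have "... <= (\<Prod>z\<in>?J. 2 ^ (snd z + 1) * m)"
  by (rule prod_mono) (use prob_le' i m in auto)
 also have "... = chain_prob a m" unfolding chain_prob_def by (subst prod.reindex) (auto simp: inj_on_def)
 finally show "\<P>(om in M. \<forall>j<a. gap (D om i) j <= 2 ^ (j + 1) * m) <= chain_prob a m" .
qed

lemma chain_prob_sq: "(\<Prod>l<2 * a. 2 ^ (l div 2 + 1) * m) = (chain_prob a m)\<^sup>2"
 by (induction a) (auto simp: chain_prob_def power2_eq_square mult_ac)

text \<open>If the index \<open>k\<close> of the short gap is one of the chain indices, it replaces
  a factor of the product that is at least \<open>m\<close>; hence the division by
  \<open>m\<close>.\<close>

lemma outer_pair_line:
 assumes m: "0 < m" "m <= 1" and i: "i \<in> {1..N}" and \<eta>: "0 <= \<eta>"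
 shows "outer_le (%om. (\<exists>k\<in>{1..q}. gap (D om i) k <= \<eta>) &
   (\<forall>j<a. gap (D om i) (2 * j) <= 2 ^ (j + 1) * m & gap (D om i) (2 * j + 1) <= 2 ^ (j + 1) * m))
  (q * (\<eta> * (chain_prob a m)\<^sup>2 / m))"
proof -
 have "outer_le (%om. gap (D om i) k <= \<eta> &
   (\<forall>j<a. gap (D om i) (2 * j) <= 2 ^ (j + 1) * m & gap (D om i) (2 * j + 1) <= 2 ^ (j + 1) * m))
  (\<eta> * (chain_prob a m)\<^sup>2 / m)" for k
 proof -
  define S where "S = {..<2 * a} - {k}"
  let ?J = "(%l. (Inl i :: nat + nat, l)) ` insert k S"
  define b where "b l = (if l = k then \<eta> else 2 ^ (l div 2 + 1) * m)" for l
  let ?B = "%z. {..b (snd z)}"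
  have b0: "0 <= b l" for l using \<eta> m by (simp add: b_def)
  have "\<P>(om in M. \<forall>z\<in>?J. GG z om \<in> ?B z) = (\<Prod>z\<in>?J. \<P>(om in M. GG z om \<in> ?B z))"
   by (rule prob_all) (use i in "auto simp: S_def")
  also have "... <= (\<Prod>z\<in>?J. b (snd z))"
   by (rule prod_mono) (use prob_le'[OF _ b0] i in auto)
  also have "... = (\<Prod>l\<in>insert k S. b l)" by (subst prod.reindex) (auto simp: inj_on_def)
  also have "... = b k * (\<Prod>l\<in>S. b l)" by (rule prod.insert) (auto simp: S_def)
  also have "b k = \<eta>" by (simp add: b_def)
  also have "(\<Prod>l\<in>S. b l) = (\<Prod>l\<in>S. 2 ^ (l div 2 + 1) * m)" by (rule prod.cong) (auto simp: S_def b_def)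
  also have "... <= (chain_prob a m)\<^sup>2 / m"
  proof (cases "k < 2 * a")
   case True
   have "(\<Prod>l\<in>S. 2 ^ (l div 2 + 1) * m) * m <= (\<Prod>l\<in>S. 2 ^ (l div 2 + 1) * m) * (2 ^ (k div 2 + 1) * m)"
   proof (rule mult_left_mono)
    have "1 * m <= 2 ^ (k div 2 + 1) * m" using m by (intro mult_right_mono one_le_power) auto
    thus "m <= 2 ^ (k div 2 + 1) * m" by simp
    show "0 <= (\<Prod>l\<in>S. 2 ^ (l div 2 + 1) * m)" using m by (intro prod_nonneg) auto
   qed
   also have "... = (\<Prod>l<2 * a. 2 ^ (l div 2 + 1) * m)"
    using True unfolding S_def by (subst prod.remove[of "{..<2 * a}" k]) (auto simp: mult_ac)
   finally show ?thesis using m unfolding chain_prob_sq by (simp add: pos_le_divide_eq)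
  next
   case False
   hence "S = {..<2 * a}" by (auto simp: S_def)
   hence "(\<Prod>l\<in>S. 2 ^ (l div 2 + 1) * m) = (chain_prob a m)\<^sup>2" using chain_prob_sq by simp
   also have "... <= (chain_prob a m)\<^sup>2 / m" using m by (simp add: pos_le_divide_eq mult_left_le)
   finally show ?thesis .
  qed
  finally have "\<P>(om in M. \<forall>z\<in>?J. GG z om \<in> ?B z) <= \<eta> * (chain_prob a m)\<^sup>2 / m"
   using \<eta> by (simp add: mult_left_mono)
  moreover have "{om \<in> space M. \<forall>z\<in>?J. GG z om \<in> ?B z} \<in> events"
   by (rule events_all) (use i in "auto simp: S_def")
  ultimately show ?thesis
  proof (intro outer_leI)
   fix om assume om: "om \<in> space M" "gap (D om i) k <= \<eta> &
    (\<forall>j<a. gap (D om i) (2 * j) <= 2 ^ (j + 1) * m & gap (D om i) (2 * j + 1) <= 2 ^ (j + 1) * m)"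
   have "gap (D om i) l <= 2 ^ (l div 2 + 1) * m" if "l < 2 * a" for l
   proof (cases "even l")
    case True
    then obtain j where "l = 2 * j" by (blast elim: evenE)
    thus ?thesis using om(2) that by simp
   next
    case False
    then obtain j where "l = 2 * j + 1" by (blast elim: oddE)
    thus ?thesis using om(2) that by simp
   qed
   thus "om \<in> {om \<in> space M. \<forall>z\<in>?J. GG z om \<in> ?B z}"
    using om by (auto simp: GG_Inl S_def b_def)
  qed
 qed
 hence "outer_le (%om. \<exists>k\<in>{1..q}. gap (D om i) k <= \<eta> &
   (\<forall>j<a. gap (D om i) (2 * j) <= 2 ^ (j + 1) * m & gap (D om i) (2 * j + 1) <= 2 ^ (j + 1) * m))
  (\<Sum>k\<in>{1..q}. \<eta> * (chain_prob a m)\<^sup>2 / m)"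
  by (intro outer_bex) auto
 thus ?thesis by (rule outer_mono) auto
qed

text \<open>The pattern prescribes an interval for each of finitely many gaps, so its probability is
  a product.\<close>

lemma good_pat_prob:
 assumes i: "i \<in> {1..N}" and mu: "0 < mu" and h: "0 < h" "(real l + 1) * h <= 1" and J: "1 <= J" and q: "1 <= q"
 shows "{t. good_pat q mu h J l t} \<in> sets (PiM UNIV (%_. borel))"
  and "h * good_rate mu J <= \<P>(om in M. D om i \<in> {t. good_pat q mu h J l t})"
proof -
 define n where "n = max J (64 * q)"
 define r where "r = 2 - 1 / real J"
 define B where "B k = (if k = 0 then {real l * h .. real l * h + h / 2}
   else if k <= J then {(1 - 1 / J) * r ^ (k - 1) * mu .. r ^ (k - 1) * mu} else {.. ln (128 * real q)})" for k
 have r: "1 <= r" using J by (simp add: r_def)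
 have pat: "good_pat q mu h J l t <-> (\<forall>k\<le>n. gap t k \<in> B k)" for t
 proof
  assume g: "good_pat q mu h J l t"
  show "\<forall>k\<le>n. gap t k \<in> B k"
  proof (intro allI impI)
   fix k assume "k <= n"
   hence "k <= J \<or> k <= 64 * q" by (auto simp: n_def)
   then consider "k = 0" | "0 < k" "k <= J" | "J < k" "k <= 64 * q" by linarith
   thus "gap t k \<in> B k"
   proof cases
    case 1 thus ?thesis using g by (simp add: good_pat_def B_def)
   next
    case 2
    then obtain j where "k = Suc j" "j < J" by (cases k) auto
    thus ?thesis using g by (simp add: good_pat_def B_def r_def)
   next
    case 3 thus ?thesis using g by (simp add: good_pat_def B_def)
   qed
  qed
 next
  assume a: "\<forall>k\<le>n. gap t k \<in> B k"
  have A0: "gap t 0 \<in> {real l * h..real l * h + h / 2}" using a[rule_format, of 0] by (simp add: B_def)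
  have A1: "gap t (Suc j) \<in> {(1 - 1 / J) * (2 - 1 / J) ^ j * mu..(2 - 1 / J) ^ j * mu}" if "j < J" for j
   using a[rule_format, of "Suc j"] that by (simp add: B_def r_def n_def)
  have A2: "gap t k <= ln (128 * real q)" if "k \<in> {Suc J..64 * q}" for k
   using a[rule_format, of k] that by (auto simp: B_def n_def)
  show "good_pat q mu h J l t" unfolding good_pat_def
  proof (intro conjI)
   show "gap t 0 \<in> {real l * h..real l * h + h / 2}" by (rule A0)
   show "\<forall>j<J. gap t (Suc j) \<in> {(1 - 1 / J) * (2 - 1 / J) ^ j * mu..(2 - 1 / J) ^ j * mu}"
    by (intro allI impI A1)
   show "\<forall>k\<in>{Suc J..64 * q}. gap t k <= ln (128 * real q)"
   proof
    fix k assume "k \<in> {Suc J..64 * q}"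
    from A2[OF this] show "gap t k <= ln (128 * real q)" by simp
   qed
  qed
 qed
 have Bs: "B k \<in> sets borel" for k by (simp add: B_def)
 have "{x \<in> space (PiM UNIV (%_. borel)). \<forall>k\<in>{..n}. gap x k \<in> B k} \<in> sets (PiM UNIV (%_. borel))"
 proof (rule sets.sets_Collect_finite_All)
  show "{x \<in> space (PiM UNIV (%_. borel)). gap x k \<in> B k} \<in> sets (PiM UNIV (%_. borel))" for k
   using measurable_sets[OF gap_meas[of k] Bs[of k]] by (simp add: vimage_def Int_def conj_commute)
 qed simp
 moreover have "{t. good_pat q mu h J l t} = {x \<in> space (PiM UNIV (%_. borel)). \<forall>k\<in>{..n}. gap x k \<in> B k}"
  unfolding pat by (auto simp: space_PiM)
 ultimately show "{t. good_pat q mu h J l t} \<in> sets (PiM UNIV (%_. borel))" by simp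
 let ?J = "(%k. (Inl i :: nat + nat, k)) ` {..n}"
 let ?p = "%k. \<P>(om in M. GG (Inl i, k) om \<in> B k)"
 have "\<P>(om in M. D om i \<in> {t. good_pat q mu h J l t}) = \<P>(om in M. \<forall>z\<in>?J. GG z om \<in> B (snd z))"
  unfolding pat by (rule arg_cong[where f = prob]) (auto simp: GG_Inl)
 also have "... = (\<Prod>z\<in>?J. \<P>(om in M. GG z om \<in> B (snd z)))"
  by (rule prob_all) (use i Bs in auto)
 also have "... = (\<Prod>k\<le>n. ?p k)" by (subst prod.reindex) (auto simp: inj_on_def)
 also have "... = ?p 0 * ((\<Prod>j<J. ?p (Suc j)) * (\<Prod>k\<in>{Suc J..n}. ?p k))"
 proof -
  have "{..n} = insert 0 (Suc ` {..<J} \<union> {Suc J..n})"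
   by (auto simp: n_def image_iff) (metis Suc_leI Suc_pred not_less_eq_eq le_eq_less_or_eq lessThan_iff less_Suc_eq_le gr0I not_le)
  hence "(\<Prod>k\<le>n. ?p k) = ?p 0 * (\<Prod>k\<in>Suc ` {..<J} \<union> {Suc J..n}. ?p k)" by simp
  also have "(\<Prod>k\<in>Suc ` {..<J} \<union> {Suc J..n}. ?p k) = (\<Prod>k\<in>Suc ` {..<J}. ?p k) * (\<Prod>k\<in>{Suc J..n}. ?p k)"
   by (rule prod.union_disjoint) auto
  also have "(\<Prod>k\<in>Suc ` {..<J}. ?p k) = (\<Prod>j<J. ?p (Suc j))" by (subst prod.reindex) auto
  finally show ?thesis .
 qed
 finally have eq: "\<P>(om in M. D om i \<in> {t. good_pat q mu h J l t})
   = ?p 0 * ((\<Prod>j<J. ?p (Suc j)) * (\<Prod>k\<in>{Suc J..n}. ?p k))" .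
 have p0: "h / 6 <= ?p 0"
 proof -
  have lh: "real l * h + h / 2 <= 1" using h by (simp add: algebra_simps)
  have "(real l * h + h / 2 - real l * h) * exp (- (real l * h + h / 2)) <= ?p 0"
   unfolding B_def using prob_window[of "(Inl i, 0)" "real l * h" "real l * h + h / 2"] i h by simp
  moreover have "h / 2 * (1 / 3) <= h / 2 * exp (- (real l * h + h / 2))"
  proof (rule mult_left_mono)
   have "exp (real l * h + h / 2) <= exp 1" using lh by simp
   also have "exp 1 <= (3 :: real)" using exp_le by simp
   finally show "1 / 3 <= exp (- (real l * h + h / 2))" by (simp add: exp_minus field_simps)
  qed (use h in simp)
  ultimately show ?thesis by simp
 qed
 have p1: "r ^ j * mu / J * exp (- (r ^ j * mu)) <= ?p (Suc j)" if "j < J" for j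
 proof -
  have "(r ^ j * mu - (1 - 1 / J) * r ^ j * mu) * exp (- (r ^ j * mu))
    <= \<P>(om in M. GG (Inl i, Suc j) om \<in> {(1 - 1 / J) * r ^ j * mu .. r ^ j * mu})"
  proof (rule prob_window)
   have "(1 - 1 / J) * (r ^ j * mu) <= 1 * (r ^ j * mu)" using r mu J by (intro mult_right_mono) auto
   thus "(1 - 1 / J) * r ^ j * mu <= r ^ j * mu" by simp
  qed (use i J r mu in auto)
  moreover have "r ^ j * mu - (1 - 1 / J) * r ^ j * mu = r ^ j * mu / J" by (simp add: algebra_simps)
  ultimately show ?thesis using that by (simp add: B_def)
 qed
 \<comment> \<open>At most \<open>64 * q\<close> gaps are concerned, each too long with probability
   \<open>1 / (128 * q)\<close>.\<close>
 have p2: "1 / 2 <= (\<Prod>k\<in>{Suc J..n}. ?p k)"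
 proof -
  define e where "e = 1 / (128 * real q)"
  have e: "0 < e" "e <= 1" using q by (auto simp: e_def)
  have "?p k = 1 - e" if "k \<in> {Suc J..n}" for k
  proof -
   have "?p k = 1 - exp (- ln (128 * real q))"
    using prob_le[of "(Inl i, k)" "ln (128 * real q)"] that i q by (auto simp: B_def)
   also have "exp (- ln (128 * real q)) = e" using q by (simp add: exp_minus e_def field_simps)
   finally show ?thesis .
  qed
  hence "(\<Prod>k\<in>{Suc J..n}. ?p k) = (1 - e) ^ card {Suc J..n}" by simp
  moreover have "(1 - e) ^ (64 * q) <= (1 - e) ^ card {Suc J..n}"
   using e by (intro power_decreasing) (auto simp: n_def)
  moreover have "1 + real (64 * q) * (- e) <= (1 + - e) ^ (64 * q)"
   by (rule Bernoulli_inequality) (use e in simp)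
  moreover have "real (64 * q) * e = 1 / 2" using q by (simp add: e_def)
  ultimately show ?thesis by simp
 qed
 have "h * good_rate mu J = h / 6 * ((\<Prod>j<J. r ^ j * mu / J * exp (- (r ^ j * mu))) * (1 / 2))"
  by (simp add: good_rate_def r_def)
 also have "... <= ?p 0 * ((\<Prod>j<J. ?p (Suc j)) * (\<Prod>k\<in>{Suc J..n}. ?p k))"
 proof (intro mult_mono p0 p2 prod_mono)
  show "0 <= r ^ j * mu / J * exp (- (r ^ j * mu)) & r ^ j * mu / J * exp (- (r ^ j * mu)) <= ?p (Suc j)"
   if "j \<in> {..<J}" for j using p1[of j] that r mu by auto
 qed (use r mu h in "auto intro!: prod_nonneg mult_nonneg_nonneg")
 finally show "h * good_rate mu J <= \<P>(om in M. D om i \<in> {t. good_pat q mu h J l t})"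
  unfolding eq .
qed

end

section \<open>Occupied cells and the bounds they give for the process\<close>

definition pat_cells :: "nat => nat => (nat => nat => real) => real => real => nat => bool" where
 "pat_cells q N d mu h J <-> (\<forall>l::nat. mu <= real l * h --> (real l + 1) * h <= 1 -->
   (\<exists>i\<in>{1..N}. good_pat q mu h J l (d i)))"

definition few_lines :: "nat => nat => (nat => nat => real) => real => nat => bool" where
 "few_lines q N d h x <-> (\<forall>l::nat. real l * h <= 1 -->
   card {i \<in> {1..N}. \<exists>k<q. d i k \<in> {real l * h .. real l * h + h}} <= x)"

text \<open>Only half of the cell is used, which keeps the particle strictly below its right end, as
  \<open>card_cells\<close> requires.\<close>

definition first_cells :: "nat => (nat => nat => real) => real => bool" where
 "first_cells N d h <-> (\<forall>l::nat. (real l + 1) * h <= 1 -->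
   (\<exists>i\<in>{1..N}. gap (d i) 0 \<in> {real l * h .. real l * h + h / 2}))"

definition regular :: "nat => nat => (nat => nat => real) => (nat => nat => real) => nat => bool" where
 "regular N W d c q <-> star_real N W d c & (\<forall>i\<in>{1..N}. reg q (real N ^ 4) (d i)) &
   (\<forall>w\<in>{1..W}. reg q (real N ^ 4) (c w))"

definition pat_ok :: "nat => real => nat => bool" where
 "pat_ok q mu J <-> 0 < mu & 1 <= J & ln (128 * real q) <= (2 - 1 / J) ^ J * mu"

context star_real
begin

lemma pat_cells_good:
 assumes pc: "pat_cells q N d mu h J" and regd: "!!i. i \<in> {1..N} ==> reg q (real N ^ 4) (d i)"
  and ok: "pat_ok q mu J" and q: "8 <= q" "256 <= N" and h: "0 < h"
  and l: "mu <= real l * h" "(real l + 1) * h <= 1"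
 shows "\<exists>i\<in>{i \<in> {1..N}. good (d i)}. real l * h <= d i 0 & d i 0 < (real l + 1) * h"
proof -
 obtain i where i: "i \<in> {1..N}" "good_pat q mu h J l (d i)" using pc l by (auto simp: pat_cells_def)
 have "good (d i)"
 proof (rule good_pat_good[OF i(2) regd[OF i(1)] _ q(1)])
  have "256 <= real N" using q by simp
  also have "real N <= real N ^ 4" using q by (intro self_le_power) auto
  finally show "256 <= real N ^ 4" .
  show "strict_mono (d i)" using d_Suc[OF i(1)] by (rule strict_monoI_Suc)
 qed (use ok l d_pos[OF i(1)] in "auto simp: pat_ok_def")
 moreover have "real l * h <= d i 0" "d i 0 < (real l + 1) * h"
  using i(2) h by (auto simp: good_pat_def gap_def algebra_simps)
 ultimately show ?thesis using i(1) by blast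
qed

text \<open>The cells between \<open>mu\<close> and \<open>m\<close> contain the starts of more than
  \<open>W\<close> good halflines.\<close>

lemma Lev_le_pat:
 assumes pc: "pat_cells q N d mu h J" and regd: "!!i. i \<in> {1..N} ==> reg q (real N ^ 4) (d i)"
  and ok: "pat_ok q mu J" and q: "8 <= q" "256 <= N" and h: "0 < h"
  and m: "mu < m" "m <= 1" "W < (m - mu) / h - 2"
 shows "Lev n <= m"
proof (rule Lev_bound)
 have "(m - mu) / h - 2 <= card {i \<in> {i \<in> {1..N}. good (d i)}. mu < d i 0 & d i 0 < m}"
  by (rule card_cells[where mu = mu and nu = m])
   (use pat_cells_good[OF pc regd ok q h] m h ok in "auto simp: pat_ok_def")
 also have "... <= real (card {i \<in> {1..N}. good (d i) & d i 0 <= m})"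
  unfolding of_nat_le_iff by (rule card_mono) auto
 finally show "W < card {i \<in> {1..N}. good (d i) & d i 0 <= m}" using m by linarith
qed

end

context star_reg
begin

lemma N256: "256 <= N"
proof -
 have "(256 :: real) <= 10 ^ 18" by simp
 hence "real 256 <= real N" using N_large(2) by simp
 thus ?thesis by (simp only: of_nat_le_iff)
qed

lemma good_cells_pat:
 assumes "pat_cells q N d mu h J" "pat_ok q mu J" "0 < h"
 shows "good_cells mu h"
 using pat_cells_good[OF assms(1) regd assms(2) q8 N256 assms(3)] by (auto simp: good_cells_def)

lemma fine_cells_first: "first_cells N d (q / N) ==> fine_cells"
proof -
 assume fc: "first_cells N d (q / N)"
 have h: "0 < real q / N" using q8 N1 by simp
 show ?thesis unfolding fine_cells_def
 proof (intro allI impI)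
  fix l :: nat assume "(real l + 1) * (q / N) <= 1"
  then obtain i where "i \<in> {1..N}" "gap (d i) 0 \<in> {real l * (q / N) .. real l * (q / N) + (q / N) / 2}"
   using fc by (auto simp: first_cells_def)
  hence i: "i \<in> {1..N}" "real l * (q / N) <= d i 0" "d i 0 <= real l * (q / N) + (q / N) / 2"
   by (auto simp: gap_def)
  have "real l * x + x / 2 < (real l + 1) * x" if "0 < x" for x :: real
   using that by (simp add: distrib_right)
  from this[OF h] have "real l * (q / N) + (q / N) / 2 < (real l + 1) * (q / N)" .
  hence "d i 0 < (real l + 1) * (q / N)" using i(3) by linarith
  thus "\<exists>i\<in>{1..N}. real l * (q / N) <= d i 0 & d i 0 < (real l + 1) * (q / N)" using i by blast
 qed
qed

lemma few_particles_lines: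
 assumes fl: "few_lines q N d h x" and h: "0 < h" "h <= 1"
 shows "few_particles h (x * q)"
 unfolding few_particles_def
proof (intro allI impI)
 fix l :: nat assume l: "real l * h <= 1"
 define S where "S = {i \<in> {1..N}. \<exists>k<q. d i k \<in> {real l * h .. real l * h + h}}"
 have S: "finite S" "card S <= x" using fl l by (auto simp: S_def few_lines_def)
 have sub: "cell h l <= S \<times> {..<q}"
 proof (rule subsetI)
  fix z assume "z \<in> cell h l"
  then obtain i k where z: "z = (i, k)" "i \<in> {1..N}" "real l * h <= d i k" "d i k < (real l + 1) * h"
   by (auto simp: cell_def)
  have le2: "d i k <= 2" using z(4) l h by (simp add: distrib_right)
  have "k < q"
  proof (rule ccontr)
   assume "~ ?thesis"
   hence "d i q <= 2" using d_le_iff[OF z(2), of q k] le2 by simp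
   moreover have "q / 4 <= d i (0 + q) - d i 0" by (rule reg_lower[OF regd[OF z(2)]]) auto
   moreover have "8 <= real q" using q8 by simp
   ultimately show False using d_pos[OF z(2), of 0] by simp
  qed
  thus "z \<in> S \<times> {..<q}" using z by (auto simp: S_def distrib_right)
 qed
 have "card (cell h l) <= card (S \<times> {..<q})" by (rule card_mono[OF _ sub]) (use S in auto)
 also have "... <= x * q" using S by simp
 finally show "finite (cell h l) & card (cell h l) <= x * q"
  using finite_subset[OF sub] S by auto
qed

end

context star_cleaning
begin

lemma outer_regular:
 assumes NW: "1 <= N" "1 <= W"
 shows "outer_le (%om. ~ regular N W (D om) (C om) q) ((N + W) * (73 * real N ^ 4 * exp (- (q / 5))))"
proof -
 have B: "1 <= real N ^ 4" using NW by (simp add: one_le_power)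
 have d: "outer_le (%om. ~ reg q (real N ^ 4) (D om i)) (73 * real N ^ 4 * exp (- (q / 5)))" if "i \<in> {1..N}" for i
  using prob_not_reg[of "%om. D om i" "%l. (Inl i, l)" "real N ^ 4" q] that B
  by (auto simp: outer_le_def GG_Inl inj_on_def image_subset_iff Bex_def)
 have c: "outer_le (%om. ~ reg q (real N ^ 4) (C om w)) (73 * real N ^ 4 * exp (- (q / 5)))" if "w \<in> {1..W}" for w
  using prob_not_reg[of "%om. C om w" "%l. (Inr w, l)" "real N ^ 4" q] that B
  by (auto simp: outer_le_def GG_Inr inj_on_def image_subset_iff Bex_def)
 have "outer_le (%om. ~ star_real N W (D om) (C om) \<or> (\<exists>i\<in>{1..N}. ~ reg q (real N ^ 4) (D om i)) \<or>
   (\<exists>w\<in>{1..W}. ~ reg q (real N ^ 4) (C om w)))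
   (0 + ((\<Sum>i\<in>{1..N}. 73 * real N ^ 4 * exp (- (q / 5))) + (\<Sum>w\<in>{1..W}. 73 * real N ^ 4 * exp (- (q / 5)))))"
  by (intro outer_or outer_bex d c outer_AE[OF AE_star_real[OF NW]]) auto
 thus ?thesis
  by (rule outer_mono) (auto simp: regular_def distrib_right)
qed

lemma outer_cells:
 assumes h: "0 < h" "h <= 1" and p: "!!l :: nat. P l ==> (real l + 1) * h <= 1 ==> outer_le (Q l) b"
  and b: "0 <= b"
 shows "outer_le (%om. \<exists>l::nat. P l & (real l + 1) * h <= 1 & Q l om) (1 / h * b)"
proof -
 define S where "S = {l :: nat. P l & (real l + 1) * h <= 1}"
 have sub: "S <= {..<nat \<lfloor>1 / h\<rfloor>}"
 proof
  fix l assume "l \<in> S"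
  hence "real l + 1 <= 1 / h" using h by (simp add: S_def pos_le_divide_eq)
  thus "l \<in> {..<nat \<lfloor>1 / h\<rfloor>}" by simp linarith
 qed
 have fin: "finite S" using sub finite_subset by blast
 have "card S <= nat \<lfloor>1 / h\<rfloor>" using card_mono[OF _ sub] by simp
 hence cS: "real (card S) <= 1 / h" using h by (simp add: le_nat_iff) linarith
 have "outer_le (%om. \<exists>l\<in>S. Q l om) (\<Sum>l\<in>S. b)"
  by (rule outer_bex[OF fin]) (use p in "auto simp: S_def")
 thus ?thesis
 proof (rule outer_mono)
  show "(\<Sum>l\<in>S. b) <= 1 / h * b" using mult_right_mono[OF cS b] by simp
 qed (auto simp: S_def)
qed

lemma outer_pat_cells:
 assumes "0 < mu" "0 < h" "h <= 1" "1 <= J" "1 <= q"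
 shows "outer_le (%om. ~ pat_cells q N (D om) mu h J) (1 / h * exp (- (N * (h * good_rate mu J))))"
proof -
 have "outer_le (%om. \<exists>l::nat. mu <= real l * h & (real l + 1) * h <= 1 & (\<forall>i\<in>{1..N}. D om i \<notin> {t. good_pat q mu h J l t}))
   (1 / h * exp (- (N * (h * good_rate mu J))))"
 proof (rule outer_cells[OF assms(2,3)])
  fix l :: nat assume l: "(real l + 1) * h <= 1"
  show "outer_le (%om. \<forall>i\<in>{1..N}. D om i \<notin> {t. good_pat q mu h J l t}) (exp (- (N * (h * good_rate mu J))))"
  proof (cases "N = 0")
   case True
   have "outer_le P 1" for P by (rule outer_leI[of "space M"]) (auto simp: prob_space)
   thus ?thesis using True by simp
  next
   case False
   hence "1 \<in> {1..N}" by simp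
   from good_pat_prob(1)[OF this assms(1,2) l assms(4,5)] show ?thesis
    by (rule outer_no_line) (rule good_pat_prob(2)[OF _ assms(1,2) l assms(4,5)])
  qed
 qed simp
 thus ?thesis by (rule outer_mono) (auto simp: pat_cells_def)
qed

lemma outer_first_cells:
 assumes "0 < h" "h <= 1"
 shows "outer_le (%om. ~ first_cells N (D om) h) (1 / h * exp (- (N * (h / 6))))"
proof -
 have A: "{t :: nat => real. gap t 0 \<in> {a..b}} \<in> sets (PiM UNIV (%_. borel))" for a b :: real
  using measurable_sets[OF gap_meas[of 0], of "{a..b}"] by (simp add: vimage_def space_PiM)
 have p: "h / 6 <= \<P>(om in M. D om i \<in> {t. gap t 0 \<in> {real l * h..real l * h + h / 2}})"
  if i: "i \<in> {1..N}" and l: "(real l + 1) * h <= 1" for i and l :: nat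
 proof -
  have lh: "real l * h + h / 2 <= 1" using assms l by (simp add: algebra_simps)
  have "(real l * h + h / 2 - real l * h) * exp (- (real l * h + h / 2))
    <= \<P>(om in M. GG (Inl i, 0) om \<in> {real l * h..real l * h + h / 2})"
   by (rule prob_window) (use i assms in auto)
  moreover have "h / 2 * (1 / 3) <= h / 2 * exp (- (real l * h + h / 2))"
  proof (rule mult_left_mono)
   have "exp (real l * h + h / 2) <= exp 1" using lh by simp
   also have "exp 1 <= (3 :: real)" using exp_le by simp
   finally show "1 / 3 <= exp (- (real l * h + h / 2))" by (simp add: exp_minus field_simps)
  qed (use assms in simp)
  ultimately show ?thesis by (simp add: GG_Inl)
 qed
 have "outer_le (%om. \<exists>l::nat. True & (real l + 1) * h <= 1 &
   (\<forall>i\<in>{1..N}. D om i \<notin> {t. gap t 0 \<in> {real l * h..real l * h + h / 2}})) (1 / h * exp (- (N * (h / 6))))"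
  by (rule outer_cells[OF assms outer_no_line[OF A p]]) simp_all
 thus ?thesis by (rule outer_mono) (auto simp: first_cells_def)
qed

lemma prob_near:
 assumes i: "i \<in> {1..N}" and h: "0 <= h"
 shows "{om \<in> space M. D om i k \<in> {a..a + h}} \<in> events" "\<P>(om in M. D om i k \<in> {a..a + h}) <= h"
proof -
 show "{om \<in> space M. D om i k \<in> {a..a + h}} \<in> events"
  using measurable_sets[OF D_meas[OF i, of k], of "{a..a + h}"] by (simp add: vimage_def Int_def conj_commute)
 define F where "F = (%l. (Inl i :: nat + nat, l)) ` {..<k}"
 define f where "f g = (\<Sum>l<k. g (Inl i, l))" for g :: "(nat + nat) \<times> nat => real"
 have f: "f \<in> borel_measurable (PiM F (%_. borel))"
  unfolding f_def F_def by (intro borel_measurable_sum measurable_component_singleton) auto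
 have eq: "D om i k = GG (Inl i, k) om + f (restrict (GW om) F)" for om
 proof -
  have "f (restrict (GW om) F) = (\<Sum>l<k. GG (Inl i, l) om)"
   unfolding f_def by (rule sum.cong) (auto simp: F_def)
  moreover have "D om i k = (\<Sum>l<k. GG (Inl i, l) om) + GG (Inl i, k) om"
   using D_sum[of om i k] by (simp add: lessThan_Suc_atMost[symmetric])
  ultimately show ?thesis by simp
 qed
 have "\<P>(om in M. a <= GG (Inl i, k) om + f (restrict (GW om) F) &
   GG (Inl i, k) om + f (restrict (GW om) F) <= a + h) <= h"
  by (rule prob_interval[OF _ _ _ f h]) (use i in "auto simp: F_def")
 thus "\<P>(om in M. D om i k \<in> {a..a + h}) <= h" unfolding eq[symmetric] by simp
qed

text \<open>The halflines are independent, so \<open>exp (s * card ...)\<close> has mean at most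
  \<open>exp (N * b)\<close>. It is applied with \<open>s = 1\<close> to exclude large counts and
  with \<open>s = -1\<close> to exclude small ones.\<close>

lemma outer_chernoff:
 fixes s b y :: real
 assumes A: "A \<in> sets (PiM UNIV (%_. borel))"
  and b: "!!i. i \<in> {1..N} ==> (exp s - 1) * \<P>(om in M. D om i \<in> A) <= b"
 shows "outer_le (%om. y <= s * real (card {i \<in> {1..N}. D om i \<in> A})) (exp (N * b - y))"
proof -
 let ?e = "%i om. ennreal (exp (s * indicat_real A (D om i)))"
 let ?S = "%om. s * (\<Sum>i\<in>{1..N}. indicat_real A (D om i))"
 have ev: "{om \<in> space M. D om i \<in> A} \<in> events" if "i \<in> {1..N}" for i
  using measurable_sets[OF D_rv[OF that] A] by (simp add: vimage_def Int_def conj_commute)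
 have card_eq: "s * real (card {i \<in> {1..N}. D om i \<in> A}) = ?S om" for om
  by (simp add: indicator_def sum.If_cases Int_def)
 let ?E = "%j om. ennreal (exp (s * indicat_real A (case j of Inl i => D om i | Inr w => C om w)))"
 have ind: "indep_vars (%_. borel) ?E (Inl ` {1..N})"
 proof -
  have "indep_vars (%_. borel) ?E ({1..N} <+> {1..W})"
   by (rule indep_vars_compose2[OF indep]) (use A in measurable)
  thus ?thesis by (rule indep_vars_subset) auto
 qed
 have one: "(\<integral>\<^sup>+om. ?e i om \<partial>M) <= ennreal (exp b)" if i: "i \<in> {1..N}" for i
 proof -
  let ?P = "\<P>(om in M. D om i \<in> A)"
  have bi: "has_bochner_integral M (%om. 1 + (exp s - 1) * indicat_real {om \<in> space M. D om i \<in> A} om) (1 + (exp s - 1) * ?P)"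
  proof -
   have "has_bochner_integral M (%om. 1 :: real) (prob (space M))"
    by (rule has_bochner_integral_cong[THEN iffD1, OF refl _ refl has_bochner_integral_real_indicator[OF sets.top]])
     (auto simp: emeasure_eq_measure)
   moreover have "has_bochner_integral M (indicat_real {om \<in> space M. D om i \<in> A}) ?P"
    by (rule has_bochner_integral_real_indicator[OF ev[OF i]]) (simp add: emeasure_eq_measure)
   ultimately show ?thesis
    by (intro has_bochner_integral_add has_bochner_integral_mult_right) (simp_all add: prob_space)
  qed
  have "(\<integral>\<^sup>+om. ?e i om \<partial>M) = (\<integral>\<^sup>+om. ennreal (1 + (exp s - 1) * indicat_real {om \<in> space M. D om i \<in> A} om) \<partial>M)"
   by (rule nn_integral_cong) (auto simp: indicator_def)
  also have "... = ennreal (1 + (exp s - 1) * ?P)"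
   using nn_integral_eq_integral[of M "%om. 1 + (exp s - 1) * indicat_real {om \<in> space M. D om i \<in> A} om"] bi
   by (simp add: has_bochner_integral_iff indicator_def)
  also have "... <= ennreal (exp b)"
   using b[OF i] exp_ge_add_one_self[of b] by (intro ennreal_leI) linarith
  finally show ?thesis .
 qed
 have Sm: "?S \<in> borel_measurable M"
 proof (intro borel_measurable_times borel_measurable_const borel_measurable_sum)
  show "(%om. indicat_real A (D om i)) \<in> borel_measurable M" if "i \<in> {1..N}" for i
   by (rule measurable_compose[OF D_rv[OF that]]) (use A in simp)
 qed
 have evS: "{om \<in> space M. y <= ?S om} \<in> events" using Sm by measurable
 have "ennreal (exp y) * emeasure M {om \<in> space M. y <= ?S om}
   = (\<integral>\<^sup>+om. ennreal (exp y) * indicator {om \<in> space M. y <= ?S om} om \<partial>M)"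
  by (rule nn_integral_cmult_indicator[OF evS, symmetric])
 also have "... <= (\<integral>\<^sup>+om. (\<Prod>i\<in>{1..N}. ?e i om) \<partial>M)"
 proof (rule nn_integral_mono)
  fix om
  have "(\<Prod>i\<in>{1..N}. ?e i om) = ennreal (exp (?S om))"
   by (simp add: prod_ennreal exp_sum[symmetric] sum_distrib_left)
  thus "ennreal (exp y) * indicator {om \<in> space M. y <= ?S om} om <= (\<Prod>i\<in>{1..N}. ?e i om)"
   by (auto split: split_indicator intro!: ennreal_leI)
 qed
 also have "... = (\<integral>\<^sup>+om. (\<Prod>j\<in>Inl ` {1..N}. ?E j om) \<partial>M)"
  by (subst prod.reindex) auto
 also have "... = (\<Prod>j\<in>Inl ` {1..N}. \<integral>\<^sup>+om. ?E j om \<partial>M)"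
  by (rule indep_vars_nn_integral) (use ind in auto)
 also have "... = (\<Prod>i\<in>{1..N}. \<integral>\<^sup>+om. ?e i om \<partial>M)"
  by (subst prod.reindex) auto
 also have "... <= (\<Prod>i\<in>{1..N}. ennreal (exp b))"
  by (intro prod_mono_ennreal one)
 also have "... = ennreal (exp (N * b))"
  by (simp add: ennreal_power exp_of_nat_mult[symmetric])
 finally have "exp y * \<P>(om in M. y <= ?S om) <= exp (N * b)"
  by (simp add: emeasure_eq_measure ennreal_mult''[symmetric])
 hence "\<P>(om in M. y <= ?S om) <= exp (N * b - y)"
  by (simp add: exp_diff pos_le_divide_eq mult.commute)
 with evS show ?thesis unfolding card_eq[symmetric] by (rule outer_meas)
qed

lemma outer_many_lines:
 fixes p :: real
 assumes A: "A \<in> sets (PiM UNIV (%_. borel))" and p: "!!i. i \<in> {1..N} ==> \<P>(om in M. D om i \<in> A) <= p"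
 shows "outer_le (%om. x < card {i \<in> {1..N}. D om i \<in> A}) (exp (2 * N * p - real x))"
proof -
 have "outer_le (%om. real x <= 1 * real (card {i \<in> {1..N}. D om i \<in> A})) (exp (N * (2 * p) - real x))"
 proof (rule outer_chernoff[OF A])
  show "(exp 1 - 1) * \<P>(om in M. D om i \<in> A) <= 2 * p" if "i \<in> {1..N}" for i
   using mult_mono[of "exp 1 - 1 :: real" 2, OF _ p[OF that]] exp_le by simp
 qed
 thus ?thesis by (rule outer_mono) (auto simp: mult_ac)
qed

lemma outer_few_hits:
 fixes p :: real
 assumes A: "A \<in> sets (PiM UNIV (%_. borel))" and p: "!!i. i \<in> {1..N} ==> p <= \<P>(om in M. D om i \<in> A)"
 shows "outer_le (%om. real (card {i \<in> {1..N}. D om i \<in> A}) <= N * p / 4) (exp (- (N * p / 4)))"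
proof -
 have "outer_le (%om. - (N * p / 4) <= - 1 * real (card {i \<in> {1..N}. D om i \<in> A})) (exp (N * (- (p / 2)) - - (N * p / 4)))"
 proof (rule outer_chernoff[OF A])
  fix i assume i: "i \<in> {1..N}"
  have "(2 :: real) <= exp 1" using exp_ge_add_one_self[of 1] by simp
  hence "exp (- 1) - 1 <= (- (1 / 2) :: real)" by (simp add: exp_minus field_simps)
  hence "(exp (- 1) - 1) * \<P>(om in M. D om i \<in> A) <= - (1 / 2) * \<P>(om in M. D om i \<in> A)"
   by (rule mult_right_mono) simp
  thus "(exp (- 1) - 1) * \<P>(om in M. D om i \<in> A) <= - (p / 2)" using p[OF i] by linarith
 qed
 thus ?thesis by (rule outer_mono) auto
qed

lemma outer_few_lines:
 fixes h :: real
 assumes h: "0 < h" "h <= 1"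
 shows "outer_le (%om. ~ few_lines q N (D om) h x) ((1 / h + 1) * exp (2 * N * (q * h) - real x))"
proof -
 define A where "A l = {t :: nat => real. \<exists>k<q. t k \<in> {real l * h .. real l * h + h}}" for l :: nat
 have A: "A l \<in> sets (PiM UNIV (%_. borel))" for l
 proof -
  have "{t \<in> space (PiM UNIV (%_. borel)). \<exists>k\<in>{..<q}. t k \<in> {real l * h .. real l * h + h}} \<in> sets (PiM UNIV (%_. borel))"
   by (rule sets.sets_Collect_finite_Ex) (auto simp: measurable_component_singleton intro!: measurable_sets_Collect)
  thus ?thesis by (simp add: A_def space_PiM Bex_def)
 qed
 have p: "\<P>(om in M. D om i \<in> A l) <= q * h" if i: "i \<in> {1..N}" for i l
 proof -
  have "\<P>(om in M. D om i \<in> A l) = prob (\<Union>k\<in>{..<q}. {om \<in> space M. D om i k \<in> {real l * h .. real l * h + h}})"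
   by (rule arg_cong[where f = prob]) (auto simp: A_def)
  also have "... <= (\<Sum>k\<in>{..<q}. \<P>(om in M. D om i k \<in> {real l * h .. real l * h + h}))"
   by (rule finite_measure_subadditive_finite) (use prob_near[OF i] h in auto)
  also have "... <= (\<Sum>k\<in>{..<q}. h)" by (rule sum_mono) (use prob_near[OF i] h in auto)
  finally show ?thesis by simp
 qed
 define S where "S = {..nat \<lfloor>1 / h\<rfloor>}"
 have "outer_le (%om. \<exists>l\<in>S. x < card {i \<in> {1..N}. D om i \<in> A l}) (\<Sum>l\<in>S. exp (2 * N * (q * h) - real x))"
  by (intro outer_bex outer_many_lines A p) (simp_all add: S_def)
 thus ?thesis
 proof (rule outer_mono)
  have "real (card S) <= 1 / h + 1" using h by (simp add: S_def)
  thus "(\<Sum>l\<in>S. exp (2 * N * (q * h) - real x)) <= (1 / h + 1) * exp (2 * N * (q * h) - real x)"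
   by (simp add: mult_right_mono)
  fix om assume "~ few_lines q N (D om) h x"
  then obtain l :: nat where l: "real l * h <= 1" "x < card {i \<in> {1..N}. D om i \<in> A l}"
   by (auto simp: few_lines_def A_def not_le)
  have "real l <= 1 / h" using l h by (simp add: pos_le_divide_eq)
  hence "l \<in> S" unfolding S_def by simp linarith
  thus "\<exists>l\<in>S. x < card {i \<in> {1..N}. D om i \<in> A l}" using l by blast
 qed
qed

end

section \<open>Measurability of the events in the theorem\<close>

context star_real
begin

lemma jumper_ring_order: "jumper W c = ring_order W c"
 using ring_order_eq by (simp add: fun_eq_iff)

lemma skip_skips: "skip n <-> skips N d (ring_order W c) n"
 unfolding skip_def skips_def tgt_def L_def T_def unfolding jumper_ring_order ..

lemma Z_place: "Z n = place N d (tgt N d (ring_order W c) n) (tgt_index N d (ring_order W c) n)"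
proof -
 have "tgt N d (ring_order W c) n = T n" "tgt_index N d (ring_order W c) n = K n (T n)"
  unfolding tgt_def tgt_index_def T_def K_def unfolding jumper_ring_order by (rule refl)+
 thus ?thesis using T_props(1)[of n] by (simp add: Z_def place_def)
qed

lemma ring_order_in: "ring_order W c n \<in> {1..W}"
 using jumper_props[of n] by (simp add: jumper_ring_order)

lemma sigma_infinite:
 assumes "!!n. Lev n <= m" "m < x"
 shows "sigma_time N W d c x = \<infinity>"
 unfolding sigma_inf_iff
proof (intro allI impI)
 fix n assume "skip n"
 hence "Z n = Lev n" by (intro landing_Z) (simp add: skip_def)
 thus "Z n < x" using assms(1)[of n] assms(2) by simp
qed

end

context star_cleaning
begin

lemma sigma_pred:
 assumes "1 <= N" "1 <= W"
 shows "\<exists>Q. Measurable.pred M Q & (AE om in M. (sigma_time N W (D om) (C om) x = \<infinity>) <-> Q om)"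
proof (intro exI conjI)
 let ?Q = "%om. \<forall>n. skips N (D om) (Jm om) n -->
   place N (D om) (tgt N (D om) (Jm om) n) (tgt_index N (D om) (Jm om) n) < x"
 note [measurable] = skips_meas Z_meas
 show "Measurable.pred M ?Q" by measurable
 show "AE om in M. (sigma_time N W (D om) (C om) x = \<infinity>) <-> ?Q om"
  using AE_star_real[OF assms]
 proof eventually_elim
  case (elim om)
  interpret star_real N W "D om" "C om" by (rule elim)
  show ?case unfolding sigma_inf_iff skip_skips Z_place Jm_def ..
 qed
qed

lemma theta_pred:
 assumes "1 <= N" "1 <= W" "0 <= b"
 shows "\<exists>Q. Measurable.pred M Q & (AE om in M. (theta_time N W (D om) (C om) <= ennreal b) <-> Q om)"
proof (intro exI conjI)
 let ?t = "%n om. if ring_order W (C om) n \<in> {1..W}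
   then C om (ring_order W (C om) n) (ring_counts W (C om) n (ring_order W (C om) n)) else 0"
 let ?Q = "%om. \<forall>n. skips N (D om) (Jm om) n --> ?t n om <= b"
 have "Measurable.pred M (%om. ?t n om <= b)" for n
  unfolding pred_def by (rule borel_measurable_le[OF ring_time_meas borel_measurable_const])
 thus "Measurable.pred M ?Q" by (intro pred_intros_countable pred_intros_logic skips_meas)
 show "AE om in M. (theta_time N W (D om) (C om) <= ennreal b) <-> ?Q om"
  using AE_star_real[OF assms(1,2)]
 proof eventually_elim
  case (elim om)
  interpret star_real N W "D om" "C om" by (rule elim)
  have "?t n om = jump_time W (C om) n" for n
   using ring_order_in[of n] unfolding jump_time_eq by (rule if_P)
  thus ?case unfolding theta_le_iff[OF assms(3)] skip_skips Jm_def by simp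
 qed
qed

lemma separated_pred:
 assumes "1 <= N" "1 <= W"
 shows "\<exists>Q. Measurable.pred M Q & (AE om in M. eventually_separated N W (D om) (C om) <-> Q om)"
proof (intro exI conjI)
 let ?L = "%n w om. fst (st N (D om) (Jm om) n) w"
 let ?Q = "%om. \<exists>m. \<forall>n. m <= n --> (\<forall>w1\<in>{1..W}. \<forall>w2\<in>{1..W}. w1 ~= w2 --> ?L n w1 om ~= ?L n w2 om)"
 have "Measurable.pred M (%om. f om ~= g om)"
  if "f \<in> meas M" "g \<in> meas M" for f g :: "'a => nat"
 proof -
  have "Measurable.pred M (%om. ~ (\<exists>k. f om = k & g om = k))"
   by (intro pred_intros_logic pred_intros_countable pred_eq_const1[OF that(1)] pred_eq_const1[OF that(2)]) simp_all
  moreover have "(%om. ~ (\<exists>k. f om = k & g om = k)) = (%om. f om ~= g om)" by auto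
  ultimately show ?thesis by (simp only:)
 qed
 note ne = this[OF st_meas(1) st_meas(1)]
 show "Measurable.pred M ?Q"
  by (intro pred_intros_countable pred_intros_finite pred_intros_logic ne) simp_all
 show "AE om in M. eventually_separated N W (D om) (C om) <-> ?Q om"
  using AE_star_real[OF assms]
 proof eventually_elim
  case (elim om)
  interpret star_real N W "D om" "C om" by (rule elim)
  show ?case unfolding eventually_separated_iff L_def unfolding jumper_ring_order Jm_def ..
 qed
qed

lemma completion_bounds:
 assumes Q: "\<exists>Q. Measurable.pred M Q & (AE om in M. P om <-> Q om)"
 shows "Measurable.pred (completion M) P"
  and "outer_le (%om. ~ P om) b ==> 1 - b <= \<P>(om in completion M. P om)"
  and "outer_le P b ==> \<P>(om in completion M. P om) <= b"
  and "0 <= \<P>(om in completion M. P om)" "\<P>(om in completion M. P om) <= 1"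
proof -
 obtain Q where Q: "Measurable.pred M Q" "AE om in M. P om <-> Q om" using assms by blast
 note pc = pred_completion[OF Q]
 have ev: "{om \<in> space M. Q om} \<in> events" "{om \<in> space M. ~ Q om} \<in> events"
  using Q(1) by (auto simp: pred_def)
 show "Measurable.pred (completion M) P" by (rule pc(1))
 show "0 <= \<P>(om in completion M. P om)" "\<P>(om in completion M. P om) <= 1"
  unfolding pc(2) by auto
 show "\<P>(om in completion M. P om) <= b" if "outer_le P b"
 proof -
  obtain A where A: "A \<in> events" "{om \<in> space M. P om} <= A" "prob A <= b"
   using \<open>outer_le P b\<close> by (auto simp: outer_le_def)
  have "\<P>(om in M. Q om) <= prob A"
  proof (rule finite_measure_mono_AE)
   show "AE om in M. om \<in> {om \<in> space M. Q om} --> om \<in> A"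
    using Q(2) AE_space
   proof eventually_elim
    case (elim om) thus ?case using A(2) by auto
   qed
  qed (rule A)
  thus ?thesis unfolding pc(2) using A by simp
 qed
 show "1 - b <= \<P>(om in completion M. P om)" if "outer_le (%om. ~ P om) b"
 proof -
  obtain A where A: "A \<in> events" "{om \<in> space M. ~ P om} <= A" "prob A <= b"
   using \<open>outer_le (%om. ~ P om) b\<close> by (auto simp: outer_le_def)
  have "\<P>(om in M. ~ Q om) <= prob A"
  proof (rule finite_measure_mono_AE)
   show "AE om in M. om \<in> {om \<in> space M. ~ Q om} --> om \<in> A"
    using Q(2) AE_space
   proof eventually_elim
    case (elim om) thus ?case using A(2) by auto
   qed
  qed (rule A)
  moreover have "\<P>(om in M. ~ Q om) = 1 - \<P>(om in M. Q om)"
   using prob_compl[OF ev(1)] by (simp add: set_diff_eq Collect_neg_eq[symmetric] conj_commute cong: conj_cong)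
  ultimately show ?thesis unfolding pc(2) using A by simp
 qed
qed

end

section \<open>Size of the chain and pattern probabilities\<close>

lemma prod_two_powers: "(\<Prod>j<n. (2 :: real) ^ j) = 2 powr (real n * (real n - 1) / 2)"
proof (induction n)
 case (Suc n)
 have "(\<Prod>j<Suc n. (2 :: real) ^ j) = 2 powr (real n * (real n - 1) / 2 + real n)"
  by (simp add: Suc powr_add powr_realpow)
 thus ?case by (simp add: field_simps)
qed simp

text \<open>The factors are \<open>2 powr (j + 1 - a)\<close>. The exponent of order
  \<open>a ^ 2 / 2\<close> is the origin of \<open>sqrt (2 * s * log 2 N)\<close> in
  \<open>aa\<close>.\<close>

lemma chain_prob_eq: "chain_prob a ((1 / 2) ^ a) = 2 powr (- (real a * (real a - 1) / 2))"
proof -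
 have half: "(1 / 2 :: real) = 2 powr (- 1)" by (simp add: powr_minus)
 have "chain_prob a ((1 / 2) ^ a) = (\<Prod>j<a. 2 ^ j) * (\<Prod>j<a. 2 * (1 / 2) ^ a)"
  unfolding chain_prob_def prod.distrib[symmetric] by (simp add: mult_ac)
 also have "(\<Prod>j<a. 2 * (1 / 2 :: real) ^ a) = 2 powr (real a * (1 - real a))"
 proof -
  have "2 * (1 / 2 :: real) ^ a = 2 powr (1 - real a)"
   by (simp add: powr_diff powr_realpow power_one_over field_simps)
  thus ?thesis by (simp add: powr_powr powr_realpow[symmetric] mult.commute)
 qed
 finally have "chain_prob a ((1 / 2) ^ a) = 2 powr (real a * (real a - 1) / 2 + real a * (1 - real a))"
  by (simp only: prod_two_powers powr_add)
 also have "real a * (real a - 1) / 2 + real a * (1 - real a) = - (real a * (real a - 1) / 2)"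
  by (simp add: field_simps)
 finally show ?thesis .
qed

text \<open>Over \<open>J\<close> steps the growth factor \<open>2 - 1 / J\<close> loses at most a
  factor 2 against true doubling (Bernoulli). So the slack needed for windows is almost
  free.\<close>

lemma ratio_power:
 assumes "j <= J" "1 <= J"
 shows "2 ^ j / 2 <= (2 - 1 / real J) ^ j" "(2 - 1 / real J) ^ j <= 2 ^ j"
proof -
 have J: "1 <= real J" "real j <= real J" using assms by auto
 have "1 / 2 <= 1 + real j * (- (1 / (2 * real J)))" using J by (simp add: field_simps)
 also have "... <= (1 + (- (1 / (2 * real J)))) ^ j"
  by (rule Bernoulli_inequality) (use J in "simp add: field_simps")
 finally have "2 ^ j * (1 / 2) <= 2 ^ j * (1 - 1 / (2 * real J)) ^ j" by (intro mult_left_mono) auto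
 also have "... = (2 * (1 - 1 / (2 * real J))) ^ j" by (simp only: power_mult_distrib)
 also have "2 * (1 - 1 / (2 * real J)) = 2 - 1 / real J" by (simp add: right_diff_distrib)
 finally show "2 ^ j / 2 <= (2 - 1 / real J) ^ j" by simp
 show "(2 - 1 / real J) ^ j <= 2 ^ j" by (rule power_mono) (use J in "auto simp: field_simps")
qed

text \<open>The leading exponent \<open>(a + 1) ^ 2 / 2\<close> agrees with that of
  \<open>chain_prob\<close>. The rest is of lower order: \<open>(1 / J) ^ J\<close> for the widths
  of the windows, and \<open>exp (- 2 ^ b)\<close> for the densities, because the gap sizes form a
  geometric series with sum at most \<open>2 ^ b\<close>.\<close>

lemma good_rate_ge:
 assumes J: "J = a + 1 + b"
 shows "1 / 12 * 2 powr (- (((real a + 1)\<^sup>2 + 3 * (real a + 1) + 3 * real b) / 2)) * (1 / J) ^ J * exp (- (2 ^ b))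
  <= good_rate ((1 / 2) ^ (a + 1)) J"
proof -
 define mu :: real where "mu = (1 / 2) ^ (a + 1)"
 have mu: "0 < mu" "mu = 2 powr (- (real a + 1))"
 proof -
  show "0 < mu" by (simp add: mu_def)
  have "2 powr (- (real a + 1)) = 1 / 2 powr (real (a + 1))"
   unfolding powr_minus_divide by (simp add: add.commute)
  also have "... = mu" by (simp only: powr_realpow mu_def power_one_over)
  finally show "mu = 2 powr (- (real a + 1))" by simp
 qed
 have J1: "1 <= J" using J by simp
 have geo: "(\<Sum>j<J. 2 ^ j * mu) <= 2 ^ b"
 proof -
  have "(\<Sum>j<J. (2 :: real) ^ j) = 2 ^ J - 1" by (induction J) auto
  hence "(\<Sum>j<J. 2 ^ j * mu) <= 2 ^ J * mu" using mu(1) by (simp add: sum_distrib_right[symmetric])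
  also have "2 ^ J * mu = 2 ^ b" by (simp add: J mu_def power_add power_one_over field_simps)
  finally show ?thesis .
 qed
 have "2 powr (- (((real a + 1)\<^sup>2 + 3 * (real a + 1) + 3 * real b) / 2)) * (1 / J) ^ J * exp (- (2 ^ b))
   <= 2 powr (real J * (real J - 1) / 2 - (real a + 2) * real J) * (1 / J) ^ J * exp (- (\<Sum>j<J. 2 ^ j * mu))"
 proof (intro mult_mono)
  have "- (((real a + 1)\<^sup>2 + 3 * (real a + 1) + 3 * real b) / 2) <= real J * (real J - 1) / 2 - (real a + 2) * real J"
   unfolding J by (simp add: power2_eq_square field_simps)
  thus "2 powr (- (((real a + 1)\<^sup>2 + 3 * (real a + 1) + 3 * real b) / 2))
    <= 2 powr (real J * (real J - 1) / 2 - (real a + 2) * real J)" by simp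
 qed (use geo in auto)
 also have "... = (\<Prod>j<J. 2 ^ j * (mu / (2 * J)) * exp (- (2 ^ j * mu)))"
 proof -
  have "(\<Prod>j<J. mu / (2 * J)) = 2 powr (- (real a + 2) * real J) * (1 / J) ^ J"
  proof -
   have "mu / (2 * J) = 2 powr (- (real a + 2)) * (1 / J)"
   proof -
    have "2 powr (- (real a + 2)) = 2 powr (- (real a + 1) - 1)"
     by (rule arg_cong[where f = "%x. 2 powr x"]) simp
    also have "... = mu / 2" unfolding powr_diff mu(2) by simp
    finally have "2 powr (- (real a + 2)) = mu / 2" .
    thus ?thesis by (simp only:) simp
   qed
   hence "(\<Prod>j<J. mu / (2 * J)) = (2 powr (- (real a + 2))) ^ J * (1 / J) ^ J"
    by (simp only: prod_constant card_lessThan power_mult_distrib)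
   also have "(2 powr (- (real a + 2))) ^ J = 2 powr (- (real a + 2) * real J)"
    by (subst powr_realpow[symmetric]) (simp_all add: powr_powr)
   finally show ?thesis .
  qed
  moreover have "(\<Prod>j<J. exp (- (2 ^ j * mu))) = exp (- (\<Sum>j<J. 2 ^ j * mu))"
   by (simp add: exp_sum sum_negf[symmetric])
  moreover have "2 powr (real J * (real J - 1) / 2 - (real a + 2) * real J)
    = 2 powr (real J * (real J - 1) / 2) * 2 powr (- (real a + 2) * real J)"
   unfolding powr_add[symmetric] by (simp add: algebra_simps)
  ultimately show ?thesis by (simp only: prod.distrib prod_two_powers mult.assoc)
 qed
 also have "... <= (\<Prod>j<J. (2 - 1 / J) ^ j * mu / J * exp (- ((2 - 1 / J) ^ j * mu)))"
 proof (rule prod_mono)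
  fix j assume "j \<in> {..<J}"
  hence r: "2 ^ j / 2 <= (2 - 1 / real J) ^ j" "(2 - 1 / real J) ^ j <= 2 ^ j" using ratio_power[of j J] by auto
  have "2 ^ j * (mu / (2 * J)) = 2 ^ j / 2 * (mu / J)" by simp
  also have "... <= (2 - 1 / real J) ^ j * (mu / J)" by (rule mult_right_mono[OF r(1)]) (use mu in auto)
  finally have 1: "2 ^ j * (mu / (2 * J)) <= (2 - 1 / real J) ^ j * mu / J" by simp
  have 2: "exp (- (2 ^ j * mu)) <= exp (- ((2 - 1 / real J) ^ j * mu))"
   using mult_right_mono[OF r(2), of mu] mu by simp
  have 0: "0 <= 2 ^ j * (mu / (2 * J))" using mu by simp
  thus "0 <= 2 ^ j * (mu / (2 * J)) * exp (- (2 ^ j * mu)) &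
   2 ^ j * (mu / (2 * J)) * exp (- (2 ^ j * mu)) <= (2 - 1 / J) ^ j * mu / J * exp (- ((2 - 1 / J) ^ j * mu))"
   using 1 by (intro conjI mult_nonneg_nonneg mult_mono 0 1 2) (auto simp: order_trans[OF 0 1])
 qed
 finally show ?thesis unfolding good_rate_def mu_def by simp
qed

section \<open>Asymptotics\<close>

text \<open>The choice of \<open>aa\<close> makes \<open>aa s N\<close> gaps of sizes \<open>2\<^sup>j * mm s N\<close> have probability about \<open>N powr (- s)\<close>.\<close>

definition qq :: "real => nat => nat" where "qq dl N = nat \<lceil>N pw dl\<rceil>"
definition aa :: "real => nat => nat" where "aa s N = nat \<lfloor>sqrt (2 * s * log 2 N)\<rfloor>"
definition mm :: "real => nat => real" where "mm s N = (1 / 2) ^ aa s N"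
text \<open>The further doublings that take the distance from order 1 past
  \<open>ln (128 * qq dl N)\<close>, as \<open>pat_ok\<close> demands.\<close>

definition bb :: "real => nat => nat" where "bb dl N = nat \<lceil>log 2 (2 * ln (128 * real (qq dl N)))\<rceil>"
definition JJ :: "real => real => nat => nat" where "JJ s dl N = aa s N + 1 + bb dl N"

lemma qq_bounds:
 assumes "0 < dl"
 shows "N pw dl <= qq dl N" "1 <= N ==> qq dl N <= 2 * N pw dl"
proof -
 have p: "0 <= N pw dl" by simp
 show "N pw dl <= qq dl N" unfolding qq_def using p by linarith
 assume "1 <= N"
 hence "1 <= N pw dl" using assms by (intro ge_one_powr_ge_zero) auto
 thus "qq dl N <= 2 * N pw dl" unfolding qq_def by linarith
qed

lemma aa_bounds:
 assumes "0 < s" "1 <= N"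
 shows "real (aa s N) <= sqrt (2 * s * log 2 N)" "sqrt (2 * s * log 2 N) - 1 <= aa s N"
proof -
 have "0 <= sqrt (2 * s * log 2 N)" using assms by simp
 thus "real (aa s N) <= sqrt (2 * s * log 2 N)" "sqrt (2 * s * log 2 N) - 1 <= aa s N"
  unfolding aa_def by linarith+
qed

lemma powr_log2: "0 < x ==> 2 powr (y * log 2 x) = x powr y"
 by (metis mult.commute powr_log_cancel powr_powr zero_less_numeral numeral_eq_one_iff semiring_norm(85))

lemma ev_ge: "eventually (%N. k <= N) (sequentially :: nat filter)"
 by (rule eventually_ge_at_top)

lemma mm_ge:
 assumes "0 < s" "0 < dl"
 shows "EV N. N pw (- dl) <= mm s N"
proof -
 have "EV N. sqrt (2 * s * log 2 (real N)) <= dl * log 2 (real N)"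
  using assms by real_asymp
 thus ?thesis using ev_ge[of 1]
 proof eventually_elim
  case (elim N)
  have "N pw (- dl) = 2 powr (- dl * log 2 N)" using elim(2) by (simp only: powr_log2[of "real N" "- dl"])
  also have "... <= 2 powr (- real (aa s N))" using elim aa_bounds[OF assms(1) elim(2)] by simp
  also have "... = mm s N" by (simp add: mm_def powr_minus_divide powr_realpow power_one_over)
  finally show ?case .
 qed
qed

lemma mm_small:
 assumes "0 < s" "0 < x"
 shows "EV N. mm s N < x"
proof -
 have "EV N. 2 powr (1 - sqrt (2 * s * log 2 (real N))) < x"
  using assms by real_asymp
 thus ?thesis using ev_ge[of 1]
 proof eventually_elim
  case (elim N)
  have "mm s N = 2 powr (- real (aa s N))" by (simp add: mm_def powr_minus_divide powr_realpow power_one_over)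
  also have "... <= 2 powr (1 - sqrt (2 * s * log 2 (real N)))" using aa_bounds[OF assms(1) elim(2)] by simp
  finally show ?case using elim by simp
 qed
qed

lemma chain_prob_le:
 assumes "0 < s" "0 < dl"
 shows "EV N. chain_prob (aa s N) (mm s N) <= N pw (- s + dl)"
proof -
 have "EV N. 3 * sqrt (2 * s * log 2 (real N)) <= 2 * dl * log 2 (real N)"
  "EV N. 2 <= sqrt (2 * s * log 2 (real N))"
  using assms by real_asymp+
 thus ?thesis using ev_ge[of 1]
 proof eventually_elim
  case (elim N)
  define u where "u = sqrt (2 * s * log 2 (real N))"
  have u2: "u * u = 2 * s * log 2 (real N)" unfolding u_def using assms elim(3) by simp
  have "(u - 1) * (u - 2) <= real (aa s N) * (real (aa s N) - 1)"
   by (rule mult_mono) (use aa_bounds[OF assms(1) elim(3)] elim(2) in "auto simp: u_def")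
  hence "2 * s * log 2 (real N) - 3 * u + 2 <= real (aa s N) * (real (aa s N) - 1)"
   using u2 by (simp add: algebra_simps)
  hence "2 * (s * log 2 (real N)) - 2 * (dl * log 2 (real N)) <= real (aa s N) * (real (aa s N) - 1)"
   using elim(1) by (simp add: u_def)
  hence "- (real (aa s N) * (real (aa s N) - 1) / 2) <= (- s + dl) * log 2 N"
   unfolding distrib_right by linarith
  hence "chain_prob (aa s N) (mm s N) <= 2 powr ((- s + dl) * log 2 N)"
   unfolding mm_def chain_prob_eq by simp
  thus ?case using elim(3) by (simp only: powr_log2[of "real N" "- s + dl"])
 qed
qed

text \<open>\<open>e\<close> more doublings raise the final distance by \<open>2 ^ e\<close>. They
  raise the sum of the gap sizes by the same factor, and since this sum is of order
  \<open>dl * ln N\<close> and stands in an exponential, \<open>4 * 2 ^ e * dl\<close> appears in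
  the exponent of \<open>N\<close>. The last bound pays for the clock patterns and the splitting of
  the dust windows in the trap.\<close>

lemma good_rate_mm:
 assumes "0 < s" "0 < dl"
 shows "EV N. N pw (- s - (4 * 2 ^ e + 1) * dl) <= good_rate (mm s N / 2) (JJ s dl N + e) &
  2 ^ e * ln (128 * real (qq dl N)) <= (2 - 1 / real (JJ s dl N + e)) ^ (JJ s dl N + e) * (mm s N / 2) &
  (1 / (2048 * real (JJ s dl N + e))) ^ (2 * (JJ s dl N + e)) \<ge> N pw (- dl)"
proof -
 let ?u = "%N. sqrt (2 * s * log 2 (real N))" and ?v = "%N. log 2 (2 * ln (256 * N pw dl)) + 1"
 have e1: "EV N. 4 + (2 * ?u N + 1 + 3 * (?u N + 1) + 3 * (2 * ?v N)) / 2 +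
   (?u N + 1 + 2 * ?v N) * log 2 (?u N + 1 + 2 * ?v N) <= dl / 2 * log 2 (real N)"
  using assms by real_asymp
 have e1': "EV N. (?u N + 1 + 2 * ?v N) * (11 + log 2 (?u N + 1 + 2 * ?v N)) <= dl / 2 * log 2 (real N)"
  using assms by real_asymp
 have e2: "EV N. 8 <= N pw dl" using assms by real_asymp
 have e3: "EV N. real e <= ?v N" using assms by real_asymp
 have e4: "EV N. 32 * 2 ^ e <= dl / 2 * log 2 (real N)" using assms by real_asymp
 show ?thesis using e1 e1' e2 e3 e4 ev_ge[of 2]
 proof eventually_elim
  case (elim N)
  define u v where "u = ?u N" and "v = ?v N"
  define q a b J where "q = qq dl N" and "a = aa s N" and "b = bb dl N + e" and "J = JJ s dl N + e"
  have q: "8 <= real q" "real q <= 2 * N pw dl"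
   using qq_bounds[OF assms(2), of N] elim by (auto simp: q_def)
  have l1: "1 <= ln (128 * real q)"
  proof -
   have "exp 1 <= (3 :: real)" by (rule exp_le)
   hence "exp 1 <= 128 * real q" using q by simp
   thus ?thesis using q by (subst ln_ge_iff) auto
  qed
  have b0: "bb dl N = nat \<lceil>log 2 (2 * ln (128 * real q))\<rceil>" by (simp add: bb_def q_def)
  have lb: "0 <= log 2 (2 * ln (128 * real q))" using l1 by (subst zero_le_log_cancel_iff) auto
  have b1: "log 2 (2 * ln (128 * real q)) <= bb dl N" "bb dl N <= log 2 (2 * ln (128 * real q)) + 1"
   unfolding b0 using lb by linarith+
  have b2: "2 ^ e * (2 * ln (128 * real q)) <= 2 ^ b"
  proof -
   have "2 * ln (128 * real q) = 2 powr (log 2 (2 * ln (128 * real q)))" using l1 by simp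
   also have "... <= 2 powr bb dl N" using b1 by simp
   finally show ?thesis by (simp add: powr_realpow b_def power_add)
  qed
  have b3: "2 ^ b <= 2 ^ e * (4 * ln (128 * real q))"
  proof -
   have "2 powr bb dl N <= 2 powr (log 2 (2 * ln (128 * real q)) + 1)" using b1 by simp
   also have "... = 4 * ln (128 * real q)" using l1 by (simp add: powr_add)
   finally show ?thesis by (simp add: powr_realpow b_def power_add)
  qed
  have lnq: "ln (128 * real q) <= ln (256 * N pw dl)"
   by (subst ln_le_cancel_iff) (use q elim in auto)
  have bv: "real b <= 2 * v"
  proof -
   have "2 * ln (128 * real q) <= 2 * ln (256 * N pw dl)" using lnq by simp
   hence "log 2 (2 * ln (128 * real q)) <= log 2 (2 * ln (256 * N pw dl))"
    using l1 by (subst log_le_cancel_iff) auto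
   thus ?thesis using b1 elim(4) by (simp add: v_def b_def)
  qed
  have au: "real a <= u" using aa_bounds(1)[OF assms(1), of N] elim by (simp add: a_def u_def)
  have u0: "0 <= u" and u2: "u\<^sup>2 = 2 * s * log 2 (real N)" using assms elim(6) by (auto simp: u_def)
  have J: "J = a + 1 + b" by (simp add: J_def JJ_def a_def b_def)
  have mu: "mm s N / 2 = (1 / 2) ^ (a + 1)" by (simp add: mm_def a_def)
  have pok: "2 ^ e * ln (128 * real q) <= (2 - 1 / J) ^ J * (mm s N / 2)"
  proof -
   have "2 ^ e * ln (128 * real q) <= 2 ^ b / 2" using b2 by simp
   also have "... = 2 ^ J / 2 * (1 / 2) ^ (a + 1)" by (simp add: J power_add power_one_over field_simps)
   also have "... <= (2 - 1 / J) ^ J * (1 / 2) ^ (a + 1)"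
    by (rule mult_right_mono[OF ratio_power(1)]) (use J in auto)
   finally show ?thesis unfolding mu .
  qed
  have J1: "1 <= real J" "real J <= u + 1 + 2 * v" using J au bv by auto
  have sq: "(real a + 1)\<^sup>2 <= 2 * s * log 2 (real N) + 2 * u + 1"
  proof -
   have "(real a + 1)\<^sup>2 <= (u + 1)\<^sup>2" by (rule power_mono) (use au in auto)
   thus ?thesis using u2 by (simp add: power2_eq_square algebra_simps)
  qed
  have Jl: "real J * log 2 J <= (u + 1 + 2 * v) * log 2 (u + 1 + 2 * v)"
   by (rule mult_mono) (use J1 in auto)
  have tot: "4 + ((real a + 1)\<^sup>2 + 3 * (real a + 1) + 3 * real b) / 2 + real J * log 2 J + 2 ^ e * (32 + 4 * dl * log 2 N)
    <= (s + (4 * 2 ^ e + 1) * dl) * log 2 N"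
  proof -
   have "4 + (2 * u + 1 + 3 * (u + 1) + 3 * (2 * v)) / 2 + (u + 1 + 2 * v) * log 2 (u + 1 + 2 * v) <= dl / 2 * log 2 N"
    using elim(1) unfolding u_def v_def .
   moreover have "((real a + 1)\<^sup>2 + 3 * (real a + 1) + 3 * real b) / 2
     <= s * log 2 N + (2 * u + 1 + 3 * (u + 1) + 3 * (2 * v)) / 2"
    using sq au bv by (simp add: field_simps)
   moreover have "(s + (4 * 2 ^ e + 1) * dl) * log 2 N + 32 * 2 ^ e =
     s * log 2 N + 2 ^ e * (32 + 4 * dl * log 2 N) + (dl / 2 * log 2 N + dl / 2 * log 2 N)"
    by (simp add: algebra_simps)
   ultimately show ?thesis using Jl elim(5) by linarith
  qed
  have ex: "2 powr (- (2 ^ e * (32 + 4 * dl * log 2 N))) <= exp (- (2 ^ b))"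
  proof -
   have "2 powr (- (2 ^ e * (32 + 4 * dl * log 2 N))) = exp (- (2 ^ e * (4 * ln (256 * N pw dl))))"
   proof -
    have "ln (256 * N pw dl) = 8 * ln 2 + dl * ln N"
    proof -
     have "ln (256 :: real) = ln (2 ^ 8)" by simp
     also have "... = 8 * ln 2" by (subst ln_realpow) auto
     finally show ?thesis using elim(6) by (simp add: ln_mult ln_powr)
    qed
    thus ?thesis by (simp add: powr_def log_def field_simps)
   qed
   also have "... <= exp (- (2 ^ b))"
   proof -
    have "2 ^ e * (4 * ln (128 * real q)) <= 2 ^ e * (4 * ln (256 * N pw dl))" using lnq by simp
    hence "2 ^ b <= 2 ^ e * (4 * ln (256 * N pw dl))" using b3 by linarith
    thus ?thesis by simp
   qed
   finally show ?thesis .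
  qed
  have "N pw (- s - (4 * 2 ^ e + 1) * dl) = 2 powr ((- s - (4 * 2 ^ e + 1) * dl) * log 2 N)"
   using elim(6) by (simp only: powr_log2[of "real N" "- s - (4 * 2 ^ e + 1) * dl"])
  also have "... <= 2 powr (- 4 + - (((real a + 1)\<^sup>2 + 3 * (real a + 1) + 3 * real b) / 2) + - (real J * log 2 J) + - (2 ^ e * (32 + 4 * dl * log 2 N)))"
  proof -
   have "(- s - (4 * 2 ^ e + 1) * dl) * log 2 N = - ((s + (4 * 2 ^ e + 1) * dl) * log 2 N)" by (simp add: algebra_simps)
   thus ?thesis using tot by (intro powr_mono) linarith+
  qed
  also have "... = 2 powr (- 4) * 2 powr (- (((real a + 1)\<^sup>2 + 3 * (real a + 1) + 3 * real b) / 2)) * 2 powr (- (real J * log 2 J)) * 2 powr (- (2 ^ e * (32 + 4 * dl * log 2 N)))"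
   by (simp only: powr_add)
  also have "... <= 1 / 12 * 2 powr (- (((real a + 1)\<^sup>2 + 3 * (real a + 1) + 3 * real b) / 2)) * (1 / J) ^ J * exp (- (2 ^ b))"
  proof (intro mult_mono ex)
   have "2 powr (- (real J * log 2 J)) = 1 / 2 powr (real J * log 2 J)" by (rule powr_minus_divide)
   also have "2 powr (real J * log 2 J) = real J ^ J" using J1 by (simp add: powr_log2 powr_realpow)
   finally show "2 powr (- (real J * log 2 J)) <= (1 / J) ^ J" by (simp add: power_one_over)
   have "(2 :: real) powr (- 4) = 1 / 2 powr (real 4)" by (simp add: powr_minus_divide)
   also have "... = 1 / 16" by (simp only: powr_realpow) simp
   finally show "(2 :: real) powr (- 4) <= 1 / 12" by simp
  qed auto
  also have "... <= good_rate (mm s N / 2) J" unfolding mu by (rule good_rate_ge[OF J])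
  finally have main: "N pw (- s - (4 * 2 ^ e + 1) * dl) <= good_rate (mm s N / 2) J" .
  have "N pw (- dl) <= (1 / (2048 * J)) ^ (2 * J)"
  proof -
   have "N pw (- dl) = 2 powr (- dl * log 2 N)"
    using elim(6) by (simp only: powr_log2[of "real N" "- dl"])
   also have "... <= 2 powr (- (2 * real J * log 2 (2048 * J)))"
   proof -
    have "log 2 (2048 * real J) = 11 + log 2 J"
    proof -
     have "log 2 (2048 :: real) = log 2 (2 ^ 11)" by simp
     also have "... = 11" by (simp only: log_pow_cancel)
     finally show ?thesis using J1 by (simp add: log_mult)
    qed
    moreover have "real J * (11 + log 2 J) <= (u + 1 + 2 * v) * (11 + log 2 (u + 1 + 2 * v))"
     by (rule mult_mono) (use J1 in auto)
    moreover have "(u + 1 + 2 * v) * (11 + log 2 (u + 1 + 2 * v)) <= dl / 2 * log 2 N"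
     using elim(2) unfolding u_def v_def .
    ultimately show ?thesis by (intro powr_mono) (auto simp: algebra_simps)
   qed
   also have "... = 1 / (2048 * real J) powr (2 * real J)"
   proof -
    have "0 < 2048 * real J" using J1 by simp
    thus ?thesis unfolding powr_minus_divide by (subst powr_log2) auto
   qed
   also have "... = 1 / (2048 * real J) powr (real (2 * J))" by simp
   also have "... = (1 / (2048 * J)) ^ (2 * J)"
    using J1 by (subst powr_realpow) (simp_all add: power_one_over)
   finally show ?thesis .
  qed
  thus ?case using main pok by (simp only: J_def q_def) simp
 qed
qed

lemma good_rate_mm0:
 assumes "0 < s" "0 < dl"
 shows "EV N. N pw (- s - 5 * dl) <= good_rate (mm s N / 2) (JJ s dl N) &
  pat_ok (qq dl N) (mm s N / 2) (JJ s dl N)"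
 using good_rate_mm[OF assms, of 0]
 by eventually_elim (simp add: pat_ok_def mm_def JJ_def)

lemma mm_pos: "0 < mm s N" "mm s N <= 1" "0 <= mm s N"
 by (auto simp: mm_def power_le_one)

lemma chain_prob_nonneg: "0 <= m ==> 0 <= chain_prob a m"
 unfolding chain_prob_def by (intro prod_nonneg) auto

lemma powr_pow: "0 < x ==> (x powr a) ^ n = x powr (a * real n)"
 by (simp add: powr_powr powr_realpow[symmetric])

section \<open>Events whose probability tends to 0 as \<open>N\<close> grows\<close>

locale star_family =
 fixes \<alpha> :: real and M :: "nat => 'a measure" and D C :: "nat => 'a => nat => nat => real"
 assumes a0: "0 < \<alpha>" and a1: "\<alpha> < 1"
  and SC: "!!N. 1 <= N ==> star_cleaning (M N) N (num_workers \<alpha> N) (D N) (C N)"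
begin

abbreviation "W N \<equiv> num_workers \<alpha> N"

definition unlikely :: "(nat => 'a => bool) => bool" where
 "unlikely P <-> (\<exists>b. (EV N. prob_space.outer_le (M N) (P N) (b N)) & b \<longlonglongrightarrow> 0)"

lemma PS: "1 <= N ==> prob_space (M N)"
 using SC star_cleaning.axioms(1) by blast

lemma unlikelyI:
 assumes "EV N. prob_space.outer_le (M N) (P N) (b N)"
  "EV N. b N <= f N" "f \<longlonglongrightarrow> 0"
 shows "unlikely P"
 unfolding unlikely_def
proof (intro exI conjI)
 show "EV N. prob_space.outer_le (M N) (P N) (f N)"
  using assms(1,2) ev_ge[of 1]
 proof eventually_elim
  case (elim N)
  show ?case by (rule prob_space.outer_mono[OF PS[OF elim(3)] elim(1,2)])
 qed
qed (rule assms(3))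

lemma unlikely_or:
 assumes "unlikely P" "unlikely Q"
 shows "unlikely (%N om. P N om \<or> Q N om)"
proof -
 obtain b b' where b: "EV N. prob_space.outer_le (M N) (P N) (b N)" "b \<longlonglongrightarrow> 0"
  "EV N. prob_space.outer_le (M N) (Q N) (b' N)" "b' \<longlonglongrightarrow> 0"
  using assms by (auto simp: unlikely_def)
 show ?thesis unfolding unlikely_def
 proof (intro exI conjI)
  show "EV N. prob_space.outer_le (M N) (%om. P N om \<or> Q N om) (b N + b' N)"
   using b(1,3) ev_ge[of 1]
  proof eventually_elim
   case (elim N)
   show ?case by (rule prob_space.outer_or[OF PS[OF elim(3)] elim(1,2)])
  qed
  show "(%N. b N + b' N) \<longlonglongrightarrow> 0" using tendsto_add[OF b(2,4)] by simp
 qed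
qed

lemma unlikely_mono:
 assumes "unlikely P" "EV N. \<forall>om\<in>space (M N). Q N om --> P N om"
 shows "unlikely Q"
proof -
 obtain b where b: "EV N. prob_space.outer_le (M N) (P N) (b N)" "b \<longlonglongrightarrow> 0"
  using assms by (auto simp: unlikely_def)
 show ?thesis unfolding unlikely_def
 proof (intro exI conjI)
  show "EV N. prob_space.outer_le (M N) (Q N) (b N)"
   using b(1) assms(2) ev_ge[of 1]
  proof eventually_elim
   case (elim N)
   show ?case by (rule prob_space.outer_mono[OF PS[OF elim(3)] elim(1) order_refl]) (use elim(2) in blast)
  qed
 qed (rule b(2))
qed

lemma W_bounds:
 assumes "1 <= N"
 shows "real (W N) <= N pw \<alpha>" "N pw \<alpha> / 2 <= W N" "1 <= W N" "W N <= N"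
proof -
 have p: "1 <= N pw \<alpha>" using assms a0 by (intro ge_one_powr_ge_zero) auto
 have "N pw \<alpha> <= N pw 1" using assms a1 by (intro powr_mono) auto
 hence p2: "N pw \<alpha> <= real N" using assms by simp
 show 1: "real (W N) <= N pw \<alpha>" unfolding num_workers_def using p by linarith
 show "1 <= W N" unfolding num_workers_def using p by linarith
 have "1 <= \<lfloor>N pw \<alpha>\<rfloor>" using p by simp
 hence "real (nat \<lfloor>N pw \<alpha>\<rfloor>) = of_int \<lfloor>N pw \<alpha>\<rfloor>" "(1 :: real) <= of_int \<lfloor>N pw \<alpha>\<rfloor>" by auto
 thus "N pw \<alpha> / 2 <= W N" unfolding num_workers_def by linarith
 show "W N <= N" using 1 p2 by linarith
qed

lemma unlikely_not_regular:
 assumes "0 < dl"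
 shows "unlikely (%N om. ~ regular N (W N) (D N om) (C N om) (qq dl N))"
proof (rule unlikelyI)
 show "EV N. prob_space.outer_le (M N) (%om. ~ regular N (W N) (D N om) (C N om) (qq dl N))
   (real (N + W N) * (73 * real N ^ 4 * exp (- (real (qq dl N) / 5))))"
  using ev_ge[of 1]
 proof eventually_elim
  case (elim N)
  show ?case by (rule star_cleaning.outer_regular[OF SC[OF elim] elim W_bounds(3)[OF elim]])
 qed
 show "EV N. real (N + W N) * (73 * real N ^ 4 * exp (- (real (qq dl N) / 5)))
   <= 2 * real N * (73 * real N ^ 4 * exp (- (N pw dl / 5)))"
  using ev_ge[of 1]
 proof eventually_elim
  case (elim N)
  show ?case
   by (intro mult_mono) (use W_bounds[OF elim] qq_bounds[OF assms, of N] in auto)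
 qed
 show "(%N. 2 * real N * (73 * real N ^ 4 * exp (- (N pw dl / 5)))) \<longlonglongrightarrow> 0"
  using assms by real_asymp
qed

text \<open>By \<open>ge\<close> a cell contains at least \<open>N powr dl\<close> patterns on
  average, so a single cell is empty with a probability that outweighs the at most
  \<open>N ^ 2\<close> cells.\<close>

lemma unlikely_not_pat_cells:
 assumes s: "0 < s" "0 < dl" and h: "EV N. 0 < h N & h N <= 1 & 1 / h N <= real N ^ 2"
  and ge: "EV N. N pw dl <= N * (h N * N pw (- s - 5 * dl))"
 shows "unlikely (%N om. ~ pat_cells (qq dl N) N (D N om) (mm s N / 2) (h N) (JJ s dl N))"
proof (rule unlikelyI)
 have p8: "EV N. 1 <= N pw dl" using s by real_asymp
 show "EV N. prob_space.outer_le (M N) (%om. ~ pat_cells (qq dl N) N (D N om) (mm s N / 2) (h N) (JJ s dl N))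
   (1 / h N * exp (- (real N * (h N * good_rate (mm s N / 2) (JJ s dl N)))))"
  using ev_ge[of 1] h p8
 proof eventually_elim
  case (elim N)
  show ?case
  proof (rule star_cleaning.outer_pat_cells[OF SC[OF elim(1)]])
   show "1 <= qq dl N" using qq_bounds(1)[OF s(2), of N] elim(3) by linarith
  qed (use elim in "auto simp: mm_def JJ_def")
 qed
 show "EV N. 1 / h N * exp (- (real N * (h N * good_rate (mm s N / 2) (JJ s dl N))))
   <= real N ^ 2 * exp (- (N pw dl))"
  using h ge good_rate_mm0[OF s]
 proof eventually_elim
  case (elim N)
  have "N * (h N * N pw (- s - 5 * dl)) <= N * (h N * good_rate (mm s N / 2) (JJ s dl N))"
   by (intro mult_left_mono) (use elim in auto)
  thus ?case by (intro mult_mono) (use elim in auto)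
 qed
 show "(%N. real N ^ 2 * exp (- (N pw dl))) \<longlonglongrightarrow> 0"
  using s by real_asymp
qed

text \<open>Twice the bound \<open>N * (q * h)\<close> for the mean number of halflines with a
  particle in the cell, plus \<open>q\<close> for the exponential tail.\<close>

definition xx :: "real => (nat => real) => nat => nat" where
 "xx dl h N = nat \<lceil>2 * real N * (real (qq dl N) * h N) + real (qq dl N)\<rceil>"

lemma unlikely_not_few_lines:
 assumes s: "0 < dl" and h: "EV N. 0 < h N & h N <= 1 & 1 / h N <= real N ^ 2"
 shows "unlikely (%N om. ~ few_lines (qq dl N) N (D N om) (h N) (xx dl h N))"
proof (rule unlikelyI)
 show "EV N. prob_space.outer_le (M N) (%om. ~ few_lines (qq dl N) N (D N om) (h N) (xx dl h N))
   ((1 / h N + 1) * exp (real (2 * N) * (real (qq dl N) * h N) - real (xx dl h N)))"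
  using ev_ge[of 1] h
 proof eventually_elim
  case (elim N)
  show ?case
   by (rule star_cleaning.outer_few_lines[OF SC[OF elim(1)]]) (use elim in auto)
 qed
 show "EV N. (1 / h N + 1) * exp (real (2 * N) * (real (qq dl N) * h N) - real (xx dl h N))
   <= (real N ^ 2 + 1) * exp (- (N pw dl))"
  using h
 proof eventually_elim
  case (elim N)
  have "2 * real N * (qq dl N * h N) + qq dl N <= xx dl h N" unfolding xx_def by linarith
  hence "real (2 * N) * (real (qq dl N) * h N) - real (xx dl h N) <= - (N pw dl)"
   using qq_bounds(1)[OF s, of N] by simp
  thus ?case by (intro mult_mono) (use elim in auto)
 qed
 show "(%N. (real N ^ 2 + 1) * exp (- (N pw dl))) \<longlonglongrightarrow> 0"
  using s by real_asymp
qed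

lemma unlikely_not_first_cells:
 assumes s: "0 < dl" "dl < 1"
 shows "unlikely (%N om. ~ first_cells N (D N om) (qq dl N / N))"
proof (rule unlikelyI)
 have 1: "EV N. 2 * N pw dl <= real N" "EV N. 1 <= N pw dl"
  using s by real_asymp+
 show "EV N. prob_space.outer_le (M N) (%om. ~ first_cells N (D N om) (qq dl N / N))
   (1 / (qq dl N / N) * exp (- (real N * (qq dl N / N / 6))))"
  using ev_ge[of 1] 1
 proof eventually_elim
  case (elim N)
  show ?case
   by (rule star_cleaning.outer_first_cells[OF SC[OF elim(1)]]) (use qq_bounds[OF s(1), of N] elim in auto)
 qed
 show "EV N. 1 / (qq dl N / N) * exp (- (real N * (qq dl N / N / 6))) <= real N * exp (- (N pw dl / 6))"
  using ev_ge[of 1] 1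
 proof eventually_elim
  case (elim N)
  have q: "1 <= real (qq dl N)" "N pw dl <= qq dl N" using qq_bounds[OF s(1), of N] elim by auto
  show ?case by (intro mult_mono) (use q elim(1) in "auto simp: field_simps")
 qed
 show "(%N. real N * exp (- (N pw dl / 6))) \<longlonglongrightarrow> 0" using s by real_asymp
qed

text \<open>There are about \<open>N powr (1 - s)\<close> chain halflines; for \<open>s\<close>
  above \<open>1 - \<alpha>\<close> they can hold only a small part of the workers, which is what
  \<open>phase1\<close> needs.\<close>

lemma unlikely_chains:
 assumes s: "0 < s" "0 < dl" and \<alpha>: "1 - s + 2 * dl < \<alpha>"
 shows "unlikely (%N om. real (W N) / (2 * qq dl N) <=
  card {i \<in> {1..N}. \<forall>j<aa s N. gap (D N om i) j <= 2 ^ (j + 1) * mm s N})"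
proof (rule unlikelyI)
 have 1: "EV N. 1 <= N pw dl" using s by real_asymp
 show "EV N. prob_space.outer_le (M N) (%om. real (W N) / (2 * qq dl N) <=
   card {i \<in> {1..N}. \<forall>j<aa s N. gap (D N om i) j <= 2 ^ (j + 1) * mm s N})
   (card {1..N} * chain_prob (aa s N) (mm s N) / (real (W N) / (2 * qq dl N)))"
  using ev_ge[of 1] 1
 proof eventually_elim
  case (elim N)
  interpret star_cleaning "M N" N "W N" "D N" "C N" by (rule SC[OF elim(1)])
  show ?case
  proof (rule outer_count)
   show "outer_le (%om. \<forall>j<aa s N. gap (D N om i) j <= 2 ^ (j + 1) * mm s N) (chain_prob (aa s N) (mm s N))"
    if "i \<in> {1..N}" for i
    by (rule outer_chain_lines[OF mm_pos(3) that])
   have "0 < real (qq dl N)" "0 < real (W N)" using elim qq_bounds(1)[OF s(2), of N] W_bounds[OF elim(1)] by linarith+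
   thus "0 < real (W N) / real (2 * qq dl N)" by simp
  qed simp
 qed
 show "EV N. card {1..N} * chain_prob (aa s N) (mm s N) / (real (W N) / (2 * qq dl N))
   <= real N * N pw (- s + dl) / (N pw \<alpha> / 2 / (4 * N pw dl))"
  using ev_ge[of 1] 1 chain_prob_le[OF s]
 proof eventually_elim
  case (elim N)
  have "0 < N pw \<alpha>" using elim by simp
  moreover have "0 < real (qq dl N)" using elim qq_bounds[OF s(2), of N] by linarith
  ultimately show ?case
   by (intro frac_le mult_mono) (use elim W_bounds[OF elim(1)] qq_bounds[OF s(2), of N] chain_prob_nonneg[OF mm_pos(3)] in "auto intro!: mult_pos_pos divide_pos_pos")
 qed
 show "(%N. real N * N pw (- s + dl) / (N pw \<alpha> / 2 / (4 * N pw dl))) \<longlonglongrightarrow> 0"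
 proof -
  have "EV N. real N * N pw (- s + dl) / (N pw \<alpha> / 2 / (4 * N pw dl))
    = 8 * N pw (1 - s + 2 * dl - \<alpha>)"
   using ev_ge[of 1]
  proof eventually_elim
   case (elim N)
   have "N pw (1 - s + 2 * dl - \<alpha>) = N pw (1 + (- s + dl) + dl - \<alpha>)" by (simp add: algebra_simps)
   also have "... = real N * N pw (- s + dl) * N pw dl / N pw \<alpha>"
    using elim by (simp only: powr_add powr_diff) simp
   finally show ?case by simp
  qed
  moreover have "(%N. 8 * N pw (1 - s + 2 * dl - \<alpha>)) \<longlonglongrightarrow> 0"
  proof -
   define e where "e = \<alpha> - (1 - s + 2 * dl)"
   have "0 < e" using \<alpha> by (simp add: e_def)
   hence "(%N. 8 * N pw (- e)) \<longlonglongrightarrow> 0" by real_asymp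
   thus ?thesis by (simp add: e_def)
  qed
  ultimately show ?thesis by (subst tendsto_cong)
 qed
qed

text \<open>The mean number of such halflines has the factors \<open>N\<close>,
  \<open>N powr (\<alpha> - 1)\<close> for the short gap and \<open>N powr (- 2 * s)\<close> for the
  two chains; the rest are powers of \<open>N powr dl\<close>.\<close>

lemma unlikely_pairs:
 assumes s: "0 < s" "0 < dl" and \<alpha>: "\<alpha> - 2 * s + 6 * dl < 0"
 shows "unlikely (%N om. \<exists>i\<in>{1..N}. (\<exists>k\<in>{1..qq dl N}. gap (D N om i) k <= 27 * real (qq dl N) ^ 2 * W N / N) &
   (\<forall>j<aa s N. gap (D N om i) (2 * j) <= 2 ^ (j + 1) * mm s N & gap (D N om i) (2 * j + 1) <= 2 ^ (j + 1) * mm s N))"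
proof (rule unlikelyI)
 let ?B = "%N. 2 * N pw dl * (27 * (2 * N pw dl) ^ 2 * N pw \<alpha> / N * (N pw (- s + dl))\<^sup>2 / N pw (- dl))"
 let ?\<eta> = "%N. 27 * real (qq dl N) ^ 2 * W N / N"
 show "EV N. prob_space.outer_le (M N) (%om. \<exists>i\<in>{1..N}. (\<exists>k\<in>{1..qq dl N}. gap (D N om i) k <= ?\<eta> N) &
   (\<forall>j<aa s N. gap (D N om i) (2 * j) <= 2 ^ (j + 1) * mm s N & gap (D N om i) (2 * j + 1) <= 2 ^ (j + 1) * mm s N))
   (\<Sum>i\<in>{1..N}. qq dl N * (?\<eta> N * (chain_prob (aa s N) (mm s N))\<^sup>2 / mm s N))"
  using ev_ge[of 1]
 proof eventually_elim
  case (elim N)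
  interpret star_cleaning "M N" N "W N" "D N" "C N" by (rule SC[OF elim(1)])
  show ?case
  proof (rule outer_bex)
   show "outer_le (%om. (\<exists>k\<in>{1..qq dl N}. gap (D N om i) k <= ?\<eta> N) &
     (\<forall>j<aa s N. gap (D N om i) (2 * j) <= 2 ^ (j + 1) * mm s N & gap (D N om i) (2 * j + 1) <= 2 ^ (j + 1) * mm s N))
     (qq dl N * (?\<eta> N * (chain_prob (aa s N) (mm s N))\<^sup>2 / mm s N))" if "i \<in> {1..N}" for i
    by (rule outer_pair_line[OF mm_pos(1,2) that]) simp
  qed simp
 qed
 show "EV N. (\<Sum>i\<in>{1..N}. qq dl N * (?\<eta> N * (chain_prob (aa s N) (mm s N))\<^sup>2 / mm s N))
   <= real N * (?B N)"
  using ev_ge[of 1] chain_prob_le[OF s] mm_ge[OF s]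
 proof eventually_elim
  case (elim N)
  have cp: "0 <= chain_prob (aa s N) (mm s N)" by (rule chain_prob_nonneg[OF mm_pos(3)])
  have "qq dl N * (?\<eta> N * (chain_prob (aa s N) (mm s N))\<^sup>2 / mm s N)
    <= ?B N"
   by (intro mult_mono frac_le power_mono divide_right_mono)
    (use elim cp mm_pos[of s N] W_bounds[OF elim(1)] qq_bounds[OF s(2), of N] in "auto intro!: divide_nonneg_nonneg mult_nonneg_nonneg")
  moreover have "real (card {1..N}) = real N" by simp
  ultimately show ?case unfolding sum_constant by (simp only:) (rule mult_left_mono, simp_all only: of_nat_0_le_iff)
 qed
 show "(%N. real N * (?B N)) \<longlonglongrightarrow> 0"
 proof -
  have "EV N. real N * (?B N)
    = 216 * N pw (\<alpha> - 2 * s + 6 * dl)"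
   using ev_ge[of 1]
  proof eventually_elim
   case (elim N)
   have "N pw (\<alpha> - 2 * s + 6 * dl) = N pw (dl + (dl + dl) + \<alpha> + ((- s + dl) + (- s + dl)) - (- dl))" by (simp add: algebra_simps)
   also have "... = N pw dl * (N pw dl * N pw dl) * N pw \<alpha> * (N pw (- s + dl) * N pw (- s + dl)) / N pw (- dl)"
    by (simp only: powr_add powr_diff)
   finally show ?case using elim by (simp add: power2_eq_square)
  qed
  moreover have "(%N. 216 * N pw (\<alpha> - 2 * s + 6 * dl)) \<longlonglongrightarrow> 0"
  proof -
   define e where "e = - (\<alpha> - 2 * s + 6 * dl)"
   have "0 < e" using \<alpha> by (simp add: e_def)
   hence "(%N. 216 * N pw (- e)) \<longlonglongrightarrow> 0" by real_asymp
   moreover have "\<alpha> - 2 * s + 6 * dl = - e" by (simp add: e_def)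
   ultimately show ?thesis by (simp only:)
  qed
  ultimately show ?thesis by (subst tendsto_cong)
 qed
qed

definition calm :: "real => real => nat => 'a => bool" where
 "calm s dl N om <-> star_reg N (W N) (D N om) (C N om) (qq dl N) &
   (\<forall>n. star_proc.Lev N (D N om) (jumper (W N) (C N om)) n <= mm s N)"

text \<open>More than \<open>W\<close> cells must fit between \<open>mm s N / 2\<close> and
  \<open>mm s N\<close>, so they have width about \<open>1 / W\<close>, and a cell contains about
  \<open>N powr (1 - \<alpha> - s)\<close> good patterns. This forces \<open>s\<close> below
  \<open>1 - \<alpha>\<close>.\<close>

lemma unlikely_not_calm:
 assumes s: "0 < s" "0 < dl" "20 * dl < 1" and \<alpha>: "s + 8 * dl <= 1 - \<alpha>"
 shows "unlikely (%N om. ~ calm s dl N om)"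
proof -
 \<comment> \<open>Exactly \<open>W + 3\<close> cells in the upper half of the range: 2 are lost in
   \<open>card_cells\<close> and the remaining number exceeds \<open>W\<close>.\<close>
 define h where "h N = mm s N / (2 * (real (W N) + 3))" for N
 have powr_split: "N pw (- s - 5 * dl) * N pw (- dl) / N pw \<alpha> * N = N pw (1 - \<alpha> - s - 6 * dl)" if "1 <= N" for N
 proof -
  have "N pw (1 - \<alpha> - s - 6 * dl) = N pw ((- s - 5 * dl) + (- dl) - \<alpha> + 1)" by (simp add: algebra_simps)
  also have "... = N pw (- s - 5 * dl) * N pw (- dl) / N pw \<alpha> * N pw 1"
   by (simp only: powr_add powr_diff)
  finally show ?thesis using that by simp
 qed
 have hN: "N pw (- dl) / (8 * N pw \<alpha>) <= h N" if "1 <= N" "N pw (- dl) <= mm s N" for N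
 proof -
  have "1 <= N pw \<alpha>" using W_bounds[OF that(1)] by linarith
  thus ?thesis unfolding h_def by (intro frac_le) (use that W_bounds[OF that(1)] mm_pos[of s N] in auto)
 qed
 have e1: "EV N. 8 * N pw dl <= N pw (2 * dl)" using s by real_asymp
 have h1: "EV N. 0 < h N & h N <= 1 & 1 / h N <= real N ^ 2"
  using ev_ge[of 1] mm_ge[OF s(1,2)] e1
 proof eventually_elim
  case (elim N)
  have m: "0 < mm s N" "mm s N <= 1" by (auto simp: mm_def power_le_one)
  have pos: "0 < N pw (- dl) / (8 * N pw \<alpha>)" using elim by simp
  have "1 / h N <= 1 / (N pw (- dl) / (8 * N pw \<alpha>))"
  proof (rule divide_left_mono[OF hN[OF elim(1,2)]])
   have "0 < h N" using pos hN[OF elim(1,2)] by linarith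
   thus "0 < h N * (N pw (- dl) / (8 * N pw \<alpha>))" using pos by (rule mult_pos_pos)
  qed simp
  also have "... = 8 * N pw dl * N pw \<alpha>" by (simp add: powr_minus_divide)
  also have "... <= N pw (2 * dl) * N pw \<alpha>" using elim by (intro mult_right_mono) auto
  also have "... = N pw (2 * dl + \<alpha>)" by (simp add: powr_add)
  also have "... <= N pw 2" by (rule powr_mono) (use elim s a1 in auto)
  also have "... = real N ^ 2" using elim by simp
  finally have "1 / h N <= real N ^ 2" .
  moreover have "h N <= 1" unfolding h_def using m by (simp add: divide_le_eq)
  ultimately show ?case using m by (simp add: h_def)
 qed
 have h2: "EV N. N pw dl <= N * (h N * N pw (- s - 5 * dl))"
  using ev_ge[of 1] mm_ge[OF s(1,2)] e1
 proof eventually_elim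
  case (elim N)
  have "8 * N pw dl <= N pw (1 - \<alpha> - s - 6 * dl)"
   by (rule order_trans[OF elim(3) powr_mono]) (use elim \<alpha> in auto)
  also have "... = 8 * (N * (N pw (- dl) / (8 * N pw \<alpha>) * N pw (- s - 5 * dl)))"
   unfolding powr_split[OF elim(1), symmetric] by simp
  also have "... <= 8 * (N * (h N * N pw (- s - 5 * dl)))"
   by (intro mult_left_mono mult_right_mono hN elim) auto
  finally show ?case by simp
 qed
 have e2: "EV N. 2 ^ 20 * N pw (20 * dl) <= real N"
  using s by real_asymp
 have e3: "EV N. 8 <= N pw dl" using s by real_asymp
 have "unlikely (%N om. ~ regular N (W N) (D N om) (C N om) (qq dl N) \<or>
   ~ pat_cells (qq dl N) N (D N om) (mm s N / 2) (h N) (JJ s dl N))"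
  by (intro unlikely_or unlikely_not_regular unlikely_not_pat_cells s h1 h2)
 thus ?thesis
 proof (rule unlikely_mono)
  show "EV N. \<forall>om\<in>space (M N). ~ calm s dl N om -->
    ~ regular N (W N) (D N om) (C N om) (qq dl N) \<or>
    ~ pat_cells (qq dl N) N (D N om) (mm s N / 2) (h N) (JJ s dl N)"
   using ev_ge[of 256] h1 e2 e3 good_rate_mm0[OF s(1,2)]
  proof eventually_elim
   case (elim N)
   have N1: "1 <= N" using elim by simp
   show ?case
   proof (intro ballI impI, rule ccontr)
    fix om assume nc: "~ calm s dl N om" and "~ (~ regular N (W N) (D N om) (C N om) (qq dl N) \<or>
     ~ pat_cells (qq dl N) N (D N om) (mm s N / 2) (h N) (JJ s dl N))"
    hence reg: "regular N (W N) (D N om) (C N om) (qq dl N)"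
     and pc: "pat_cells (qq dl N) N (D N om) (mm s N / 2) (h N) (JJ s dl N)" by auto
    interpret star_real N "W N" "D N om" "C N om" using reg by (simp add: regular_def)
    have q8: "8 <= qq dl N" using qq_bounds(1)[OF s(2), of N] elim by linarith
    have m: "0 < mm s N" "mm s N <= 1" by (auto simp: mm_def power_le_one)
    have Lev: "Lev n <= mm s N" for n
    proof (rule Lev_le_pat[OF pc _ _ q8])
     have "(mm s N - mm s N / 2) / h N = real (W N) + 3" using m(1) unfolding h_def by (simp add: field_simps)
     thus "W N < (mm s N - mm s N / 2) / h N - 2" by simp
    qed (use reg elim m in "auto simp: regular_def")
    have "real (qq dl N) ^ 20 <= (2 * N pw dl) ^ 20"
     by (rule power_mono) (use qq_bounds[OF s(2), of N] N1 in auto)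
    also have "... = 2 ^ 20 * N pw (20 * dl)"
     using N1 by (simp add: power_mult_distrib powr_powr powr_realpow[symmetric] mult.commute)
    also have "... <= N" using elim by simp
    finally have "real (qq dl N ^ 20) <= real N" by simp
    hence qN: "qq dl N ^ 20 <= N" by (simp only: of_nat_le_iff)
    have "star_reg N (W N) (D N om) (C N om) (qq dl N)"
    proof unfold_locales
     show "Lev n <= 1" for n using Lev[of n] m by simp
    qed (use reg q8 qN W_bounds[OF N1] in "auto simp: regular_def")
    thus False using nc Lev by (simp add: calm_def)
   qed
  qed
 qed
qed

lemma unlikely_sigma:
 assumes "0 < x"
 shows "unlikely (%N om. sigma_time N (W N) (D N om) (C N om) x ~= \<infinity>)"
proof -
 define dl where "dl = (1 - \<alpha>) / 20"
 define s where "s = 1 - \<alpha> - 8 * dl"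
 have d: "0 < dl" "20 * dl < 1" "0 < s" using a0 a1 by (auto simp: dl_def s_def)
 have "unlikely (%N om. ~ calm s dl N om)" by (rule unlikely_not_calm) (use d in "auto simp: s_def")
 thus ?thesis
 proof (rule unlikely_mono)
  show "EV N. \<forall>om\<in>space (M N). sigma_time N (W N) (D N om) (C N om) x ~= \<infinity> --> ~ calm s dl N om"
   using mm_small[OF d(3) assms]
  proof eventually_elim
   case (elim N)
   show ?case
   proof (intro ballI impI notI)
    fix om assume sg: "sigma_time N (W N) (D N om) (C N om) x ~= \<infinity>" and c: "calm s dl N om"
    interpret star_reg N "W N" "D N om" "C N om" "qq dl N" using c by (simp add: calm_def)
    have "sigma_time N (W N) (D N om) (C N om) x = \<infinity>"
     by (rule sigma_infinite[of "mm s N"]) (use c elim in "auto simp: calm_def")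
    thus False using sg by simp
   qed
  qed
 qed
qed

text \<open>Two values of the parameter are in play: \<open>calm\<close> with one below
  \<open>1 - \<alpha>\<close> bounds the level from above, while \<open>s\<close> above
  \<open>1 - \<alpha>\<close> makes chains rare, so that the level reaches \<open>mm s N\<close>
  within one period and the good cells above \<open>mm s N / 2\<close> are available
  afterwards.\<close>

lemma unlikely_theta_small:
 assumes ep: "0 < ep" "ep <= 1"
 shows "unlikely (%N om. ~ theta_time N (W N) (D N om) (C N om) <= ennreal (N pw (1 - \<alpha> + ep)))"
proof -
 define gam where "gam = 1 - \<alpha>"
 \<comment> \<open>The product keeps \<open>50 * dl\<close> below each of \<open>\<alpha>\<close>,
   \<open>gam\<close> and \<open>ep\<close>.\<close>
 define dl where "dl = \<alpha> * gam * ep / 50"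
 define s where "s = gam + 4 * dl"
 \<comment> \<open>The width at which a cell contains \<open>N powr dl\<close> good patterns on
   average, given the rate \<open>N powr (- s - 5 * dl)\<close>.\<close>
 define h where "h N = N pw (- \<alpha> + 10 * dl)" for N
 \<comment> \<open>A period divides the number of skipping workers by at least
   \<open>N powr (9 * dl)\<close>: landings are about \<open>N powr (gam + ep / 2)\<close> per
   worker, particles per cell about \<open>N powr gam\<close>. So \<open>1 / dl\<close> periods
   exhaust the at most \<open>N\<close> workers.\<close>
 define P where "P = nat \<lceil>1 / dl\<rceil>"
 have g: "0 < gam" "gam < 1" using a0 a1 by (auto simp: gam_def)
 have al: "\<alpha> = 1 - gam" by (simp add: gam_def)
 have ge: "\<alpha> * gam * ep <= gam" "\<alpha> * gam * ep <= ep" "\<alpha> * gam * ep <= \<alpha>" "0 < \<alpha> * gam * ep"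
 proof -
  have *: "x * y * z <= x" if "0 <= x" "0 <= y" "y <= 1" "0 <= z" "z <= 1" for x y z :: real
   using mult_mono[of "x * y" x z 1] mult_left_le[of y x] that by simp
  show "\<alpha> * gam * ep <= gam" "\<alpha> * gam * ep <= ep" "\<alpha> * gam * ep <= \<alpha>"
   using *[of gam \<alpha> ep] *[of ep \<alpha> gam] *[of \<alpha> gam ep] g a0 a1 ep by (simp_all add: mult_ac)
  show "0 < \<alpha> * gam * ep" using g a0 ep by simp
 qed
 have d: "0 < dl" "50 * dl <= gam" "50 * dl <= ep" "50 * dl <= \<alpha>" "20 * dl < 1" "0 < s" unfolding dl_def s_def using ge g by linarith+
 have P: "1 <= dl * real P"
 proof -
  have "1 / dl <= real P" unfolding P_def by linarith
  thus ?thesis using d by (simp add: field_simps)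
 qed
 let ?T = "%N. N pw (gam + ep / 2)"
 let ?ml = "%N. (?T N / 4 - 2 * real (qq dl N) - 3) / (4000 * real (qq dl N) ^ 2) - 1"
 let ?A = "%N. xx dl h N * qq dl N"
 have hle: "EV N. 0 < h N & h N <= 1 & 1 / h N <= real N ^ 2"
  using ev_ge[of 1]
 proof eventually_elim
  case (elim N)
  have "h N <= N pw 0" unfolding h_def by (rule powr_mono) (use d elim in auto)
  moreover have "1 / h N = N pw (- (- \<alpha> + 10 * dl))" unfolding h_def powr_minus_divide ..
  moreover have "N pw (- (- \<alpha> + 10 * dl)) <= N pw 2" by (rule powr_mono) (use d a1 elim in auto)
  moreover have "N pw 2 = real N ^ 2" using elim by simp
  ultimately show ?case using elim by (simp add: h_def)
 qed
 have hge: "EV N. N pw dl <= N * (h N * N pw (- s - 5 * dl))"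
  using ev_ge[of 1]
 proof eventually_elim
  case (elim N)
  have "N pw dl = N pw (1 + ((- \<alpha> + 10 * dl) + (- s - 5 * dl)))"
   by (simp add: s_def al)
  also have "... = N * (h N * N pw (- s - 5 * dl))"
   unfolding h_def using elim by (simp only: powr_add) simp
  finally show ?case by simp
 qed
 have eml: "EV N. N pw (gam + ep / 2 - 3 * dl) <= ?ml N"
 proof -
  define rh where "rh = gam + ep / 2 - 4 * dl"
  have rh: "0 < rh" "gam + ep / 2 = rh + 4 * dl" "gam + ep / 2 - 3 * dl = rh + dl" using d g ep by (auto simp: rh_def)
  have 1: "EV N. N pw (rh + dl) <= (N pw (rh + 4 * dl) / 4 - 4 * N pw dl - 3) / (4000 * (2 * N pw dl) ^ 2) - 1"
   using rh(1) d(1) by real_asymp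
  have 2: "EV N. 0 <= N pw (rh + 4 * dl) / 4 - 4 * N pw dl - 3"
   using rh(1) d(1) by real_asymp
  show ?thesis unfolding rh(3) unfolding rh(2) using 1 2 ev_ge[of 1]
  proof eventually_elim
   case (elim N)
   have q: "N pw dl <= qq dl N" "qq dl N <= 2 * N pw dl" using qq_bounds[OF d(1), of N] elim by auto
   have "0 < N pw dl" using elim(3) by simp
   hence q0: "0 < real (qq dl N)" using q by linarith
   have "(N pw (rh + 4 * dl) / 4 - 4 * N pw dl - 3) / (4000 * (2 * N pw dl) ^ 2)
     <= (N pw (rh + 4 * dl) / 4 - 2 * real (qq dl N) - 3) / (4000 * real (qq dl N) ^ 2)"
   proof (rule frac_le)
    show "4000 * (real (qq dl N))\<^sup>2 <= 4000 * (2 * N pw dl)\<^sup>2"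
     by (intro mult_left_mono power_mono) (use q in auto)
   qed (use elim q q0 in auto)
   thus ?case using elim(1) by linarith
  qed
 qed
 have eA: "EV N. 5 * real (?A N) <= N pw (gam + 13 * dl)"
 proof -
  have "EV N. 5 * ((4 * N pw dl * N pw (gam + 10 * dl) + 2 * N pw dl + 1) * (2 * N pw dl)) <= N pw (gam + 13 * dl)"
   using g d(1) by real_asymp
  thus ?thesis using ev_ge[of 1]
  proof eventually_elim
   case (elim N)
   have q: "qq dl N <= 2 * N pw dl" using qq_bounds[OF d(1), of N] elim by auto
   have Nh: "real N * h N = N pw (gam + 10 * dl)"
   proof -
    have "N pw (gam + 10 * dl) = N pw (1 + (- \<alpha> + 10 * dl))" by (simp add: al)
    also have "... = N pw 1 * h N" unfolding h_def by (rule powr_add)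
    finally show ?thesis using elim by simp
   qed
   have "0 <= 2 * real N * (qq dl N * h N) + qq dl N" by (simp add: h_def)
   hence "real (xx dl h N) <= 2 * real N * (qq dl N * h N) + qq dl N + 1" unfolding xx_def by linarith
   also have "... = 2 * real (qq dl N) * N pw (gam + 10 * dl) + qq dl N + 1" unfolding Nh[symmetric] by (simp add: mult_ac)
   also have "... <= 2 * (2 * N pw dl) * N pw (gam + 10 * dl) + 2 * N pw dl + 1"
    by (intro add_mono mult_right_mono mult_left_mono q) auto
   finally have "real (xx dl h N) <= 4 * N pw dl * N pw (gam + 10 * dl) + 2 * N pw dl + 1" by simp
   hence "real (?A N) <= (4 * N pw dl * N pw (gam + 10 * dl) + 2 * N pw dl + 1) * (2 * N pw dl)"
    unfolding of_nat_mult by (intro mult_mono q) auto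
   thus ?case using elim(1) by linarith
  qed
 qed
 have et: "EV N. 8 * real (qq dl N) + 12 < ?T N"
 proof -
  define rh where "rh = gam + ep / 2 - dl"
  have rh: "0 < rh" "gam + ep / 2 = rh + dl" using d g ep by (auto simp: rh_def)
  have "EV N. 16 * N pw dl + 12 < N pw (rh + dl)" using rh(1) d(1) by real_asymp
  thus ?thesis unfolding rh using ev_ge[of 1]
  proof eventually_elim
   case (elim N) thus ?case using qq_bounds[OF d(1), of N] by linarith
  qed
 qed
 have etP: "EV N. ?T N + P * ?T N <= N pw (gam + ep)"
 proof -
  define e where "e = ep / 2"
  have e: "0 < e" "ep / 2 = e" "ep = 2 * e" using ep by (auto simp: e_def)
  have "EV N. (1 + real P) * N pw e <= N pw (2 * e)" using e(1) by real_asymp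
  thus ?thesis unfolding e(2) unfolding e(3)
  proof eventually_elim
   case (elim N)
   have "N pw (gam + e) + real P * N pw (gam + e) = N pw gam * ((1 + real P) * N pw e)"
    by (simp add: powr_add algebra_simps)
   also have "... <= N pw gam * N pw (2 * e)" by (rule mult_left_mono[OF elim]) simp
   finally show ?case by (simp add: powr_add)
  qed
 qed
 have e2: "EV N. 2 * (real N * qq dl N) < real (W N) * ?ml N"
 proof -
  define kp where "kp = ep / 2 - 4 * dl"
  have kp: "0 < kp" using d by (auto simp: kp_def)
  have "EV N. 4 * N pw (1 + dl) < N pw (1 + kp + dl) / 2" using kp(1) d(1) by real_asymp
  thus ?thesis using eml ev_ge[of 1]
  proof eventually_elim
   case (elim N)
   have "2 * (real N * qq dl N) <= 2 * (real N * (2 * N pw dl))"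
    by (intro mult_left_mono) (use qq_bounds[OF d(1), of N] elim in auto)
   also have "... = 4 * N pw (1 + dl)" using elim by (simp add: powr_add)
   also have "... < N pw (1 + kp + dl) / 2" by (rule elim)
   also have "1 + kp + dl = \<alpha> + (gam + ep / 2 - 3 * dl)" by (simp add: kp_def al)
   also have "N pw (\<alpha> + (gam + ep / 2 - 3 * dl)) / 2 = N pw \<alpha> / 2 * N pw (gam + ep / 2 - 3 * dl)"
    by (simp add: powr_add)
   also have "... <= real (W N) * ?ml N"
    by (rule mult_mono) (use W_bounds[OF elim(3)] elim in auto)
   finally show ?case .
  qed
 qed
 have e4: "EV N. real (W N) * (5 * real (?A N)) ^ P < ?ml N ^ P"
  using eml eA ev_ge[of 2]
 proof eventually_elim
  case (elim N)
  have N1: "1 <= N" using elim by simp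
  have "real (W N) * (5 * real (?A N)) ^ P <= real N * (N pw (gam + 13 * dl)) ^ P"
   by (intro mult_mono power_mono) (use W_bounds[OF N1] elim in auto)
  also have "... = N pw (1 + (gam + 13 * dl) * P)"
   using N1 powr_add[of "real N" 1 "(gam + 13 * dl) * P"] powr_pow[of "real N" "gam + 13 * dl" P] by simp
  also have "... < N pw ((gam + ep / 2 - 3 * dl) * P)"
  proof (rule powr_less_mono)
   have "(gam + 13 * dl) * P + 9 * (dl * P) <= (gam + ep / 2 - 3 * dl) * P"
   proof -
    have "(gam + 22 * dl) * P <= (gam + ep / 2 - 3 * dl) * P" by (rule mult_right_mono) (use d in auto)
    thus ?thesis by (simp add: algebra_simps)
   qed
   thus "1 + (gam + 13 * dl) * P < (gam + ep / 2 - 3 * dl) * P" using P by linarith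
  qed (use elim in auto)
  also have "... = (N pw (gam + ep / 2 - 3 * dl)) ^ P"
   using N1 by (simp add: powr_pow)
  also have "... <= ?ml N ^ P" by (rule power_mono) (use elim in auto)
  finally show ?case .
 qed
 let ?X = "%N om. ~ calm (1 - \<alpha> - 8 * dl) dl N om \<or>
   ~ pat_cells (qq dl N) N (D N om) (mm s N / 2) (h N) (JJ s dl N) \<or>
   ~ few_lines (qq dl N) N (D N om) (h N) (xx dl h N) \<or>
   real (W N) / (2 * qq dl N) <= card {i \<in> {1..N}. \<forall>j<aa s N. gap (D N om i) j <= 2 ^ (j + 1) * mm s N}"
 have "unlikely (%N om. ?X N om)"
  by (intro unlikely_or unlikely_not_calm unlikely_not_pat_cells unlikely_not_few_lines unlikely_chains hle hge)
   (use d in "auto simp: s_def al")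
 thus ?thesis
 proof (rule unlikely_mono)
  show "EV N. \<forall>om\<in>space (M N). ~ theta_time N (W N) (D N om) (C N om) <= ennreal (N pw (1 - \<alpha> + ep)) -->
   ?X N om"
   using hle eml et etP e2 e4 good_rate_mm0[OF d(6,1)] ev_ge[of 1]
  proof eventually_elim
   case (elim N)
   show ?case
   proof (intro ballI impI, rule ccontr)
    fix om assume nt: "~ theta_time N (W N) (D N om) (C N om) <= ennreal (N pw (1 - \<alpha> + ep))"
     and "~ (?X N om)"
    hence c: "calm (1 - \<alpha> - 8 * dl) dl N om"
     and pc: "pat_cells (qq dl N) N (D N om) (mm s N / 2) (h N) (JJ s dl N)"
     and fl: "few_lines (qq dl N) N (D N om) (h N) (xx dl h N)"
     and ch: "card {i \<in> {1..N}. \<forall>j<aa s N. gap (D N om i) j <= 2 ^ (j + 1) * mm s N} < real (W N) / (2 * qq dl N)"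
     by auto
    interpret star_reg N "W N" "D N om" "C N om" "qq dl N" using c by (simp add: calm_def)
    have ml: "min_land (?T N) = ?ml N" by (simp add: min_land_def)
    have "0 < N pw (gam + ep / 2 - 3 * dl)" using elim by simp
    hence ml0: "0 < ?ml N" using elim(2) by linarith
    have q0: "0 < real (qq dl N)" using q8 by simp
    have N2: "N pw (gam + ep) <= real N ^ 2"
    proof -
     have "N pw (gam + ep) <= N pw 2" by (rule powr_mono) (use g ep elim in auto)
     also have "... = real N ^ 2" using elim by simp
     finally show ?thesis .
    qed
    have aux: "a + b * z < w * z" if "b * z <= w / 2 * z" "2 * a < w * z" for a b w z :: real
     using that by simp
    have T0: "0 <= ?T N" by simp
    have TP: "0 <= P * ?T N" by simp
    have "mm s N <= Lev (steps (?T N))"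
    proof (rule phase1[OF T0])
     show "?T N <= real N ^ 2" using elim(4) N2 TP by linarith
     show "0 < mm s N" "2 ^ aa s N * mm s N <= 1" by (auto simp: mm_def power_one_over)
     show "0 < min_land (?T N)" unfolding ml by (rule ml0)
     have "real (qq dl N) * card (chain_lines (aa s N) (mm s N)) * ?ml N <= real (W N) / 2 * ?ml N"
     proof (rule mult_right_mono)
      have "real (card (chain_lines (aa s N) (mm s N))) < real (W N) / (2 * qq dl N)"
       using ch unfolding chain_lines_def .
      hence "real (card (chain_lines (aa s N) (mm s N))) * (2 * qq dl N) < real (W N)"
       using q0 by (simp add: pos_less_divide_eq)
      thus "real (qq dl N) * card (chain_lines (aa s N) (mm s N)) <= real (W N) / 2" by (simp add: mult_ac)
     qed (use ml0 in simp)
     thus "real N * qq dl N + qq dl N * card (chain_lines (aa s N) (mm s N)) * min_land (?T N) < W N * min_land (?T N)"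
      using elim(5) unfolding ml of_nat_mult by (rule aux)
    qed
    hence lev: "mm s N / 2 <= Lev (steps (?T N))" using Lev_pos[of "steps (?T N)"] by (simp add: mm_def)
    have "U (?T N + P * ?T N) = {}"
    proof (rule U_empty[OF good_cells_pat[OF pc] few_particles_lines[OF fl]])
     show "?T N + P * ?T N <= real N ^ 2" using elim(4) N2 by linarith
     show "real (W N) * (5 * real (?A N)) ^ P < min_land (?T N) ^ P" unfolding ml by (rule elim)
    qed (use elim T0 lev ml0 ml in auto)
    hence "jump_time (W N) (C N om) n <= N pw (1 - \<alpha> + ep)" if "skip n" for n
     using U_empty_skip[OF _ that] elim(4) unfolding gam_def by force
    thus False using nt theta_le_iff by simp
   qed
  qed
 qed
qed

lemma unlikely_theta:
 assumes "0 < ep"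
 shows "unlikely (%N om. ~ theta_time N (W N) (D N om) (C N om) <= ennreal (N pw (1 - \<alpha> + ep)))"
proof -
 have "unlikely (%N om. ~ theta_time N (W N) (D N om) (C N om) <= ennreal (N pw (1 - \<alpha> + min ep 1)))"
  by (rule unlikely_theta_small) (use assms in auto)
 thus ?thesis
 proof (rule unlikely_mono)
  show "EV N. \<forall>om\<in>space (M N). ~ theta_time N (W N) (D N om) (C N om) <= ennreal (N pw (1 - \<alpha> + ep)) -->
   ~ theta_time N (W N) (D N om) (C N om) <= ennreal (N pw (1 - \<alpha> + min ep 1))"
   using ev_ge[of 1]
  proof eventually_elim
   case (elim N)
   have "ennreal (N pw (1 - \<alpha> + min ep 1)) <= ennreal (N pw (1 - \<alpha> + ep))"
    by (intro ennreal_leI powr_mono) (use elim in auto)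
   thus ?case using order_trans by blast
  qed
 qed
qed

text \<open>With \<open>s = 1 - \<alpha> - 8 * dl\<close> the condition of
  \<open>unlikely_pairs\<close> becomes \<open>3 * \<alpha> - 2 + 22 * dl < 0\<close>. The time
  bound is used with exponent \<open>2 - \<alpha>\<close>, so that all skips are over by time
  \<open>N ^ 2\<close>.\<close>

lemma unlikely_not_separated:
 assumes "\<alpha> < 2 / 3"
 shows "unlikely (%N om. ~ eventually_separated N (W N) (D N om) (C N om))"
proof -
 define dl where "dl = min ((1 - \<alpha>) / 50) ((2 - 3 * \<alpha>) / 50)"
 define s where "s = 1 - \<alpha> - 8 * dl"
 have d: "0 < dl" "50 * dl <= 1 - \<alpha>" "50 * dl <= 2 - 3 * \<alpha>" using a1 assms by (auto simp: dl_def min_def)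
 have d1: "20 * dl < 1" "0 < s" "dl < 1" using d a0 by (auto simp: s_def)
 let ?X = "%N om. ~ calm s dl N om \<or>
   ~ theta_time N (W N) (D N om) (C N om) <= ennreal (N pw (1 - \<alpha> + 1)) \<or>
   ~ first_cells N (D N om) (qq dl N / N) \<or>
   (\<exists>i\<in>{1..N}. (\<exists>k\<in>{1..qq dl N}. gap (D N om i) k <= 27 * real (qq dl N) ^ 2 * W N / N) &
   (\<forall>j<aa s N. gap (D N om i) (2 * j) <= 2 ^ (j + 1) * mm s N & gap (D N om i) (2 * j + 1) <= 2 ^ (j + 1) * mm s N))"
 have "unlikely (%N om. ?X N om)"
  by (intro unlikely_or unlikely_not_calm unlikely_theta unlikely_not_first_cells unlikely_pairs)
   (use d d1 in "auto simp: s_def")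
 thus ?thesis
 proof (rule unlikely_mono)
  show "EV N. \<forall>om\<in>space (M N). ~ eventually_separated N (W N) (D N om) (C N om) -->
   ?X N om"
   using ev_ge[of 1]
  proof eventually_elim
   case (elim N)
   show ?case
   proof (intro ballI impI, rule ccontr)
    fix om assume ns: "~ eventually_separated N (W N) (D N om) (C N om)"
     and no: "~ (?X N om)"
    have c: "calm s dl N om" using no by blast
    interpret star_reg N "W N" "D N om" "C N om" "qq dl N" using c by (simp add: calm_def)
    have "N pw (1 - \<alpha> + 1) <= N pw 2" by (rule powr_mono) (use a0 elim in auto)
    also have "... = real N ^ 2" using elim by simp
    finally have N2: "N pw (1 - \<alpha> + 1) <= real N ^ 2" .
    have th: "jump_time (W N) (C N om) p <= real N ^ 2" if "skip p" for p
    proof -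
     have "theta_time N (W N) (D N om) (C N om) <= ennreal (N pw (1 - \<alpha> + 1))" using no by blast
     hence "jump_time (W N) (C N om) p <= N pw (1 - \<alpha> + 1)" using that theta_le_iff by simp
     thus ?thesis using N2 by linarith
    qed
    have fc: "fine_cells" by (rule fine_cells_first) (use no in blast)
    have "pair_lines (aa s N) (mm s N) ~= {}"
     by (rule pair_line[OF fc th _ _ ns]) (use c in "auto simp: calm_def mm_def power_one_over")
    moreover have "pair_lines (aa s N) (mm s N) = {}"
     unfolding pair_lines_def eta_def using no by blast
    ultimately show False by simp
   qed
  qed
 qed
qed

end

text \<open>In \<open>f\<close> every occurring \<open>E kp\<close> contributes
  \<open>1 / prob (S kp) - 1\<close> on success and \<open>-1\<close> on failure. Of two that occur
  together, the later one has a success independent of everything else, so the terms are orthogonal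
  and the mean of \<open>f ^ 2\<close> is at most the sum of \<open>prob (E kp) / p0\<close>. If no
  success occurs, \<open>f\<close> is minus the number of occurrences, and Markov's inequality
  applies.\<close>

lemma (in prob_space) second_moment:
 fixes E S :: "'k => 'a set" and p0 R :: real
 assumes T: "finite T" and ev: "!!kp. kp \<in> T ==> E kp \<in> events" "!!kp. kp \<in> T ==> S kp \<in> events"
  and p0: "0 < p0" "!!kp. kp \<in> T ==> p0 <= prob (S kp)" and R: "0 < R"
  and fresh: "!!kp. kp \<in> T ==> prob (E kp \<inter> S kp) = prob (E kp) * prob (S kp)"
  and pairs: "!!kp nu. kp \<in> T ==> nu \<in> T ==> kp ~= nu ==> E kp \<inter> E nu = {} \<or> later kp nu \<or> later nu kp"
  and later: "!!kp nu. kp \<in> T ==> nu \<in> T ==> later kp nu ==>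
   prob (E kp \<inter> E nu \<inter> S nu) = prob (E kp \<inter> E nu) * prob (S nu) &
   prob (E kp \<inter> E nu \<inter> S kp \<inter> S nu) = prob (E kp \<inter> E nu \<inter> S kp) * prob (S nu)"
 shows "outer_le (%om. R <= card {kp \<in> T. om \<in> E kp} & (\<forall>kp\<in>T. om \<in> E kp --> om \<notin> S kp))
  ((\<Sum>kp\<in>T. prob (E kp)) / (p0 * R\<^sup>2))"
proof -
 define p where "p kp = prob (S kp)" for kp
 define f where "f om = (\<Sum>kp\<in>T. indicat_real (E kp) om * (indicat_real (S kp) om / p kp - 1))" for om
 define g where "g kp nu om = indicat_real (E kp \<inter> E nu \<inter> S kp \<inter> S nu) om * (1 / (p kp * p nu))
   - indicat_real (E kp \<inter> E nu \<inter> S kp) om * (1 / p kp) - indicat_real (E kp \<inter> E nu \<inter> S nu) om * (1 / p nu)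
   + indicat_real (E kp \<inter> E nu) om" for kp nu om
 define v where "v kp nu = prob (E kp \<inter> E nu \<inter> S kp \<inter> S nu) * (1 / (p kp * p nu))
   - prob (E kp \<inter> E nu \<inter> S kp) * (1 / p kp) - prob (E kp \<inter> E nu \<inter> S nu) * (1 / p nu)
   + prob (E kp \<inter> E nu)" for kp nu
 have p: "p0 <= p kp" "0 < p kp" if "kp \<in> T" for kp using p0(2)[OF that] p0(1) unfolding p_def by linarith+
 have sq: "(f om)\<^sup>2 = (\<Sum>kp\<in>T. \<Sum>nu\<in>T. g kp nu om)" for om
  unfolding power2_eq_square f_def sum_product
  by (intro sum.cong refl) (auto simp: g_def indicator_def divide_inverse algebra_simps)
 have ind: "has_bochner_integral M (%om. indicat_real A om * a) (prob A * a)" if "A \<in> events" for A a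
  by (rule has_bochner_integral_mult_left, rule has_bochner_integral_real_indicator[OF that])
   (simp add: emeasure_eq_measure)
 have ind1: "has_bochner_integral M (indicat_real A) (prob A)" if "A \<in> events" for A
  by (rule has_bochner_integral_real_indicator[OF that]) (simp add: emeasure_eq_measure)
 have bi: "has_bochner_integral M (g kp nu) (v kp nu)" if "kp \<in> T" "nu \<in> T" for kp nu
  unfolding g_def[abs_def] v_def
  by (intro has_bochner_integral_add has_bochner_integral_diff ind ind1 sets.Int ev that)
 have vf: "has_bochner_integral M (%om. (f om)\<^sup>2) (\<Sum>kp\<in>T. \<Sum>nu\<in>T. v kp nu)"
  unfolding sq by (intro has_bochner_integral_sum bi)
 have v_later: "v kp nu = 0" if "kp \<in> T" "nu \<in> T" "later kp nu" for kp nu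
  using later[OF that] p(2)[OF that(1)] p(2)[OF that(2)] by (simp add: v_def p_def)
 have v_sym: "v kp nu = v nu kp" for kp nu
  by (simp add: v_def Int_ac mult.commute)
 have v_off: "v kp nu = 0" if "kp \<in> T" "nu \<in> T" "kp ~= nu" for kp nu
  using pairs[OF that]
 proof (elim disjE)
  assume "E kp \<inter> E nu = {}"
  thus ?thesis by (simp add: v_def)
 next
  assume "later kp nu" thus ?thesis by (rule v_later[OF that(1,2)])
 next
  assume "later nu kp" thus ?thesis using v_later[OF that(2,1)] v_sym by simp
 qed
 have v_diag: "v kp kp <= prob (E kp) / p0" if "kp \<in> T" for kp
 proof -
  have "v kp kp = prob (E kp) * (1 / p kp - 1)"
   using fresh[OF that] p(2)[OF that] by (simp add: v_def p_def field_simps)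
  also have "... <= prob (E kp) * (1 / p0)"
  proof (rule mult_left_mono)
   have "1 / p kp <= 1 / p0" using p(1)[OF that] p0(1) by (simp add: frac_le)
   thus "1 / p kp - 1 <= 1 / p0" by simp
  qed simp
  finally show ?thesis by simp
 qed
 have "(\<Sum>kp\<in>T. \<Sum>nu\<in>T. v kp nu) = (\<Sum>kp\<in>T. v kp kp)"
 proof (rule sum.cong[OF refl])
  fix kp assume kp: "kp \<in> T"
  have "(\<Sum>nu\<in>T. v kp nu) = (\<Sum>nu\<in>{kp}. v kp nu)"
   by (rule sum.mono_neutral_right[OF T]) (use kp v_off in auto)
  thus "(\<Sum>nu\<in>T. v kp nu) = v kp kp" by simp
 qed
 also have "... <= (\<Sum>kp\<in>T. prob (E kp)) / p0"
  unfolding sum_divide_distrib by (rule sum_mono[OF v_diag])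
 finally have var: "(\<integral>om. (f om)\<^sup>2 \<partial>M) <= (\<Sum>kp\<in>T. prob (E kp)) / p0"
  using has_bochner_integral_integral_eq[OF vf] by simp
 have [measurable]: "(%om. (f om)\<^sup>2) \<in> borel_measurable M"
  using has_bochner_integral_iff vf by (metis borel_measurable_integrable)
 have mark: "\<P>(om in M. R\<^sup>2 <= (f om)\<^sup>2) <= (\<integral>om. (f om)\<^sup>2 \<partial>M) / R\<^sup>2"
  by (rule integral_Markov_inequality_measure[where A = "{}"]) (use vf R in "auto simp: has_bochner_integral_iff")
 show ?thesis
 proof (rule outer_leI[of "{om \<in> space M. R\<^sup>2 <= (f om)\<^sup>2}"])
  show "{om \<in> space M. R\<^sup>2 <= (f om)\<^sup>2} \<in> events" by measurable
  have "(\<integral>om. (f om)\<^sup>2 \<partial>M) / R\<^sup>2 <= (\<Sum>kp\<in>T. prob (E kp)) / p0 / R\<^sup>2" by (rule divide_right_mono[OF var]) simp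
  thus "\<P>(om in M. R\<^sup>2 <= (f om)\<^sup>2) <= (\<Sum>kp\<in>T. prob (E kp)) / (p0 * R\<^sup>2)" using mark by simp
  fix om assume om: "om \<in> space M" "R <= card {kp \<in> T. om \<in> E kp} & (\<forall>kp\<in>T. om \<in> E kp --> om \<notin> S kp)"
  have "f om = (\<Sum>kp\<in>T. - indicat_real (E kp) om)"
   unfolding f_def by (rule sum.cong) (use om in "auto simp: indicator_def")
  also have "... = - real (card {kp \<in> T. om \<in> E kp})"
   using T by (simp add: sum_negf indicator_def sum.If_cases Int_def)
  finally have "(f om)\<^sup>2 = (real (card {kp \<in> T. om \<in> E kp}))\<^sup>2" by simp
  moreover have "R\<^sup>2 <= (real (card {kp \<in> T. om \<in> E kp}))\<^sup>2" by (rule power_mono) (use om R in auto)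
  ultimately show "om \<in> {om \<in> space M. R\<^sup>2 <= (f om)\<^sup>2}" using om by simp
 qed
qed

section \<open>Fresh coincidences\<close>

text \<open>One implication suffices because \<open>x\<close> and \<open>x'\<close> can be
  exchanged. This form allows to start from a configuration in which the event holds and to read off
  from it what has been revealed, as in \<open>agree\<close>.\<close>

definition dep :: "(('i => real) => bool) => 'i set => bool" where
 "dep P F <-> (\<forall>x x'. (\<forall>z\<in>F. x z = x' z) --> P x --> P x')"

lemma dep_conj: "dep P F ==> dep Q F ==> dep (%x. P x & Q x) F"
 unfolding dep_def by blast

lemma dep_mono: "dep P F ==> F <= F' ==> dep P F'"
 unfolding dep_def by blast

lemma dep_eq: "dep P F ==> (!!z. z \<in> F ==> x z = x' z) ==> P x <-> P x'"
 unfolding dep_def by metis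

abbreviation "cfgM \<equiv> PiM UNIV (%_. borel :: real measure)"

context exp_family
begin

lemma ext_meas:
 "(%y z. if z \<in> F then y z else 0) \<in> measurable (PiM F (%_. borel)) (cfgM :: ('i => real) measure)"
proof (rule measurable_PiM_single')
 fix z show "(%y. if z \<in> F then y z else (0 :: real)) \<in> borel_measurable (PiM F (%_. borel))"
  by (cases "z \<in> F") auto
qed auto

lemma dep_restrict:
 assumes "dep P F"
 shows "P (%z. G z om) <-> P (%z. if z \<in> F then restrict (%z. G z om) F z else 0)"
 by (rule dep_eq[OF assms]) simp

lemma dep_pred:
 assumes "F <= I" "dep P F" "Measurable.pred cfgM P"
 shows "{y \<in> space (PiM F (%_. borel)). P (%z. if z \<in> F then y z else 0)} \<in> sets (PiM F (%_. borel))"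
  and "{om \<in> space M. P (%z. G z om)} \<in> events"
proof -
 show 1: "{y \<in> space (PiM F (%_. borel)). P (%z. if z \<in> F then y z else 0)} \<in> sets (PiM F (%_. borel))"
  using measurable_compose[OF ext_meas assms(3)] by (simp add: pred_def)
 have r: "(%om. restrict (%z. G z om) F) \<in> measurable M (PiM F (%_. borel))"
  by (rule measurable_restrict) (use assms(1) G_meas in auto)
 from measurable_compose[OF r measurable_compose[OF ext_meas assms(3)]]
 show "{om \<in> space M. P (%z. G z om)} \<in> events"
  unfolding dep_restrict[OF assms(2)] by (simp add: pred_def)
qed

lemma indep_parts:
 assumes F: "F1 <= I" "F2 <= I" "F1 \<inter> F2 = {}"
  and P: "dep P F1" "Measurable.pred cfgM P" and Q: "dep Q F2" "Measurable.pred cfgM Q"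
 shows "\<P>(om in M. P (%z. G z om) & Q (%z. G z om))
  = \<P>(om in M. P (%z. G z om)) * \<P>(om in M. Q (%z. G z om))"
proof -
 let ?R = "%F om. restrict (%z. G z om) F"
 let ?P = "{y \<in> space (PiM F1 (%_. borel)). P (%z. if z \<in> F1 then y z else 0)}"
 let ?Q = "{y \<in> space (PiM F2 (%_. borel)). Q (%z. if z \<in> F2 then y z else 0)}"
 have ind: "indep_var (PiM F1 (%_. borel)) (?R F1) (PiM F2 (%_. borel)) (?R F2)"
  by (rule indep_var_restrict[OF indepG]) (use F in auto)
 have sp: "?R F om \<in> space (PiM F (%_. borel :: real measure))" for F om by (simp add: space_PiM)
 have "{om \<in> space M. P (%z. G z om) & Q (%z. G z om)} = (%om. (?R F1 om, ?R F2 om)) -` (?P \<times> ?Q) \<inter> space M"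
  unfolding dep_restrict[OF P(1)] dep_restrict[OF Q(1)] using sp by auto
 moreover have "{om \<in> space M. P (%z. G z om)} = ?R F1 -` ?P \<inter> space M"
  unfolding dep_restrict[OF P(1)] using sp by auto
 moreover have "{om \<in> space M. Q (%z. G z om)} = ?R F2 -` ?Q \<inter> space M"
  unfolding dep_restrict[OF Q(1)] using sp by auto
 ultimately show ?thesis
  using indep_varD[OF ind dep_pred(1)[OF F(1) P] dep_pred(1)[OF F(2) Q]] by simp
qed

end

type_synonym cfg = "(nat + nat) \<times> nat => real"

definition dx :: "cfg => nat => nat => real" where "dx x i k = (\<Sum>l\<le>k. x (Inl i, l))"
definition cx :: "cfg => nat => nat => real" where "cx x w r = (\<Sum>l\<le>r. x (Inr w, l))"

lemma gap_sum: "gap (%k. \<Sum>l\<le>k. y l) j = y j"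
 by (cases j) (simp_all add: gap_def)

lemma gap_dx [simp]: "gap (dx x i) j = x (Inl i, j)" and gap_cx [simp]: "gap (cx x w) j = x (Inr w, j)"
 unfolding dx_def cx_def by (rule gap_sum)+

lemma (in star_cleaning) D_dx: "D om = dx (GW om)" and C_cx: "C om = cx (GW om)"
 by (simp_all add: fun_eq_iff dx_def cx_def D_sum C_sum)

lemma dx_meas: "(%x. dx x i k) \<in> borel_measurable cfgM" and cx_meas: "(%x. cx x w r) \<in> borel_measurable cfgM"
 unfolding dx_def cx_def by simp_all

declare st.simps(2) [simp del] ring_counts.simps(2) [simp del]

abbreviation "cons N d J n \<equiv> snd (snd (st N d J n))"

lemma target_in:
 assumes "1 <= N" shows "target N d s w \<in> {1..N}"
proof -
 obtain i where "i \<in> {1..N}" "\<forall>j\<in>{1..N}. front_dist N d s w i <= front_dist N d s w j"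
  using ex_min_if_finite[of "front_dist N d s w ` {1..N}"] assms by (auto simp: not_less)
 hence "\<exists>i. i \<in> {1..N} & (\<forall>j\<in>{1..N}. front_dist N d s w i <= front_dist N d s w j)" by blast
 from LeastI_ex[OF this] show ?thesis unfolding target_def by blast
qed

lemma cons_Suc: "cons N d J (Suc n) i = (if i = tgt N d J n then Suc (cons N d J n i) else cons N d J n i)"
 by (cases "st N d J n") (simp add: st.simps(2) tgt_def Let_def)

lemma cons_mono: "m <= n ==> cons N d J m i <= cons N d J n i"
 by (induction rule: dec_induct) (auto simp: cons_Suc)

lemma st_valid:
 assumes N: "1 <= N"
 shows "fst (st N d J n) w = 0 \<or> fst (st N d J n) w \<in> {1..N} &
  fst (snd (st N d J n)) w < cons N d J n (fst (st N d J n) w)"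
proof (induction n)
 case (Suc n)
 obtain l x k where s: "st N d J n = (l, x, k)" by (metis prod.exhaust)
 have t: "target N d (l, x, k) (J n) \<in> {1..N}" by (rule target_in[OF N])
 show ?case using Suc t by (auto simp: st.simps(2) s Let_def)
qed simp

lemma target_cong:
 assumes "!!i. i \<in> {1..N} ==> d i (k i) = d' i (k i)" "place N d (l w) (x w) = place N d' (l w) (x w)"
 shows "target N d (l, x, k) w = target N d' (l, x, k) w"
proof -
 have "front_dist N d (l, x, k) w i = front_dist N d' (l, x, k) w i" if "i \<in> {1..N}" for i
  by (simp only: front_dist_def prod.case assms(1)[OF that] assms(2))
 hence "(i \<in> {1..N} & (\<forall>j\<in>{1..N}. front_dist N d (l, x, k) w i <= front_dist N d (l, x, k) w j)) <->
   (i \<in> {1..N} & (\<forall>j\<in>{1..N}. front_dist N d' (l, x, k) w i <= front_dist N d' (l, x, k) w j))" for i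
  by (metis (no_types, lifting))
 thus ?thesis unfolding target_def by presburger
qed

lemma tgt_cong:
 assumes N: "1 <= N" and ag: "!!i k. i \<in> {1..N} ==> k <= cons N d J n i ==> d i k = d' i k"
  and s: "st N d' J' n = st N d J n" and J: "J' n = J n"
 shows "tgt N d' J' n = tgt N d J n"
proof -
 obtain l x k where s1: "st N d J n = (l, x, k)" by (metis prod.exhaust)
 have "target N d (l, x, k) (J n) = target N d' (l, x, k) (J n)"
 proof (rule target_cong)
  show "d i (k i) = d' i (k i)" if "i \<in> {1..N}" for i using ag[OF that, of "k i"] by (simp add: s1)
  show "place N d (l (J n)) (x (J n)) = place N d' (l (J n)) (x (J n))"
   using st_valid[OF N, of d J n "J n"] ag[of "l (J n)" "x (J n)"] by (auto simp: s1 place_def)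
 qed
 thus ?thesis unfolding tgt_def s J s1 by simp
qed

text \<open>A jump looks at the first remaining particle of each halfline and at particles already
  removed; gaps further out can be changed without effect.\<close>

lemma st_cong:
 assumes N: "1 <= N" and ag: "!!i k. i \<in> {1..N} ==> k <= cons N d J n i ==> d i k = d' i k"
  and J: "!!m. m < n ==> J' m = J m" and "m <= n"
 shows "st N d' J' m = st N d J m"
 using \<open>m <= n\<close>
proof (induction m)
 case (Suc m)
 have IH: "st N d' J' m = st N d J m" using Suc by simp
 have Jm: "J' m = J m" using J Suc by simp
 have "tgt N d' J' m = tgt N d J m"
 proof (rule tgt_cong[OF N _ IH Jm])
  fix i k assume "i \<in> {1..N}" "k <= cons N d J m i"
  thus "d i k = d' i k" using ag[of i k] cons_mono[of m n N d J i] Suc by simp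
 qed
 thus ?case using IH Jm by (cases "st N d J m") (simp add: st.simps(2) tgt_def Let_def)
qed simp

lemma ring_counts_Suc:
 "ring_counts W c (Suc n) v = (if v = ring_order W c n then Suc (ring_counts W c n v) else ring_counts W c n v)"
 by (simp add: ring_counts.simps(2) ring_order_def Let_def)

lemma ring_counts_mono: "m <= n ==> ring_counts W c m v <= ring_counts W c n v"
 by (induction rule: dec_induct) (auto simp: ring_counts_Suc)

lemma next_ring_cong:
 assumes "!!v. v \<in> {1..W} ==> c v (r v) = c' v (r v)"
 shows "next_ring W c' r = next_ring W c r"
proof -
 have "(w \<in> {1..W} & (\<forall>v\<in>{1..W}. c' w (r w) <= c' v (r v))) <-> (w \<in> {1..W} & (\<forall>v\<in>{1..W}. c w (r w) <= c v (r v)))" for w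
  using assms by (metis (no_types, lifting))
 thus ?thesis unfolding next_ring_def by presburger
qed

lemma clock_cong:
 assumes ag: "!!v r. v \<in> {1..W} ==> r <= ring_counts W c n v ==> c v r = c' v r" and m: "m <= n"
 shows "ring_counts W c' m = ring_counts W c m" "ring_order W c' m = ring_order W c m"
proof -
 have nr: "next_ring W c' (ring_counts W c m) = next_ring W c (ring_counts W c m)" if "m <= n" for m
  by (rule next_ring_cong) (use ag ring_counts_mono[OF that] in auto)
 show *: "ring_counts W c' m = ring_counts W c m" using m
 proof (induction m)
  case (Suc m)
  thus ?case using nr[of m] by (simp add: ring_counts.simps(2) Let_def)
 qed simp
 show "ring_order W c' m = ring_order W c m" unfolding ring_order_def * by (rule nr[OF m])
qed

definition hit :: "nat => nat => (nat => nat => real) => (nat => nat => real) => nat => nat => nat => nat => nat => bool" where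
 "hit N W d c n i k w r <-> tgt N d (ring_order W c) n = i & tgt_index N d (ring_order W c) n = k &
   ring_order W c n = w & ring_counts W c n w = r"

abbreviation "consumed N W d c n \<equiv> cons N d (ring_order W c) n"

lemma hit_cong:
 assumes N: "1 <= N" and d: "!!i k. i \<in> {1..N} ==> k <= consumed N W d c n i ==> d i k = d' i k"
  and c: "!!v r. v \<in> {1..W} ==> r <= ring_counts W c n v ==> c v r = c' v r" and m: "m <= n"
 shows "hit N W d' c' m i k w r <-> hit N W d c m i k w r"
  and "ring_counts W c' m = ring_counts W c m"
proof -
 have cc: "ring_counts W c' m = ring_counts W c m" "ring_order W c' m = ring_order W c m" if "m <= n" for m
  by (rule clock_cong[where n = n]; use c that in simp)+
 have s: "st N d' (ring_order W c') m = st N d (ring_order W c) m"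
  by (rule st_cong[OF N d _ m]) (use cc in auto)
 have "tgt N d' (ring_order W c') m = tgt N d (ring_order W c) m"
 proof (rule tgt_cong[OF N _ s cc(2)[OF m]])
  fix i k assume "i \<in> {1..N}" "k <= consumed N W d c m i"
  thus "d i k = d' i k" using d[of i k] cons_mono[OF m, of N d "ring_order W c" i] by simp
 qed
 thus "hit N W d' c' m i k w r <-> hit N W d c m i k w r"
  unfolding hit_def tgt_index_def s cc(1)[OF m] cc(2)[OF m] by simp
 show "ring_counts W c' m = ring_counts W c m" by (rule cc(1)[OF m])
qed

lemma hit_pred: "Measurable.pred cfgM (%x. hit N W (dx x) (cx x) n i k w r)"
proof -
 note ro = measurable_ring_counts[where M = cfgM and c = cx, OF cx_meas]
 note s = measurable_st[where M = cfgM and d = dx and J = "%x. ring_order W (cx x)", OF dx_meas ro(2)]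
 have t: "(%x. tgt N (dx x) (ring_order W (cx x)) n) \<in> meas cfgM"
  unfolding tgt_def by (rule measurable_target[where d = dx, OF dx_meas s ro(2)])
 have ti: "(%x. tgt_index N (dx x) (ring_order W (cx x)) n) \<in> meas cfgM"
  unfolding tgt_index_def by (rule measurable_compose_countable[OF s(3) t])
 note [measurable] = ro t ti
 show ?thesis unfolding hit_def by (intro pred_intros_logic) measurable
qed

lemma hit_later:
 assumes "hit N W d c m i k w r" "m < n"
 shows "r < ring_counts W c n w" "k < consumed N W d c n i"
proof -
 have "Suc r = ring_counts W c (Suc m) w" using assms by (simp add: hit_def ring_counts_Suc)
 thus "r < ring_counts W c n w" using ring_counts_mono[of "Suc m" n W c w] assms by simp
 have "Suc k = consumed N W d c (Suc m) i" using assms by (auto simp: hit_def cons_Suc tgt_index_def)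
 thus "k < consumed N W d c n i" using cons_mono[of "Suc m" n N d "ring_order W c" i] assms by simp
qed

lemma hit_consumed: "hit N W d c n i k w r ==> consumed N W d c n i = k"
 by (auto simp: hit_def tgt_index_def)

lemma hit_unique:
 assumes "hit N W d c m i k w r" "hit N W d c n i k w' r'"
 shows "m = n" "w = w'" "r = r'"
proof -
 show "m = n" using hit_later(2)[OF assms(1)] hit_later(2)[OF assms(2)] hit_consumed[OF assms(1)] hit_consumed[OF assms(2)]
  by (metis less_irrefl nat_neq_iff)
 thus "w = w'" "r = r'" using assms by (auto simp: hit_def)
qed

lemma hit_unique_ring:
 assumes "hit N W d c m i k w r" "hit N W d c n i' k' w r"
 shows "m = n" "i = i'"
proof -
 have "ring_counts W c m w = r" "ring_counts W c n w = r" using assms by (auto simp: hit_def)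
 thus "m = n" using hit_later(1)[OF assms(1), of n] hit_later(1)[OF assms(2), of m] by (metis less_irrefl nat_neq_iff)
 thus "i = i'" using assms by (auto simp: hit_def)
qed

text \<open>Unlike \<open>reg\<close> this involves finitely many gaps from index \<open>a\<close>
  on, so it can be demanded of fresh gaps within a bounded horizon.\<close>

definition fin_reg :: "nat => nat => nat => (nat => real) => bool" where
 "fin_reg H a R y <-> (\<forall>k\<in>{a..<a + R}. real H / 4 <= (\<Sum>l\<in>{k..<k + H}. y l) & (\<Sum>l\<in>{k..<k + H}. y l) <= 4 * real H)"

text \<open>Particles come in close pairs, one for each of the two workers. The long gap and the
  short gap next to it together stay below the distance reached, so two workers who alternate can
  both always advance.\<close>

definition dust_pat :: "nat => real => (nat => real) => bool" where
 "dust_pat J mu y <-> (\<forall>l<J.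
   y (2 * l + 2) \<in> {(1 - 1 / J) * ((2 - 1 / J) ^ l * mu) .. (1 - 1 / (2 * J)) * ((2 - 1 / J) ^ l * mu)} &
   y (2 * l + 3) \<in> {0 .. 1 / (2 * J) * ((2 - 1 / J) ^ l * mu)})"

text \<open>The \<open>J\<close> rests together exceed \<open>J\<close> by at most
  \<open>1 / 16\<close>, too little to change the order of the rings of two workers about half a
  unit apart.\<close>

definition clock_pat :: "nat => nat => (nat => real) => bool" where
 "clock_pat J a y <-> (\<forall>l<J. y (a + l) \<in> {1 .. 1 + 1 / (16 * J)})"

text \<open>After a meeting on halfline \<open>i\<close>, the unrevealed gaps make the two workers alternate. In the meeting
  itself, the bit and the residues separate the tuples so that no two tuples of a class share a clock gap.\<close>

definition fresh_at :: "nat => nat => nat => nat => real => cfg => nat => nat => nat => nat => nat => bool" where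
 "fresh_at J H R jj mu x i A rh B sm <->
   (dust_pat J mu (%l. x (Inl i, l)) & fin_reg H (2 * J + 2) R (%l. x (Inl i, l))) &
   (clock_pat J (rh + 2) (%l. x (Inr A, l)) & fin_reg H (rh + 2 + J) R (%l. x (Inr A, l))) &
   x (Inr B, sm + 1) \<in> {real jj / 8 + 1 / 2 .. real jj / 8 + 9 / 16} &
   (clock_pat J (sm + 2) (%l. x (Inr B, l)) & fin_reg H (sm + 2 + J) R (%l. x (Inr B, l)))"

text \<open>The count \<open>Suc rh\<close> says that \<open>A\<close> is still resting after the
  first removal when \<open>B\<close> makes the second. Of \<open>A\<close> the gap
  \<open>Suc rh\<close> has been looked at, of \<open>B\<close> nothing after \<open>sm\<close>; the
  clause on \<open>jj\<close> records the former, so that the fresh gap of \<open>B\<close> can be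
  matched to it.\<close>

definition meet_at :: "nat => nat => nat => nat => bool => nat => nat => nat => real => real => real => cfg =>
  nat => nat => nat => nat => nat => nat => nat => bool" where
 "meet_at N W La bt ob ph ph' jj mu h ta x i nA nB A rh B sm <->
   hit N W (dx x) (cx x) nA i 0 A rh & hit N W (dx x) (cx x) nB i 1 B sm & nA < nB &
   ring_counts W (cx x) nB A = Suc rh & cx x B sm - cx x A rh <= ta &
   x (Inr A, Suc rh) \<in> {real jj / 8 ..< real jj / 8 + 1 / 8} &
   x (Inl i, 0) \<in> {mu .. 2 * mu} & x (Inl i, 1) <= h &
   bit A bt = ob & bit B bt = (~ ob) & rh mod La = ph & sm mod La = ph'"

definition tuples_at :: "nat => nat => nat => (nat \<times> nat \<times> nat \<times> nat \<times> nat \<times> nat \<times> nat) set" where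
 "tuples_at N W nmax = {1..N} \<times> {..<nmax} \<times> {..<nmax} \<times> {1..W} \<times> {..<nmax} \<times> {1..W} \<times> {..<nmax}"

section \<open>Independence of meetings and fresh patterns\<close>

locale pair_setup = star_cleaning +
 fixes J H R La bt ph ph' jj nmax :: nat and ob :: bool and mu h ta :: real
 assumes N1: "1 <= N" and La: "J + R + H + 2 <= La"
begin

abbreviation "fresh_ok \<equiv> fresh_at J H R jj mu"
abbreviation "meet \<equiv> meet_at N W La bt ob ph ph' jj mu h ta"
abbreviation "tuples \<equiv> tuples_at N W nmax"
lemmas fresh_ok_def = fresh_at_def and meet_def = meet_at_def and tuples_def = tuples_at_def

text \<open>What the history up to the landing of \<open>B\<close> has not revealed. The next ring
  of \<open>A\<close> is already scheduled, that of \<open>B\<close> is not; hence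
  \<open>rh + 2\<close> but \<open>sm + 1\<close>.\<close>

definition tail :: "nat => nat => nat => nat => nat => ((nat + nat) \<times> nat) set" where
 "tail i A rh B sm = {(Inl i, l) | l. 2 <= l} \<union> {(Inr A, l) | l. rh + 2 <= l} \<union> {(Inr B, l) | l. sm + 1 <= l}"

text \<open>The part of \<open>tail\<close> that a pattern looks at. The clocks are cut off after
  \<open>La\<close> rings, so that a later meeting of the same worker finds fresh gaps
  again.\<close>

definition horizon :: "nat => nat => nat => nat => nat => ((nat + nat) \<times> nat) set" where
 "horizon i A rh B sm = {(Inl i, l) | l. 2 <= l} \<union> {(Inr A, l) | l. rh + 2 <= l & l < rh + La} \<union>
   {(Inr B, l) | l. sm + 1 <= l & l < sm + La}"

lemma fin_reg_cong:
 assumes "!!l. a <= l ==> l < a + R + H ==> y l = y' l"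
 shows "fin_reg H a R y <-> fin_reg H a R y'"
proof -
 have "(\<Sum>l\<in>{k..<k + H}. y l) = (\<Sum>l\<in>{k..<k + H}. y' l)" if "k \<in> {a..<a + R}" for k
  by (rule sum.cong) (use assms that in auto)
 thus ?thesis unfolding fin_reg_def by simp
qed

lemma fresh_dep: "dep (%x. fresh_ok x i A rh B sm) (horizon i A rh B sm)"
 unfolding dep_def
proof (intro allI impI)
 fix x x' :: cfg assume ag: "\<forall>z\<in>horizon i A rh B sm. x z = x' z" and ok: "fresh_ok x i A rh B sm"
 have d: "x (Inl i, l) = x' (Inl i, l)" if "2 <= l" for l using ag that by (auto simp: horizon_def)
 have a: "x (Inr A, l) = x' (Inr A, l)" if "rh + 2 <= l" "l < rh + La" for l using ag that by (auto simp: horizon_def)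
 have b: "x (Inr B, l) = x' (Inr B, l)" if "sm + 1 <= l" "l < sm + La" for l using ag that by (auto simp: horizon_def)
 have "dust_pat J mu (%l. x (Inl i, l)) <-> dust_pat J mu (%l. x' (Inl i, l))"
  unfolding dust_pat_def by (simp add: d)
 moreover have "fin_reg H (2 * J + 2) R (%l. x (Inl i, l)) <-> fin_reg H (2 * J + 2) R (%l. x' (Inl i, l))"
  by (rule fin_reg_cong) (simp add: d)
 moreover have "clock_pat J (rh + 2) (%l. x (Inr A, l)) <-> clock_pat J (rh + 2) (%l. x' (Inr A, l))"
  unfolding clock_pat_def using a[of "rh + 2 + l" for l] La by simp
 moreover have "fin_reg H (rh + 2 + J) R (%l. x (Inr A, l)) <-> fin_reg H (rh + 2 + J) R (%l. x' (Inr A, l))"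
  by (rule fin_reg_cong) (rule a, use La in auto)
 moreover have "x (Inr B, sm + 1) = x' (Inr B, sm + 1)" by (rule b) (use La in auto)
 moreover have "clock_pat J (sm + 2) (%l. x (Inr B, l)) <-> clock_pat J (sm + 2) (%l. x' (Inr B, l))"
  unfolding clock_pat_def using b[of "sm + 2 + l" for l] La by simp
 moreover have "fin_reg H (sm + 2 + J) R (%l. x (Inr B, l)) <-> fin_reg H (sm + 2 + J) R (%l. x' (Inr B, l))"
  by (rule fin_reg_cong) (rule b, use La in auto)
 ultimately show "fresh_ok x' i A rh B sm" using ok unfolding fresh_ok_def by simp
qed

lemma fresh_pred: "Measurable.pred cfgM (%x. fresh_ok x i A rh B sm)"
 unfolding fresh_ok_def dust_pat_def clock_pat_def fin_reg_def by measurable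

lemma meet_pred: "Measurable.pred cfgM (%x. meet x i nA nB A rh B sm)"
proof -
 note [measurable] = hit_pred cx_meas measurable_ring_counts(1)[where M = cfgM and c = cx, OF cx_meas]
 show ?thesis unfolding meet_def by measurable
qed

lemma mod_gap:
 assumes "a < b" "a mod La = b mod La" shows "a + La <= b"
proof -
 have "La dvd b - a" using assms mod_eq_dvd_iff_nat[of a b La] by simp
 hence "La <= b - a" using assms by (intro dvd_imp_le) auto
 thus ?thesis using assms by simp
qed

text \<open>In a configuration with the meeting, the counts at jump \<open>nB'\<close> are known,
  and all gaps up to them lie outside \<open>tail\<close>.\<close>

lemma agree:
 assumes m: "meet x j nA' nB' A' rh' B' sm'"
  and ag: "\<forall>z\<in>II - tail j A' rh' B' sm'. x z = x' z"
 shows "!!i k. i \<in> {1..N} ==> k <= consumed N W (dx x) (cx x) nB' i ==> dx x i k = dx x' i k"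
  and "!!v r. v \<in> {1..W} ==> r <= ring_counts W (cx x) nB' v ==> x (Inr v, r) = x' (Inr v, r)"
  and "!!v r. v \<in> {1..W} ==> r <= ring_counts W (cx x) nB' v ==> cx x v r = cx x' v r"
proof -
 have c1: "consumed N W (dx x) (cx x) nB' j = 1" using m hit_consumed by (auto simp: meet_def)
 have rA: "ring_counts W (cx x) nB' A' = Suc rh'" and rB: "ring_counts W (cx x) nB' B' = sm'" and AB: "A' ~= B'"
  using m by (auto simp: meet_def hit_def)
 show d: "dx x i k = dx x' i k" if "i \<in> {1..N}" "k <= consumed N W (dx x) (cx x) nB' i" for i k
  unfolding dx_def
 proof (rule sum.cong[OF refl])
  fix l assume "l \<in> {..k}"
  hence "i = j ==> l < 2" using that c1 by simp
  thus "x (Inl i, l) = x' (Inl i, l)" by (intro ag[rule_format]) (use that in "auto simp: tail_def")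
 qed
 show c: "x (Inr v, r) = x' (Inr v, r)" if "v \<in> {1..W}" "r <= ring_counts W (cx x) nB' v" for v r
  by (rule ag[rule_format]) (use that rA rB AB in "auto simp: tail_def")
 show "cx x v r = cx x' v r" if "v \<in> {1..W}" "r <= ring_counts W (cx x) nB' v" for v r
  unfolding cx_def by (rule sum.cong[OF refl]) (use c that in auto)
qed

lemma meet_transfer:
 assumes m': "meet x j nA' nB' A' rh' B' sm'" and j: "j \<in> {1..N}"
  and ag: "\<forall>z\<in>II - tail j A' rh' B' sm'. x z = x' z"
  and m: "meet x i nA nB A rh B sm" and i: "i \<in> {1..N}" "A \<in> {1..W}" "B \<in> {1..W}"
  and le: "nB < nB' \<or> (i, nA, nB, A, rh, B, sm) = (j, nA', nB', A', rh', B', sm')"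
 shows "meet x' i nA nB A rh B sm"
proof -
 note ag' = agree[OF m' ag]
 have nle: "nA < nB" "nA <= nB'" "nB <= nB'" using m le by (auto simp: meet_def)
 note hc = hit_cong[OF N1 ag'(1) ag'(3)]
 have hA: "hit N W (dx x) (cx x) nA i 0 A rh" and hB: "hit N W (dx x) (cx x) nB i 1 B sm" using m by (auto simp: meet_def)
 have rrh: "Suc rh <= ring_counts W (cx x) nB' A"
  using hit_later(1)[OF hA, of nB'] nle by simp
 have rsm: "sm <= ring_counts W (cx x) nB' B"
  using hB ring_counts_mono[OF nle(3), of W "cx x" B] by (simp add: hit_def)
 have "cx x' B sm = cx x B sm" "cx x' A rh = cx x A rh" "x' (Inr A, Suc rh) = x (Inr A, Suc rh)"
  using ag'(3)[OF i(3) rsm] ag'(3)[OF i(2), of rh] ag'(2)[OF i(2) rrh] rrh by auto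
 moreover have "x' (Inl i, 0) = x (Inl i, 0)" "x' (Inl i, 1) = x (Inl i, 1)"
  using ag[rule_format, of "(Inl i, 0)"] ag[rule_format, of "(Inl i, 1)"] i(1) by (auto simp: tail_def)
 moreover have "ring_counts W (cx x') nB = ring_counts W (cx x) nB"
  by (rule hit_cong(2)[where n = nB' and d = "dx x" and d' = "dx x'", OF N1]) (use ag'(1,3) nle in auto)
 moreover have "hit N W (dx x') (cx x') nA i 0 A rh <-> hit N W (dx x) (cx x) nA i 0 A rh"
  by (rule hit_cong(1)[where n = nB', OF N1]) (use ag'(1,3) nle in auto)
 moreover have "hit N W (dx x') (cx x') nB i 1 B sm <-> hit N W (dx x) (cx x) nB i 1 B sm"
  by (rule hit_cong(1)[where n = nB', OF N1]) (use ag'(1,3) nle in auto)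
 ultimately show ?thesis using m unfolding meet_def by simp
qed

lemma meet_dep:
 assumes "i \<in> {1..N}" "A \<in> {1..W}" "B \<in> {1..W}"
 shows "dep (%x. meet x i nA nB A rh B sm) (II - tail i A rh B sm)"
 unfolding dep_def using meet_transfer[of _ i nA nB A rh B sm _ i nA nB A rh B sm] assms by blast

text \<open>The earlier meeting is history for the later one. Its pattern also avoids the later
  tail: the halflines differ, the bit keeps a worker from being \<open>A\<close> in one tuple and
  \<open>B\<close> in the other, and equal residues keep two meetings of one worker in the same role
  \<open>La\<close> rings apart.\<close>

lemma meet_pair_dep:
 assumes i: "i \<in> {1..N}" "A \<in> {1..W}" "B \<in> {1..W}" and j: "j \<in> {1..N}" "A' \<in> {1..W}" "B' \<in> {1..W}"
  and later: "nB < nB'" "i ~= j"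
 shows "dep (%x. meet x i nA nB A rh B sm & meet x j nA' nB' A' rh' B' sm') (II - tail j A' rh' B' sm')"
  and "dep (%x. (meet x i nA nB A rh B sm & meet x j nA' nB' A' rh' B' sm') & fresh_ok x i A rh B sm) (II - tail j A' rh' B' sm')"
proof -
 show 1: "dep (%x. meet x i nA nB A rh B sm & meet x j nA' nB' A' rh' B' sm') (II - tail j A' rh' B' sm')"
  unfolding dep_def
 proof (intro allI impI)
  fix x x' :: cfg assume ag: "\<forall>z\<in>II - tail j A' rh' B' sm'. x z = x' z"
   and m: "meet x i nA nB A rh B sm & meet x j nA' nB' A' rh' B' sm'"
  show "meet x' i nA nB A rh B sm & meet x' j nA' nB' A' rh' B' sm'"
   using meet_transfer[of x j nA' nB' A' rh' B' sm' x' i nA nB A rh B sm]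
    meet_transfer[of x j nA' nB' A' rh' B' sm' x' j nA' nB' A' rh' B' sm'] ag m i j later by blast
 qed
 show "dep (%x. (meet x i nA nB A rh B sm & meet x j nA' nB' A' rh' B' sm') & fresh_ok x i A rh B sm) (II - tail j A' rh' B' sm')"
  unfolding dep_def
 proof (intro allI impI)
  fix x x' :: cfg assume ag: "\<forall>z\<in>II - tail j A' rh' B' sm'. x z = x' z"
   and m: "(meet x i nA nB A rh B sm & meet x j nA' nB' A' rh' B' sm') & fresh_ok x i A rh B sm"
  hence mi: "meet x i nA nB A rh B sm" and mj: "meet x j nA' nB' A' rh' B' sm'" by auto
  have hA: "hit N W (dx x) (cx x) nA i 0 A rh" and hB: "hit N W (dx x) (cx x) nB i 1 B sm"
   and hA': "hit N W (dx x) (cx x) nA' j 0 A' rh'" and hB': "hit N W (dx x) (cx x) nB' j 1 B' sm'"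
   and rA': "ring_counts W (cx x) nB' A' = Suc rh'" and n: "nA < nB"
   and mods: "rh mod La = rh' mod La" "sm mod La = sm' mod La"
   and bits: "A ~= B'" "B ~= A'" using mi mj by (auto simp: meet_def)
  have A: "rh + La <= rh'" if "A = A'"
  proof (rule mod_gap[OF _ mods(1)])
   have "rh ~= rh'" using hit_unique_ring(2)[of N W "dx x" "cx x" nA i 0 A rh nA' j 0] hA hA' later that by auto
   moreover have "rh < Suc rh'" using hit_later(1)[OF hA, of nB'] rA' that n later by simp
   ultimately show "rh < rh'" by simp
  qed
  have B: "sm + La <= sm'" if "B = B'"
  proof (rule mod_gap[OF _ mods(2)])
   have "ring_counts W (cx x) nB' B = sm'" using hB' that by (simp add: hit_def)
   thus "sm < sm'" using hit_later(1)[OF hB later(1)] by simp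
  qed
  have "x z = x' z" if z: "z \<in> horizon i A rh B sm" for z
   by (rule ag[rule_format]) (use z i A B later bits in "auto simp: horizon_def tail_def")
  hence "fresh_ok x' i A rh B sm" using fresh_dep[of i A rh B sm] m unfolding dep_def by blast
  moreover have "meet x' i nA nB A rh B sm & meet x' j nA' nB' A' rh' B' sm'"
   using 1 ag mi mj unfolding dep_def by blast
  ultimately show "(meet x' i nA nB A rh B sm & meet x' j nA' nB' A' rh' B' sm') & fresh_ok x' i A rh B sm" by blast
 qed
qed

definition EE where
 "EE = (%(i, nA, nB, A, rh, B, sm). {om \<in> space M. meet (GW om) i nA nB A rh B sm})"

definition SS where
 "SS = (%(i, nA, nB, A, rh, B, sm). {om \<in> space M. fresh_ok (GW om) i A rh B sm})"

lemma horizon_II: "i \<in> {1..N} ==> A \<in> {1..W} ==> B \<in> {1..W} ==> horizon i A rh B sm <= II"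
 by (auto simp: horizon_def)

lemma tail_horizon: "(II - tail i A rh B sm) \<inter> horizon i A rh B sm = {}"
 by (auto simp: horizon_def tail_def)

lemma EE_events: "kp \<in> tuples ==> EE kp \<in> events" and SS_events: "kp \<in> tuples ==> SS kp \<in> events"
proof -
 assume "kp \<in> tuples"
 then obtain i nA nB A rh B sm where k: "kp = (i, nA, nB, A, rh, B, sm)" "i \<in> {1..N}" "A \<in> {1..W}" "B \<in> {1..W}"
  by (auto simp: tuples_def)
 show "EE kp \<in> events" unfolding EE_def k(1) prod.case
  by (rule dep_pred(2)[OF _ meet_dep meet_pred]) (use k in auto)
 show "SS kp \<in> events" unfolding SS_def k(1) prod.case
  by (rule dep_pred(2)[OF _ fresh_dep fresh_pred]) (use k horizon_II in auto)
qed

lemma fresh_after: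
 assumes i: "i \<in> {1..N}" "A \<in> {1..W}" "B \<in> {1..W}" and P: "dep P (II - tail i A rh B sm)" "Measurable.pred cfgM P"
 shows "\<P>(om in M. P (GW om) & fresh_ok (GW om) i A rh B sm)
  = \<P>(om in M. P (GW om)) * \<P>(om in M. fresh_ok (GW om) i A rh B sm)"
 by (rule indep_parts[OF _ horizon_II[OF i] tail_horizon P fresh_dep fresh_pred]) auto

text \<open>A halfline has one first and one second removal, so its tuples give disjoint events; all
  of them require its second gap to be at most \<open>h\<close>.\<close>

lemma sum_EE: "(\<Sum>kp\<in>tuples. prob (EE kp)) <= N * h" if "0 <= h"
proof -
 define T' where "T' = {..<nmax} \<times> {..<nmax} \<times> {1..W} \<times> {..<nmax} \<times> {1..W} \<times> {..<nmax}"
 have fin: "finite T'" by (simp add: T'_def)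
 have "(\<Sum>kp\<in>tuples. prob (EE kp)) = (\<Sum>i\<in>{1..N}. \<Sum>kp\<in>T'. prob (EE (i, kp)))"
  unfolding tuples_def T'_def[symmetric] by (simp add: sum.cartesian_product)
 also have "... <= (\<Sum>i\<in>{1..N}. h)"
 proof (rule sum_mono)
  fix i assume i: "i \<in> {1..N}"
  have ev: "EE (i, kp) \<in> events" if "kp \<in> T'" for kp
   by (rule EE_events) (use that i in "auto simp: tuples_def T'_def")
  have "disjoint_family_on (%kp. EE (i, kp)) T'"
   unfolding disjoint_family_on_def
  proof (intro ballI impI, rule ccontr)
   fix k k' assume kk: "k \<in> T'" "k' \<in> T'" "k ~= k'" "EE (i, k) \<inter> EE (i, k') ~= {}"
   obtain nA nB A rh B sm where k: "k = (nA, nB, A, rh, B, sm)" by (metis prod.exhaust)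
   obtain nA' nB' A' rh' B' sm' where k': "k' = (nA', nB', A', rh', B', sm')" by (metis prod.exhaust)
   obtain om where "meet (GW om) i nA nB A rh B sm" "meet (GW om) i nA' nB' A' rh' B' sm'"
    using kk(4) by (auto simp: EE_def k k')
   hence h: "hit N W (dx (GW om)) (cx (GW om)) nA i 0 A rh" "hit N W (dx (GW om)) (cx (GW om)) nA' i 0 A' rh'"
    "hit N W (dx (GW om)) (cx (GW om)) nB i 1 B sm" "hit N W (dx (GW om)) (cx (GW om)) nB' i 1 B' sm'"
    by (auto simp: meet_def)
   have "k = k'" unfolding k k' using hit_unique[OF h(1,2)] hit_unique[OF h(3,4)] by simp
   thus False using kk by simp
  qed
  moreover have "(%kp. EE (i, kp)) ` T' <= events" using ev by blast
  ultimately have "(\<Sum>kp\<in>T'. prob (EE (i, kp))) = prob (\<Union>kp\<in>T'. EE (i, kp))"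
   by (intro finite_measure_finite_Union[symmetric] fin)
  also have "... <= \<P>(om in M. GG (Inl i, 1) om <= h)"
  proof (rule finite_measure_mono)
   show "{om \<in> space M. GG (Inl i, 1) om <= h} \<in> events"
    using G_meas[of "(Inl i, 1)"] i by simp
  qed (auto simp: EE_def meet_def)
  also have "... <= h" by (rule prob_le') (use i that in auto)
  finally show "(\<Sum>kp\<in>T'. prob (EE (i, kp))) <= h" .
 qed
 finally show ?thesis by simp
qed

lemma outer_no_success:
 fixes p0 r :: real
 assumes p0: "0 < p0" "!!i A rh B sm. i \<in> {1..N} ==> A \<in> {1..W} ==> B \<in> {1..W} ==> A ~= B ==>
   p0 <= \<P>(om in M. fresh_ok (GW om) i A rh B sm)"
  and r: "0 < r" and h: "0 <= h"
 shows "outer_le (%om. r <= card {(i, nA, nB, A, rh, B, sm) \<in> tuples. meet (GW om) i nA nB A rh B sm} &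
   (\<forall>(i, nA, nB, A, rh, B, sm)\<in>tuples. meet (GW om) i nA nB A rh B sm --> ~ fresh_ok (GW om) i A rh B sm))
  (N * h / (p0 * r\<^sup>2))"
proof -
 define T where "T = {kp \<in> tuples. case kp of (i, nA, nB, A, rh, B, sm) => A ~= B}"
 define later :: "nat \<times> nat \<times> nat \<times> nat \<times> nat \<times> nat \<times> nat => nat \<times> nat \<times> nat \<times> nat \<times> nat \<times> nat \<times> nat => bool"
  where "later = (%(i, nA, nB, A, rh, B, sm) (j, nA', nB', A', rh', B', sm'). nB < nB' & i ~= j)"
 have TT: "T <= tuples" by (auto simp: T_def)
 have fin: "finite tuples" by (simp add: tuples_def)
 have main: "outer_le (%om. r <= card {kp \<in> T. om \<in> EE kp} & (\<forall>kp\<in>T. om \<in> EE kp --> om \<notin> SS kp))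
  ((\<Sum>kp\<in>T. prob (EE kp)) / (p0 * r\<^sup>2))"
 proof (rule second_moment[where later = later, OF _ _ _ p0(1) _ r])
  show "finite T" using finite_subset[OF TT fin] .
  fix kp assume kp: "kp \<in> T"
  show "EE kp \<in> events" "SS kp \<in> events" by (rule EE_events[OF subsetD[OF TT kp]], rule SS_events[OF subsetD[OF TT kp]])
  obtain i nA nB A rh B sm where k: "kp = (i, nA, nB, A, rh, B, sm)" "i \<in> {1..N}" "A \<in> {1..W}" "B \<in> {1..W}" "A ~= B"
   using kp by (auto simp: T_def tuples_def)
  show "p0 <= prob (SS kp)" unfolding SS_def k(1) prod.case by (rule p0(2)) (use k in auto)
  have "EE kp \<inter> SS kp = {om \<in> space M. meet (GW om) i nA nB A rh B sm & fresh_ok (GW om) i A rh B sm}"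
   by (auto simp: k(1) EE_def SS_def)
  thus "prob (EE kp \<inter> SS kp) = prob (EE kp) * prob (SS kp)"
   using fresh_after[OF k(2-4) meet_dep[OF k(2-4)] meet_pred, of nA nB rh sm] by (simp add: k(1) EE_def SS_def)
  fix nu assume nu: "nu \<in> T"
  obtain j nA' nB' A' rh' B' sm' where l: "nu = (j, nA', nB', A', rh', B', sm')" "j \<in> {1..N}" "A' \<in> {1..W}" "B' \<in> {1..W}" "A' ~= B'"
   using nu by (auto simp: T_def tuples_def)
  show "EE kp \<inter> EE nu = {} \<or> later kp nu \<or> later nu kp" if ne: "kp ~= nu"
  proof (cases "EE kp \<inter> EE nu = {}")
   case False
   then obtain om where m: "meet (GW om) i nA nB A rh B sm" "meet (GW om) j nA' nB' A' rh' B' sm'"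
    by (auto simp: EE_def k(1) l(1))
   have "i ~= j"
   proof
    assume "i = j"
    hence h: "hit N W (dx (GW om)) (cx (GW om)) nA i 0 A rh" "hit N W (dx (GW om)) (cx (GW om)) nA' i 0 A' rh'"
     "hit N W (dx (GW om)) (cx (GW om)) nB i 1 B sm" "hit N W (dx (GW om)) (cx (GW om)) nB' i 1 B' sm'"
     using m by (auto simp: meet_def)
    have "kp = nu" unfolding k(1) l(1) using \<open>i = j\<close> hit_unique[OF h(1,2)] hit_unique[OF h(3,4)] by simp
    thus False using ne by simp
   qed
   moreover have "nB ~= nB'" using m \<open>i ~= j\<close> by (auto simp: meet_def hit_def)
   ultimately show ?thesis by (auto simp: later_def k(1) l(1))
  qed simp
  assume "later kp nu"
  hence lt: "nB < nB'" "i ~= j" by (auto simp: later_def k(1) l(1))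
  note md = meet_pair_dep[OF k(2-4) l(2-4) lt, of nA rh sm nA' rh' sm']
  have "EE kp \<inter> EE nu \<inter> SS nu = {om \<in> space M. (meet (GW om) i nA nB A rh B sm & meet (GW om) j nA' nB' A' rh' B' sm')
    & fresh_ok (GW om) j A' rh' B' sm'}"
   "EE kp \<inter> EE nu = {om \<in> space M. meet (GW om) i nA nB A rh B sm & meet (GW om) j nA' nB' A' rh' B' sm'}"
   by (auto simp: k(1) l(1) EE_def SS_def)
  moreover have "\<P>(om in M. (meet (GW om) i nA nB A rh B sm & meet (GW om) j nA' nB' A' rh' B' sm')
    & fresh_ok (GW om) j A' rh' B' sm') = \<P>(om in M. meet (GW om) i nA nB A rh B sm & meet (GW om) j nA' nB' A' rh' B' sm')
    * \<P>(om in M. fresh_ok (GW om) j A' rh' B' sm')"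
   by (rule fresh_after[OF l(2-4) md(1)]) (intro pred_intros_logic meet_pred)
  ultimately have 1: "prob (EE kp \<inter> EE nu \<inter> SS nu) = prob (EE kp \<inter> EE nu) * prob (SS nu)"
   by (simp add: l(1) SS_def)
  have "EE kp \<inter> EE nu \<inter> SS kp \<inter> SS nu = {om \<in> space M. ((meet (GW om) i nA nB A rh B sm & meet (GW om) j nA' nB' A' rh' B' sm')
    & fresh_ok (GW om) i A rh B sm) & fresh_ok (GW om) j A' rh' B' sm'}"
   "EE kp \<inter> EE nu \<inter> SS kp = {om \<in> space M. (meet (GW om) i nA nB A rh B sm & meet (GW om) j nA' nB' A' rh' B' sm')
    & fresh_ok (GW om) i A rh B sm}"
   by (auto simp: k(1) l(1) EE_def SS_def)
  moreover have "\<P>(om in M. ((meet (GW om) i nA nB A rh B sm & meet (GW om) j nA' nB' A' rh' B' sm')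
    & fresh_ok (GW om) i A rh B sm) & fresh_ok (GW om) j A' rh' B' sm')
    = \<P>(om in M. (meet (GW om) i nA nB A rh B sm & meet (GW om) j nA' nB' A' rh' B' sm')
    & fresh_ok (GW om) i A rh B sm) * \<P>(om in M. fresh_ok (GW om) j A' rh' B' sm')"
   by (rule fresh_after[OF l(2-4) md(2)]) (intro pred_intros_logic meet_pred fresh_pred)
  ultimately have 2: "prob (EE kp \<inter> EE nu \<inter> SS kp \<inter> SS nu) = prob (EE kp \<inter> EE nu \<inter> SS kp) * prob (SS nu)"
   by (simp add: l(1) SS_def)
  show "prob (EE kp \<inter> EE nu \<inter> SS nu) = prob (EE kp \<inter> EE nu) * prob (SS nu) &
   prob (EE kp \<inter> EE nu \<inter> SS kp \<inter> SS nu) = prob (EE kp \<inter> EE nu \<inter> SS kp) * prob (SS nu)"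
   using 1 2 ..
 qed
 show ?thesis
 proof (rule outer_mono[OF main])
  have "(\<Sum>kp\<in>T. prob (EE kp)) <= (\<Sum>kp\<in>tuples. prob (EE kp))" by (rule sum_mono2[OF fin TT]) simp
  also have "... <= N * h" by (rule sum_EE[OF h])
  finally show "(\<Sum>kp\<in>T. prob (EE kp)) / (p0 * r\<^sup>2) <= N * h / (p0 * r\<^sup>2)"
   by (rule divide_right_mono) (use p0 in simp)
  fix om assume om: "om \<in> space M" and a: "r <= card {(i, nA, nB, A, rh, B, sm) \<in> tuples. meet (GW om) i nA nB A rh B sm} &
   (\<forall>(i, nA, nB, A, rh, B, sm)\<in>tuples. meet (GW om) i nA nB A rh B sm --> ~ fresh_ok (GW om) i A rh B sm)"
  have "{(i, nA, nB, A, rh, B, sm) \<in> tuples. meet (GW om) i nA nB A rh B sm} = {kp \<in> T. om \<in> EE kp}"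
   using om by (auto simp: T_def EE_def meet_def)
  thus "r <= card {kp \<in> T. om \<in> EE kp} & (\<forall>kp\<in>T. om \<in> EE kp --> om \<notin> SS kp)"
   using a by (auto simp: T_def EE_def SS_def)
 qed
qed

end

section \<open>Probability of a fresh pattern\<close>

lemma all_even_odd: "(\<forall>m<2 * J. P m) <-> (\<forall>l<J. P (2 * l) & P (2 * l + 1))" for J :: nat
proof
 assume *: "\<forall>l<J. P (2 * l) & P (2 * l + 1)"
 show "\<forall>m<2 * J. P m"
 proof (intro allI impI)
  fix m assume "m < 2 * J"
  hence "m div 2 < J" by simp
  hence "P (2 * (m div 2))" "P (2 * (m div 2) + 1)" using * by auto
  thus "P m" by (cases "even m") (auto elim!: evenE oddE)
 qed
qed auto

lemma prod_div2: "(\<Prod>m<2 * J. f (m div 2)) = (\<Prod>l<J. f l :: real)\<^sup>2" for J :: nat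
 by (induction J) (simp_all add: power2_eq_square mult_ac)

lemma (in star_cleaning) prob_line_windows:
 fixes lo hi p :: "nat => real"
 assumes I: "!!l. l < n ==> (v, a + l) \<in> II" and w: "!!l. l < n ==> p l <= \<P>(om in M. GG (v, a + l) om \<in> {lo l..hi l})"
  and p: "!!l. l < n ==> 0 <= p l"
 shows "(\<Prod>l<n. p l) <= \<P>(om in M. \<forall>l<n. GG (v, a + l) om \<in> {lo l..hi l})"
proof -
 let ?f = "%l. (v, a + l)"
 let ?B = "%z. {lo (snd z - a)..hi (snd z - a)}"
 have "(\<Prod>l<n. p l) <= (\<Prod>l<n. \<P>(om in M. GG (?f l) om \<in> {lo l..hi l}))"
  by (rule prod_mono) (use w p in auto)
 also have "... = (\<Prod>z\<in>?f ` {..<n}. \<P>(om in M. GG z om \<in> ?B z))"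
  by (subst prod.reindex) (auto simp: inj_on_def)
 also have "... = \<P>(om in M. \<forall>z\<in>?f ` {..<n}. GG z om \<in> ?B z)"
  by (rule prob_all[symmetric]) (use I in auto)
 also have "{om \<in> space M. \<forall>z\<in>?f ` {..<n}. GG z om \<in> ?B z} = {om \<in> space M. \<forall>l<n. GG (v, a + l) om \<in> {lo l..hi l}}"
  by auto
 finally show ?thesis .
qed

lemma (in star_cleaning) outer_not_fin_reg:
 assumes I: "!!l. (v, l) \<in> II"
 shows "outer_le (%om. ~ fin_reg H a R (%l. GG (v, l) om)) (R * (2 * exp (- 2 / 5 * H)))"
proof -
 let ?S = "%k om. \<Sum>l\<in>{k..<k + H}. GG (v, l) om"
 have one: "outer_le (%om. ?S k om < H / 4 \<or> 4 * real H < ?S k om) (exp (- 2 / 5 * H) + exp (- 2 / 5 * H))" for k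
 proof -
  let ?J = "(%l. (v, l)) ` {k..<k + H}"
  have eq: "(\<Sum>j\<in>?J. GG j om) = ?S k om" for om by (subst sum.reindex) (auto simp: inj_on_def)
  have card: "card ?J = H" by (subst card_image) (auto simp: inj_on_def)
  have [measurable]: "?S k \<in> borel_measurable M" by (intro borel_measurable_sum G_meas I)
  have J: "finite ?J" "?J <= II" using I by auto
  show ?thesis
   by (intro outer_or outer_meas)
    (use chernoff_lower[OF J] chernoff_upper[OF J] in "simp_all add: eq card")
 qed
 have "outer_le (%om. \<exists>k\<in>{a..<a + R}. ?S k om < H / 4 \<or> 4 * real H < ?S k om) (\<Sum>k\<in>{a..<a + R}. exp (- 2 / 5 * H) + exp (- 2 / 5 * H))"
  by (rule outer_bex) (simp_all only: finite_atLeastLessThan one)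
 thus ?thesis
  by (rule outer_mono) (auto simp: fin_reg_def not_le)
qed

lemma (in exp_family) indep_chain:
 assumes F: "F1 <= I" "F2 <= I" "F1 \<inter> F2 = {}"
  and P: "dep P F1" "Measurable.pred cfgM P" and Q: "dep Q F2" "Measurable.pred cfgM Q"
  and p: "p <= \<P>(om in M. P (%z. G z om))" "q <= \<P>(om in M. Q (%z. G z om))" "0 <= q"
 shows "p * q <= \<P>(om in M. P (%z. G z om) & Q (%z. G z om))"
 unfolding indep_parts[OF F P Q] by (rule mult_mono) (use p in auto)

context pair_setup
begin

text \<open>Both gaps of a pair have windows of half the width used in \<open>good_pat\<close>, so
  the price is the square of \<open>good_rate\<close> up to the factor \<open>(1 / 4) ^ J\<close>:
  one chain for each worker.\<close>

lemma dust_pat_prob: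
 assumes i: "i \<in> {1..N}" and J: "1 <= J" and mu: "0 < mu"
 shows "(good_rate mu J)\<^sup>2 * (1 / 4) ^ J <= \<P>(om in M. dust_pat J mu (%l. GG (Inl i, l) om))"
proof -
 define u where "u l = (2 - 1 / real J) ^ l * mu" for l
 define lo where "lo m = (if even m then (1 - 1 / J) * u (m div 2) else 0)" for m
 define hi where "hi m = (if even m then (1 - 1 / (2 * J)) * u (m div 2) else 1 / (2 * J) * u (m div 2))" for m
 define p where "p l = u l / (2 * J) * exp (- u l)" for l
 have J1: "1 / real J <= 1" using J by simp
 have u: "0 < u l" for l unfolding u_def using mu J1 by (intro mult_pos_pos zero_less_power) linarith+
 have eq: "dust_pat J mu y <-> (\<forall>m<2 * J. y (2 + m) \<in> {lo m..hi m})" for y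
  unfolding all_even_odd by (simp add: dust_pat_def lo_def hi_def u_def numeral_3_eq_3 add.commute)
 have w: "p (m div 2) <= \<P>(om in M. GG (Inl i, 2 + m) om \<in> {lo m..hi m})" for m
 proof -
  have lohi: "0 <= lo m" "hi m - lo m = u (m div 2) / (2 * J)" "hi m <= u (m div 2)"
  proof -
   show "0 <= lo m" using u[of "m div 2"] J1 by (simp add: lo_def)
   show "hi m - lo m = u (m div 2) / (2 * J)"
    using J by (simp add: lo_def hi_def field_simps)
   have "(1 - 1 / (2 * J)) * u (m div 2) <= 1 * u (m div 2)" "1 / (2 * J) * u (m div 2) <= 1 * u (m div 2)"
    by (rule mult_right_mono; use u[of "m div 2"] J in simp)+
   thus "hi m <= u (m div 2)" by (simp add: hi_def)
  qed
  have "0 <= u (m div 2) / (2 * J)" using u[of "m div 2"] by simp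
  hence "lo m <= hi m" using lohi(2) by linarith
  hence "(hi m - lo m) * exp (- hi m) <= \<P>(om in M. GG (Inl i, 2 + m) om \<in> {lo m..hi m})"
   by (intro prob_window) (use i lohi in auto)
  moreover have "p (m div 2) <= (hi m - lo m) * exp (- hi m)"
   unfolding p_def lohi(2) by (rule mult_left_mono) (use lohi u[of "m div 2"] in auto)
  ultimately show ?thesis by simp
 qed
 have p0: "0 <= p l" for l using u[of l] by (simp add: p_def)
 have "(\<Prod>m<2 * J. p (m div 2)) <= \<P>(om in M. \<forall>m<2 * J. GG (Inl i, 2 + m) om \<in> {lo m..hi m})"
  by (rule prob_line_windows) (use i w p0 in auto)
 moreover have "(good_rate mu J)\<^sup>2 * (1 / 4) ^ J <= (\<Prod>m<2 * J. p (m div 2))"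
 proof -
  define g where "g = (\<Prod>l<J. u l / J * exp (- u l))"
  have gr: "good_rate mu J = 1 / 12 * g" by (simp add: good_rate_def g_def u_def)
  have g0: "0 <= g" unfolding g_def by (intro prod_nonneg mult_nonneg_nonneg divide_nonneg_nonneg) (use less_imp_le[OF u] in auto)
  have "(\<Prod>l<J. p l) = (\<Prod>l<J. (u l / J * exp (- u l)) * (1 / 2))" by (simp add: p_def mult_ac)
  also have "... = g * (1 / 2) ^ J" unfolding prod.distrib g_def by simp
  finally have "(\<Prod>m<2 * J. p (m div 2)) = g\<^sup>2 * (1 / 4) ^ J"
   unfolding prod_div2 by (simp add: power_mult_distrib power2_eq_square flip: power_mult_distrib)
  moreover have "(good_rate mu J)\<^sup>2 <= g\<^sup>2" by (rule power_mono) (use g0 gr in auto)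
  ultimately show ?thesis by (simp add: mult_right_mono)
 qed
 ultimately show ?thesis unfolding eq by linarith
qed

lemma clock_pat_prob:
 assumes w: "w \<in> {1..W}" and J: "1 <= J"
 shows "(1 / (128 * J)) ^ J <= \<P>(om in M. clock_pat J a (%l. GG (Inr w, l) om))"
proof -
 have one: "1 / (128 * J) <= \<P>(om in M. GG (Inr w, a + l) om \<in> {1..1 + 1 / (16 * J)})" for l
 proof -
  have "(1 + 1 / (16 * J) - 1) * exp (- (1 + 1 / (16 * J))) <= \<P>(om in M. GG (Inr w, a + l) om \<in> {1..1 + 1 / (16 * J)})"
   by (rule prob_window) (use w in auto)
  moreover have "1 / (128 * J) <= (1 + 1 / (16 * J) - 1) * exp (- (1 + 1 / (16 * J)))"
  proof -
   have "exp (1 + 1 / (16 * real J)) <= exp (1 + 1 / 16)" using J by (simp add: field_simps)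
   also have "... = exp 1 * exp (1 / 16)" by (rule exp_add)
   also have "... <= 3 * 2"
   proof (rule mult_mono)
    show "exp 1 <= (3 :: real)" by (rule exp_le)
    have "exp (1 / 16 :: real) <= 1 + 1 / 16 + (1 / 16)\<^sup>2" by (rule exp_bound) auto
    thus "exp (1 / 16 :: real) <= 2" by (simp add: power2_eq_square)
   qed auto
   finally have "inverse 6 <= inverse (exp (1 + 1 / (16 * real J)))" by (intro le_imp_inverse_le) auto
   hence "1 / 8 <= exp (- (1 + 1 / (16 * real J)))" unfolding exp_minus by simp
   hence "1 / (16 * J) * (1 / 8) <= 1 / (16 * J) * exp (- (1 + 1 / (16 * real J)))" by (rule mult_left_mono) simp
   thus ?thesis by simp
  qed
  ultimately show ?thesis by linarith
 qed
 have "(\<Prod>l<J. 1 / (128 * real J)) <= \<P>(om in M. \<forall>l<J. GG (Inr w, a + l) om \<in> {1..1 + 1 / (16 * J)})"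
  by (rule prob_line_windows) (use w one in auto)
 thus ?thesis unfolding clock_pat_def by simp
qed

text \<open>The patterns and the three regularity conditions concern disjoint sets of gaps; by
  \<open>HR\<close> the latter fail with probability at most \<open>1 / 2\<close> together.\<close>

lemma fresh_prob:
 assumes mu: "0 < mu" and J: "1 <= J" and HR: "12 * real R * exp (- 2 / 5 * H) <= 1"
  and i: "i \<in> {1..N}" "A \<in> {1..W}" "B \<in> {1..W}" "A ~= B"
 shows "(good_rate mu J)\<^sup>2 * (1 / 4) ^ J * ((1 / (128 * J)) ^ J * (1 / (128 * J)) ^ J * (exp (- (real jj / 8 + 1)) / 32))
  <= \<P>(om in M. fresh_ok (GW om) i A rh B sm)"
proof -
 define P1 where "P1 x <-> dust_pat J mu (%l. x (Inl i, l))" for x :: cfg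
 define P2 where "P2 x <-> clock_pat J (rh + 2) (%l. x (Inr A, l))" for x :: cfg
 define P3 where "P3 x <-> x (Inr B, sm + 1) \<in> {real jj / 8 + 1 / 2 .. real jj / 8 + 9 / 16}" for x :: cfg
 define P4 where "P4 x <-> clock_pat J (sm + 2) (%l. x (Inr B, l))" for x :: cfg
 define P5 where "P5 x <-> fin_reg H (2 * J + 2) R (%l. x (Inl i, l)) &
   fin_reg H (rh + 2 + J) R (%l. x (Inr A, l)) & fin_reg H (sm + 2 + J) R (%l. x (Inr B, l))" for x :: cfg
 define F1 :: "((nat + nat) \<times> nat) set" where "F1 = {(Inl i, l) | l. 2 <= l & l < 2 * J + 2}"
 define F2 :: "((nat + nat) \<times> nat) set" where "F2 = {(Inr A, l) | l. rh + 2 <= l & l < rh + 2 + J}"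
 define F3 :: "((nat + nat) \<times> nat) set" where "F3 = {(Inr B, sm + 1)}"
 define F4 :: "((nat + nat) \<times> nat) set" where "F4 = {(Inr B, l) | l. sm + 2 <= l & l < sm + 2 + J}"
 define F5 :: "((nat + nat) \<times> nat) set" where "F5 = {(Inl i, l) | l. 2 * J + 2 <= l} \<union> {(Inr A, l) | l. rh + 2 + J <= l} \<union> {(Inr B, l) | l. sm + 2 + J <= l}"
 have d1: "dep P1 F1" unfolding dep_def P1_def dust_pat_def F1_def by (auto simp: numeral_3_eq_3)
 have d2: "dep P2 F2" unfolding dep_def P2_def clock_pat_def F2_def by auto
 have d3: "dep P3 F3" unfolding dep_def P3_def F3_def by auto
 have d4: "dep P4 F4" unfolding dep_def P4_def clock_pat_def F4_def by auto
 have d5: "dep P5 F5" unfolding dep_def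
 proof (intro allI impI)
  fix x x' :: cfg assume ag: "\<forall>z\<in>F5. x z = x' z" and "P5 x"
  moreover have "fin_reg H (2 * J + 2) R (%l. x (Inl i, l)) <-> fin_reg H (2 * J + 2) R (%l. x' (Inl i, l))"
   by (rule fin_reg_cong) (use ag in "auto simp: F5_def")
  moreover have "fin_reg H (rh + 2 + J) R (%l. x (Inr A, l)) <-> fin_reg H (rh + 2 + J) R (%l. x' (Inr A, l))"
   by (rule fin_reg_cong) (use ag in "auto simp: F5_def")
  moreover have "fin_reg H (sm + 2 + J) R (%l. x (Inr B, l)) <-> fin_reg H (sm + 2 + J) R (%l. x' (Inr B, l))"
   by (rule fin_reg_cong) (use ag in "auto simp: F5_def")
  ultimately show "P5 x'" unfolding P5_def by blast
 qed
 have m1: "Measurable.pred cfgM P1" unfolding P1_def[abs_def] dust_pat_def by measurable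
 have m2: "Measurable.pred cfgM P2" unfolding P2_def[abs_def] clock_pat_def by measurable
 have m3: "Measurable.pred cfgM P3" unfolding P3_def[abs_def] by measurable
 have m4: "Measurable.pred cfgM P4" unfolding P4_def[abs_def] clock_pat_def by measurable
 have m5: "Measurable.pred cfgM P5" unfolding P5_def[abs_def] fin_reg_def by measurable
 have I1: "F1 <= II" and I2: "F2 <= II" and I3: "F3 <= II" and I4: "F4 <= II" and I5: "F5 <= II"
  using i by (auto simp: F1_def F2_def F3_def F4_def F5_def)
 have p1: "(good_rate mu J)\<^sup>2 * (1 / 4) ^ J <= \<P>(om in M. P1 (GW om))"
  unfolding P1_def by (rule dust_pat_prob[OF i(1) J mu])
 have p2: "(1 / (128 * J)) ^ J <= \<P>(om in M. P2 (GW om))"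
  unfolding P2_def by (rule clock_pat_prob[OF i(2) J])
 have p4: "(1 / (128 * J)) ^ J <= \<P>(om in M. P4 (GW om))"
  unfolding P4_def by (rule clock_pat_prob[OF i(3) J])
 have p3: "1 / 16 * exp (- (real jj / 8 + 1)) <= \<P>(om in M. P3 (GW om))"
 proof -
  have "(real jj / 8 + 9 / 16 - (real jj / 8 + 1 / 2)) * exp (- (real jj / 8 + 9 / 16)) <= \<P>(om in M. P3 (GW om))"
   unfolding P3_def by (rule prob_window) (use i in auto)
  thus ?thesis by (rule order_trans[rotated]) simp
 qed
 have p5: "1 / 2 <= \<P>(om in M. P5 (GW om))"
 proof -
  let ?b = "R * (2 * exp (- 2 / 5 * H))"
  have "outer_le (%om. ~ fin_reg H (2 * J + 2) R (%l. GG (Inl i, l) om) \<or>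
    ~ fin_reg H (rh + 2 + J) R (%l. GG (Inr A, l) om) \<or> ~ fin_reg H (sm + 2 + J) R (%l. GG (Inr B, l) om)) (?b + (?b + ?b))"
   by (intro outer_or outer_not_fin_reg) (use i in auto)
  then obtain Z where Z: "Z \<in> events" "{om \<in> space M. ~ P5 (GW om)} <= Z" "prob Z <= ?b + (?b + ?b)"
   by (auto simp: outer_le_def P5_def)
  have ev: "{om \<in> space M. P5 (GW om)} \<in> events" by (rule dep_pred(2)[OF I5 d5 m5])
  have "1 - prob Z = prob (space M - Z)" using prob_compl[OF Z(1)] by simp
  also have "... <= \<P>(om in M. P5 (GW om))"
   by (rule finite_measure_mono[OF _ ev]) (use Z(2) in auto)
  finally show ?thesis using Z(3) HR by simp
 qed
 note c45 = indep_chain[OF I4 I5 _ d4 m4 d5 m5 p4 p5]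
 have c45: "(1 / (128 * J)) ^ J * (1 / 2) <= \<P>(om in M. P4 (GW om) & P5 (GW om))"
  by (rule c45) (use i in "auto simp: F4_def F5_def")
 have d45: "dep (%x. P4 x & P5 x) (F4 \<union> F5)" by (intro dep_conj dep_mono[OF d4] dep_mono[OF d5]) auto
 have m45: "Measurable.pred cfgM (%x. P4 x & P5 x)" by (intro pred_intros_logic m4 m5)
 have c345: "1 / 16 * exp (- (real jj / 8 + 1)) * ((1 / (128 * J)) ^ J * (1 / 2))
   <= \<P>(om in M. P3 (GW om) & P4 (GW om) & P5 (GW om))"
  by (rule indep_chain[OF I3 _ _ d3 m3 d45 m45 p3 c45]) (use I4 I5 i in "auto simp: F3_def F4_def F5_def")
 have d345: "dep (%x. P3 x & P4 x & P5 x) (F3 \<union> (F4 \<union> F5))" by (intro dep_conj dep_mono[OF d3] dep_mono[OF d4] dep_mono[OF d5]) auto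
 have m345: "Measurable.pred cfgM (%x. P3 x & P4 x & P5 x)" by (intro pred_intros_logic m3 m4 m5)
 have c2345: "(1 / (128 * J)) ^ J * (1 / 16 * exp (- (real jj / 8 + 1)) * ((1 / (128 * J)) ^ J * (1 / 2)))
   <= \<P>(om in M. P2 (GW om) & P3 (GW om) & P4 (GW om) & P5 (GW om))"
  by (rule indep_chain[OF I2 _ _ d2 m2 d345 m345 p2 c345]) (use I3 I4 I5 i in "auto simp: F2_def F3_def F4_def F5_def")
 have d2345: "dep (%x. P2 x & P3 x & P4 x & P5 x) (F2 \<union> (F3 \<union> (F4 \<union> F5)))" by (intro dep_conj dep_mono[OF d2] dep_mono[OF d3] dep_mono[OF d4] dep_mono[OF d5]) auto
 have m2345: "Measurable.pred cfgM (%x. P2 x & P3 x & P4 x & P5 x)" by (intro pred_intros_logic m2 m3 m4 m5)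
 have "(good_rate mu J)\<^sup>2 * (1 / 4) ^ J * ((1 / (128 * J)) ^ J * (1 / 16 * exp (- (real jj / 8 + 1)) * ((1 / (128 * J)) ^ J * (1 / 2))))
   <= \<P>(om in M. P1 (GW om) & P2 (GW om) & P3 (GW om) & P4 (GW om) & P5 (GW om))"
  by (rule indep_chain[OF I1 _ _ d1 m1 d2345 m2345 p1 c2345]) (use I2 I3 I4 I5 i in "auto simp: F1_def F2_def F3_def F4_def F5_def")
 moreover have "(P1 x & P2 x & P3 x & P4 x & P5 x) <-> fresh_ok x i A rh B sm" for x
  unfolding P1_def P2_def P3_def P4_def P5_def fresh_ok_def by auto
 ultimately show ?thesis by (simp add: mult_ac)
qed

end

section \<open>The trap: two workers who never leave their common halfline\<close>

lemma fin_reg_window: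
 assumes "fin_reg H a R (gap t)" "a <= Suc k" "Suc k < a + R"
 shows "H / 4 <= t (k + H) - t k" "t (k + H) - t k <= 4 * real H"
proof -
 have "{Suc k..<Suc k + H} = {Suc k..k + H}" by auto
 hence *: "t (k + H) - t k = (\<Sum>l\<in>{Suc k..<Suc k + H}. gap t l)" using diff_eq_sum_gap[of t k H] by simp
 have "Suc k \<in> {a..<a + R}" using assms by simp
 from assms(1)[unfolded fin_reg_def, rule_format, OF this]
 show "H / 4 <= t (k + H) - t k" "t (k + H) - t k <= 4 * real H"
  unfolding * by simp_all
qed

lemma fin_reg_windows:
 assumes "fin_reg H a R (gap t)" "a <= Suc k" "k + m * H < a + R"
 shows "m * (H / 4) <= t (k + m * H) - t k & t (k + m * H) - t k <= m * (4 * real H)"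
 using assms(3)
proof (induction m)
 case (Suc m)
 show ?case
 proof (cases "H = 0")
  case False
  have "Suc (k + m * H) < a + R" "a <= Suc (k + m * H)" using Suc.prems False assms(2) by auto
  from fin_reg_window[OF assms(1) this(2,1)]
  have w: "H / 4 <= t (k + m * H + H) - t (k + m * H)" "t (k + m * H + H) - t (k + m * H) <= 4 * real H" .
  have IH: "m * (H / 4) <= t (k + m * H) - t k" "t (k + m * H) - t k <= m * (4 * real H)" using Suc by simp_all
  have e1: "k + Suc m * H = k + m * H + H" by simp
  have e2: "Suc m * (H / 4) = m * (H / 4) + H / 4" "Suc m * (4 * real H) = m * (4 * real H) + 4 * real H"
   by (simp_all add: distrib_right)
  show ?thesis unfolding e1 e2 by (rule conjI; use IH w in linarith)
 qed simp
qed simp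

text \<open>Three regimes succeed each other: the patterns for the first \<open>J\<close> rings of
  each worker, block regularity up to index \<open>K0\<close>, which explains the size of
  \<open>R\<close>, and \<open>no_far_skip\<close> beyond. \<open>HD\<close> makes the distance at
  the first change large compared with the fluctuations of blocks of length
  \<open>H\<close>.\<close>

locale pair_trap = star_reg +
 fixes i A B nA nB rh sm J H R :: nat and mu g0 :: real
 assumes fc: fine_cells
  and i: "i \<in> {1..N}" and AW: "A \<in> {1..W}" and BW: "B \<in> {1..W}" and AB: "A ~= B" and nAB: "nA < nB"
  and sA: "jumper W c nA = A" "cnt 0 nA A = rh" "T nA = i" "K nA i = 0"
  and sB: "jumper W c nB = B" "cnt 0 nB B = sm" "T nB = i" "K nB i = 1"
  and cA: "cnt 0 nB A = Suc rh"
  and tau: "c B sm - c A rh <= 1 / 16" and gA: "gap (c A) (Suc rh) \<in> {g0..<g0 + 1 / 8}"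
  and gB: "gap (c B) (sm + 1) \<in> {g0 + 1 / 2..g0 + 9 / 16}"
  and pA: "clock_pat J (rh + 2) (gap (c A))" and rA: "fin_reg H (rh + 2 + J) R (gap (c A))"
  and pB: "clock_pat J (sm + 2) (gap (c B))" and rB: "fin_reg H (sm + 2 + J) R (gap (c B))"
  and pD: "dust_pat J mu (gap (d i))" and rD: "fin_reg H (2 * J + 2) R (gap (d i))"
  and d0: "mu <= d i 0" and d1: "gap (d i) 1 <= 1 / (2 * J) * mu"
  and J: "2 <= J" and mu: "0 < mu" and H: "1 <= H" and HD: "80 * real H <= (2 - 1 / J) ^ J * mu"
  and R: "4000 * q ^ 2 + 20 * H <= R"
  and eta_small: "eta < (1 - 1 / J) * mu" and time: "g0 + J + 4 <= 4 * (real q + 3)" and g0: "0 <= g0"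
  and tN: "c B sm + g0 + J + 4 <= real N ^ 2"
begin

definition "a u = c A (Suc rh + u)"
definition "b u = c B (Suc sm + u)"

lemma J1: "1 / real J <= 1 / 2" "0 < real J"
 using J by (simp_all add: field_simps)

lemma ratio_pos: "1 <= 2 - 1 / real J" "0 < (2 - 1 / real J) ^ l" "0 <= (2 - 1 / real J) ^ l * mu"
proof -
 show "1 <= 2 - 1 / real J" using J1 by linarith
 hence *: "0 < 2 - 1 / real J" by linarith
 show "0 < (2 - 1 / real J) ^ l" by (rule zero_less_power[OF *])
 thus "0 <= (2 - 1 / real J) ^ l * mu" using mu by (intro mult_nonneg_nonneg) auto
qed

lemma growth: "l <= J ==> (2 - 1 / J) ^ l * mu <= d i (2 * l)"
proof (induction l)
 case (Suc l)
 have "gap (d i) (2 * l + 2) \<ge> (1 - 1 / J) * ((2 - 1 / J) ^ l * mu)" using pD Suc.prems by (auto simp: dust_pat_def)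
 hence "(1 - 1 / J) * ((2 - 1 / J) ^ l * mu) <= d i (2 * l + 2) - d i (2 * l + 1)" by (simp add: gap_def)
 moreover have "d i (2 * l) <= d i (2 * l + 1)" using d_le_iff[OF i] by simp
 ultimately have "(1 - 1 / J) * ((2 - 1 / J) ^ l * mu) + (2 - 1 / J) ^ l * mu <= d i (2 * l + 2)"
  using Suc by simp
 thus ?case by (simp add: algebra_simps)
qed (use d0 in simp)

text \<open>The short gap before and the long gap after an odd index add up to at most
  \<open>(2 - 1 / J) ^ l * mu\<close>, which is below the distance by \<open>growth\<close>. For
  \<open>l = 0\<close> the short gap is the one required by the meeting.\<close>

lemma double_even: assumes "l < J" shows "d i (2 * l + 2) <= 2 * d i (2 * l)"
proof -
 let ?u = "(2 - 1 / real J) ^ l * mu"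
 have "gap (d i) (2 * l + 2) <= (1 - 1 / (2 * J)) * ?u" using pD assms by (auto simp: dust_pat_def)
 moreover have "gap (d i) (2 * l + 1) <= 1 / (2 * J) * ?u"
 proof (cases l)
  case 0 thus ?thesis using d1 by simp
 next
  case (Suc k)
  have "gap (d i) (2 * k + 3) <= 1 / (2 * J) * ((2 - 1 / real J) ^ k * mu)" using pD assms Suc by (auto simp: dust_pat_def)
  also have "... <= 1 / (2 * J) * ?u"
  proof (rule mult_left_mono)
   have "(2 - 1 / real J) ^ k * 1 <= (2 - 1 / real J) ^ k * (2 - 1 / real J)" using ratio_pos(1) less_imp_le[OF ratio_pos(2)] by (intro mult_left_mono)
   thus "(2 - 1 / real J) ^ k * mu <= ?u" using mu unfolding Suc power_Suc2 by (intro mult_right_mono) auto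
  qed (use J1 in simp)
  finally show ?thesis by (simp add: Suc numeral_3_eq_3)
 qed
 ultimately have "gap (d i) (2 * l + 1) + gap (d i) (2 * l + 2) <= ?u" by (simp add: algebra_simps)
 moreover have "?u <= d i (2 * l)" using growth[of l] assms by simp
 moreover have "gap (d i) (2 * l + 1) + gap (d i) (2 * l + 2) = d i (2 * l + 2) - d i (2 * l)" by (simp add: gap_def)
 ultimately show ?thesis by linarith
qed

lemma double_odd: assumes "l < J" shows "d i (2 * l + 3) <= 2 * d i (2 * l + 1)"
proof -
 let ?u = "(2 - 1 / real J) ^ l * mu"
 have "gap (d i) (2 * l + 2) <= (1 - 1 / (2 * J)) * ?u" "gap (d i) (2 * l + 3) <= 1 / (2 * J) * ?u"
  using pD assms by (auto simp: dust_pat_def)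
 hence "gap (d i) (2 * l + 2) + gap (d i) (2 * l + 3) <= ?u" by (simp add: algebra_simps)
 moreover have "gap (d i) (2 * l + 2) + gap (d i) (2 * l + 3) = d i (2 * l + 3) - d i (2 * l + 1)"
  by (simp add: gap_def numeral_3_eq_3)
 moreover have "?u <= d i (2 * l)" using growth[of l] assms by simp
 moreover have "d i (2 * l) <= d i (2 * l + 1)" using d_le_iff[OF i] by simp
 ultimately show ?thesis by linarith
qed

text \<open>The next \<open>18 * H\<close> particles extend over at most \<open>72 * H\<close>, less
  than the distance \<open>80 * H\<close> already reached.\<close>

lemma double_late:
 assumes "2 * J + 1 <= x" "x < K0" "k <= x + 18 * H"
 shows "d i k <= 2 * d i x"
proof -
 have "d i k <= d i (x + 18 * H)" using d_le_iff[OF i] assms by simp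
 moreover have "d i (x + 18 * H) - d i x <= 18 * (4 * real H)"
  using fin_reg_windows[OF rD, of x 18] assms R by simp
 moreover have "80 * real H <= d i x"
 proof -
  have "80 * real H <= d i (2 * J)" using HD growth[of J] by simp
  also have "... <= d i x" using d_le_iff[OF i] assms by simp
  finally show ?thesis .
 qed
 ultimately show ?thesis by linarith
qed

lemma jt_nB: "jt nB = c B sm" and jt_nA: "jt nA = c A rh"
 using jump_time_ring[OF sA(1)] jump_time_ring[OF sB(1)] sA sB by simp_all

lemma pattern_times:
 assumes "clock_pat J s (gap t)" "s = Suc r" "u <= J"
 shows "real u <= t (r + u) - t r" "t (r + u) - t r <= u + 1 / 16"
proof -
 have "real u <= t (r + u) - t r & t (r + u) - t r <= u * (1 + 1 / (16 * J))"
  using assms(3)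
 proof (induction u)
  case (Suc u)
  have "gap t (Suc (r + u)) \<in> {1..1 + 1 / (16 * J)}" using assms Suc.prems by (auto simp: clock_pat_def)
  thus ?case using Suc by (simp add: gap_def distrib_right)
 qed simp
 moreover have "real u * (1 / (16 * real J)) <= 1 / 16" using assms(3) J1(2) by (simp add: field_simps)
 ultimately show "real u <= t (r + u) - t r" "t (r + u) - t r <= u + 1 / 16" by (auto simp: distrib_left)
qed

lemma a_times: "u <= J ==> a 0 + u <= a u" "u <= J ==> a u <= a 0 + u + 1 / 16"
 using pattern_times[OF pA, of "Suc rh" u] by (auto simp: a_def)

lemma b_times: "u <= J ==> b 0 + u <= b u" "u <= J ==> b u <= b 0 + u + 1 / 16"
 using pattern_times[OF pB, of "Suc sm" u] by (auto simp: b_def)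

text \<open>The windows for the two gaps are shifted by \<open>1 / 2\<close> and have widths
  \<open>1 / 8\<close> and \<open>1 / 16\<close>, and the landings differ by at most
  \<open>1 / 16\<close>. So \<open>b 0 - a 0\<close> is between \<open>3 / 8\<close> and
  \<open>5 / 8\<close>, which leaves room on both sides for the drift \<open>1 / 16\<close> of the
  clock patterns.\<close>

lemma start_times: "a 0 + 3 / 8 < b 0" "b 0 <= a 0 + 5 / 8" "a 0 <= c B sm + g0 + 1 / 8" "b 0 <= c B sm + g0 + 9 / 16"
proof -
 have "c A rh < c B sm" using nAB jt_nA jt_nB enum.e_less_iff by metis
 moreover have "a 0 = c A rh + gap (c A) (Suc rh)" "b 0 = c B sm + gap (c B) (sm + 1)" by (simp_all add: a_def b_def gap_def)
 ultimately show "a 0 + 3 / 8 < b 0" "b 0 <= a 0 + 5 / 8" "a 0 <= c B sm + g0 + 1 / 8" "b 0 <= c B sm + g0 + 9 / 16"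
  using tau gA gB by auto
qed

lemma alternate: "u <= J ==> a u < b u" "u < J ==> b u < a (Suc u)"
proof -
 assume "u <= J" thus "a u < b u" using a_times(2)[of u] b_times(1)[of u] start_times by linarith
next
 assume "u < J" thus "b u < a (Suc u)" using b_times(2)[of u] a_times(1)[of "Suc u"] start_times by simp
qed

lemma a_less: "a u < a v <-> u < v" and b_less: "b u < b v <-> u < v"
 by (simp_all add: a_def b_def c_less_iff[OF AW] c_less_iff[OF BW])

lemma gap_a_le: assumes "J <= u" "u < K0" shows "a (Suc u) - a u <= 4 * real H"
proof -
 have 1: "a (Suc u) <= a (u + H)" using c_le_iff[OF AW] H by (simp add: a_def)
 have "c A (Suc rh + u + H) - c A (Suc rh + u) <= 4 * real H"
  by (rule fin_reg_window(2)[OF rA]) (use assms R in auto)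
 thus ?thesis using 1 by (simp add: a_def add.assoc)
qed

lemma gap_b_le: assumes "J <= Suc u" "u < K0" shows "b (Suc u) - b u <= 4 * real H"
proof (cases "J <= u")
 case True
 have 1: "b (Suc u) <= b (u + H)" using c_le_iff[OF BW] H by (simp add: b_def)
 have "c B (Suc sm + u + H) - c B (Suc sm + u) <= 4 * real H"
  by (rule fin_reg_window(2)[OF rB]) (use True assms R in auto)
 thus ?thesis using 1 by (simp add: b_def add.assoc)
next
 case False
 hence "Suc u = J" using assms by simp
 hence "b (Suc u) - b u <= 1 + 1 / 16" using b_times(2)[of "Suc u"] b_times(1)[of u] by simp
 thus ?thesis using H by simp
qed

text \<open>Seventeen blocks of \<open>H\<close> rings last at least \<open>17 / 4 * H\<close>, more
  than \<open>4 * H\<close>.\<close>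

lemma few_a: assumes "J <= u" "u < K0" "u <= u'" "a u' - a u < 4 * real H" shows "u' < u + 17 * H"
proof (rule ccontr)
 assume "~ ?thesis"
 hence "a (u + 17 * H) <= a u'" using c_le_iff[OF AW] by (simp add: a_def)
 moreover have "17 * (H / 4) <= c A (Suc rh + u + 17 * H) - c A (Suc rh + u)"
  using fin_reg_windows[OF rA, of "Suc rh + u" 17] assms R by simp
 ultimately show False using assms(4) H by (simp add: a_def add.assoc)
qed

lemma few_b: assumes "J <= u" "u < K0" "u <= u'" "b u' - b u < 4 * real H" shows "u' < u + 17 * H"
proof (rule ccontr)
 assume "~ ?thesis"
 hence "b (u + 17 * H) <= b u'" using c_le_iff[OF BW] by (simp add: b_def)
 moreover have "17 * (H / 4) <= c B (Suc sm + u + 17 * H) - c B (Suc sm + u)"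
  using fin_reg_windows[OF rB, of "Suc sm + u" 17] assms R by simp
 ultimately show False using assms(4) H by (simp add: b_def add.assoc)
qed

definition "uA n = cnt 0 n A - Suc rh"
definition "uB n = cnt 0 n B - Suc sm"

lemma cnt_A: "nB < n ==> cnt 0 n A = Suc rh + uA n" and cnt_B: "nB < n ==> cnt 0 n B = Suc sm + uB n"
proof -
 assume n: "nB < n"
 have "cnt 0 n A = cnt 0 nB A + cnt nB n A" by (rule cnt_split) (use n in auto)
 thus "cnt 0 n A = Suc rh + uA n" using cA by (simp add: uA_def)
 have "cnt 0 n B = cnt 0 (Suc nB) B + cnt (Suc nB) n B" by (rule cnt_split) (use n in auto)
 moreover have "cnt 0 (Suc nB) B = Suc sm" using cnt_Suc[of 0 nB B] sB by simp
 ultimately show "cnt 0 n B = Suc sm + uB n" by (simp add: uB_def)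
qed

lemma less_uA: "nB < n ==> u < uA n <-> a u < jt n" and less_uB: "nB < n ==> u < uB n <-> b u < jt n"
 using ring_count[OF AW, of "Suc rh + u" n] ring_count[OF BW, of "Suc sm + u" n] cnt_A[of n] cnt_B[of n] by (auto simp: a_def b_def)

lemma jt_A: "nB < n ==> jp n = A ==> jt n = a (uA n)" and jt_B: "nB < n ==> jp n = B ==> jt n = b (uB n)"
 using jump_time_ring[of n A] jump_time_ring[of n B] cnt_A[of n] cnt_B[of n] by (auto simp: a_def b_def)

lemma uA_Suc: "nB < n ==> uA (Suc n) = (if jp n = A then Suc (uA n) else uA n)"
 and uB_Suc: "nB < n ==> uB (Suc n) = (if jp n = B then Suc (uB n) else uB n)"
 using cnt_Suc[of 0 n A] cnt_Suc[of 0 n B] cnt_A[of n] cnt_A[of "Suc n"] cnt_B[of n] cnt_B[of "Suc n"] by auto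

text \<open>Nobody else is on the halfline and every ring of the two since the meeting has removed
  one particle from it. The last two clauses express a worker's index by the number of rings of the
  other that preceded his own last ring; the difference to the present counts is what was removed
  during his rest.\<close>

definition inv :: "nat => bool" where
 "inv n <-> L n A = i & L n B = i & K n i = 2 + uA n + uB n & (\<forall>w. L n w = i --> w \<in> {A, B}) &
   (uA n = 0 --> X n A = 0) & (uB n = 0 --> X n B = 1) &
   (\<forall>u. uA n = Suc u --> (\<exists>v. X n A = 2 + u + v & (\<forall>v'. v' < v <-> b v' < a u))) &
   (\<forall>v. uB n = Suc v --> (\<exists>u. X n B = 2 + u + v & (\<forall>u'. u' < u <-> a u' < b v)))"

lemma no_skip:
 assumes w: "jp n = w" "L n w = i" and dbl: "X n w < K0 ==> d i (K n i) <= 2 * d i (X n w)"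
 shows "T n = i"
proof (cases "X n w < K0")
 case False
 hence "~ skip n" using no_far_skip[of n] w by auto
 thus ?thesis using w i by (auto simp: skip_def)
next
 case True
 show ?thesis
 proof (rule ccontr)
  assume ne: "T n ~= i"
  have "FD n (T n) <= FD n i" by (rule T_props(2)[OF i])
  moreover have "FD n i = d i (K n i) - d i (X n w)" using w i Y_eq[of n w] by (simp add: FD_def)
  moreover have "FD n (T n) = d i (X n w) + d (T n) (K n (T n))" using w ne i Y_eq[of n w] by (simp add: FD_def)
  moreover have "0 < d (T n) (K n (T n))" by (rule d_pos[OF T_props(1)])
  ultimately show False using dbl[OF True] by linarith
 qed
qed

text \<open>A third worker would land at the level. While the patterns last, the level has risen by
  at most \<open>eta\<close> since the meeting and cannot have crossed the first long gap;
  afterwards the front of this halfline is far beyond distance 1.\<close>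

lemma not_landing:
 assumes n: "nB < n" and inv: "inv n" and w: "jp n \<notin> {A, B}"
 shows "T n ~= i"
proof
 assume T: "T n = i"
 have Ki: "K n i = 2 + uA n + uB n" using inv by (simp add: inv_def)
 have "L n (jp n) ~= i" using inv w by (auto simp: inv_def)
 hence "Z n = Lev n" using T by (intro landing_Z) simp
 hence lev: "Lev n = d i (K n i)" using T by (simp add: Z_def)
 show False
 proof (cases "jt n <= c B sm + g0 + J + 4")
  case True
  have "jt n - jt nB <= 4 * (real q + 3)" using True time jt_nB by linarith
  hence "Lev n - Lev nB <= eta"
   by (intro window_rise(2)[OF fc]) (use n True tN in auto)
  moreover have "Lev nB <= d i 1" using Lev_le[OF i, of nB] sB by simp
  moreover have "(1 - 1 / J) * mu <= gap (d i) 2" using pD[unfolded dust_pat_def, rule_format, of 0] J by (simp add: numeral_2_eq_2)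
  hence "(1 - 1 / J) * mu <= d i 2 - d i 1" by (simp add: gap_def numeral_2_eq_2)
  moreover have "d i 2 <= d i (K n i)" using d_le_iff[OF i] Ki by simp
  ultimately show False using lev eta_small by linarith
 next
  case False
  have "a (J - 1) < jt n" using a_times(2)[of "J - 1"] start_times(3) False J by (simp add: of_nat_diff)
  hence "J - 1 < uA n" using less_uA[OF n] by simp
  moreover have "b (J - 1) < jt n" using b_times(2)[of "J - 1"] start_times(4) False J by (simp add: of_nat_diff)
  hence "J - 1 < uB n" using less_uB[OF n] by simp
  ultimately have "2 * J <= K n i" using Ki by simp
  hence "d i (2 * J) <= Lev n" using lev d_le_iff[OF i] by simp
  moreover have "80 * real H <= d i (2 * J)" using HD growth[of J] by simp
  ultimately show False using lev1[of n] H by simp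
 qed
qed

lemma double_mid: "d i (2 * J + 2) <= 2 * d i (2 * J)"
proof -
 obtain l where l: "J = Suc l" using J by (cases J) auto
 have "gap (d i) (2 * l + 3) <= 1 / (2 * J) * ((2 - 1 / J) ^ l * mu)" using pD l by (auto simp: dust_pat_def)
 also have "... <= 1 / 4 * ((2 - 1 / J) ^ l * mu)"
  by (rule mult_right_mono[OF _ ratio_pos(3)]) (use J in "simp add: field_simps")
 also have "(2 - 1 / J) ^ l * mu <= d i (2 * l)" using growth[of l] l by simp
 also have "d i (2 * l) <= d i (2 * J)" using d_le_iff[OF i] l by simp
 finally have 1: "d i (2 * J + 1) - d i (2 * J) <= 1 / 4 * d i (2 * J)"
  by (simp add: gap_def numeral_3_eq_3 l)
 have "d i (2 * J + 2) <= d i (2 * J + 1 + H)" using d_le_iff[OF i] H by simp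
 moreover have "d i (2 * J + 1 + H) - d i (2 * J + 1) <= 4 * real H"
  by (rule fin_reg_window(2)[OF rD]) (use R H in auto)
 moreover have "80 * real H <= d i (2 * J)" using HD growth[of J] by simp
 ultimately show ?thesis using 1 by linarith
qed

text \<open>As long as the rings alternate, \<open>B\<close> removes one particle between two rings
  of \<open>A\<close>, so the next particle is two indices ahead and \<open>double_even\<close>
  applies. Later a rest lasts at most \<open>4 * H\<close>, in which \<open>B\<close> rings at most
  \<open>17 * H\<close> times, and \<open>double_late\<close> applies.\<close>

lemma A_advances:
 assumes n: "nB < n" and inv: "inv n" and w: "jp n = A"
 shows "T n = i"
proof (rule no_skip[OF w])
 show "L n A = i" using inv by (simp add: inv_def)
 have Ki: "K n i = 2 + uA n + uB n" using inv by (simp add: inv_def)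
 have lb: "v < uB n <-> b v < a (uA n)" for v using less_uB[OF n] jt_A[OF n w] by simp
 assume X: "X n A < K0"
 show "d i (K n i) <= 2 * d i (X n A)"
 proof (cases "uA n")
  case 0
  have "uB n = 0" using lb[of 0] alternate(1)[of 0] 0 by auto
  thus ?thesis using inv Ki 0 double_even[of 0] J by (simp add: inv_def numeral_2_eq_2)
 next
  case (Suc u)
  obtain v where v: "X n A = 2 + u + v" "!!v'. v' < v <-> b v' < a u" using inv Suc by (auto simp: inv_def)
  show ?thesis
  proof (cases "uA n <= J")
   case True
   have "~ v < u"
   proof
    assume "v < u"
    hence "b v < a (Suc v)" "a (Suc v) <= a u" using alternate(2)[of v] True Suc a_less[of u "Suc v"] by auto
    thus False using v(2)[of v] by simp
   qed
   moreover have "~ u < v" using v(2)[of u] alternate(1)[of u] True Suc by auto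
   ultimately have vu: "v = u" by simp
   have "~ uA n < uB n" using lb[of "uA n"] alternate(1)[of "uA n"] True by auto
   moreover have "u < uB n" using lb[of u] alternate(2)[of u] True Suc by simp
   ultimately have "uB n = Suc u" using Suc by simp
   hence "K n i = 2 * Suc u + 2" "X n A = 2 * Suc u" using Ki v vu Suc by auto
   thus ?thesis using double_even[of "Suc u"] double_mid True Suc by (cases "Suc u = J") auto
  next
   case False
   hence uJ2: "J <= u" using Suc by simp
   have vJ: "J <= v"
   proof (rule ccontr)
    assume "~ J <= v"
    hence "b v < a (Suc v)" "a (Suc v) <= a u" using alternate(2)[of v] uJ2 a_less[of u "Suc v"] by auto
    thus False using v(2)[of v] by simp
   qed
   have uv: "u < K0" "v < K0" using X v by auto
   have "uB n <= v + 17 * H"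
   proof (rule ccontr)
    assume c: "~ ?thesis"
    hence 1: "uB n - 1 < uB n" "v <= uB n - 1" by auto
    have "b (uB n - 1) < a (Suc u)" using lb 1 Suc by simp
    moreover have "a u <= b v" using v(2)[of v] by simp
    moreover have "a (Suc u) - a u <= 4 * real H" by (rule gap_a_le[OF uJ2 uv(1)])
    ultimately have "uB n - 1 < v + 17 * H" by (intro few_b[OF vJ uv(2) 1(2)]) linarith
    thus False using c by simp
   qed
   hence "K n i <= X n A + 18 * H" using Ki v(1) Suc H by simp
   thus ?thesis by (intro double_late) (use v(1) uJ2 vJ X in auto)
  qed
 qed
qed

text \<open>As for \<open>A\<close>, but with odd indices while the rings alternate, since
  \<open>A\<close> always rings before \<open>B\<close>.\<close>

lemma B_advances:
 assumes n: "nB < n" and inv: "inv n" and w: "jp n = B"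
 shows "T n = i"
proof (rule no_skip[OF w])
 show "L n B = i" using inv by (simp add: inv_def)
 have Ki: "K n i = 2 + uA n + uB n" using inv by (simp add: inv_def)
 have la: "u < uA n <-> a u < b (uB n)" for u using less_uA[OF n] jt_B[OF n w] by simp
 assume X: "X n B < K0"
 show "d i (K n i) <= 2 * d i (X n B)"
 proof (cases "uB n")
  case 0
  have "0 < uA n" "~ 1 < uA n" using la[of 0] la[of 1] alternate(1)[of 0] alternate(2)[of 0] 0 J by auto
  hence "uA n = 1" by simp
  thus ?thesis using inv Ki 0 double_odd[of 0] J by (simp add: inv_def numeral_3_eq_3)
 next
  case (Suc v)
  obtain u where u: "X n B = 2 + u + v" "!!u'. u' < u <-> a u' < b v" using inv Suc by (auto simp: inv_def)
  show ?thesis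
  proof (cases "uB n < J")
   case True
   have "v < u" using u(2)[of v] alternate(1)[of v] True Suc by simp
   moreover have "~ Suc v < u" using u(2)[of "Suc v"] alternate(2)[of v] True Suc by auto
   ultimately have uv: "u = Suc v" by simp
   have "Suc v < uA n" using la[of "Suc v"] alternate(1)[of "Suc v"] True Suc by simp
   moreover have "~ Suc (Suc v) < uA n" using la[of "Suc (Suc v)"] alternate(2)[of "Suc v"] True Suc by auto
   ultimately have "uA n = Suc (Suc v)" by simp
   hence "K n i = 2 * Suc v + 3" "X n B = 2 * Suc v + 1" using Ki u uv Suc by auto
   thus ?thesis using double_odd[of "Suc v"] True Suc by simp
  next
   case False
   hence vJ: "J <= Suc v" using Suc by simp
   have "a (J - 1) < b (J - 1)" "b (J - 1) <= b v" using alternate(1)[of "J - 1"] b_less[of v "J - 1"] vJ by auto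
   hence "J - 1 < u" using u(2)[of "J - 1"] by simp
   hence uJ: "J <= u" by simp
   have uv: "u < K0" "v < K0" using X u by auto
   have "uA n <= u + 17 * H"
   proof (rule ccontr)
    assume c: "~ ?thesis"
    hence 1: "uA n - 1 < uA n" "u <= uA n - 1" by auto
    have "a (uA n - 1) < b (Suc v)" using la 1 Suc by simp
    moreover have "b v <= a u" using u(2)[of u] by simp
    moreover have "b (Suc v) - b v <= 4 * real H" by (rule gap_b_le[OF vJ uv(2)])
    ultimately have "uA n - 1 < u + 17 * H" by (intro few_a[OF uJ uv(1) 1(2)]) linarith
    thus False using c by simp
   qed
   hence "K n i <= X n B + 18 * H" using Ki u(1) Suc H by simp
   thus ?thesis by (intro double_late) (use u(1) uJ vJ X J in auto)
  qed
 qed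
qed

lemma inv_step:
 assumes n: "nB < n" and inv: "inv n"
 shows "inv (Suc n)"
proof -
 have Ki: "K n i = 2 + uA n + uB n" and LA: "L n A = i" and LB: "L n B = i"
  and on: "!!w. L n w = i ==> w \<in> {A, B}" using inv by (auto simp: inv_def)
 consider "jp n = A" | "jp n = B" | "jp n \<notin> {A, B}" by blast
 thus ?thesis
 proof cases
  case 1
  have T: "T n = i" by (rule A_advances[OF n inv 1])
  have u: "uA (Suc n) = Suc (uA n)" "uB (Suc n) = uB n" using uA_Suc[OF n] uB_Suc[OF n] 1 AB by auto
  have XA: "X (Suc n) A = 2 + uA n + uB n" "X (Suc n) B = X n B" using X_Suc[of n] 1 AB T Ki by auto
  have lb: "\<forall>v'. v' < uB n <-> b v' < a (uA n)" using less_uB[OF n] jt_A[OF n 1] by simp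
  have "\<exists>v. X (Suc n) A = 2 + uA n + v & (\<forall>v'. v' < v <-> b v' < a (uA n))"
   using XA(1) lb by blast
  moreover have "K (Suc n) i = 2 + uA (Suc n) + uB (Suc n)" using K_Suc[of n i] T Ki u by simp
  moreover have "L (Suc n) A = i" "L (Suc n) B = i" using L_Suc[of n] 1 T LB by auto
  moreover have "\<forall>w. L (Suc n) w = i --> w \<in> {A, B}" using L_Suc[of n] 1 on by auto
  ultimately show ?thesis using inv unfolding inv_def u XA(2) by simp
 next
  case 2
  have T: "T n = i" by (rule B_advances[OF n inv 2])
  have u: "uB (Suc n) = Suc (uB n)" "uA (Suc n) = uA n" using uA_Suc[OF n] uB_Suc[OF n] 2 AB by auto
  have XB: "X (Suc n) B = 2 + uA n + uB n" "X (Suc n) A = X n A" using X_Suc[of n] 2 AB T Ki by auto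
  have la: "\<forall>u'. u' < uA n <-> a u' < b (uB n)" using less_uA[OF n] jt_B[OF n 2] by simp
  have "\<exists>v. X (Suc n) B = 2 + v + uB n & (\<forall>u'. u' < v <-> a u' < b (uB n))"
   using XB(1) la by blast
  moreover have "K (Suc n) i = 2 + uA (Suc n) + uB (Suc n)" using K_Suc[of n i] T Ki u by simp
  moreover have "L (Suc n) A = i" "L (Suc n) B = i" using L_Suc[of n] 2 T LA by auto
  moreover have "\<forall>w. L (Suc n) w = i --> w \<in> {A, B}" using L_Suc[of n] 2 on by auto
  ultimately show ?thesis using inv unfolding inv_def u XB(2) by simp
 next
  case 3
  have T: "T n ~= i" by (rule not_landing[OF n inv 3])
  have u: "uB (Suc n) = uB n" "uA (Suc n) = uA n" using uA_Suc[OF n] uB_Suc[OF n] 3 by auto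
  have X: "X (Suc n) B = X n B" "X (Suc n) A = X n A" using X_Suc[of n] 3 by auto
  have "K (Suc n) i = K n i" using K_Suc[of n i] T by simp
  moreover have "L (Suc n) A = i" "L (Suc n) B = i" using L_Suc[of n] 3 LA LB by auto
  moreover have "\<forall>w. L (Suc n) w = i --> w \<in> {A, B}" using L_Suc[of n] T on by auto
  ultimately show ?thesis using inv unfolding inv_def u X by simp
 qed
qed

lemma inv_start: "inv (Suc nB)"
proof -
 have u: "uA (Suc nB) = 0" "uB (Suc nB) = 0"
  using cnt_Suc[of 0 nB A] cnt_Suc[of 0 nB B] cA sB AB by (auto simp: uA_def uB_def)
 have noA: "jp m ~= A" if "Suc nA <= m" "m < nB" for m
 proof
  assume "jp m = A"
  have "cnt 0 (Suc nA) A = Suc rh" using cnt_Suc[of 0 nA A] sA by simp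
  hence "Suc rh <= cnt 0 m A" using cnt_split[of 0 "Suc nA" m A] that by simp
  moreover have "cnt 0 (Suc m) A = Suc (cnt 0 m A)" using cnt_Suc[of 0 m A] \<open>jp m = A\<close> by simp
  moreover have "cnt 0 (Suc m) A <= cnt 0 nB A" using cnt_split[of 0 "Suc m" nB A] that by simp
  ultimately show False using cA by simp
 qed
 have "L nB A = L (Suc nA) A & X nB A = X (Suc nA) A"
  by (rule stays) (use nAB noA in auto)
 moreover have "L (Suc nA) A = i" "X (Suc nA) A = 0" using L_Suc[of nA A] X_Suc[of nA A] sA by auto
 ultimately have A: "L (Suc nB) A = i" "X (Suc nB) A = 0" using L_Suc[of nB A] X_Suc[of nB A] sB AB by auto
 have B: "L (Suc nB) B = i" "X (Suc nB) B = 1" using L_Suc[of nB B] X_Suc[of nB B] sB by auto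
 have K: "K (Suc nB) i = 2" using K_Suc[of nB i] sB by simp
 have "w \<in> {A, B}" if w: "L (Suc nB) w = i" for w
 proof -
  obtain e where e: "e < Suc nB" "jp e = w" "T e = i" using entry_line[OF w] i by auto
  have "e = nA \<or> e = nB"
  proof (rule ccontr)
   assume ne: "~ ?thesis"
   hence "e < nB" using e by simp
   hence "K e i = 0" using consumed_inj[of e nB] e sB by simp
   moreover have "e < nA \<or> nA < e" using ne by auto
   ultimately show False using consumed_inj[of e nA] consumed_inj[of nA e] e sA by auto
  qed
  thus ?thesis using e sA sB by auto
 qed
 thus ?thesis using A B K u by (simp add: inv_def)
qed

lemma trapped: "~ eventually_separated N W d c"
proof -
 have inv: "inv n" if "Suc nB <= n" for n
  using that by (induction rule: dec_induct) (auto intro: inv_start inv_step)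
 show ?thesis
 proof
  assume "eventually_separated N W d c"
  then obtain m where m: "\<forall>n\<ge>m. \<forall>w1\<in>{1..W}. \<forall>w2\<in>{1..W}. w1 ~= w2 --> L n w1 ~= L n w2"
   unfolding eventually_separated_iff by blast
  have "L (max m (Suc nB)) A = i" "L (max m (Suc nB)) B = i" using inv[of "max m (Suc nB)"] by (auto simp: inv_def)
  thus False using m[rule_format, of "max m (Suc nB)" A B] AW BW AB by simp
 qed
qed

end

section \<open>Counting coincidences\<close>

text \<open>\<open>1 / 72\<close> is a quarter of \<open>1 / 18\<close>, the product of
  \<open>1 / 6\<close> for the first gap and \<open>1 / 3\<close> for the second; up to powers of
  \<open>h\<close> this bounds the probability for one halfline from below.\<close>

definition close_cells :: "nat => (nat => nat => real) => real => bool" where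
 "close_cells N d h <-> (\<forall>l::nat. (real l + 1) * h <= 1 -->
   N * h\<^sup>2 / 72 < card {i \<in> {1..N}. gap (d i) 0 \<in> {real l * h .. real l * h + h / 2} & gap (d i) 1 \<in> {0..h}})"

context star_cleaning
begin

lemma outer_close_cells:
 assumes h: "0 < h" "h <= 1"
 shows "outer_le (%om. ~ close_cells N (D om) h) (1 / h * exp (- (N * (h\<^sup>2 / 18) / 4)))"
proof -
 define A :: "nat => (nat => real) set" where "A l = {t. gap t 0 \<in> {real l * h .. real l * h + h / 2} & gap t 1 \<in> {0..h}}" for l
 have A: "A l \<in> sets (PiM UNIV (%_. borel))" for l
 proof -
  have "{t \<in> space (PiM UNIV (%_. borel)). gap t 0 \<in> {real l * h .. real l * h + h / 2} & gap t 1 \<in> {0..h}} \<in> sets (PiM UNIV (%_. borel))"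
   by measurable
  thus ?thesis by (simp add: A_def space_PiM)
 qed
 have exp3: "1 / 3 <= exp (- x)" if "x <= 1" for x :: real
 proof -
  have "exp x <= exp 1" using that by simp
  also have "exp 1 <= (3 :: real)" by (rule exp_le)
  finally show ?thesis by (simp add: exp_minus field_simps)
 qed
 have p: "h\<^sup>2 / 18 <= \<P>(om in M. D om i \<in> A l)" if i: "i \<in> {1..N}" and l: "(real l + 1) * h <= 1" for i l
 proof -
  let ?lo = "%k :: nat. if k = 0 then real l * h else 0" and ?hi = "%k :: nat. if k = 0 then real l * h + h / 2 else h"
  have "(\<Prod>k<2. if k = (0 :: nat) then h / 2 * (1 / 3) else h * (1 / 3)) <= \<P>(om in M. \<forall>k<2. GG (Inl i, 0 + k) om \<in> {?lo k..?hi k})"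
  proof (rule prob_line_windows)
   fix k :: nat assume "k < 2"
   have hi1: "?hi k <= 1" using l h by (simp add: distrib_right)
   have "(?hi k - ?lo k) * exp (- ?hi k) <= \<P>(om in M. GG (Inl i, 0 + k) om \<in> {?lo k..?hi k})"
    by (rule prob_window) (use i h in auto)
   moreover have "(?hi k - ?lo k) * (1 / 3) <= (?hi k - ?lo k) * exp (- ?hi k)"
    by (rule mult_left_mono[OF exp3[OF hi1]]) (use h in auto)
   ultimately show "(if k = 0 then h / 2 * (1 / 3) else h * (1 / 3)) <= \<P>(om in M. GG (Inl i, 0 + k) om \<in> {?lo k..?hi k})"
    by (cases "k = 0") simp_all
  qed (use i h in auto)
  moreover have "(\<Prod>k<2. if k = (0 :: nat) then h / 2 * (1 / 3) else h * (1 / 3)) = h\<^sup>2 / 18"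
   by (simp add: numeral_2_eq_2 lessThan_Suc power2_eq_square)
  moreover have "(\<forall>k<2. GG (Inl i, 0 + k) om \<in> {?lo k..?hi k}) <-> D om i \<in> A l" for om
   by (auto simp: A_def GG_Inl less_2_cases_iff)
  ultimately show ?thesis by simp
 qed
 have "outer_le (%om. \<exists>l::nat. True & (real l + 1) * h <= 1 & real (card {i \<in> {1..N}. D om i \<in> A l}) <= N * (h\<^sup>2 / 18) / 4)
   (1 / h * exp (- (N * (h\<^sup>2 / 18) / 4)))"
  by (rule outer_cells[OF h outer_few_hits[OF A p]]) simp_all
 thus ?thesis by (rule outer_mono) (auto simp: close_cells_def A_def not_less)
qed

text \<open>First removals after which the worker's next gap is so short that he might make the
  second removal himself, or longer than the values of \<open>jj\<close> cover.\<close>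

definition rare :: "nat => real => real => real => cfg => nat => bool" where
 "rare nmax h ta g x i <-> (\<exists>n<nmax. \<exists>w\<in>{1..W}. \<exists>r<nmax. (hit N W (dx x) (cx x) n i 0 w r & x (Inl i, 1) <= h) &
   (x (Inr w, Suc r) <= ta \<or> g < x (Inr w, Suc r)))"

text \<open>At the removal the worker's next gap is unrevealed, so its size is independent of the
  removal. The tuples give disjoint events within that of a second dust gap of at most
  \<open>h\<close>, which makes the union bound exact.\<close>

lemma outer_rare_line:
 assumes N: "1 <= N" and i: "i \<in> {1..N}" and h: "0 <= h" and ta: "0 <= ta" "0 <= g"
 shows "outer_le (%om. rare nmax h ta g (GW om) i) (h * (ta + exp (- g)))"
proof -
 define T where "T = {..<nmax} \<times> {1..W} \<times> {..<nmax}"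
 define P where "P = (%(n, w, r) (x :: cfg). hit N W (dx x) (cx x) n i 0 w r & x (Inl i, 1) <= h)"
 define Q where "Q = (%(n :: nat, w, r) (x :: cfg). x (Inr w, Suc r) <= ta \<or> g < x (Inr w, Suc r))"
 let ?G = "%om z. GG z om"
 have fin: "finite T" by (simp add: T_def)
 have Pm: "Measurable.pred cfgM (P kp)" for kp
 proof -
  note [measurable] = hit_pred
  show ?thesis unfolding P_def by (cases kp) (simp, measurable)
 qed
 have Qm: "Measurable.pred cfgM (Q kp)" for kp unfolding Q_def by (cases kp) (simp, measurable)
 have Pd: "dep (P (n, w, r)) (II - {(Inr w, Suc r)})" if "w \<in> {1..W}" for n w r
  unfolding dep_def
 proof (intro allI impI)
  fix x x' :: cfg assume ag: "\<forall>z\<in>II - {(Inr w, Suc r)}. x z = x' z" and px: "P (n, w, r) x"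
  have d: "dx x i' k = dx x' i' k" if "i' \<in> {1..N}" for i' k
   unfolding dx_def by (rule sum.cong[OF refl]) (use ag that in auto)
  have c: "cx x v r' = cx x' v r'" if "v \<in> {1..W}" "r' <= ring_counts W (cx x) n v" for v r'
   unfolding cx_def
  proof (rule sum.cong[OF refl])
   fix l assume "l \<in> {..r'}"
   hence "(Inr v, l) ~= (Inr w, Suc r)" using px that by (auto simp: P_def hit_def)
   thus "x (Inr v, l) = x' (Inr v, l)" using ag that by auto
  qed
  have "hit N W (dx x') (cx x') n i 0 w r <-> hit N W (dx x) (cx x) n i 0 w r"
   by (rule hit_cong(1)[where n = n, OF N]) (use d c in auto)
  moreover have "x' (Inl i, 1) = x (Inl i, 1)" using ag i by auto
  ultimately show "P (n, w, r) x'" using px by (simp add: P_def)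
 qed
 have Pev: "{om \<in> space M. P kp (?G om)} \<in> events" if "kp \<in> T" for kp
  using that dep_pred(2)[OF _ Pd Pm] by (auto simp: T_def)
 have Qd: "dep (Q (n, w, r)) {(Inr w, Suc r)}" for n w r by (simp add: dep_def Q_def)
 have Qp: "{om \<in> space M. Q (n, w, r) (?G om)} \<in> events" "\<P>(om in M. Q (n, w, r) (?G om)) <= ta + exp (- g)" if w: "w \<in> {1..W}" for n w r
 proof -
  show "{om \<in> space M. Q (n, w, r) (?G om)} \<in> events" by (rule dep_pred(2)[OF _ Qd Qm]) (use w in auto)
  have "\<P>(om in M. Q (n, w, r) (?G om)) <= prob ({om \<in> space M. GG (Inr w, Suc r) om <= ta} \<union> {om \<in> space M. g < GG (Inr w, Suc r) om})"
   by (rule finite_measure_mono) (use w G_meas[of "(Inr w, Suc r)"] in "auto simp: Q_def")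
  also have "... <= \<P>(om in M. GG (Inr w, Suc r) om <= ta) + \<P>(om in M. g < GG (Inr w, Suc r) om)"
   by (rule measure_Un_le) (use w G_meas[of "(Inr w, Suc r)"] in auto)
  also have "... <= ta + exp (- g)"
   using prob_le'[of "(Inr w, Suc r)" ta] prob_gt[of "(Inr w, Suc r)" g] w ta by simp
  finally show "\<P>(om in M. Q (n, w, r) (?G om)) <= ta + exp (- g)" .
 qed
 have one: "outer_le (%om. P kp (?G om) & Q kp (?G om)) (\<P>(om in M. P kp (?G om)) * (ta + exp (- g)))" if "kp \<in> T" for kp
 proof -
  obtain n w r where k: "kp = (n, w, r)" "w \<in> {1..W}" using \<open>kp \<in> T\<close> by (auto simp: T_def)
  have "\<P>(om in M. P kp (?G om) & Q kp (?G om)) = \<P>(om in M. P kp (?G om)) * \<P>(om in M. Q kp (?G om))"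
   unfolding k(1) by (rule indep_parts[OF _ _ _ Pd Pm Qd Qm]) (use k in auto)
  also have "... <= \<P>(om in M. P kp (?G om)) * (ta + exp (- g))"
   unfolding k(1) by (rule mult_left_mono[OF Qp(2)]) (use k in auto)
  finally show ?thesis
   by (rule outer_meas[rotated]) (use Pev[OF \<open>kp \<in> T\<close>] Qp(1)[OF k(2)] k in "auto simp: Collect_conj_eq2")
 qed
 have disj: "disjoint_family_on (%kp. {om \<in> space M. P kp (?G om)}) T"
  unfolding disjoint_family_on_def
 proof (intro ballI impI, rule ccontr)
  fix k k' assume kk: "k \<in> T" "k' \<in> T" "k ~= k'" "{om \<in> space M. P k (?G om)} \<inter> {om \<in> space M. P k' (?G om)} ~= {}"
  obtain n w r where k: "k = (n, w, r)" by (metis prod.exhaust)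
  obtain n' w' r' where k': "k' = (n', w', r')" by (metis prod.exhaust)
  obtain om where h: "hit N W (dx (?G om)) (cx (?G om)) n i 0 w r" "hit N W (dx (?G om)) (cx (?G om)) n' i 0 w' r'"
   using kk(4) by (auto simp: P_def k k')
  have "k = k'" unfolding k k' using hit_unique[OF h] by simp
  thus False using kk by simp
 qed
 have "(\<Sum>kp\<in>T. \<P>(om in M. P kp (?G om))) <= h"
 proof -
  have "(%kp. {om \<in> space M. P kp (?G om)}) ` T <= events" using Pev by blast
  hence "(\<Sum>kp\<in>T. \<P>(om in M. P kp (?G om))) = prob (\<Union>kp\<in>T. {om \<in> space M. P kp (?G om)})"
   by (intro finite_measure_finite_Union[symmetric] fin disj)
  also have "... <= \<P>(om in M. GG (Inl i, 1) om <= h)"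
   by (rule finite_measure_mono) (use G_meas[of "(Inl i, 1)"] i in "auto simp: P_def")
  also have "... <= h" by (rule prob_le') (use i h in auto)
  finally show ?thesis .
 qed
 hence le: "(\<Sum>kp\<in>T. \<P>(om in M. P kp (?G om)) * (ta + exp (- g))) <= h * (ta + exp (- g))"
  unfolding sum_distrib_right[symmetric] by (rule mult_right_mono) (use ta in simp)
 show ?thesis
  by (rule outer_mono[OF outer_bex[OF fin one] le]) (auto simp: rare_def T_def P_def Q_def)
qed

end

context star_reg
begin

lemma fast_line:
 assumes i: "i \<in> {1..N}" and before: "K (steps t) i = 0" and after: "2 <= K (steps (t + ta)) i"
 shows "\<exists>nA nB. nA < nB & nB < steps (t + ta) & T nA = i & K nA i = 0 & T nB = i & K nB i = 1 & jt nB - jt nA <= ta"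
proof -
 obtain nA where A: "nA < steps (t + ta)" "T nA = i" "K nA i = 0" using consumed_at[of 0 "steps (t + ta)" i] after by auto
 obtain nB where B: "nB < steps (t + ta)" "T nB = i" "K nB i = 1" using consumed_at[of 1 "steps (t + ta)" i] after by auto
 have "nA < nB" using K_mono[of nB nA i] A B by (cases "nA < nB") auto
 moreover have "~ nA < steps t"
 proof
  assume "nA < steps t"
  hence "K (Suc nA) i <= K (steps t) i" by (intro K_mono) simp
  thus False using before K_Suc[of nA i] A by simp
 qed
 hence "t < jt nA" using less_steps by simp
 moreover have "jt nB <= t + ta" using less_steps B by simp
 ultimately have "nA < nB" "jt nB - jt nA <= ta" by auto
 thus ?thesis using A B by blast
qed

text \<open>A boundary of a time slot lies in at most three of the level intervals
  \<open>{l * h .. (l + 2) * h}\<close>, and all other intervals are passed within a single slot.\<close>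

lemma card_fast_lines:
 fixes h ta m :: real and S :: nat
 assumes cc: "close_cells N d h" and h: "0 < h" and ta: "0 < ta" and m: "0 < m" "m <= 1" "m <= Lev (steps (S * ta))"
 shows "(m / (2 * h) - 5 - 3 * (real S + 1)) * (N * h\<^sup>2 / 72)
  <= card {i \<in> {1..N}. gap (d i) 0 \<in> {m / 2..m} & gap (d i) 1 <= h &
    (\<exists>nA nB. nA < nB & nB < steps (S * ta) & T nA = i & K nA i = 0 & T nB = i & K nB i = 1 & jt nB - jt nA <= ta)}"
  (is "_ <= real (card ?F)")
proof -
 define all where "all = {l :: nat. m / 2 <= real l * h & (real l + 2) * h <= m}"
 define bad where "bad = (\<Union>s\<in>{..S}. {l :: nat. real l * h <= Lev (steps (s * ta)) & Lev (steps (s * ta)) <= (real l + 2) * h})"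
 define cand where "cand l = {i \<in> {1..N}. gap (d i) 0 \<in> {real l * h .. real l * h + h / 2} & gap (d i) 1 \<in> {0..h}}" for l :: nat
 have fin_all: "finite all"
 proof (rule finite_subset)
  show "all <= {..nat \<lfloor>m / h\<rfloor>}"
  proof
   fix l assume "l \<in> all"
   hence "real l * h <= m" using h by (simp add: all_def distrib_right)
   hence "real l <= m / h" using h by (simp add: pos_le_divide_eq)
   thus "l \<in> {..nat \<lfloor>m / h\<rfloor>}" by (simp add: le_nat_iff le_floor_iff)
  qed
 qed simp
 have card_all: "m / (2 * h) - 5 <= card all"
 proof -
  define l0 where "l0 = nat \<lceil>m / (2 * h)\<rceil>"
  define l1 where "l1 = nat (\<lfloor>m / h\<rfloor> - 2)"
  have sub: "{l0..l1} <= all" if "2 <= \<lfloor>m / h\<rfloor>"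
  proof
   fix l assume l: "l \<in> {l0..l1}"
   have "m / (2 * h) <= l" using l m h unfolding l0_def by (simp add: nat_le_iff ceiling_le_iff)
   hence "m / 2 <= real l * h" using h by (simp add: field_simps)
   moreover have "real l + 2 <= m / h" using l that unfolding l1_def by (simp add: le_nat_iff le_floor_iff le_diff_eq)
   hence "(real l + 2) * h <= m" using h by (simp add: pos_le_divide_eq)
   ultimately show "l \<in> all" by (simp add: all_def)
  qed
  show ?thesis
  proof (cases "2 <= \<lfloor>m / h\<rfloor>")
   case True
   have "card {l0..l1} <= card all" by (rule card_mono[OF fin_all sub[OF True]])
   hence "real l1 + 1 - real l0 <= card all" by simp
   moreover have "real l0 <= m / (2 * h) + 1" unfolding l0_def using m h by (simp add: of_nat_nat ceiling_correct)
   moreover have "m / h - 3 <= real l1" unfolding l1_def using True by (simp add: of_nat_nat) linarith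
   moreover have "m / h = m / (2 * h) + m / (2 * h)" using h by (simp add: field_simps)
   ultimately show ?thesis by linarith
  next
   case False
   hence "m / h < 2" by linarith
   hence "m / (2 * h) < 5" using h by (simp add: field_simps)
   thus ?thesis by simp
  qed
 qed
 have card_bad: "finite bad" "card bad <= 3 * (S + 1)"
 proof -
  have one: "finite {l :: nat. real l * h <= y & y <= (real l + 2) * h} & card {l :: nat. real l * h <= y & y <= (real l + 2) * h} <= 3" for y
  proof -
   have sub: "{l :: nat. real l * h <= y & y <= (real l + 2) * h} <= {nat \<lfloor>y / h\<rfloor> - 2..nat \<lfloor>y / h\<rfloor>}"
   proof
    fix l :: nat assume "l \<in> {l. real l * h <= y & y <= (real l + 2) * h}"
    hence "real l <= y / h" "y / h <= real l + 2" using h by (auto simp: field_simps)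
    thus "l \<in> {nat \<lfloor>y / h\<rfloor> - 2..nat \<lfloor>y / h\<rfloor>}" by (simp add: le_nat_iff le_floor_iff) linarith
   qed
   have "card {nat \<lfloor>y / h\<rfloor> - 2..nat \<lfloor>y / h\<rfloor>} <= 3" by simp
   thus ?thesis using card_mono[OF _ sub] finite_subset[OF sub] by fastforce
  qed
  show "finite bad" unfolding bad_def using one by blast
  have "card bad <= (\<Sum>s\<in>{..S}. card {l :: nat. real l * h <= Lev (steps (s * ta)) & Lev (steps (s * ta)) <= (real l + 2) * h})"
   unfolding bad_def by (rule card_UN_le) simp
  also have "... <= (\<Sum>s\<in>{..S}. 3)" by (rule sum_mono) (use one in blast)
  finally show "card bad <= 3 * (S + 1)" by simp
 qed
 have cand_card: "N * h\<^sup>2 / 72 <= card (cand l)" if "l \<in> all" for l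
 proof -
  have "(real l + 1) * h <= 1" using that m h by (simp add: all_def distrib_right)
  thus ?thesis using cc unfolding close_cells_def cand_def by force
 qed
 have sub: "cand l <= ?F" if l: "l \<in> all - bad" for l
 proof
  fix i assume "i \<in> cand l"
  hence i: "i \<in> {1..N}" "real l * h <= d i 0" "d i 0 <= real l * h + h / 2" "d i 1 - d i 0 <= h" by (auto simp: cand_def gap_def)
  have nb: "Lev (steps (s * ta)) < real l * h \<or> (real l + 2) * h < Lev (steps (s * ta))" if "s <= S" for s :: nat
   using l that by (auto simp: bad_def not_le)
  have i1: "d i 0 < (real l + 2) * h" "d i 1 < (real l + 2) * h" using i h by (auto simp: distrib_right)
  have "Lev (steps (real 0 * ta)) <= d i 0" using Lev_le[OF i(1), of 0] by (simp add: steps_0)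
  hence P0: "Lev (steps (real 0 * ta)) < real l * h" using nb[of 0] i1 by auto
  have PS: "~ Lev (steps (real S * ta)) < real l * h" using m l h by (auto simp: all_def distrib_right)
  \<comment> \<open>A slot that starts with the level below the interval and ends with it no longer
    below. As the interval is not bad, the level is beyond it at the end of the slot.\<close>
  obtain s where s: "s < S" "Lev (steps (real s * ta)) < real l * h" "~ Lev (steps (real (Suc s) * ta)) < real l * h"
   using ex_least_nat_less[of "%s. ~ Lev (steps (real s * ta)) < real l * h" S] P0 PS
   by (metis lessI less_Suc_eq_le not_less)
  have "(real l + 2) * h < Lev (steps (real (Suc s) * ta))" using nb[of "Suc s"] s by auto
  hence up: "(real l + 2) * h < Lev (steps (real s * ta + ta))" by (simp add: distrib_right add.commute)
  have "K (steps (real s * ta)) i = 0" using first_le_Lev[of "steps (real s * ta)" i] s(2) i(2) by fastforce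
  moreover have "2 <= K (steps (real s * ta + ta)) i"
  proof (rule ccontr)
   assume "~ ?thesis"
   hence "d i (K (steps (real s * ta + ta)) i) <= d i 1" using d_le_iff[OF i(1)] by simp
   thus False using Lev_le[OF i(1), of "steps (real s * ta + ta)"] up i1 by linarith
  qed
  ultimately obtain nA nB where n: "nA < nB" "nB < steps (real s * ta + ta)" "T nA = i" "K nA i = 0" "T nB = i" "K nB i = 1" "jt nB - jt nA <= ta"
   using fast_line[OF i(1)] by blast
  have "real s * ta + ta = real (Suc s) * ta" by (simp add: distrib_right)
  also have "... <= S * ta" by (rule mult_right_mono) (use s ta in auto)
  finally have "steps (real s * ta + ta) <= steps (S * ta)" by (rule steps_mono)
  hence "nB < steps (S * ta)" using n by simp
  moreover have "gap (d i) 0 \<in> {m / 2..m}" using i l h by (auto simp: all_def gap_def distrib_right)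
  ultimately show "i \<in> ?F" using i(1,4) n by (auto simp: gap_def)
 qed
 have "(m / (2 * h) - 5 - 3 * (real S + 1)) <= card (all - bad)"
 proof -
  have "card all <= card (all - bad) + card bad"
   using card_Un_le[of "all - bad" bad] card_mono[of "(all - bad) \<union> bad" all] fin_all card_bad(1) by fastforce
  hence "real (card all) <= card (all - bad) + real (3 * (S + 1))" using card_bad(2) by linarith
  thus ?thesis using card_all by simp
 qed
 hence "(m / (2 * h) - 5 - 3 * (real S + 1)) * (N * h\<^sup>2 / 72) <= card (all - bad) * (N * h\<^sup>2 / 72)"
  by (rule mult_right_mono) simp
 also have "... = (\<Sum>l\<in>all - bad. N * h\<^sup>2 / 72)" by simp
 also have "... <= (\<Sum>l\<in>all - bad. real (card (cand l)))" by (rule sum_mono) (use cand_card in auto)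
 also have "... = real (card (\<Union>l\<in>all - bad. cand l))"
 proof -
  have "cand l \<inter> cand l' = {}" if "l ~= l'" for l l'
  proof (rule ccontr)
   assume "cand l \<inter> cand l' ~= {}"
   then obtain i where "real l * h <= d i 0" "d i 0 <= real l * h + h / 2" "real l' * h <= d i 0" "d i 0 <= real l' * h + h / 2"
    by (auto simp: cand_def gap_def)
   hence "real l * h < (real l' + 1) * h" "real l' * h < (real l + 1) * h" using h by (auto simp: distrib_right)
   hence "real l < real l' + 1" "real l' < real l + 1" using h by auto
   thus False using that by linarith
  qed
  thus ?thesis by (subst card_UN_disjoint) (use fin_all in "auto simp: cand_def")
 qed
 also have "... <= card ?F" unfolding of_nat_le_iff by (rule card_mono) (use sub in auto)
 finally show ?thesis .
qed

end

lemma (in star_real) hit_iff: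
 assumes w: "w \<in> {1..W}"
 shows "hit N W d c n i k w r <-> T n = i & K n i = k & jumper W c n = w & cnt 0 n w = r"
proof -
 have "tgt N d (ring_order W c) n = T n" "tgt_index N d (ring_order W c) n = K n (T n)"
  unfolding tgt_def tgt_index_def T_def K_def unfolding jumper_ring_order by (rule refl)+
 thus ?thesis unfolding hit_def ring_counts_eq[OF w] by (auto simp: jumper_ring_order)
qed

lemma (in star_proc) cnt_le: "cnt 0 n w <= n"
 unfolding cnt_def using card_mono[of "{0..<n}" "{p \<in> {0..<n}. J p = w}"] by fastforce

context star_reg
begin

lemma steps_eq_sum: "n = (\<Sum>w\<in>{1..W}. cnt 0 n w)"
proof (induction n)
 case (Suc n)
 have "(\<Sum>w\<in>{1..W}. cnt 0 (Suc n) w) = (\<Sum>w\<in>{1..W}. cnt 0 n w + (if jp n = w then 1 else 0))"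
  by (rule sum.cong) (simp_all add: cnt_Suc)
 also have "... = (\<Sum>w\<in>{1..W}. cnt 0 n w) + 1" using jumper_props[of n] by (simp add: sum.distrib)
 finally show ?case using Suc by simp
qed simp

lemma steps_le:
 fixes t :: real
 assumes t: "0 <= t"
 shows "real (steps t) <= W * (4 * t + q + 2)"
proof (cases "steps t")
 case 0 thus ?thesis using t by simp
next
 case (Suc n)
 hence jn: "jt n <= t" using less_steps[of n t] by simp
 have one: "real (cnt 0 n w) <= 4 * t + q + 1" if w: "w \<in> {1..W}" for w
 proof (cases "cnt 0 n w <= q")
  case False
  define r where "r = cnt 0 n w - 1"
  have r: "r < cnt 0 n w" "q <= r" "cnt 0 n w = Suc r" using False by (auto simp: r_def)
  have "c w r < jt n" using ring_count[OF w] r by simp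
  moreover have "r / 4 <= c w r" by (rule c_ge[OF w r(2)])
  ultimately show ?thesis using jn r by simp
 qed (use t in simp)
 have "real n = (\<Sum>w\<in>{1..W}. real (cnt 0 n w))" using steps_eq_sum[of n] by (metis of_nat_sum)
 also have "... <= (\<Sum>w\<in>{1..W}. 4 * t + q + 1)" by (rule sum_mono) (rule one)
 finally have "real n <= W * (4 * t + q + 1)" by simp
 moreover have "1 <= real W" using W1 by simp
 ultimately show ?thesis using Suc by (simp add: distrib_left)
qed

text \<open>If the rest of the first worker exceeds the time between the two removals, he has not
  rung again, so the second removal is due to somebody else.\<close>

lemma fast_meet:
 assumes "nA < nB" "jt nB - jt nA <= ta" "ta < gap (c (jp nA)) (Suc (cnt 0 nA (jp nA)))"
 shows "jp nA ~= jp nB" "cnt 0 nB (jp nA) = Suc (cnt 0 nA (jp nA))"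
proof -
 define A rh where "A = jp nA" and "rh = cnt 0 nA A"
 have A: "A \<in> {1..W}" using jumper_props[of nA] by (simp add: A_def)
 have tA: "jt nA = c A rh" using jump_time_ring[of nA A] by (simp add: A_def rh_def)
 have "jt nA < jt nB" using assms(1) enum.e_less_iff by simp
 hence "rh < cnt 0 nB A" using ring_count[OF A] tA by simp
 moreover have late: "jt nB < c A (Suc rh)" using assms(2,3) tA by (simp add: gap_def A_def[symmetric] rh_def[symmetric])
 hence "~ Suc rh < cnt 0 nB A" using ring_count[OF A, of "Suc rh" nB] by simp
 ultimately have eq: "cnt 0 nB A = Suc rh" by simp
 thus "cnt 0 nB (jp nA) = Suc (cnt 0 nA (jp nA))" by (simp add: A_def rh_def)
 show "jp nA ~= jp nB"
 proof
  assume "jp nA = jp nB"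
  hence "jt nB = c A (Suc rh)" using jump_time_ring[of nB A] eq by (simp add: A_def)
  thus False using late by simp
 qed
qed

end

lemma bit_differ:
 fixes A B :: nat
 assumes "A ~= B" "A < 2 ^ n" "B < 2 ^ n"
 shows "\<exists>bt<n. bit A bt ~= bit B bt"
proof (rule ccontr)
 assume "~ ?thesis"
 hence "take_bit n A = take_bit n B" by (intro bit_eqI) (auto simp: bit_take_bit_iff)
 thus False using assms by (simp add: take_bit_nat_eq_self)
qed

definition classes :: "nat => nat => nat => (nat \<times> bool \<times> nat \<times> nat \<times> nat) set" where
 "classes bmax La jmax = {..<bmax} \<times> UNIV \<times> {..<La} \<times> {..<La} \<times> {..<jmax}"

context star_cleaning
begin

text \<open>Every fast halfline that is not rare gives a meeting of some class; the pigeonhole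
  principle selects a class with many meetings.\<close>

lemma class_exists:
 fixes h ta mu g r :: real and S q :: nat
 assumes sr: "star_reg N W (D om) (C om) q" and cc: "close_cells N (D om) h" and h: "0 < h" and ta: "0 < ta"
  and mu: "0 < mu" "2 * mu <= 1" "2 * mu <= star_proc.Lev N (D om) (jumper W (C om)) (star_real.steps W (C om) (S * ta))"
  and nmax: "W * (4 * (S * ta) + q + 2) <= real nmax" and bmax: "W < 2 ^ bmax" and jmax: "8 * g < jmax" and La: "0 < La"
  and nrare: "real (card {i \<in> {1..N}. rare nmax h ta g (GW om) i}) < xr"
  and r: "xr + card (classes bmax La jmax) * r <= (mu / h - 5 - 3 * (real S + 1)) * (N * h\<^sup>2 / 72)"
  and r0: "0 < r"
 shows "\<exists>(bt, ob, ph, ph', jj)\<in>classes bmax La jmax.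
  r <= card {(i, nA, nB, A, rh, B, sm) \<in> tuples_at N W nmax. meet_at N W La bt ob ph ph' jj mu h ta (GW om) i nA nB A rh B sm}"
proof -
 let ?x = "%z. GG z om" and ?Cl = "classes bmax La jmax"
 interpret star_reg N W "D om" "C om" q by (rule sr)
 define Fc where "Fc = (%(bt, ob, ph, ph', jj). {i. \<exists>nA nB A rh B sm. (i, nA, nB, A, rh, B, sm) \<in> tuples_at N W nmax & meet_at N W La bt ob ph ph' jj mu h ta ?x i nA nB A rh B sm})"
 define F where "F = {i \<in> {1..N}. gap (D om i) 0 \<in> {2 * mu / 2..2 * mu} & gap (D om i) 1 <= h &
    (\<exists>nA nB. nA < nB & nB < steps (S * ta) & T nA = i & K nA i = 0 & T nB = i & K nB i = 1 & jump_time W (C om) nB - jump_time W (C om) nA <= ta)}"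
 define Ra where "Ra = {i \<in> {1..N}. rare nmax h ta g ?x i}"
 have fast: "(mu / h - 5 - 3 * (real S + 1)) * (N * h\<^sup>2 / 72) <= card F"
  using card_fast_lines[OF cc h ta, of "2 * mu" S] mu unfolding F_def by simp
 have dxe: "dx ?x = D om" "cx ?x = C om" by (simp_all add: D_dx C_cx)
 have "steps (S * ta) <= nmax" using steps_le[of "real S * ta"] nmax ta by simp
 have sub: "F - Ra <= (\<Union>c\<in>?Cl. Fc c)"
 proof
  fix i assume "i \<in> F - Ra"
  then obtain nA nB where i: "i \<in> {1..N}" "gap (D om i) 0 \<in> {mu..2 * mu}" "gap (D om i) 1 <= h" "~ rare nmax h ta g ?x i"
   and n: "nA < nB" "nB < steps (S * ta)" "T nA = i" "K nA i = 0" "T nB = i" "K nB i = 1"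
    "jump_time W (C om) nB - jump_time W (C om) nA <= ta" by (auto simp: F_def Ra_def)
  define A B where "A = jumper W (C om) nA" and "B = jumper W (C om) nB"
  define rh sm where "rh = cnt 0 nA A" and "sm = cnt 0 nB B"
  have AB: "A \<in> {1..W}" "B \<in> {1..W}" using jumper_props by (auto simp: A_def B_def)
  have nn: "nA < nmax" "nB < nmax" "rh < nmax" "sm < nmax"
   using n \<open>steps (S * ta) <= nmax\<close> cnt_le[of nA A] cnt_le[of nB B] by (auto simp: rh_def sm_def)
  have hA: "hit N W (D om) (C om) nA i 0 A rh" unfolding hit_iff[OF AB(1)] using n by (simp add: A_def rh_def)
  have hB: "hit N W (D om) (C om) nB i 1 B sm" unfolding hit_iff[OF AB(2)] using n by (simp add: B_def sm_def)
  have ga: "ta < GG (Inr A, Suc rh) om" "GG (Inr A, Suc rh) om <= g"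
  proof -
   have "rare nmax h ta g ?x i" if "GG (Inr A, Suc rh) om <= ta \<or> g < GG (Inr A, Suc rh) om"
    unfolding rare_def dxe
    by (rule exI[of _ nA], rule conjI[OF nn(1)], rule bexI[OF _ AB(1)], rule exI[of _ rh], rule conjI[OF nn(3)])
     (use that hA i(3) in "simp add: GG_Inl")
   hence "~ (GG (Inr A, Suc rh) om <= ta \<or> g < GG (Inr A, Suc rh) om)" using i(4) by blast
   thus "ta < GG (Inr A, Suc rh) om" "GG (Inr A, Suc rh) om <= g" by simp_all
  qed
  have "ta < gap (C om A) (Suc rh)" using ga by (simp add: GG_Inr)
  note fm = fast_meet[OF n(1,7) this[unfolded rh_def A_def]]
  have ne: "A ~= B" and cA: "ring_counts W (C om) nB A = Suc rh"
   using fm ring_counts_eq[OF AB(1), of nB] by (simp_all add: A_def B_def rh_def)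
  have "A < 2 ^ bmax" "B < 2 ^ bmax" using AB bmax by auto
  then obtain bt where bt: "bt < bmax" "bit A bt ~= bit B bt" using bit_differ[OF ne] by blast
  define jj where "jj = nat \<lfloor>8 * GG (Inr A, Suc rh) om\<rfloor>"
  have g0: "0 <= 8 * GG (Inr A, Suc rh) om" using ga ta by linarith
  have jj: "real jj <= 8 * GG (Inr A, Suc rh) om" "8 * GG (Inr A, Suc rh) om < jj + 1" using g0 unfolding jj_def by linarith+
  have "jj < jmax" using jj(1) ga(2) jmax by linarith
  have "C om B sm - C om A rh <= ta" using n(7) jump_time_ring[of nA A] jump_time_ring[of nB B] by (simp add: A_def B_def rh_def sm_def)
  hence "meet_at N W La bt (bit A bt) (rh mod La) (sm mod La) jj mu h ta ?x i nA nB A rh B sm"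
   unfolding meet_at_def dxe using hA hB n(1) cA jj i bt(2) by (auto simp: GG_Inl)
  moreover have "(i, nA, nB, A, rh, B, sm) \<in> tuples_at N W nmax" using i AB nn by (simp add: tuples_at_def)
  ultimately have "i \<in> Fc (bt, bit A bt, rh mod La, sm mod La, jj)" unfolding Fc_def by blast
  moreover have "(bt, bit A bt, rh mod La, sm mod La, jj) \<in> ?Cl" using bt La \<open>jj < jmax\<close> by (simp add: classes_def)
  ultimately show "i \<in> (\<Union>c\<in>?Cl. Fc c)" by blast
 qed
 have fin: "finite ?Cl" "finite (tuples_at N W nmax)" by (simp_all add: classes_def tuples_at_def)
 have finFc: "finite (Fc c)" for c
  by (rule finite_subset[of _ "{1..N}"]) (auto simp: Fc_def tuples_at_def split: prod.splits)
 have "real (card F) <= card (F - Ra) + card Ra"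
 proof -
  have "card F <= card (F - Ra) + card Ra"
   using card_Un_le[of "F - Ra" Ra] card_mono[of "(F - Ra) \<union> Ra" F] by (auto simp: F_def Ra_def)
  thus ?thesis by linarith
 qed
 moreover have "real (card Ra) < xr" using nrare by (simp add: Ra_def)
 ultimately have big: "card ?Cl * r < card (F - Ra)" using fast r by linarith
 have "card (F - Ra) <= (\<Sum>c\<in>?Cl. card (Fc c))"
  using card_mono[OF _ sub] card_UN_le[OF fin(1), of Fc] finFc fin(1) by (meson finite_UN order_trans)
 hence "card ?Cl * r < (\<Sum>c\<in>?Cl. real (card (Fc c)))" using big by (simp flip: of_nat_sum)
 hence "\<exists>c\<in>?Cl. r <= card (Fc c)"
 proof (rule contrapos_pp)
  assume "~ (\<exists>c\<in>?Cl. r <= card (Fc c))"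
  hence "(\<Sum>c\<in>?Cl. real (card (Fc c))) <= (\<Sum>c\<in>?Cl. r)" by (intro sum_mono) auto
  thus "~ card ?Cl * r < (\<Sum>c\<in>?Cl. real (card (Fc c)))" by simp
 qed
 then obtain bt ob ph ph' jj where c: "(bt, ob, ph, ph', jj) \<in> ?Cl" "r <= card (Fc (bt, ob, ph, ph', jj))" by auto
 let ?T = "{(i, nA, nB, A, rh, B, sm) \<in> tuples_at N W nmax. meet_at N W La bt ob ph ph' jj mu h ta ?x i nA nB A rh B sm}"
 have finT: "finite ?T" by (rule finite_subset[OF _ fin(2)]) auto
 have "Fc (bt, ob, ph, ph', jj) <= fst ` ?T" unfolding Fc_def by force
 hence "card (Fc (bt, ob, ph, ph', jj)) <= card ?T"
  using card_mono[of "fst ` ?T" "Fc (bt, ob, ph, ph', jj)"] card_image_le[OF finT, of fst] finT by (meson finite_imageI order_trans)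
 hence "r <= card ?T" using c(2) by linarith
 thus ?thesis using c(1) by (intro bexI[of _ "(bt, ob, ph, ph', jj)"]) auto
qed

lemma fresh_not_separated:
 fixes h ta mu :: real and q :: nat
 assumes sr: "star_reg N W (D om) (C om) q" and fc: "first_cells N (D om) (q / N)"
  and t: "(i, nA, nB, A, rh, B, sm) \<in> tuples_at N W nmax"
  and m: "meet_at N W La bt ob ph ph' jj mu h ta (GW om) i nA nB A rh B sm"
  and fr: "fresh_at J H R jj mu (GW om) i A rh B sm"
  and J: "2 <= J" and mu: "0 < mu" and H: "1 <= H" and HD: "80 * real H <= (2 - 1 / J) ^ J * mu"
  and R: "4000 * q ^ 2 + 20 * H <= R" and eta: "27 * real q ^ 2 * W / N < (1 - 1 / J) * mu"
  and time: "real jj / 8 + J + 4 <= 4 * (real q + 3)" and h: "h <= 1 / (2 * J) * mu" and ta: "ta <= 1 / 16"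
  and nm: "4 * (real nmax + 2 * q + 1) + real jj / 8 + J + 4 <= real N ^ 2"
 shows "~ eventually_separated N W (D om) (C om)"
proof -
 interpret star_reg N W "D om" "C om" q by (rule sr)
 have dxe: "dx (GW om) = D om" "cx (GW om) = C om" by (simp_all add: D_dx C_cx)
 have i: "i \<in> {1..N}" and AB: "A \<in> {1..W}" "B \<in> {1..W}" and sm: "sm < nmax" using t by (auto simp: tuples_at_def)
 have hA: "hit N W (D om) (C om) nA i 0 A rh" and hB: "hit N W (D om) (C om) nB i 1 B sm" and nn: "nA < nB"
  and cA: "ring_counts W (C om) nB A = Suc rh" and ct: "C om B sm - C om A rh <= ta"
  and gA: "gap (C om A) (Suc rh) \<in> {real jj / 8..<real jj / 8 + 1 / 8}"
  and d0: "gap (D om i) 0 \<in> {mu..2 * mu}" and d1: "gap (D om i) 1 <= h" and bits: "bit A bt = ob" "bit B bt = (~ ob)"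
  using m unfolding meet_at_def dxe GG_Inl GG_Inr by auto
 have ne: "A ~= B" using bits by auto
 have gg: "(%l. GG (Inl i, l) om) = gap (D om i)" "(%l. GG (Inr A, l) om) = gap (C om A)" "(%l. GG (Inr B, l) om) = gap (C om B)"
  by (simp_all add: fun_eq_iff GG_Inl GG_Inr)
 have fresh: "dust_pat J mu (gap (D om i))" "fin_reg H (2 * J + 2) R (gap (D om i))"
  "clock_pat J (rh + 2) (gap (C om A))" "fin_reg H (rh + 2 + J) R (gap (C om A))"
  "gap (C om B) (sm + 1) \<in> {real jj / 8 + 1 / 2..real jj / 8 + 9 / 16}"
  "clock_pat J (sm + 2) (gap (C om B))" "fin_reg H (sm + 2 + J) R (gap (C om B))"
  using fr unfolding fresh_at_def gg GG_Inr by auto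
 have cB: "C om B sm <= 4 * (real nmax + 2 * q + 1)"
 proof -
  have "C om B (0 + sm) - C om B 0 <= 4 * (real sm + real q + 1 + real 0 / real N ^ 4)"
   by (rule reg_upper'[OF regc[OF AB(2)] c_mono[OF AB(2)] B_pos])
  moreover have "C om B 0 <= q" by (rule reg_0[OF regc[OF AB(2)]])
  moreover have "real sm <= nmax" using sm by simp
  ultimately show ?thesis by simp
 qed
 have hitA: "T nA = i" "K nA i = 0" "jumper W (C om) nA = A" "cnt 0 nA A = rh" using hA unfolding hit_iff[OF AB(1)] by auto
 have hitB: "T nB = i" "K nB i = 1" "jumper W (C om) nB = B" "cnt 0 nB B = sm" using hB unfolding hit_iff[OF AB(2)] by auto
 interpret pair_trap N W "D om" "C om" q i A B nA nB rh sm J H R mu "real jj / 8"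
 proof unfold_locales
  show "fine_cells" by (rule fine_cells_first[OF fc])
  show "C om B sm - C om A rh <= 1 / 16" using ct ta by linarith
  show "mu <= D om i 0" using d0 by (simp add: gap_def)
  show "gap (D om i) 1 <= 1 / (2 * J) * mu" using d1 h by linarith
  show "eta < (1 - 1 / J) * mu" using eta by (simp add: eta_def)
  show "C om B sm + real jj / 8 + J + 4 <= real N ^ 2" using cB nm by linarith
  show "cnt 0 nB A = Suc rh" using cA ring_counts_eq[OF AB(1), of nB] by simp
 qed (use i AB ne nn hitA hitB gA fresh J mu H HD R time in auto)
 show ?thesis by (rule trapped)
qed

lemma outer_no_pair:
 fixes p0 r h mu ta :: real
 assumes N: "1 <= N" and La: "J + R + H + 2 <= La" and r: "0 < r" and h: "0 <= h" and p0: "0 < p0"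
  and mu: "0 < mu" and J: "1 <= J" and HR: "12 * real R * exp (- 2 / 5 * H) <= 1"
  and p0_le: "!!jj. jj < jmax ==> p0 <= (good_rate mu J)\<^sup>2 * (1 / 4) ^ J * ((1 / (128 * J)) ^ J * (1 / (128 * J)) ^ J * (exp (- (real jj / 8 + 1)) / 32))"
 shows "outer_le (%om. \<exists>(bt, ob, ph, ph', jj)\<in>classes bmax La jmax.
   r <= card {(i, nA, nB, A, rh, B, sm) \<in> tuples_at N W nmax. meet_at N W La bt ob ph ph' jj mu h ta (GW om) i nA nB A rh B sm} &
   (\<forall>(i, nA, nB, A, rh, B, sm)\<in>tuples_at N W nmax. meet_at N W La bt ob ph ph' jj mu h ta (GW om) i nA nB A rh B sm -->
    ~ fresh_at J H R jj mu (GW om) i A rh B sm))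
  (card (classes bmax La jmax) * (N * h / (p0 * r\<^sup>2)))"
proof -
 let ?P = "%(bt, ob, ph, ph', jj) om. r <= card {(i, nA, nB, A, rh, B, sm) \<in> tuples_at N W nmax. meet_at N W La bt ob ph ph' jj mu h ta (GW om) i nA nB A rh B sm} &
   (\<forall>(i, nA, nB, A, rh, B, sm)\<in>tuples_at N W nmax. meet_at N W La bt ob ph ph' jj mu h ta (GW om) i nA nB A rh B sm -->
    ~ fresh_at J H R jj mu (GW om) i A rh B sm)"
 have "outer_le (%om. \<exists>c\<in>classes bmax La jmax. ?P c om) (\<Sum>c\<in>classes bmax La jmax. N * h / (p0 * r\<^sup>2))"
 proof (rule outer_bex)
  show "finite (classes bmax La jmax)" by (simp add: classes_def)
  fix c assume c: "c \<in> classes bmax La jmax"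
  obtain bt ob ph ph' jj where cd: "c = (bt, ob, ph, ph', jj)" by (metis prod.exhaust)
  have jj: "jj < jmax" using c by (simp add: cd classes_def)
  interpret P: pair_setup M N W D C J H R La bt ph ph' jj nmax ob mu h ta
   by unfold_locales (use N La in auto)
  show "outer_le (?P c) (N * h / (p0 * r\<^sup>2))"
   unfolding cd prod.case
  proof (rule P.outer_no_success[OF p0 _ r h])
   fix i A rh B sm assume iAB: "i \<in> {1..N}" "A \<in> {1..W}" "B \<in> {1..W}" "A ~= B"
   show "p0 <= \<P>(om in M. fresh_at J H R jj mu (GW om) i A rh B sm)"
    by (rule order_trans[OF p0_le[OF jj] P.fresh_prob[OF mu J HR iAB, unfolded of_nat_mult of_nat_numeral]])
  qed
 qed
 thus ?thesis by (rule outer_mono) (auto simp: split_beta)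
qed

end

text \<open>With \<open>H\<close> of order \<open>10 * ln q\<close> a block fails with probability
  of order at most \<open>1 / q ^ 4\<close>, which outweighs the number \<open>R\<close> of blocks,
  of order \<open>q ^ 2\<close>. The bound for \<open>q\<close> comes from
  \<open>50640 <= 226 ^ 2\<close>.\<close>

lemma window_parameters:
 fixes q :: nat
 assumes q: "226 <= q"
 defines "H \<equiv> nat \<lceil>10 * ln (real q)\<rceil>"
 shows "1 <= H" "80 * real H <= 1024 * ln (128 * real q)" "real H <= 11 * q" "12 * real (4000 * q ^ 2 + 20 * H) * exp (- 2 / 5 * H) <= 1"
proof -
 have q0: "226 <= real q" using q by simp
 have l1: "1 <= ln (real q)"
 proof -
  have "exp 1 <= (3 :: real)" by (rule exp_le)
  hence "exp 1 <= real q" using q0 by linarith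
  thus ?thesis using q0 by (subst ln_ge_iff) auto
 qed
 have H: "10 * ln (real q) <= H" "real H <= 10 * ln (real q) + 1" unfolding H_def using l1 by linarith+
 show "1 <= H" using H l1 by linarith
 have lq: "ln (real q) <= q" using ln_le_minus_one[of "real q"] q0 by linarith
 show "80 * real H <= 1024 * ln (128 * real q)"
 proof -
  have "ln (128 * real q) \<ge> ln (real q)" by (subst ln_le_cancel_iff) (use q0 in auto)
  thus ?thesis using H(2) l1 by linarith
 qed
 show H11: "real H <= 11 * q" using H(2) lq q0 by linarith
 have "exp (- 2 / 5 * H) <= exp (- (4 * ln (real q)))" using H(1) by simp
 also have "... = 1 / real q ^ 4"
 proof -
  have "exp (4 * ln (real q)) = exp (ln (real q)) ^ 4" by (simp add: exp_of_nat_mult[symmetric])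
  thus ?thesis using q0 by (simp add: exp_minus field_simps)
 qed
 finally have ex: "exp (- 2 / 5 * H) <= 1 / real q ^ 4" .
 have R: "12 * real (4000 * q ^ 2 + 20 * H) <= real q ^ 4"
 proof -
  have qq: "real q <= real q ^ 2" using q0 by (simp add: power2_eq_square)
  have "12 * real (4000 * q ^ 2 + 20 * H) = 48000 * real q ^ 2 + 240 * real H" by simp
  also have "... <= 48000 * real q ^ 2 + 240 * (11 * real q ^ 2)" using H11 qq by linarith
  also have "... = 50640 * real q ^ 2" by simp
  also have "... <= real q ^ 2 * real q ^ 2"
  proof (rule mult_right_mono)
   have "(226 :: real) ^ 2 <= real q ^ 2" by (rule power_mono) (use q0 in auto)
   thus "50640 <= real q ^ 2" by simp
  qed simp
  finally show ?thesis by (simp add: power_add[symmetric])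
 qed
 have "12 * real (4000 * q ^ 2 + 20 * H) * exp (- 2 / 5 * H) <= real q ^ 4 * (1 / real q ^ 4)"
  by (rule mult_mono[OF R ex]) auto
 thus "12 * real (4000 * q ^ 2 + 20 * H) * exp (- 2 / 5 * H) <= 1" using q0 by simp
qed

section \<open>Coexistence when \<open>\<alpha> > 2 / 3\<close>\<close>

context star_family
begin

text \<open>Up to multiples of \<open>dl\<close> in the exponents: the level reaches order
  \<open>m\<close> within time \<open>N powr gam\<close>, so intervals of length
  \<open>h = N powr (- gam)\<close> are mostly passed within one short slot. They contain
  \<open>N * h\<close> halflines with a second gap of at most \<open>h\<close>, each giving a
  meeting. A meeting succeeds with probability \<open>p0 = N powr (- 2 * gam)\<close>, and the bound
  \<open>N * h / (p0 * r ^ 2)\<close> of the second moment with \<open>r = N * h\<close> is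
  \<open>N powr (3 * gam - 1)\<close>, that is \<open>N powr (- kp)\<close>.\<close>

lemma unlikely_separated:
 assumes \<alpha>: "2 / 3 < \<alpha>"
 shows "unlikely (%N om. eventually_separated N (W N) (D N om) (C N om))"
proof -
 define gam where "gam = 1 - \<alpha>"
 define kp where "kp = 3 * \<alpha> - 2"
 \<comment> \<open>The total loss will be \<open>8252 * dl\<close>, and \<open>10000 * dl\<close> is
   at most \<open>kp\<close>.\<close>
 define dl where "dl = kp * gam / 10000"
 have g: "0 < gam" "gam < 1 / 3" "0 < kp" "kp <= 1" and al: "\<alpha> = 1 - gam" and ka: "kp = 1 - 3 * gam"
  using a1 \<alpha> by (auto simp: gam_def kp_def)
 have d: "0 < dl" "10000 * dl <= gam" "10000 * dl <= kp"
  using g mult_right_mono[of kp 1 gam] mult_left_mono[of gam 1 kp] by (auto simp: dl_def)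
 define s where "s = gam + 4 * dl"
 have s: "0 < s" using g d by (simp add: s_def)
 define q where "q N = qq dl N" for N
 define m where "m N = mm s N" for N
 \<comment> \<open>Ten extra doublings replace \<open>ln (128 * q)\<close> by
   \<open>1024 * ln (128 * q)\<close>, which dominates the \<open>80 * H\<close> required in the
   trap.\<close>
 define J where "J N = JJ s dl N + 10" for N
 define t1 where "t1 N = N pw (gam + 5 * dl)" for N
 \<comment> \<open>Short enough that a clock gap of at most \<open>ta N\<close> is rare.\<close>
 define ta where "ta N = N pw (- 4 * dl)" for N
 define S where "S N = nat \<lceil>t1 N / ta N\<rceil>" for N
 \<comment> \<open>Slightly less than the reciprocal of the number of slots, so that the intervals
   below the level outnumber those hit by slot boundaries.\<close>
 define h where "h N = N pw (- gam - 11 * dl)" for N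
 define H where "H N = nat \<lceil>10 * ln (real (q N))\<rceil>" for N
 define R where "R N = 4000 * q N ^ 2 + 20 * H N" for N
 define La where "La N = J N + R N + H N + 2" for N
 define nmax where "nmax N = nat \<lceil>W N * (4 * (S N * ta N) + q N + 2)\<rceil>" for N
 define bmax where "bmax N = nat \<lceil>log 2 (real N)\<rceil> + 1" for N
 \<comment> \<open>Makes too long a gap, of probability \<open>exp (- gm N)\<close>, as rare as too
   short a one, of probability at most \<open>ta N\<close>.\<close>
 define gm where "gm N = 4 * dl * ln (real N)" for N
 define jmax where "jmax N = nat \<lfloor>8 * gm N\<rfloor> + 1" for N
 define xr where "xr N = h N * N pw (1 - 2 * dl) / 2" for N
 define r where "r N = h N * N pw (1 - 12 * dl)" for N
 \<comment> \<open>Twice \<open>4097 * dl\<close> from \<open>good_rate_mm\<close> at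
   \<open>e = 10\<close>, \<open>8 * dl\<close> from \<open>2 * s\<close>, and \<open>6 * dl\<close>
   for the clock patterns and the fresh gap of \<open>B\<close>.\<close>
 define p0 where "p0 N = N pw (- 2 * gam - 8208 * dl)" for N
 define cl where "cl N = classes (bmax N) (La N) (jmax N)" for N
 note big = ev_ge
 have q: "N pw dl <= q N" "1 <= N ==> q N <= 2 * N pw dl" for N
  using qq_bounds[OF d(1), of N] by (auto simp: q_def)
 have mge: "EV N. N pw (- dl) <= m N" unfolding m_def by (rule mm_ge[OF s d(1)])
 have m01: "0 < m N" "m N <= 1" for N unfolding m_def by (rule mm_pos)+
 have h0: "1 <= N ==> 0 < h N" "1 <= N ==> h N <= 1" "1 <= N ==> 0 < ta N" for N
 proof -
  assume N: "1 <= N"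
  show "0 < h N" "0 < ta N" using N by (auto simp: h_def ta_def)
  have "h N <= N pw 0" unfolding h_def by (rule powr_mono) (use N g d in auto)
  thus "h N <= 1" using N by simp
 qed
 have ed: "EV N. 300 <= N pw dl" using d(1) by real_asymp
 have rate: "EV N. N pw (- s - 4097 * dl) <= good_rate (m N / 2) (J N) &
  1024 * ln (128 * real (q N)) <= (2 - 1 / real (J N)) ^ J N * (m N / 2) &
  N pw (- dl) <= (1 / (2048 * real (J N))) ^ (2 * J N)"
  using good_rate_mm[OF s d(1), of 10] unfolding q_def m_def J_def by simp
 have J10: "10 <= J N" for N by (simp add: J_def)
 have Jle: "EV N. real (J N) <= N pw dl"
  using rate big[of 1]
 proof eventually_elim
  case (elim N)
  have J1: "1 <= real (J N)" using J10[of N] by simp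
  have "2048 * real (J N) <= (2048 * real (J N)) ^ (2 * J N)" by (rule self_le_power) (use J10[of N] J1 in auto)
  moreover have "N pw (- dl) <= 1 / (2048 * real (J N)) ^ (2 * J N)" using elim by (simp add: power_one_over)
  hence "1 / (1 / (2048 * real (J N)) ^ (2 * J N)) <= 1 / N pw (- dl)" using elim by (intro divide_left_mono) (use J1 in auto)
  hence "(2048 * real (J N)) ^ (2 * J N) <= N pw dl" by (simp add: powr_minus_divide)
  ultimately show ?case using J1 by linarith
 qed
 have q226: "EV N. 300 <= q N"
  using ed
 proof eventually_elim
  case (elim N)
  have "real 300 <= real (q N)" using elim q(1)[of N] by simp
  thus ?case by (simp only: of_nat_le_iff)
 qed
 have Lale: "EV N. real (La N) <= N pw (3 * dl)"
 proof -
  have "EV N. 17000 * (N pw dl) ^ 2 + 1000 * N pw dl <= N pw (3 * dl)"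
   using d(1) by real_asymp
  thus ?thesis using Jle q226 ed big[of 1]
  proof eventually_elim
   case (elim N)
   have "real (H N) <= 11 * q N" unfolding H_def by (rule window_parameters(3)) (use elim in simp)
   moreover have "real (q N) <= 2 * N pw dl" by (rule q(2)[OF elim(5)])
   moreover have "4000 * real (q N) ^ 2 <= 4000 * (2 * N pw dl) ^ 2"
    by (intro mult_left_mono power_mono q(2) elim) auto
   hence "4000 * real (q N) ^ 2 <= 16000 * (N pw dl) ^ 2" by (simp add: power_mult_distrib)
   moreover have "real (La N) = real (J N) + 4000 * real (q N) ^ 2 + 21 * real (H N) + 2" by (simp add: La_def R_def)
   moreover have "0 <= (N pw dl) ^ 2" by simp
   ultimately show ?case using elim(1,2,4) by linarith
  qed
 qed
 have jmaxle: "EV N. real (jmax N) <= N pw dl & 4 * dl * ln (real N) <= N pw dl"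
 proof -
  have "EV N. 8 * (4 * dl * ln (real N)) + 1 <= N pw dl" using d(1) by real_asymp
  thus ?thesis using big[of 1]
  proof eventually_elim
   case (elim N)
   have "0 <= gm N" using elim d(1) by (simp add: gm_def)
   hence "real (jmax N) <= 8 * gm N + 1" unfolding jmax_def by linarith
   thus ?case using elim \<open>0 <= gm N\<close> by (simp add: gm_def)
  qed
 qed
 have bmaxle: "EV N. real (bmax N) <= N pw dl"
 proof -
  have "EV N. log 2 (real N) + 2 <= N pw dl" using d(1) by real_asymp
  thus ?thesis using big[of 1]
  proof eventually_elim
   case (elim N)
   have "0 <= log 2 (real N)" using elim by simp
   thus ?case using elim unfolding bmax_def by linarith
  qed
 qed
 have clle: "EV N. real (card (cl N)) <= N pw (9 * dl)"
  using Lale jmaxle bmaxle ed big[of 1]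
 proof eventually_elim
  case (elim N)
  have "real (card (cl N)) = real (bmax N) * (2 * (real (La N) * (real (La N) * real (jmax N))))"
   by (simp add: cl_def classes_def card_cartesian_product)
  also have "... <= N pw dl * (N pw dl * (N pw (3 * dl) * (N pw (3 * dl) * N pw dl)))"
   by (intro mult_mono) (use elim in auto)
  also have "... = N pw (dl + (dl + (3 * dl + (3 * dl + dl))))" by (simp only: powr_add)
  also have "dl + (dl + (3 * dl + (3 * dl + dl))) = 9 * dl" by simp
  finally show ?case .
 qed
 have S_bounds: "EV N. t1 N <= S N * ta N & S N * ta N <= t1 N + 1 & real (S N) <= N pw (gam + 9 * dl) + 1"
  using big[of 1]
 proof eventually_elim
  case (elim N)
  have ta: "0 < ta N" by (rule h0(3)[OF elim])
  have "ta N <= N pw 0" unfolding ta_def by (rule powr_mono) (use d elim in auto)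
  hence ta1: "ta N <= 1" using elim by simp
  have "0 <= t1 N / ta N" using ta by (simp add: t1_def)
  hence S: "t1 N / ta N <= S N" "S N <= t1 N / ta N + 1" unfolding S_def by linarith+
  have "t1 N <= S N * ta N" using S(1) ta by (simp add: pos_divide_le_eq)
  moreover have "S N * ta N <= (t1 N / ta N + 1) * ta N" by (rule mult_right_mono[OF S(2)]) (use ta in simp)
  hence "S N * ta N <= t1 N + ta N" using ta by (simp add: distrib_right)
  moreover have "t1 N / ta N = N pw (gam + 9 * dl)"
  proof -
   have "gam + 9 * dl = gam + 5 * dl - (- 4 * dl)" by simp
   thus ?thesis unfolding t1_def ta_def by (simp only: powr_diff)
  qed
  ultimately show ?case using S(2) ta1 by simp
 qed
 have hN: "h N * N pw e = N pw (e - gam - 11 * dl)" for N e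
  unfolding h_def powr_add[symmetric] by (simp add: algebra_simps)
 have count: "EV N. xr N + card (cl N) * r N <= (m N / 2 / h N - 5 - 3 * (real (S N) + 1)) * (N * (h N)\<^sup>2 / 72)"
 proof -
  have e1: "EV N. 5 + 3 * (N pw (gam + 9 * dl) + 1 + 1) <= N pw (gam + 10 * dl) / 4"
   using g d(1) by real_asymp
  have e2: "EV N. 288 <= N pw dl / 1" using ed by eventually_elim simp
  have e3: "EV N. N pw (1 - 3 * dl) <= N pw (1 - 2 * dl) / 2"
  proof -
   have "EV N. 2 <= N pw dl" using d(1) by real_asymp
   thus ?thesis using big[of 1]
   proof eventually_elim
    case (elim N)
    have "N pw (1 - 2 * dl) = N pw (1 - 3 * dl) * N pw dl" unfolding powr_add[symmetric] by simp
    moreover have "N pw (1 - 3 * dl) * 2 <= N pw (1 - 3 * dl) * N pw dl" by (rule mult_left_mono[OF elim(1)]) simp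
    ultimately show ?case by simp
   qed
  qed
  show ?thesis using e1 e2 e3 clle mge S_bounds big[of 1]
  proof eventually_elim
   case (elim N)
   have h: "0 < h N" by (rule h0(1)[OF elim(7)])
   have mh: "N pw (gam + 10 * dl) / 2 <= m N / 2 / h N"
   proof -
    have "N pw (gam + 10 * dl) * h N = N pw (- dl)" using hN[of N "gam + 10 * dl"] by (simp add: mult.commute)
    thus ?thesis using elim(5) h by (simp add: pos_le_divide_eq)
   qed
   have A: "N pw (gam + 10 * dl) / 4 <= m N / 2 / h N - 5 - 3 * (real (S N) + 1)"
   proof -
    have *: "x / 4 <= y - 5 - 3 * (z + 1)" if "x / 2 <= y" "5 + 3 * (v + 1 + 1) <= x / 4" "z <= v + 1" for x y z v :: real
     using that by simp
    show ?thesis by (rule *[OF mh elim(1) conjunct2[OF conjunct2[OF elim(6)]]])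
   qed
   have "N pw (gam + 10 * dl) / 4 * (N * (h N)\<^sup>2 / 72) = h N * N pw (1 - dl) / 288"
   proof -
    have "N pw (1 - dl) = N pw 1 * (h N * N pw (gam + 10 * dl))"
     unfolding hN powr_add[symmetric] by simp
    thus ?thesis using elim(7) by (simp add: power2_eq_square)
   qed
   moreover have "N pw (gam + 10 * dl) / 4 * (N * (h N)\<^sup>2 / 72) <= (m N / 2 / h N - 5 - 3 * (real (S N) + 1)) * (N * (h N)\<^sup>2 / 72)"
    by (rule mult_right_mono[OF A]) simp
   moreover have "h N * N pw (1 - 2 * dl) <= h N * N pw (1 - dl) / 288"
   proof -
    have "N pw (1 - dl) = N pw (1 - 2 * dl) * N pw dl" unfolding powr_add[symmetric] by simp
    moreover have "N pw (1 - 2 * dl) * 288 <= N pw (1 - 2 * dl) * N pw dl" by (rule mult_left_mono) (use elim(2) in auto)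
    ultimately have "N pw (1 - 2 * dl) <= N pw (1 - dl) / 288" by simp
    hence "h N * N pw (1 - 2 * dl) <= h N * (N pw (1 - dl) / 288)" by (rule mult_left_mono) (use h in simp)
    thus ?thesis by simp
   qed
   moreover have "card (cl N) * r N <= xr N"
   proof -
    have "card (cl N) * r N <= N pw (9 * dl) * r N" by (rule mult_right_mono[OF elim(4)]) (use h in "simp add: r_def")
    also have "... = h N * N pw (1 - 3 * dl)"
    proof -
     have "N pw (1 - 3 * dl) = N pw (9 * dl) * N pw (1 - 12 * dl)" unfolding powr_add[symmetric] by simp
     thus ?thesis by (simp add: r_def)
    qed
    also have "... <= h N * (N pw (1 - 2 * dl) / 2)" by (rule mult_left_mono[OF elim(3)]) (use h in simp)
    finally show ?thesis by (simp add: xr_def)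
   qed
   ultimately show ?case unfolding xr_def by linarith
  qed
 qed
 have level: "EV N. 2 * (real N * q N) < real (W N) * ((t1 N / 4 - 2 * real (q N) - 3) / (4000 * real (q N) ^ 2) - 1) &
   0 < (t1 N / 4 - 2 * real (q N) - 3) / (4000 * real (q N) ^ 2) - 1 & t1 N <= real N ^ 2"
 proof -
  have 1: "EV N. N pw (gam + 2 * dl) <= (N pw (gam + 5 * dl) / 4 - 4 * N pw dl - 3) / (4000 * (2 * N pw dl) ^ 2) - 1"
   using g d(1) by real_asymp
  have 2: "EV N. 0 <= N pw (gam + 5 * dl) / 4 - 4 * N pw dl - 3"
   using g d(1) by real_asymp
  have 3: "EV N. 4 * N pw (1 + dl) < N pw (1 + 2 * dl) / 2" using d(1) by real_asymp
  show ?thesis using 1 2 3 big[of 1]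
  proof eventually_elim
   case (elim N)
   have q': "N pw dl <= q N" "q N <= 2 * N pw dl" using q elim by auto
   have "0 < N pw dl" using elim(4) by simp
   hence q0: "0 < real (q N)" using q' by linarith
   have "(N pw (gam + 5 * dl) / 4 - 4 * N pw dl - 3) / (4000 * (2 * N pw dl) ^ 2)
     <= (t1 N / 4 - 2 * real (q N) - 3) / (4000 * real (q N) ^ 2)"
    unfolding t1_def
   proof (rule frac_le)
    show "4000 * (real (q N))\<^sup>2 <= 4000 * (2 * N pw dl)\<^sup>2"
     by (intro mult_left_mono power_mono) (use q' in auto)
   qed (use elim q' q0 in auto)
   hence ml: "N pw (gam + 2 * dl) <= (t1 N / 4 - 2 * real (q N) - 3) / (4000 * real (q N) ^ 2) - 1" using elim(1) by linarith
   have "0 < N pw (gam + 2 * dl)" using elim by simp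
   hence pos: "0 < (t1 N / 4 - 2 * real (q N) - 3) / (4000 * real (q N) ^ 2) - 1" using ml by linarith
   have "2 * (real N * q N) <= 2 * (real N * (2 * N pw dl))"
    by (intro mult_left_mono) (use q' in auto)
   also have "... = 4 * N pw (1 + dl)" using elim by (simp add: powr_add)
   also have "... < N pw (1 + 2 * dl) / 2" by (rule elim)
   also have "1 + 2 * dl = \<alpha> + (gam + 2 * dl)" by (simp add: al)
   also have "N pw (\<alpha> + (gam + 2 * dl)) / 2 = N pw \<alpha> / 2 * N pw (gam + 2 * dl)"
    by (simp add: powr_add)
   also have "... <= real (W N) * ((t1 N / 4 - 2 * real (q N) - 3) / (4000 * real (q N) ^ 2) - 1)"
    by (rule mult_mono) (use W_bounds[OF elim(4)] ml in auto)
   finally have "2 * (real N * q N) < real (W N) * ((t1 N / 4 - 2 * real (q N) - 3) / (4000 * real (q N) ^ 2) - 1)" .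
   moreover have "t1 N <= N pw 2" unfolding t1_def by (rule powr_mono) (use g d elim in auto)
   hence "t1 N <= real N ^ 2" using elim by simp
   ultimately show ?case using pos by simp
  qed
 qed
 have trap_ok: "EV N. 27 * real (q N) ^ 2 * W N / N < (1 - 1 / J N) * (m N / 2) & h N <= 1 / (2 * J N) * (m N / 2) & ta N <= 1 / 16"
 proof -
  have 1: "EV N. 108 * N pw (2 * dl - gam) < N pw (- dl) / 4"
  proof -
   define e where "e = gam - 3 * dl"
   have e: "0 < e" "2 * dl - gam = - dl - e" using d g by (auto simp: e_def)
   show ?thesis unfolding e(2) using e(1) d(1) by real_asymp
  qed
  have 2: "EV N. N pw (- gam - 11 * dl) * (4 * N pw dl) <= N pw (- dl)"
   using g d(1) by real_asymp
  have 3: "EV N. N pw (- 4 * dl) <= 1 / 16" using d(1) by real_asymp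
  show ?thesis using 1 2 3 mge Jle big[of 1]
  proof eventually_elim
   case (elim N)
   have J: "10 <= real (J N)" using J10[of N] by simp
   have "27 * real (q N) ^ 2 * W N / N <= 27 * (2 * N pw dl) ^ 2 * N pw \<alpha> / N"
    by (intro divide_right_mono mult_mono power_mono) (use q(2)[OF elim(6)] W_bounds[OF elim(6)] in auto)
   also have "... = 108 * N pw (2 * dl - gam)"
   proof -
    have "N pw (2 * dl - gam) = N pw (dl + dl + \<alpha> - 1)" by (simp add: al)
    also have "... = N pw dl * N pw dl * N pw \<alpha> / N pw 1" by (simp only: powr_add powr_diff)
    finally show ?thesis using elim(6) by (simp add: power2_eq_square)
   qed
   also have "... < N pw (- dl) / 4" by (rule elim)
   also have "... <= m N / 4" using elim by simp
   also have "... <= (1 - 1 / J N) * (m N / 2)"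
   proof -
    have "1 / 2 * (m N / 2) <= (1 - 1 / J N) * (m N / 2)" by (rule mult_right_mono) (use J m01[of N] in "auto simp: field_simps")
    thus ?thesis by simp
   qed
   finally have "27 * real (q N) ^ 2 * W N / N < (1 - 1 / J N) * (m N / 2)" .
   moreover have "h N * (4 * J N) <= m N"
   proof -
    have "h N * (4 * J N) <= h N * (4 * N pw dl)" by (intro mult_left_mono) (use elim(5) h0(1)[OF elim(6)] in auto)
    also have "... <= N pw (- dl)" unfolding h_def by (rule elim)
    finally show ?thesis using elim(4) by simp
   qed
   hence "h N <= 1 / (2 * J N) * (m N / 2)" using J by (simp add: field_simps)
   ultimately show ?case using elim(3) by (simp add: ta_def)
  qed
 qed
 have nmax_ok: "EV N. W N * (4 * (S N * ta N) + q N + 2) <= real (nmax N) &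
   4 * (real (nmax N) + 2 * q N + 1) + 2 * N pw dl + 4 <= real N ^ 2"
 proof -
  have "EV N. 4 * (real N * (4 * (N pw (1 / 2) + 1) + 2 * N pw (1 / 2) + 2) + 1 + 2 * (2 * N pw (1 / 2)) + 1) + 2 * N pw (1 / 2) + 4 <= real N ^ 2"
   by real_asymp
  thus ?thesis using S_bounds big[of 1]
  proof eventually_elim
   case (elim N)
   have dh: "N pw dl <= N pw (1 / 2)" "t1 N <= N pw (1 / 2)"
    unfolding t1_def by (intro powr_mono; use g d elim in simp)+
   have q': "real (q N) <= 2 * N pw (1 / 2)" using q(2)[OF elim(3)] dh by linarith
   have t0: "0 <= S N * ta N" using h0(3)[OF elim(3)] by simp
   have n0: "0 <= W N * (4 * (S N * ta N) + q N + 2)" using t0 by simp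
   hence nm: "W N * (4 * (S N * ta N) + q N + 2) <= nmax N" "nmax N <= W N * (4 * (S N * ta N) + q N + 2) + 1"
    unfolding nmax_def by linarith+
   have "W N * (4 * (S N * ta N) + q N + 2) <= real N * (4 * (N pw (1 / 2) + 1) + 2 * N pw (1 / 2) + 2)"
    by (rule mult_mono) (use W_bounds[OF elim(3)] elim(2) dh q' t0 in auto)
   hence "4 * (real (nmax N) + 2 * real (q N) + 1) + 2 * N pw dl + 4 <= real N ^ 2"
    using nm(2) elim(1) q' dh unfolding distrib_left by linarith
   thus ?case using nm(1) by simp
  qed
 qed
 have p0_ok: "EV N. \<forall>jj<jmax N. p0 N <= (good_rate (m N / 2) (J N))\<^sup>2 * (1 / 4) ^ J N *
   ((1 / (128 * J N)) ^ J N * (1 / (128 * J N)) ^ J N * (exp (- (real jj / 8 + 1)) / 32))"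
  using rate ed big[of 1]
 proof eventually_elim
  case (elim N)
  show ?case
  proof (intro allI impI)
   fix jj assume jj: "jj < jmax N"
   have J: "0 < real (J N)" using J10[of N] by simp
   have gm0: "0 <= gm N" using elim d(1) by (simp add: gm_def)
   have "real jj <= 8 * gm N" using jj gm0 unfolding jmax_def by linarith
   hence "exp (- (gm N + 1)) <= exp (- (real jj / 8 + 1))" by simp
   moreover have "exp (- (gm N + 1)) = N pw (- 4 * dl) * exp (- 1)"
    using elim(3) by (simp add: gm_def powr_def exp_add[symmetric])
   moreover have "N pw (- dl) <= exp (- 1) / 32"
   proof -
    have "N pw (- dl) = 1 / N pw dl" by (rule powr_minus_divide)
    also have "... <= 1 / 300" using elim by (intro divide_left_mono) auto
    also have "... <= exp (- 1) / 32"
    proof -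
     have "exp 1 <= (3 :: real)" by (rule exp_le)
     hence "inverse 3 <= inverse (exp (1 :: real))" by (intro le_imp_inverse_le) auto
     thus ?thesis by (simp add: exp_minus)
    qed
    finally show ?thesis .
   qed
   hence "N pw (- 4 * dl) * N pw (- dl) <= N pw (- 4 * dl) * (exp (- 1) / 32)" by (rule mult_left_mono) simp
   ultimately have ex: "N pw (- 4 * dl) * N pw (- dl) <= exp (- (real jj / 8 + 1)) / 32" by linarith
   have gr: "N pw (- s - 4097 * dl) * N pw (- s - 4097 * dl) <= (good_rate (m N / 2) (J N))\<^sup>2"
    unfolding power2_eq_square by (intro mult_mono order_trans[OF _ conjunct1[OF elim(1)]]) (use elim(1) in auto)
   have "(1 / (2048 * real (J N))) ^ (2 * J N) <= (1 / 4) ^ J N * ((1 / (128 * J N)) ^ J N * (1 / (128 * J N)) ^ J N)"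
   proof -
    have "(1 / (2048 * real (J N))) ^ (2 * J N) = ((1 / (2048 * real (J N))) ^ 2) ^ J N" by (simp add: power_mult)
    also have "... <= (1 / 4 * (1 / (128 * J N) * (1 / (128 * J N)))) ^ J N"
     by (rule power_mono) (use J in "auto simp: power2_eq_square field_simps")
    finally show ?thesis by (simp only: power_mult_distrib)
   qed
   hence pt: "N pw (- dl) <= (1 / 4) ^ J N * ((1 / (128 * J N)) ^ J N * (1 / (128 * J N)) ^ J N)" using elim(1) by linarith
   have "p0 N = (N pw (- s - 4097 * dl) * N pw (- s - 4097 * dl)) * (N pw (- dl) * (N pw (- 4 * dl) * N pw (- dl)))"
    unfolding p0_def powr_add[symmetric] s_def by (simp add: algebra_simps)
   also have "... <= (good_rate (m N / 2) (J N))\<^sup>2 * ((1 / 4) ^ J N * ((1 / (128 * J N)) ^ J N * (1 / (128 * J N)) ^ J N) * (exp (- (real jj / 8 + 1)) / 32))"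
    by (intro mult_mono gr pt ex) auto
   finally show "p0 N <= (good_rate (m N / 2) (J N))\<^sup>2 * (1 / 4) ^ J N *
     ((1 / (128 * J N)) ^ J N * (1 / (128 * J N)) ^ J N * (exp (- (real jj / 8 + 1)) / 32))"
    by (simp only: mult.assoc)
  qed
 qed
 let ?rare = "%N om i. star_cleaning.rare N (W N) (nmax N) (h N) (ta N) (gm N) (%z. star_cleaning.GG (D N) (C N) z om) i"
 have u_rare: "unlikely (%N om. xr N <= card {i \<in> {1..N}. ?rare N om i})"
 proof (rule unlikelyI)
  show "EV N. prob_space.outer_le (M N) (%om. xr N <= card {i \<in> {1..N}. ?rare N om i})
    (card {1..N} * (h N * (ta N + exp (- gm N))) / xr N)"
   using big[of 1]
  proof eventually_elim
   case (elim N)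
   interpret star_cleaning "M N" N "W N" "D N" "C N" by (rule SC[OF elim])
   have "0 < xr N" using h0(1)[OF elim] elim by (simp add: xr_def)
   thus ?case
    by (intro outer_count outer_rare_line) (use elim h0[OF elim] d(1) in "auto simp: gm_def")
  qed
  show "EV N. card {1..N} * (h N * (ta N + exp (- gm N))) / xr N <= 4 * N pw (- 2 * dl)"
   using big[of 1]
  proof eventually_elim
   case (elim N)
   have h: "0 < h N" by (rule h0(1)[OF elim])
   have "exp (- gm N) = ta N" using elim by (simp add: gm_def ta_def powr_def)
   hence "card {1..N} * (h N * (ta N + exp (- gm N))) / xr N = 4 * (real N * ta N / N pw (1 - 2 * dl))"
    using h by (simp add: xr_def)
   also have "real N * ta N / N pw (1 - 2 * dl) = N pw (1 + (- 4 * dl) - (1 - 2 * dl))"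
    unfolding powr_diff powr_add ta_def using elim by simp
   finally show ?case by simp
  qed
  show "(%N. 4 * N pw (- 2 * dl)) \<longlonglongrightarrow> 0" using d(1) by real_asymp
 qed
 have u_close: "unlikely (%N om. ~ close_cells N (D N om) (h N))"
 proof (rule unlikelyI)
  show "EV N. prob_space.outer_le (M N) (%om. ~ close_cells N (D N om) (h N)) (1 / h N * exp (- (N * ((h N)\<^sup>2 / 18) / 4)))"
   using big[of 1]
  proof eventually_elim
   case (elim N)
   show ?case by (rule star_cleaning.outer_close_cells[OF SC[OF elim] h0(1,2)[OF elim]])
  qed
  show "EV N. 1 / h N * exp (- (N * ((h N)\<^sup>2 / 18) / 4)) <= real N * exp (- (N pw (1 / 10) / 72))"
   using big[of 1]
  proof eventually_elim
   case (elim N)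
   have "1 / h N = N pw (- (- gam - 11 * dl))" unfolding h_def powr_minus_divide ..
   also have "... <= N pw 1" by (rule powr_mono) (use g d elim in auto)
   finally have 1: "1 / h N <= real N" using elim by simp
   have "real N * (h N)\<^sup>2 = N pw (1 + (- gam - 11 * dl) + (- gam - 11 * dl))"
    unfolding powr_add h_def using elim by (simp add: power2_eq_square)
   moreover have "N pw (1 / 10) <= N pw (1 + (- gam - 11 * dl) + (- gam - 11 * dl))"
    by (rule powr_mono) (use g d elim in auto)
   ultimately have 2: "N pw (1 / 10) <= real N * (h N)\<^sup>2" by simp
   show ?case by (intro mult_mono 1) (use 2 in auto)
  qed
  show "(%N. real N * exp (- (N pw (1 / 10) / 72))) \<longlonglongrightarrow> 0" by real_asymp
 qed
 let ?bad = "%N om. \<exists>(bt, ob, ph, ph', jj)\<in>cl N.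
   r N <= card {(i, nA, nB, A, rh, B, sm) \<in> tuples_at N (W N) (nmax N). meet_at N (W N) (La N) bt ob ph ph' jj (m N / 2) (h N) (ta N) (%z. star_cleaning.GG (D N) (C N) z om) i nA nB A rh B sm} &
   (\<forall>(i, nA, nB, A, rh, B, sm)\<in>tuples_at N (W N) (nmax N). meet_at N (W N) (La N) bt ob ph ph' jj (m N / 2) (h N) (ta N) (%z. star_cleaning.GG (D N) (C N) z om) i nA nB A rh B sm -->
    ~ fresh_at (J N) (H N) (R N) jj (m N / 2) (%z. star_cleaning.GG (D N) (C N) z om) i A rh B sm)"
 have u_bad: "unlikely ?bad"
 proof (rule unlikelyI)
  show "EV N. prob_space.outer_le (M N) (?bad N) (card (cl N) * (N * h N / (p0 N * (r N)\<^sup>2)))"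
   using p0_ok q226 big[of 1]
  proof eventually_elim
   case (elim N)
   interpret star_cleaning "M N" N "W N" "D N" "C N" by (rule SC[OF elim(3)])
   have HR: "12 * real (R N) * exp (- 2 / 5 * H N) <= 1"
    unfolding R_def H_def by (rule window_parameters(4)) (use elim in simp)
   show ?case unfolding cl_def
    by (rule outer_no_pair[OF elim(3) _ _ _ _ _ _ HR])
     (use elim h0[OF elim(3)] m01[of N] J10[of N] in "auto simp: La_def r_def p0_def")
  qed
  show "EV N. card (cl N) * (N * h N / (p0 N * (r N)\<^sup>2)) <= N pw (- (kp - 8252 * dl))"
   using clle big[of 1]
  proof eventually_elim
   case (elim N)
   have h: "0 < h N" by (rule h0(1)[OF elim(2)])
   have "N * h N / (p0 N * (r N)\<^sup>2) = N pw (1 + (- gam - 11 * dl) - ((- 2 * gam - 8208 * dl) + ((1 - 12 * dl - gam - 11 * dl) + (1 - 12 * dl - gam - 11 * dl))))"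
   proof -
    have "r N = N pw (1 - 12 * dl - gam - 11 * dl)" unfolding r_def by (rule hN)
    moreover have "N * h N = N pw (1 + (- gam - 11 * dl))"
     unfolding h_def using elim(2) powr_add[of "real N" 1 "- gam - 11 * dl"] by simp
    ultimately show ?thesis by (simp only: p0_def power2_eq_square powr_add[symmetric] powr_diff[symmetric])
   qed
   also have "1 + (- gam - 11 * dl) - ((- 2 * gam - 8208 * dl) + ((1 - 12 * dl - gam - 11 * dl) + (1 - 12 * dl - gam - 11 * dl))) = - (kp - 8243 * dl)"
    by (simp add: ka)
   finally have eq: "N * h N / (p0 N * (r N)\<^sup>2) = N pw (- (kp - 8243 * dl))" .
   have "card (cl N) * (N * h N / (p0 N * (r N)\<^sup>2)) <= N pw (9 * dl) * N pw (- (kp - 8243 * dl))"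
    unfolding eq by (rule mult_right_mono[OF elim(1)]) simp
   also have "... = N pw (- (kp - 8252 * dl))" unfolding powr_add[symmetric] by (simp add: algebra_simps)
   finally show ?case .
  qed
  have "0 < kp - 8252 * dl" using d by simp
  thus "(%N. N pw (- (kp - 8252 * dl))) \<longlonglongrightarrow> 0" by real_asymp
 qed
 let ?X = "%N om. ~ calm (1 - \<alpha> - 8 * dl) dl N om \<or> ~ first_cells N (D N om) (qq dl N / N) \<or>
   real (W N) / (2 * qq dl N) <= card {i \<in> {1..N}. \<forall>j<aa s N. gap (D N om i) j <= 2 ^ (j + 1) * mm s N} \<or>
   xr N <= card {i \<in> {1..N}. ?rare N om i} \<or> ~ close_cells N (D N om) (h N) \<or> ?bad N om"
 have "unlikely (%N om. ?X N om)"
  by (intro unlikely_or unlikely_not_calm unlikely_not_first_cells unlikely_chains u_rare u_close u_bad)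
   (use d g in "auto simp: s_def al")
 thus ?thesis
 proof (rule unlikely_mono)
  show "EV N. \<forall>om\<in>space (M N). eventually_separated N (W N) (D N om) (C N om) -->
   ?X N om"
   using level S_bounds count nmax_ok trap_ok rate q226 Jle jmaxle big[of 1]
  proof eventually_elim
   case (elim N)
   show ?case
   proof (intro ballI impI, rule ccontr)
    fix om assume es: "eventually_separated N (W N) (D N om) (C N om)"
     and no: "~ (?X N om)"
    have N1: "1 <= N" using elim by simp
    interpret SCN: star_cleaning "M N" N "W N" "D N" "C N" by (rule SC[OF N1])
    have c: "calm (1 - \<alpha> - 8 * dl) dl N om" and fc: "first_cells N (D N om) (real (q N) / N)"
     and ch: "card {i \<in> {1..N}. \<forall>j<aa s N. gap (D N om i) j <= 2 ^ (j + 1) * m N} < real (W N) / (2 * q N)"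
     and ra: "card {i \<in> {1..N}. ?rare N om i} < xr N" and cc: "close_cells N (D N om) (h N)" and nb: "~ ?bad N om"
     using no by (auto simp: q_def m_def not_le)
    have sr: "star_reg N (W N) (D N om) (C N om) (q N)" using c by (simp add: calm_def q_def)
    interpret X: star_reg N "W N" "D N om" "C N om" "q N" by (rule sr)
    let ?ml = "(t1 N / 4 - 2 * real (q N) - 3) / (4000 * real (q N) ^ 2) - 1"
    have ml: "X.min_land (t1 N) = ?ml" by (simp add: X.min_land_def)
    have ml0: "0 < ?ml" using elim(1) by simp
    have q0: "0 < real (q N)" using elim(7) by simp
    have aux: "x + b * z < w * z" if "b * z <= w / 2 * z" "2 * x < w * z" for x b w z :: real
     using that by simp
    have "m N <= X.Lev (X.steps (t1 N))"
    proof (rule X.phase1)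
     show "0 <= t1 N" by (simp add: t1_def)
     show "t1 N <= real N ^ 2" using elim(1) by simp
     show "0 < m N" "2 ^ aa s N * m N <= 1" by (auto simp: m_def mm_def power_one_over)
     show "0 < X.min_land (t1 N)" unfolding ml by (rule ml0)
     have "real (q N) * card (X.chain_lines (aa s N) (m N)) * ?ml <= real (W N) / 2 * ?ml"
     proof (rule mult_right_mono)
      have "real (card (X.chain_lines (aa s N) (m N))) < real (W N) / (2 * q N)"
       using ch unfolding X.chain_lines_def .
      hence "real (card (X.chain_lines (aa s N) (m N))) * (2 * q N) < real (W N)"
       using q0 by (simp add: pos_less_divide_eq)
      thus "real (q N) * card (X.chain_lines (aa s N) (m N)) <= real (W N) / 2" by (simp add: mult_ac)
     qed (use ml0 in simp)
     thus "real N * q N + q N * card (X.chain_lines (aa s N) (m N)) * X.min_land (t1 N) < W N * X.min_land (t1 N)"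
      using conjunct1[OF elim(1)] unfolding ml of_nat_mult by (rule aux)
    qed
    also have "... <= X.Lev (X.steps (S N * ta N))" by (intro X.Lev_mono X.steps_mono) (use elim(2) in simp)
    finally have lev: "2 * (m N / 2) <= X.Lev (X.steps (S N * ta N))" by simp
    have bm: "W N < 2 ^ bmax N"
    proof -
     have "real N = 2 powr (log 2 (real N))" using N1 by simp
     also have "... <= 2 powr (real (nat \<lceil>log 2 (real N)\<rceil>))"
      by (rule powr_mono) (auto intro: real_nat_ceiling_ge)
     also have "... = 2 ^ nat \<lceil>log 2 (real N)\<rceil>" by (simp add: powr_realpow)
     also have "... < 2 ^ bmax N" by (simp add: bmax_def)
     finally have "real N < real (2 ^ bmax N)" by simp
     hence "N < 2 ^ bmax N" by (simp only: of_nat_less_iff)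
     thus ?thesis using W_bounds(4)[OF N1] by simp
    qed
    have jm: "8 * gm N < jmax N" unfolding jmax_def by linarith
    have "\<exists>(bt, ob, ph, ph', jj)\<in>classes (bmax N) (La N) (jmax N).
     r N <= card {(i, nA, nB, A, rh, B, sm) \<in> tuples_at N (W N) (nmax N). meet_at N (W N) (La N) bt ob ph ph' jj (m N / 2) (h N) (ta N) (%z. SCN.GG z om) i nA nB A rh B sm}"
     by (rule SCN.class_exists[OF sr cc h0(1)[OF N1] h0(3)[OF N1] _ _ lev _ bm jm _ ra])
      (use elim m01[of N] h0[OF N1] N1 in "auto simp: La_def r_def cl_def")
    then obtain bt ob ph ph' jj where cls: "(bt, ob, ph, ph', jj) \<in> cl N"
     and rc: "r N <= card {(i, nA, nB, A, rh, B, sm) \<in> tuples_at N (W N) (nmax N). meet_at N (W N) (La N) bt ob ph ph' jj (m N / 2) (h N) (ta N) (%z. SCN.GG z om) i nA nB A rh B sm}"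
     unfolding cl_def by blast
    then obtain i nA nB A rh B sm where t: "(i, nA, nB, A, rh, B, sm) \<in> tuples_at N (W N) (nmax N)"
     and mt: "meet_at N (W N) (La N) bt ob ph ph' jj (m N / 2) (h N) (ta N) (%z. SCN.GG z om) i nA nB A rh B sm"
     and fr: "fresh_at (J N) (H N) (R N) jj (m N / 2) (%z. SCN.GG z om) i A rh B sm"
     using nb by fast
    have jj: "real jj <= 8 * gm N"
    proof -
     have "jj < jmax N" using cls by (simp add: cl_def classes_def)
     moreover have "0 <= gm N" using N1 d(1) by (simp add: gm_def)
     ultimately show ?thesis unfolding jmax_def by linarith
    qed
    have jd: "real jj / 8 <= N pw dl" using jj elim(9) by (simp add: gm_def)
    have q226': "226 <= q N" using elim(7) by simp
    have "~ eventually_separated N (W N) (D N om) (C N om)"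
    proof (rule SCN.fresh_not_separated[OF sr fc t mt fr])
     show "2 <= J N" using J10[of N] by simp
     show "0 < m N / 2" using m01[of N] by simp
     show "1 <= H N" unfolding H_def by (rule window_parameters(1)[OF q226'])
     have "80 * real (H N) <= 1024 * ln (128 * real (q N))" unfolding H_def by (rule window_parameters(2)[OF q226'])
     thus "80 * real (H N) <= (2 - 1 / J N) ^ J N * (m N / 2)" using elim(6) by linarith
     show "4000 * q N ^ 2 + 20 * H N <= R N" by (simp add: R_def)
     show "real jj / 8 + J N + 4 <= 4 * (real (q N) + 3)" using jd elim(8) q(1)[of N] powr_ge_zero[of "real N" dl] unfolding distrib_left by linarith
     show "4 * (real (nmax N) + 2 * q N + 1) + real jj / 8 + J N + 4 <= real N ^ 2" using jd elim(8) elim(4) by linarith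
    qed (use elim(5) in auto)
    thus False using es by simp
   qed
  qed
 qed
qed

end

section \<open>Limits of the probabilities in the completed measure\<close>

context star_family
begin

lemma probability_limits:
 assumes Q: "!!N. 1 <= N ==> \<exists>Q. Measurable.pred (M N) Q & (AE om in M N. P N om <-> Q om)"
 shows "unlikely (%N om. ~ P N om) ==> (%N. \<P>(om in completion (M N). P N om)) \<longlonglongrightarrow> 1"
  and "unlikely P ==> (%N. \<P>(om in completion (M N). P N om)) \<longlonglongrightarrow> 0"
proof -
 assume "unlikely (%N om. ~ P N om)"
 then obtain b where b: "EV N. prob_space.outer_le (M N) (%om. ~ P N om) (b N)" "b \<longlonglongrightarrow> 0"
  by (auto simp: unlikely_def)
 show "(%N. \<P>(om in completion (M N). P N om)) \<longlonglongrightarrow> 1"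
 proof (rule tendsto_sandwich)
  show "EV N. 1 - b N <= \<P>(om in completion (M N). P N om)"
   using b(1) ev_ge[of 1]
  proof eventually_elim
   case (elim N)
   show ?case by (rule star_cleaning.completion_bounds(2)[OF SC[OF elim(2)] Q[OF elim(2)] elim(1)])
  qed
  show "EV N. \<P>(om in completion (M N). P N om) <= 1"
   using ev_ge[of 1]
  proof eventually_elim
   case (elim N)
   show ?case by (rule star_cleaning.completion_bounds(5)[OF SC[OF elim] Q[OF elim]])
  qed
  show "(%N. 1 - b N) \<longlonglongrightarrow> 1" using tendsto_diff[OF tendsto_const[of 1] b(2)] by simp
 qed simp
next
 assume "unlikely P"
 then obtain b where b: "EV N. prob_space.outer_le (M N) (P N) (b N)" "b \<longlonglongrightarrow> 0"
  by (auto simp: unlikely_def)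
 show "(%N. \<P>(om in completion (M N). P N om)) \<longlonglongrightarrow> 0"
 proof (rule tendsto_sandwich[OF _ _ tendsto_const b(2)])
  show "EV N. 0 <= \<P>(om in completion (M N). P N om)"
   using ev_ge[of 1]
  proof eventually_elim
   case (elim N)
   show ?case by (rule star_cleaning.completion_bounds(4)[OF SC[OF elim] Q[OF elim]])
  qed
  show "EV N. \<P>(om in completion (M N). P N om) <= b N"
   using b(1) ev_ge[of 1]
  proof eventually_elim
   case (elim N)
   show ?case by (rule star_cleaning.completion_bounds(3)[OF SC[OF elim(2)] Q[OF elim(2)] elim(1)])
  qed
 qed
qed

end

theorem theorem1:
  fixes \<alpha> :: real
    and M :: "nat \<Rightarrow> 'a measure"
    and D C :: "nat \<Rightarrow> 'a \<Rightarrow> nat \<Rightarrow> nat \<Rightarrow> real"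
  assumes "0 < \<alpha>" and "\<alpha> < 1"
    and "\<And>N. 1 \<le> N \<Longrightarrow> star_cleaning (M N) N (num_workers \<alpha> N) (D N) (C N)"
  shows
    "(\<forall>N\<ge>1.
        (\<forall>x>0. Measurable.pred (completion (M N))
           (\<lambda>\<omega>. sigma_time N (num_workers \<alpha> N) (D N \<omega>) (C N \<omega>) x = \<infinity>)) \<and>
        (\<forall>\<epsilon>>0. Measurable.pred (completion (M N))
           (\<lambda>\<omega>. theta_time N (num_workers \<alpha> N) (D N \<omega>) (C N \<omega>)
                   \<le> ennreal (real N powr (1 - \<alpha> + \<epsilon>)))) \<and>
        Measurable.pred (completion (M N))
          (\<lambda>\<omega>. eventually_separated N (num_workers \<alpha> N) (D N \<omega>) (C N \<omega>)))
     \<and>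
     ((\<forall>x>0. (\<lambda>N. \<P>(\<omega> in completion (M N).
          sigma_time N (num_workers \<alpha> N) (D N \<omega>) (C N \<omega>) x = \<infinity>)) \<longlonglongrightarrow> 1) \<and>
      (\<forall>\<epsilon>>0. (\<lambda>N. \<P>(\<omega> in completion (M N).
          theta_time N (num_workers \<alpha> N) (D N \<omega>) (C N \<omega>)
            \<le> ennreal (real N powr (1 - \<alpha> + \<epsilon>)))) \<longlonglongrightarrow> 1))
     \<and>
     (2 / 3 < \<alpha> \<longrightarrow>
        (\<lambda>N. \<P>(\<omega> in completion (M N).
          eventually_separated N (num_workers \<alpha> N) (D N \<omega>) (C N \<omega>))) \<longlonglongrightarrow> 0)
     \<and>
     (\<alpha> < 2 / 3 \<longrightarrow>
        (\<lambda>N. \<P>(\<omega> in completion (M N).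
          eventually_separated N (num_workers \<alpha> N) (D N \<omega>) (C N \<omega>))) \<longlonglongrightarrow> 1)"
proof -
 interpret star_family \<alpha> M D C
  by (rule star_family.intro) (fact assms)+
 have s: "\<exists>Q. Measurable.pred (M N) Q & (AE om in M N. (sigma_time N (W N) (D N om) (C N om) x = \<infinity>) <-> Q om)"
  if "1 <= N" for N x
  by (rule star_cleaning.sigma_pred[OF SC[OF that] that W_bounds(3)[OF that]])
 have t: "\<exists>Q. Measurable.pred (M N) Q & (AE om in M N. (theta_time N (W N) (D N om) (C N om) <= ennreal (N pw y)) <-> Q om)"
  if "1 <= N" for N y
  by (rule star_cleaning.theta_pred[OF SC[OF that] that W_bounds(3)[OF that]]) simp
 have e: "\<exists>Q. Measurable.pred (M N) Q & (AE om in M N. eventually_separated N (W N) (D N om) (C N om) <-> Q om)"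
  if "1 <= N" for N
  by (rule star_cleaning.separated_pred[OF SC[OF that] that W_bounds(3)[OF that]])
 show ?thesis
 proof (intro conjI allI impI)
  fix N :: nat assume N: "1 <= N"
  show "Measurable.pred (completion (M N)) (%om. sigma_time N (W N) (D N om) (C N om) x = \<infinity>)" for x
   by (rule star_cleaning.completion_bounds(1)[OF SC[OF N] s[OF N]])
  show "Measurable.pred (completion (M N)) (%om. theta_time N (W N) (D N om) (C N om) <= ennreal (N pw (1 - \<alpha> + ep)))" for ep
   by (rule star_cleaning.completion_bounds(1)[OF SC[OF N] t[OF N]])
  show "Measurable.pred (completion (M N)) (%om. eventually_separated N (W N) (D N om) (C N om))"
   by (rule star_cleaning.completion_bounds(1)[OF SC[OF N] e[OF N]])
 next
  fix x :: real assume "0 < x"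
  thus "(%N. \<P>(om in completion (M N). sigma_time N (W N) (D N om) (C N om) x = \<infinity>)) \<longlonglongrightarrow> 1"
   by (intro probability_limits(1)[OF s] unlikely_sigma)
 next
  fix ep :: real assume "0 < ep"
  thus "(%N. \<P>(om in completion (M N). theta_time N (W N) (D N om) (C N om) <= ennreal (N pw (1 - \<alpha> + ep)))) \<longlonglongrightarrow> 1"
   by (intro probability_limits(1)[OF t] unlikely_theta)
 next
  assume "2 / 3 < \<alpha>"
  thus "(%N. \<P>(om in completion (M N). eventually_separated N (W N) (D N om) (C N om))) \<longlonglongrightarrow> 0"
   by (intro probability_limits(2)[OF e] unlikely_separated)
 next
  assume "\<alpha> < 2 / 3"
  thus "(%N. \<P>(om in completion (M N). eventually_separated N (W N) (D N om) (C N om))) \<longlonglongrightarrow> 1"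
   by (intro probability_limits(1)[OF e] unlikely_not_separated)
 qed
qed

end
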